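(* Let $(A,B,P)$ be a tetrablock contraction on a Hilbert space $\mathcal H$ with fundamental operators $F_1$ and $F_2$. Let $D_P=(I-P^*P)^{1/2}$, let $\mathcal D_P$ be the closure of the range of $D_P$, and let $\mathcal K=\mathcal H\oplus\mathcal D_P\oplus\mathcal D_P\oplus\cdots=\mathcal H\oplus \ell^2(\mathcal D_P)$, with $\mathcal H$ embedded in $\mathcal K$ by $h\mapsto(h,0,0,\dots)$. Consider the operators $V_1,V_2,V_3$ on $\mathcal K$ defined by $$V_1(h_0,h_1,h_2,\dots)=(Ah_0,\;F_2^*D_Ph_0+F_1h_1,\;F_2^*h_1+F_1h_2,\;F_2^*h_2+F_1h_3,\dots),$$ $$V_2(h_0,h_1,h_2,\dots)=(Bh_0,\;F_1^*D_Ph_0+F_2h_1,\;F_1^*h_1+F_2h_2,\;F_1^*h_2+F_2h_3,\dots),$$ $$V_3(h_0,h_1,h_2,\dots)=(Ph_0,\;D_Ph_0,\;h_1,\;h_2,\dots).$$ Then: (1) $(V_1,V_2,V_3)$ is a minimal tetrablock isometric dilation of $(A,B,P)$ if $[F_1,F_2]=0$ and $[F_1,F_1^*]=[F_2,F_2^*]$. (2) If there is a tetrablock isometric dilation $(W_1,W_2,W_3)$ of $(A,B,P)$ such that $W_3$ is the minimal isometric dilation of $P$, then $(W_1,W_2,W_3)$ is unitarily equivalent to $(V_1,V_2,V_3)$. Moreover, $[F_1,F_2]=0$ and $[F_1,F_1^*]=[F_2,F_2^*]$.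
   Context: All Hilbert spaces are complex and all operators are bounded and linear; $[X,Y]=XY-YX$. The tetrablock is $E=\{(a_{11},a_{22},\det M): M=\begin{pmatrix} a_{11} & a_{12} \\ a_{21} & a_{22} \end{pmatrix}\text{ a symmetric complex matrix with operator norm }\|M\|<1\}\subset\mathbb C^3$ (the same set is obtained without requiring $M$ symmetric), and $\overline E$ is its closure. A compact set $K\subset\mathbb C^n$ is a spectral set for a commuting $n$-tuple of operators if the Taylor joint spectrum of the tuple is contained in $K$ and $\|r(\text{tuple})\|\le\sup_K|r|$ for every rational function $r$ with poles off $K$. A tetrablock contraction is a commuting triple $(A,B,P)$ of operators on a Hilbert space for which $\overline E$ is a spectral set. The fundamental operators of a tetrablock contraction $(A,B,P)$ are the operators $F_1,F_2\in\mathcal B(\mathcal D_P)$ (which exist and are unique) such that $A-B^*P=D_PF_1D_P$ and $B-A^*P=D_PF_2D_P$. The distinguished boundary $bE$ is the Shilov boundary of $\overline E$ relative to the algebra of functions continuous on $\overline E$ and holomorphic on $E$; it is known that $bE=\{(x_1,x_2,x_3): x_1=\overline{x_2}x_3,\ |x_3|=1,\ |x_2|\le1\}$. A tetrablock unitary is a commuting triple of normal operators whose Taylor joint spectrum is contained in $bE$. A tetrablock isometry is the restriction of a tetrablock unitary to a joint invariant subspace. A (simultaneous) dilation of a commuting tuple $(\delta_1,\dots,\delta_n)$ on $\mathcal H$ is a commuting tuple $(\Delta_1,\dots,\Delta_n)$ on a Hilbert space $\mathcal K\supseteq\mathcal H$ with $P_{\mathcal H}\Delta_1^{k_1}\cdots\Delta_n^{k_n}|_{\mathcal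 H}=\delta_1^{k_1}\cdots\delta_n^{k_n}$ for all non-negative integers $k_1,\dots,k_n$. It is minimal if $\mathcal K$ is the closed linear span of the vectors $\Delta_1^{k_1}\cdots\Delta_n^{k_n}h$ with $k_i\ge0$ integers and $h\in\mathcal H$. A tetrablock isometric dilation is a dilation that is a tetrablock isometry. In (2), "$W_3$ is the minimal isometric dilation of $P$" means that $W_3$, as a single operator, is an isometric dilation of $P$ that is minimal in this sense, i.e. the space on which $(W_1,W_2,W_3)$ acts is the closed span of $\{W_3^kh:k\ge0,\ h\in\mathcal H\}$. *)

theory Defs
  imports "HOL-Analysis.Analysis" "HOL-Library.Poly_Mapping"
begin

text \<open>
  The real structure is the underlying one, so that the norm and the topology are those of
  the library class \<^class>\<open>real_inner\<close>. The complex inner product is linear in its first argument.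
\<close>

class complex_inner = real_inner +
  fixes scaleC :: "complex \<Rightarrow> 'a \<Rightarrow> 'a" (infixr "*\<^sub>C" 75)
    and cinner :: "'a \<Rightarrow> 'a \<Rightarrow> complex"
  assumes scaleR_scaleC: "scaleR r x = complex_of_real r *\<^sub>C x"
    and scaleC_add_right: "c *\<^sub>C (x + y) = c *\<^sub>C x + c *\<^sub>C y"
    and scaleC_add_left: "(c + d) *\<^sub>C x = c *\<^sub>C x + d *\<^sub>C x"
    and scaleC_scaleC: "c *\<^sub>C d *\<^sub>C x = (c * d) *\<^sub>C x"
    and cinner_commute: "cinner x y = cnj (cinner y x)"
    and cinner_add_left: "cinner (x + y) z = cinner x z + cinner y z"
    and cinner_scaleC_left: "cinner (c *\<^sub>C x) y = c * cinner x y"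
    and inner_eq_Re_cinner: "inner x y = Re (cinner x y)"

class chilbert_space = complex_inner + complete_space

context complex_inner
begin

lemma cinner_scaleC_right: "cinner x (c *\<^sub>C y) = cnj c * cinner x y"
  by (metis cinner_commute cinner_scaleC_left complex_cnj_mult complex_cnj_cnj)

lemma norm_scaleC: "norm (c *\<^sub>C x) = cmod c * norm x"
proof -
  have "cinner (c *\<^sub>C x) (c *\<^sub>C x) = complex_of_real ((cmod c)\<^sup>2) * cinner x x"
    by (metis cinner_scaleC_left cinner_scaleC_right complex_norm_square mult.assoc)
  then have "inner (c *\<^sub>C x) (c *\<^sub>C x) = (cmod c)\<^sup>2 * inner x x"
    by (simp add: inner_eq_Re_cinner)
  then show ?thesis
    by (simp add: norm_eq_sqrt_inner real_sqrt_mult)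
qed

end

lemma norm_cinner_le: "cmod (cinner x y) \<le> norm x * norm y"
  for x y :: "'a::complex_inner"
proof (cases "cinner x y = 0")
  case False
  define u where "u = cnj (sgn (cinner x y))"
  have "cmod u = 1"
    using False by (simp add: u_def norm_sgn)
  have "cmod (cinner x y) = Re (u * cinner x y)"
  proof -
    have "cinner x y * cnj (cinner x y) = complex_of_real ((cmod (cinner x y))\<^sup>2)"
      by (simp only: complex_norm_square)
    then have "u * cinner x y = complex_of_real (cmod (cinner x y))"
      using False by (simp add: u_def sgn_div_norm scaleR_conv_of_real field_simps power2_eq_square)
    then show ?thesis by simp
  qed
  also have "\<dots> = inner (u *\<^sub>C x) y"
    by (simp add: inner_eq_Re_cinner cinner_scaleC_left)
  also have "\<dots> \<le> norm (u *\<^sub>C x) * norm y"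
    by (rule norm_cauchy_schwarz)
  finally show ?thesis
    by (simp add: norm_scaleC \<open>cmod u = 1\<close>)
qed simp

typedef (overloaded) ('a::complex_inner) ell2 =
  "{f :: nat \<Rightarrow> 'a. summable (\<lambda>n. (norm (f n))\<^sup>2)}"
  morphisms ell2_nth Abs_ell2
  by (rule exI[of _ "\<lambda>_. 0"]) simp

lemma ell2_eqI: "(\<And>n. ell2_nth x n = ell2_nth y n) \<Longrightarrow> x = y"
  by (metis ell2_nth_inject ext)

lemma summable_ell2: "summable (\<lambda>n. (norm (ell2_nth x n))\<^sup>2)"
  using ell2_nth[of x] by simp

lemma ell2_nth_Abs: "summable (\<lambda>n. (norm (f n))\<^sup>2) \<Longrightarrow> ell2_nth (Abs_ell2 f) = f"
  by (simp add: Abs_ell2_inverse)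

lemma summable_sq_add:
  fixes f g :: "nat \<Rightarrow> 'a::real_inner"
  assumes "summable (\<lambda>n. (norm (f n))\<^sup>2)" "summable (\<lambda>n. (norm (g n))\<^sup>2)"
  shows "summable (\<lambda>n. (norm (f n + g n))\<^sup>2)"
proof (rule summable_comparison_test')
  show "summable (\<lambda>n. 2 * (norm (f n))\<^sup>2 + 2 * (norm (g n))\<^sup>2)"
    by (intro summable_add summable_mult assms)
  fix n
  have "(norm (f n + g n))\<^sup>2 \<le> (norm (f n) + norm (g n))\<^sup>2"
    by (simp add: norm_triangle_ineq power_mono)
  also have "\<dots> \<le> 2 * (norm (f n))\<^sup>2 + 2 * (norm (g n))\<^sup>2"
    using sum_squares_bound[of "norm (f n)" "norm (g n)"] by (simp add: power2_sum)
  finally show "norm ((norm (f n + g n))\<^sup>2) \<le> 2 * (norm (f n))\<^sup>2 + 2 * (norm (g n))\<^sup>2"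
    by simp
qed

lemma summable_sq_cinner:
  fixes f g :: "nat \<Rightarrow> 'a::complex_inner"
  assumes "summable (\<lambda>n. (norm (f n))\<^sup>2)" "summable (\<lambda>n. (norm (g n))\<^sup>2)"
  shows "summable (\<lambda>n. cinner (f n) (g n))"
proof (rule summable_comparison_test')
  show "summable (\<lambda>n. (norm (f n))\<^sup>2 + (norm (g n))\<^sup>2)"
    by (intro summable_add assms)
  fix n
  have "cmod (cinner (f n) (g n)) \<le> norm (f n) * norm (g n)"
    by (rule norm_cinner_le)
  also have "\<dots> \<le> (norm (f n))\<^sup>2 + (norm (g n))\<^sup>2"
    using sum_squares_bound[of "norm (f n)" "norm (g n)"]
      mult_nonneg_nonneg[OF norm_ge_zero[of "f n"] norm_ge_zero[of "g n"]] by (simp only: mult.assoc)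
  finally show "norm (cinner (f n) (g n)) \<le> (norm (f n))\<^sup>2 + (norm (g n))\<^sup>2" .
qed

lemma summable_sq_scaleC:
  fixes f :: "nat \<Rightarrow> 'a::complex_inner"
  assumes "summable (\<lambda>n. (norm (f n))\<^sup>2)"
  shows "summable (\<lambda>n. (norm (c *\<^sub>C f n))\<^sup>2)"
  using summable_mult[OF assms, of "(cmod c)\<^sup>2"] by (simp add: norm_scaleC power_mult_distrib)

instantiation ell2 :: (complex_inner) complex_inner
begin

definition "0 = Abs_ell2 (\<lambda>_. 0)"
definition "x + y = Abs_ell2 (\<lambda>n. ell2_nth x n + ell2_nth y n)"
definition "c *\<^sub>C x = Abs_ell2 (\<lambda>n. c *\<^sub>C ell2_nth x n)"
definition "- x = Abs_ell2 (\<lambda>n. - ell2_nth x n)" for x :: "'a ell2"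
definition "x - y = Abs_ell2 (\<lambda>n. ell2_nth x n - ell2_nth y n)"
definition "r *\<^sub>R x = Abs_ell2 (\<lambda>n. r *\<^sub>R ell2_nth x n)"
definition "cinner x y = suminf (\<lambda>n. cinner (ell2_nth x n) (ell2_nth y n))"
definition "inner x y = Re (cinner x y)" for x y :: "'a ell2"
definition "norm x = sqrt (inner x x)" for x :: "'a ell2"
definition "sgn x = scaleR (inverse (norm x)) x" for x :: "'a ell2"
definition "dist x y = norm (x - y)" for x y :: "'a ell2"
definition "(uniformity :: ('a ell2 \<times> 'a ell2) filter)
  = (INF e\<in>{0<..}. principal {(x, y). dist x y < e})"
definition "open U \<longleftrightarrow> (\<forall>x\<in>U. \<forall>\<^sub>F (x', y) in uniformity. x' = x \<longrightarrow> y \<in> U)" for U :: "'a ell2 set"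

lemma ell2_nth_zero: "ell2_nth 0 n = 0"
  by (simp add: zero_ell2_def ell2_nth_Abs)

lemma ell2_nth_add: "ell2_nth (x + y) n = ell2_nth x n + ell2_nth y n"
  by (simp add: plus_ell2_def ell2_nth_Abs summable_sq_add summable_ell2)

lemma ell2_nth_scaleC: "ell2_nth (c *\<^sub>C x) n = c *\<^sub>C ell2_nth x n"
  by (simp add: scaleC_ell2_def ell2_nth_Abs summable_sq_scaleC summable_ell2)

lemma ell2_nth_uminus: "ell2_nth (- x) n = - ell2_nth x n"
  by (simp add: uminus_ell2_def ell2_nth_Abs summable_ell2)

lemma ell2_nth_scaleR: "ell2_nth (r *\<^sub>R x) n = r *\<^sub>R ell2_nth x n"
  by (simp add: scaleR_ell2_def ell2_nth_Abs scaleR_scaleC summable_sq_scaleC summable_ell2)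

lemma ell2_nth_diff: "ell2_nth (x - y) n = ell2_nth x n - ell2_nth y n"
  using summable_sq_add[OF summable_ell2[of x] summable_ell2[of "- y"]]
  by (simp add: minus_ell2_def ell2_nth_Abs ell2_nth_uminus)

lemmas ell2_nth_simps =
  ell2_nth_zero ell2_nth_add ell2_nth_scaleC ell2_nth_uminus ell2_nth_scaleR ell2_nth_diff

lemma inner_ell2_self: "inner x x = suminf (\<lambda>n. (norm (ell2_nth x n))\<^sup>2)" for x :: "'a ell2"
  unfolding inner_ell2_def cinner_ell2_def
  using summable_sq_cinner[OF summable_ell2 summable_ell2]
  by (subst Re_suminf) (simp_all add: inner_eq_Re_cinner[symmetric] power2_norm_eq_inner)

instance
proof
  fix x y z :: "'a ell2" and a b :: real and c d :: complex
  show "x + y + z = x + (y + z)" "x + y = y + x" "0 + x = x" "- x + x = 0" "x - y = x + - y"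
    by (rule ell2_eqI; simp add: ell2_nth_simps)+
  show "a *\<^sub>R (x + y) = a *\<^sub>R x + a *\<^sub>R y" "(a + b) *\<^sub>R x = a *\<^sub>R x + b *\<^sub>R x"
    "a *\<^sub>R b *\<^sub>R x = (a * b) *\<^sub>R x" "1 *\<^sub>R x = x"
    by (rule ell2_eqI; simp add: ell2_nth_simps scaleR_add_right scaleR_add_left)+
  show "dist x y = norm (x - y)" "sgn x = scaleR (inverse (norm x)) x" "norm x = sqrt (inner x x)"
    "inner x y = Re (cinner x y)"
    by (simp_all add: dist_ell2_def sgn_ell2_def norm_ell2_def inner_ell2_def)
  show "(uniformity :: ('a ell2 \<times> 'a ell2) filter)
      = (INF e\<in>{0<..}. principal {(x, y). dist x y < e})"
    by (rule uniformity_ell2_def)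
  show "open U \<longleftrightarrow> (\<forall>x\<in>U. \<forall>\<^sub>F (x', y) in uniformity. x' = x \<longrightarrow> y \<in> U)" for U :: "'a ell2 set"
    by (rule open_ell2_def)
  show "a *\<^sub>R x = complex_of_real a *\<^sub>C x"
    by (rule ell2_eqI) (simp add: ell2_nth_simps scaleR_scaleC)
  show "c *\<^sub>C (x + y) = c *\<^sub>C x + c *\<^sub>C y"
    "(c + d) *\<^sub>C x = c *\<^sub>C x + d *\<^sub>C x"
    "c *\<^sub>C d *\<^sub>C x = (c * d) *\<^sub>C x"
    by (rule ell2_eqI; simp add: ell2_nth_simps scaleC_add_right scaleC_add_left scaleC_scaleC)+
  have cnj: "cinner x y = cnj (cinner y x)" for x y :: "'a ell2"
  proof -
    have "(\<lambda>n. cinner (ell2_nth y n) (ell2_nth x n)) sums cinner y x"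
      unfolding cinner_ell2_def by (intro summable_sums summable_sq_cinner summable_ell2)
    then have "(\<lambda>n. cnj (cinner (ell2_nth y n) (ell2_nth x n))) sums cnj (cinner y x)"
      by (simp add: sums_cnj)
    then show ?thesis
      unfolding cinner_ell2_def[of x y] cinner_commute[symmetric] by (simp add: sums_iff)
  qed
  have add: "cinner (x + y) z = cinner x z + cinner y z" for x y z :: "'a ell2"
    unfolding cinner_ell2_def
    by (simp add: ell2_nth_simps cinner_add_left suminf_add summable_sq_cinner summable_ell2)
  have mult: "cinner (c *\<^sub>C x) y = c * cinner x y" for c and x y :: "'a ell2"
    unfolding cinner_ell2_def
    by (simp add: ell2_nth_simps cinner_scaleC_left suminf_mult summable_sq_cinner summable_ell2)
  show "cinner x y = cnj (cinner y x)" by (rule cnj)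
  show "cinner (x + y) z = cinner x z + cinner y z" by (rule add)
  show "cinner (c *\<^sub>C x) y = c * cinner x y" by (rule mult)
  show "inner x y = inner y x"
    unfolding inner_ell2_def by (subst cnj) simp
  show "inner (x + y) z = inner x z + inner y z"
    unfolding inner_ell2_def by (simp add: add)
  have "a *\<^sub>R x = complex_of_real a *\<^sub>C x"
    by (rule ell2_eqI) (simp add: ell2_nth_simps scaleR_scaleC)
  then show "inner (a *\<^sub>R x) y = a * inner x y"
    unfolding inner_ell2_def by (simp add: mult)
  show "0 \<le> inner x x"
    unfolding inner_ell2_self by (intro suminf_nonneg summable_ell2) simp
  have "x = 0 \<longleftrightarrow> (\<forall>n. ell2_nth x n = 0)"
    by (metis ell2_eqI ell2_nth_zero)
  then show "inner x x = 0 \<longleftrightarrow> x = 0"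
    unfolding inner_ell2_self by (subst suminf_eq_zero_iff[OF summable_ell2]) simp_all
qed

end

lemma norm_ell2_sq: "(norm x)\<^sup>2 = suminf (\<lambda>n. (norm (ell2_nth x n))\<^sup>2)"
  by (simp add: power2_norm_eq_inner inner_ell2_self)

lemma sum_norm_ell2_le: "(\<Sum>n<N. (norm (ell2_nth x n))\<^sup>2) \<le> (norm x)\<^sup>2"
  unfolding norm_ell2_sq by (intro sum_le_suminf summable_ell2) auto

lemma norm_ell2_nth_le: "norm (ell2_nth x n) \<le> norm x"
proof -
  have "(norm (ell2_nth x n))\<^sup>2 \<le> (\<Sum>k<Suc n. (norm (ell2_nth x k))\<^sup>2)"
    by (simp add: sum_nonneg)
  also have "\<dots> \<le> (norm x)\<^sup>2" by (rule sum_norm_ell2_le)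
  finally show ?thesis by (rule power2_le_imp_le) simp
qed

instance ell2 :: (chilbert_space) chilbert_space
proof
  fix X :: "nat \<Rightarrow> 'a ell2"
  assume X: "Cauchy X"
  have "Cauchy (\<lambda>m. ell2_nth (X m) n)" for n
  proof (rule metric_CauchyI)
    fix e :: real assume "0 < e"
    with X obtain M where M: "\<forall>m\<ge>M. \<forall>k\<ge>M. dist (X m) (X k) < e"
      unfolding Cauchy_def by blast
    have "dist (ell2_nth (X m) n) (ell2_nth (X k) n) \<le> dist (X m) (X k)" for m k
      using norm_ell2_nth_le[of "X m - X k" n] by (simp add: dist_norm ell2_nth_simps)
    with M show "\<exists>M. \<forall>m\<ge>M. \<forall>k\<ge>M. dist (ell2_nth (X m) n) (ell2_nth (X k) n) < e"
      by (meson le_less_trans)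
  qed
  then have "\<exists>l. (\<lambda>m. ell2_nth (X m) n) \<longlonglongrightarrow> l" for n
    by (meson Cauchy_convergent convergent_def)
  then obtain f where f: "\<And>n. (\<lambda>m. ell2_nth (X m) n) \<longlonglongrightarrow> f n" by metis
  have key: "\<exists>M. \<forall>m\<ge>M. \<forall>N. (\<Sum>n<N. (norm (ell2_nth (X m) n - f n))\<^sup>2) \<le> e\<^sup>2"
    if "0 < e" for e :: real
  proof -
    from X that obtain M where M: "\<forall>m\<ge>M. \<forall>k\<ge>M. dist (X m) (X k) < e"
      unfolding Cauchy_def by blast
    have "(\<Sum>n<N. (norm (ell2_nth (X m) n - f n))\<^sup>2) \<le> e\<^sup>2" if "m \<ge> M" for m N
    proof (rule tendsto_upperbound)
      show "(\<lambda>k. \<Sum>n<N. (norm (ell2_nth (X m) n - ell2_nth (X k) n))\<^sup>2)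
          \<longlonglongrightarrow> (\<Sum>n<N. (norm (ell2_nth (X m) n - f n))\<^sup>2)"
        by (intro tendsto_intros f)
      have "(\<Sum>n<N. (norm (ell2_nth (X m) n - ell2_nth (X k) n))\<^sup>2) \<le> e\<^sup>2" if "k \<ge> M" for k
      proof -
        have "(\<Sum>n<N. (norm (ell2_nth (X m) n - ell2_nth (X k) n))\<^sup>2) \<le> (norm (X m - X k))\<^sup>2"
          using sum_norm_ell2_le[where N=N and x="X m - X k"] by (simp add: ell2_nth_simps)
        also have "\<dots> \<le> e\<^sup>2"
          using M \<open>m \<ge> M\<close> \<open>k \<ge> M\<close> by (intro power_mono) (auto simp: dist_norm less_imp_le)
        finally show ?thesis .
      qed
      then show "\<forall>\<^sub>F k in sequentially. (\<Sum>n<N. (norm (ell2_nth (X m) n - ell2_nth (X k) n))\<^sup>2) \<le> e\<^sup>2"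
        by (auto simp: eventually_sequentially)
    qed simp
    then show ?thesis by blast
  qed
  have sm: "summable (\<lambda>n. (norm (ell2_nth (X m) n - f n))\<^sup>2)"
    if "\<forall>N. (\<Sum>n<N. (norm (ell2_nth (X m) n - f n))\<^sup>2) \<le> c" for m c
    using that by (intro summableI_nonneg_bounded[where x=c]) auto
  obtain m0 where "\<forall>N. (\<Sum>n<N. (norm (ell2_nth (X m0) n - f n))\<^sup>2) \<le> 1\<^sup>2"
    using key[of 1] by auto
  then have "summable (\<lambda>n. (norm (ell2_nth (X m0) n - f n))\<^sup>2)"
    by (rule sm)
  then have "summable (\<lambda>n. (norm (f n - ell2_nth (X m0) n))\<^sup>2)"
    by (simp add: norm_minus_commute)
  from summable_sq_add[OF this summable_ell2[of "X m0"]]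
  have fs: "ell2_nth (Abs_ell2 f) = f"
    by (simp add: ell2_nth_Abs)
  have "X \<longlonglongrightarrow> Abs_ell2 f"
  proof (rule metric_LIMSEQ_I)
    fix r :: real assume "0 < r"
    then obtain M where M: "\<forall>m\<ge>M. \<forall>N. (\<Sum>n<N. (norm (ell2_nth (X m) n - f n))\<^sup>2) \<le> (r/2)\<^sup>2"
      using key[of "r/2"] by auto
    have "dist (X m) (Abs_ell2 f) < r" if "m \<ge> M" for m
    proof -
      have b: "\<forall>N. (\<Sum>n<N. (norm (ell2_nth (X m) n - f n))\<^sup>2) \<le> (r/2)\<^sup>2"
        using M that by blast
      have "(norm (X m - Abs_ell2 f))\<^sup>2 = suminf (\<lambda>n. (norm (ell2_nth (X m) n - f n))\<^sup>2)"
        by (simp add: norm_ell2_sq ell2_nth_simps fs)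
      also have "\<dots> \<le> (r/2)\<^sup>2"
        using b by (intro suminf_le_const sm) auto
      finally have "norm (X m - Abs_ell2 f) \<le> r/2"
        by (rule power2_le_imp_le) (use \<open>0 < r\<close> in simp)
      with \<open>0 < r\<close> show ?thesis by (simp add: dist_norm)
    qed
    then show "\<exists>M. \<forall>m\<ge>M. dist (X m) (Abs_ell2 f) < r" by blast
  qed
  then show "convergent X" by (auto simp: convergent_def)
qed

text \<open>
  A Hilbert space is represented by a closed complex subspace \<open>S\<close> of a type of class
  \<^class>\<open>chilbert_space\<close>, and an operator on it by a function whose values outside \<open>S\<close> are
  irrelevant.
\<close>

definition closed_csubspace :: "'a::complex_inner set \<Rightarrow> bool" where
  "closed_csubspace S \<longleftrightarrow> 0 \<in> S \<and> (\<forall>x\<in>S. \<forall>y\<in>S. x + y \<in> S) \<and> (\<forall>c. \<forall>x\<in>S. c *\<^sub>C x \<in> S) \<and> closed S"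

definition closed_cspan :: "'a::complex_inner set \<Rightarrow> 'a set" where
  "closed_cspan X = \<Inter> {M. closed_csubspace M \<and> X \<subseteq> M}"

definition clinear_on :: "'a::complex_inner set \<Rightarrow> ('a \<Rightarrow> 'b::complex_inner) \<Rightarrow> bool" where
  "clinear_on S T \<longleftrightarrow> (\<forall>x\<in>S. \<forall>y\<in>S. T (x + y) = T x + T y) \<and> (\<forall>c. \<forall>x\<in>S. T (c *\<^sub>C x) = c *\<^sub>C T x)"

definition operator_on :: "'a::complex_inner set \<Rightarrow> ('a \<Rightarrow> 'a) \<Rightarrow> bool" where
  "operator_on S T \<longleftrightarrow> closed_csubspace S \<and> T ` S \<subseteq> S \<and> clinear_on S T
    \<and> (\<exists>C. \<forall>x\<in>S. norm (T x) \<le> C * norm x)"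

definition adjoint_on :: "'a::complex_inner set \<Rightarrow> ('a \<Rightarrow> 'a) \<Rightarrow> 'a \<Rightarrow> 'a" where
  "adjoint_on S T y = (THE z. z \<in> S \<and> (\<forall>x\<in>S. cinner (T x) y = cinner x z))"

definition normal_on :: "'a::complex_inner set \<Rightarrow> ('a \<Rightarrow> 'a) \<Rightarrow> bool" where
  "normal_on S T \<longleftrightarrow> operator_on S T \<and> (\<forall>x\<in>S. T (adjoint_on S T x) = adjoint_on S T (T x))"

definition commutator :: "('a \<Rightarrow> 'a) \<Rightarrow> ('a \<Rightarrow> 'a) \<Rightarrow> 'a \<Rightarrow> 'a::ab_group_add" where
  "commutator X Y x = X (Y x) - Y (X x)"

definition orth_proj :: "'a::complex_inner set \<Rightarrow> 'a \<Rightarrow> 'a" where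
  "orth_proj M x = (THE y. y \<in> M \<and> (\<forall>m\<in>M. cinner (x - y) m = 0))"

definition isometric_embedding ::
    "'a::complex_inner set \<Rightarrow> 'b::complex_inner set \<Rightarrow> ('a \<Rightarrow> 'b) \<Rightarrow> bool" where
  "isometric_embedding S L J \<longleftrightarrow> clinear_on S J \<and> J ` S \<subseteq> L
    \<and> (\<forall>x\<in>S. \<forall>y\<in>S. cinner (J x) (J y) = cinner x y)"

definition commuting_triple_on ::
    "'a::complex_inner set \<Rightarrow> ('a \<Rightarrow> 'a) \<Rightarrow> ('a \<Rightarrow> 'a) \<Rightarrow> ('a \<Rightarrow> 'a) \<Rightarrow> bool" where
  "commuting_triple_on S T1 T2 T3 \<longleftrightarrow> operator_on S T1 \<and> operator_on S T2 \<and> operator_on S T3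
    \<and> (\<forall>x\<in>S. commutator T1 T2 x = 0 \<and> commutator T1 T3 x = 0 \<and> commutator T2 T3 x = 0)"

definition unitarily_equivalent ::
    "'a::complex_inner set \<Rightarrow> ('a \<Rightarrow> 'a) \<Rightarrow> ('a \<Rightarrow> 'a) \<Rightarrow> ('a \<Rightarrow> 'a)
      \<Rightarrow> 'b::complex_inner set \<Rightarrow> ('b \<Rightarrow> 'b) \<Rightarrow> ('b \<Rightarrow> 'b) \<Rightarrow> ('b \<Rightarrow> 'b) \<Rightarrow> bool" where
  "unitarily_equivalent S W1 W2 W3 L V1 V2 V3 \<longleftrightarrow>
    (\<exists>U. isometric_embedding S L U \<and> U ` S = L
      \<and> (\<forall>x\<in>S. U (W1 x) = V1 (U x) \<and> U (W2 x) = V2 (U x) \<and> U (W3 x) = V3 (U x)))"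

text \<open>
  Exactness of the Koszul complex
  \<open>0 \<rightarrow> S \<rightarrow> S\<^sup>3 \<rightarrow> S\<^sup>3 \<rightarrow> S \<rightarrow> 0\<close> of a commuting triple, where
  \<open>x \<mapsto> (T1 x, T2 x, T3 x)\<close>, then
  \<open>(x1, x2, x3) \<mapsto> (T1 x2 - T2 x1, T1 x3 - T3 x1, T2 x3 - T3 x2)\<close>, then
  \<open>(y12, y13, y23) \<mapsto> T1 y23 - T2 y13 + T3 y12\<close>.
  The inclusions of images in kernels hold by commutativity.
\<close>

definition koszul_exact ::
    "'a::complex_inner set \<Rightarrow> ('a \<Rightarrow> 'a) \<Rightarrow> ('a \<Rightarrow> 'a) \<Rightarrow> ('a \<Rightarrow> 'a) \<Rightarrow> bool" where
  "koszul_exact S T1 T2 T3 \<longleftrightarrow>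
    (\<forall>x\<in>S. T1 x = 0 \<and> T2 x = 0 \<and> T3 x = 0 \<longrightarrow> x = 0)
    \<and> (\<forall>x1\<in>S. \<forall>x2\<in>S. \<forall>x3\<in>S.
        T1 x2 - T2 x1 = 0 \<and> T1 x3 - T3 x1 = 0 \<and> T2 x3 - T3 x2 = 0 \<longrightarrow>
        (\<exists>x\<in>S. x1 = T1 x \<and> x2 = T2 x \<and> x3 = T3 x))
    \<and> (\<forall>y12\<in>S. \<forall>y13\<in>S. \<forall>y23\<in>S.
        T1 y23 - T2 y13 + T3 y12 = 0 \<longrightarrow>
        (\<exists>x1\<in>S. \<exists>x2\<in>S. \<exists>x3\<in>S.
          y12 = T1 x2 - T2 x1 \<and> y13 = T1 x3 - T3 x1 \<and> y23 = T2 x3 - T3 x2))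
    \<and> (\<forall>z\<in>S. \<exists>y12\<in>S. \<exists>y13\<in>S. \<exists>y23\<in>S. z = T1 y23 - T2 y13 + T3 y12)"

definition taylor_spectrum ::
    "'a::complex_inner set \<Rightarrow> ('a \<Rightarrow> 'a) \<Rightarrow> ('a \<Rightarrow> 'a) \<Rightarrow> ('a \<Rightarrow> 'a) \<Rightarrow> (complex \<times> complex \<times> complex) set" where
  "taylor_spectrum S T1 T2 T3 =
    {(z1, z2, z3). \<not> koszul_exact S (\<lambda>x. T1 x - z1 *\<^sub>C x) (\<lambda>x. T2 x - z2 *\<^sub>C x) (\<lambda>x. T3 x - z3 *\<^sub>C x)}"

text \<open>A polynomial in three variables is given by its finitely many nonzero coefficients.\<close>

type_synonym poly3 = "(nat \<times> nat \<times> nat) \<Rightarrow>\<^sub>0 complex"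

definition poly3_eval :: "poly3 \<Rightarrow> complex \<times> complex \<times> complex \<Rightarrow> complex" where
  "poly3_eval p = (\<lambda>(z1, z2, z3).
    \<Sum>(i, j, k)\<in>Poly_Mapping.keys p. Poly_Mapping.lookup p (i, j, k) * z1 ^ i * z2 ^ j * z3 ^ k)"

definition poly3_op ::
    "poly3 \<Rightarrow> ('a::complex_inner \<Rightarrow> 'a) \<Rightarrow> ('a \<Rightarrow> 'a) \<Rightarrow> ('a \<Rightarrow> 'a) \<Rightarrow> 'a \<Rightarrow> 'a" where
  "poly3_op p T1 T2 T3 x =
    (\<Sum>(i, j, k)\<in>Poly_Mapping.keys p.
      Poly_Mapping.lookup p (i, j, k) *\<^sub>C (T1 ^^ i) ((T2 ^^ j) ((T3 ^^ k) x)))"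

text \<open>
  A rational function with poles off \<open>K\<close> is a quotient \<open>p / q\<close> of polynomials with \<open>q\<close> zero-free
  on \<open>K\<close>; the operator \<open>q(T)\<close> is then a bijection of \<open>S\<close> by the spectral mapping theorem, since the
  Taylor spectrum is contained in \<open>K\<close>.
\<close>

definition rational3_op ::
    "'a::complex_inner set \<Rightarrow> poly3 \<Rightarrow> poly3 \<Rightarrow> ('a \<Rightarrow> 'a) \<Rightarrow> ('a \<Rightarrow> 'a) \<Rightarrow> ('a \<Rightarrow> 'a) \<Rightarrow> 'a \<Rightarrow> 'a" where
  "rational3_op S p q T1 T2 T3 x = poly3_op p T1 T2 T3 (inv_into S (poly3_op q T1 T2 T3) x)"

definition spectral_set ::
    "(complex \<times> complex \<times> complex) set \<Rightarrow> 'a::complex_inner set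
      \<Rightarrow> ('a \<Rightarrow> 'a) \<Rightarrow> ('a \<Rightarrow> 'a) \<Rightarrow> ('a \<Rightarrow> 'a) \<Rightarrow> bool" where
  "spectral_set K S T1 T2 T3 \<longleftrightarrow> compact K \<and> taylor_spectrum S T1 T2 T3 \<subseteq> K
    \<and> (\<forall>p q. (\<forall>z\<in>K. poly3_eval q z \<noteq> 0) \<longrightarrow>
        (\<forall>x\<in>S. norm (rational3_op S p q T1 T2 T3 x)
          \<le> (SUP z\<in>K. cmod (poly3_eval p z / poly3_eval q z)) * norm x))"

definition tetrablock :: "(complex \<times> complex \<times> complex) set" where
  "tetrablock = {(M $ 1 $ 1, M $ 2 $ 2, det M) | M :: complex^2^2. transpose M = M \<and> onorm ((*v) M) < 1}"

definition tetrablock_algebra :: "(complex \<times> complex \<times> complex \<Rightarrow> complex) set" where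
  "tetrablock_algebra = {f. continuous_on (closure tetrablock) f
    \<and> (\<forall>z\<in>tetrablock. \<exists>d1 d2 d3.
        (f has_derivative (\<lambda>(h1, h2, h3). d1 * h1 + d2 * h2 + d3 * h3)) (at z))}"

text \<open>
  The Shilov boundary is the smallest closed subset of \<open>X\<close> on which every \<open>\<bar>f\<bar>\<close> attains its
  maximum over \<open>X\<close>; a smallest one, if it exists, is the intersection of all of them.
\<close>

definition shilov_boundary :: "'a::topological_space set \<Rightarrow> ('a \<Rightarrow> complex) set \<Rightarrow> 'a set" where
  "shilov_boundary X F =
    \<Inter> {C. C \<subseteq> X \<and> closed C \<and> (\<forall>f\<in>F. \<forall>z\<in>X. \<exists>w\<in>C. cmod (f z) \<le> cmod (f w))}"

definition distinguished_boundary :: "(complex \<times> complex \<times> complex) set" where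
  "distinguished_boundary = shilov_boundary (closure tetrablock) tetrablock_algebra"

definition tetrablock_contraction ::
    "'a::complex_inner set \<Rightarrow> ('a \<Rightarrow> 'a) \<Rightarrow> ('a \<Rightarrow> 'a) \<Rightarrow> ('a \<Rightarrow> 'a) \<Rightarrow> bool" where
  "tetrablock_contraction S A B P \<longleftrightarrow>
    commuting_triple_on S A B P \<and> spectral_set (closure tetrablock) S A B P"

definition tetrablock_unitary ::
    "'a::complex_inner set \<Rightarrow> ('a \<Rightarrow> 'a) \<Rightarrow> ('a \<Rightarrow> 'a) \<Rightarrow> ('a \<Rightarrow> 'a) \<Rightarrow> bool" where
  "tetrablock_unitary S U1 U2 U3 \<longleftrightarrow> commuting_triple_on S U1 U2 U3
    \<and> normal_on S U1 \<and> normal_on S U2 \<and> normal_on S U3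
    \<and> taylor_spectrum S U1 U2 U3 \<subseteq> distinguished_boundary"

text \<open>
  The type argument names the type in which the larger Hilbert space carrying the tetrablock
  unitary is sought; it is needed because HOL has no existential quantifier over types.
\<close>

definition tetrablock_isometry ::
    "'u::chilbert_space itself \<Rightarrow> 'a::complex_inner set \<Rightarrow> ('a \<Rightarrow> 'a) \<Rightarrow> ('a \<Rightarrow> 'a) \<Rightarrow> ('a \<Rightarrow> 'a) \<Rightarrow> bool" where
  "tetrablock_isometry _ S W1 W2 W3 \<longleftrightarrow> commuting_triple_on S W1 W2 W3
    \<and> (\<exists>(L :: 'u set) U1 U2 U3 J. tetrablock_unitary L U1 U2 U3 \<and> isometric_embedding S L J
        \<and> (\<forall>x\<in>S. U1 (J x) = J (W1 x) \<and> U2 (J x) = J (W2 x) \<and> U3 (J x) = J (W3 x)))"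

text \<open>
  Here the small Hilbert space is the whole type \<open>'h\<close>; it is regarded as a subspace of \<open>S\<close> through
  the isometric embedding \<open>J\<close>.
\<close>

definition dilation ::
    "'k::complex_inner set \<Rightarrow> ('h::complex_inner \<Rightarrow> 'k) \<Rightarrow> ('k \<Rightarrow> 'k) \<Rightarrow> ('k \<Rightarrow> 'k) \<Rightarrow> ('k \<Rightarrow> 'k)
      \<Rightarrow> ('h \<Rightarrow> 'h) \<Rightarrow> ('h \<Rightarrow> 'h) \<Rightarrow> ('h \<Rightarrow> 'h) \<Rightarrow> bool" where
  "dilation S J W1 W2 W3 A B P \<longleftrightarrow> commuting_triple_on S W1 W2 W3 \<and> isometric_embedding UNIV S J
    \<and> (\<forall>k1 k2 k3 h. orth_proj (range J) ((W1 ^^ k1) ((W2 ^^ k2) ((W3 ^^ k3) (J h))))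
          = J ((A ^^ k1) ((B ^^ k2) ((P ^^ k3) h))))"

definition minimal_dilation ::
    "'k::complex_inner set \<Rightarrow> ('h::complex_inner \<Rightarrow> 'k) \<Rightarrow> ('k \<Rightarrow> 'k) \<Rightarrow> ('k \<Rightarrow> 'k) \<Rightarrow> ('k \<Rightarrow> 'k)
      \<Rightarrow> ('h \<Rightarrow> 'h) \<Rightarrow> ('h \<Rightarrow> 'h) \<Rightarrow> ('h \<Rightarrow> 'h) \<Rightarrow> bool" where
  "minimal_dilation S J W1 W2 W3 A B P \<longleftrightarrow> dilation S J W1 W2 W3 A B P
    \<and> S = closed_cspan {(W1 ^^ k1) ((W2 ^^ k2) ((W3 ^^ k3) (J h))) | k1 k2 k3 h. True}"

definition minimal_isometric_dilation ::
    "'k::complex_inner set \<Rightarrow> ('h::complex_inner \<Rightarrow> 'k) \<Rightarrow> ('k \<Rightarrow> 'k) \<Rightarrow> ('h \<Rightarrow> 'h) \<Rightarrow> bool" where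
  "minimal_isometric_dilation S J W P \<longleftrightarrow> operator_on S W \<and> (\<forall>x\<in>S. norm (W x) = norm x)
    \<and> isometric_embedding UNIV S J
    \<and> (\<forall>k h. orth_proj (range J) ((W ^^ k) (J h)) = J ((P ^^ k) h))
    \<and> S = closed_cspan {(W ^^ k) (J h) | k h. True}"

text \<open>The positive square root of \<open>I - P\<^sup>*P\<close>.\<close>

definition defect_op :: "('h::complex_inner \<Rightarrow> 'h) \<Rightarrow> 'h \<Rightarrow> 'h" where
  "defect_op P = (THE D. operator_on UNIV D
    \<and> (\<forall>x. cinner (D x) x \<in> \<real>\<^sub>\<ge>\<^sub>0)
    \<and> (\<forall>x. D (D x) = x - adjoint_on UNIV P (P x)))"

definition defect_space :: "('h::complex_inner \<Rightarrow> 'h) \<Rightarrow> 'h set" where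
  "defect_space P = closure (range (defect_op P))"

definition fundamental_operators ::
    "('h::complex_inner \<Rightarrow> 'h) \<Rightarrow> ('h \<Rightarrow> 'h) \<Rightarrow> ('h \<Rightarrow> 'h) \<Rightarrow> ('h \<Rightarrow> 'h) \<Rightarrow> ('h \<Rightarrow> 'h) \<Rightarrow> bool" where
  "fundamental_operators A B P F1 F2 \<longleftrightarrow>
    operator_on (defect_space P) F1 \<and> operator_on (defect_space P) F2
    \<and> (\<forall>x. A x - adjoint_on UNIV B (P x) = defect_op P (F1 (defect_op P x)))
    \<and> (\<forall>x. B x - adjoint_on UNIV A (P x) = defect_op P (F2 (defect_op P x)))"

definition dilation_space :: "('h::complex_inner \<Rightarrow> 'h) \<Rightarrow> 'h ell2 set" where
  "dilation_space P = {x. \<forall>n. ell2_nth x (Suc n) \<in> defect_space P}"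

definition ell2_embed :: "'h::complex_inner \<Rightarrow> 'h ell2" where
  "ell2_embed h = Abs_ell2 (\<lambda>n. if n = 0 then h else 0)"

text \<open>
  \<open>(h0, h1, h2, \<dots>) \<mapsto> (T h0, G\<^sup>* D\<^sub>P h0 + F h1, G\<^sup>* h1 + F h2, \<dots>)\<close>, the common form of
  \<open>V1\<close> and \<open>V2\<close>.
\<close>

definition dilation_op ::
    "('h::complex_inner \<Rightarrow> 'h) \<Rightarrow> ('h \<Rightarrow> 'h) \<Rightarrow> ('h \<Rightarrow> 'h) \<Rightarrow> ('h \<Rightarrow> 'h) \<Rightarrow> 'h ell2 \<Rightarrow> 'h ell2" where
  "dilation_op P T F G x = Abs_ell2 (\<lambda>n. case n of
      0 \<Rightarrow> T (ell2_nth x 0)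
    | Suc 0 \<Rightarrow> adjoint_on (defect_space P) G (defect_op P (ell2_nth x 0)) + F (ell2_nth x 1)
    | Suc (Suc m) \<Rightarrow> adjoint_on (defect_space P) G (ell2_nth x (m + 1)) + F (ell2_nth x (m + 2)))"

definition V1 :: "('h::complex_inner \<Rightarrow> 'h) \<Rightarrow> ('h \<Rightarrow> 'h) \<Rightarrow> ('h \<Rightarrow> 'h) \<Rightarrow> ('h \<Rightarrow> 'h) \<Rightarrow> 'h ell2 \<Rightarrow> 'h ell2" where
  "V1 A P F1 F2 = dilation_op P A F1 F2"

definition V2 :: "('h::complex_inner \<Rightarrow> 'h) \<Rightarrow> ('h \<Rightarrow> 'h) \<Rightarrow> ('h \<Rightarrow> 'h) \<Rightarrow> ('h \<Rightarrow> 'h) \<Rightarrow> 'h ell2 \<Rightarrow> 'h ell2" where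
  "V2 B P F1 F2 = dilation_op P B F2 F1"

definition V3 :: "('h::complex_inner \<Rightarrow> 'h) \<Rightarrow> 'h ell2 \<Rightarrow> 'h ell2" where
  "V3 P x = Abs_ell2 (\<lambda>n. case n of
      0 \<Rightarrow> P (ell2_nth x 0)
    | Suc 0 \<Rightarrow> defect_op P (ell2_nth x 0)
    | Suc (Suc m) \<Rightarrow> ell2_nth x (m + 1))"

end

theory Submission
  imports Defs "HOL-Complex_Analysis.Conformal_Mappings"
begin

text \<open>
  The rational functions \<open>(x\<^sub>1 - z x\<^sub>3) / (1 - z x\<^sub>2)\<close>, \<open>\<bar>z\<bar> \<le> 1\<close>, are bounded by \<open>1\<close> on the
  tetrablock. For a tetrablock contraction this gives \<open>\<bar>\<langle>F\<^sub>1 d, d\<rangle>\<bar> + \<bar>\<langle>F\<^sub>2 d, d\<rangle>\<bar> \<le> \<parallel>d\<parallel>\<^sup>2\<close>, and for a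
  tetrablock isometry with isometric third component it gives \<open>W\<^sub>1 = W\<^sub>2\<^sup>* W\<^sub>3\<close> and \<open>W\<^sub>2 = W\<^sub>1\<^sup>* W\<^sub>3\<close>.

  (1) The commutator conditions make \<open>F\<^sub>2 + z F\<^sub>1\<^sup>*\<close> normal for \<open>\<bar>z\<bar> = 1\<close>, so its norm is its numerical
  radius, which is at most \<open>1\<close>, and \<open>V\<^sub>2\<close> is a contraction. It extends to a normal operator \<open>N\<close> commuting
  with a unitary extension \<open>U\<close> of \<open>V\<^sub>3\<close>. The triple \<open>(N\<^sup>* U, N, U)\<close> extends \<open>(V\<^sub>1, V\<^sub>2, V\<^sub>3)\<close>, because
  \<open>V\<^sub>1 = V\<^sub>2\<^sup>* V\<^sub>3\<close>, and it is a tetrablock unitary: a point of the joint spectrum of commuting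
  normal operators is an approximate joint eigenvalue, and hence lies in \<open>bE\<close>.

  (2) By minimality the Gram matrix of the vectors \<open>W\<^sub>3\<^sup>k h\<close> is determined by \<open>P\<close>, so that \<open>W\<^sub>3\<close> may be
  taken to be \<open>V\<^sub>3\<close>. Then \<open>W\<^sub>1 = W\<^sub>2\<^sup>* W\<^sub>3\<close> determines \<open>W\<^sub>1 h\<close> for \<open>h \<in> H\<close>, and similarly for \<open>W\<^sub>2\<close>. The
  commutator relations are the entries of \<open>V\<^sub>1 V\<^sub>2 = V\<^sub>2 V\<^sub>1\<close>.
\<close>

section \<open>Complex inner product spaces\<close>

text \<open>The notions speak of operators on closed subspaces, with a Taylor spectrum given by
  exactness of a Koszul complex. Two devices make them tractable. An operator on a subspace is
  extended by zero to the whole space, so that all algebra takes place in one Banach algebra, where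
  the projection onto the subspace acts as the identity of that subspace. For commuting normal
  triples, exactness of the Koszul complex amounts to a joint lower bound, and the failure of an
  inequality between affine functions of the triple produces joint approximate eigenvectors; these
  stand in for a functional calculus. Fuglede's theorem is needed because the components of a
  tetrablock unitary are assumed to commute with each other, but not with each other's adjoints.

  Of the Shilov boundary two facts enter. It lies in the closed tetrablock, which yields the
  inequalities for a tetrablock unitary; and it contains all points
  \<open>(cnj \<beta> * c, \<beta>, c)\<close> with \<open>|c| = 1\<close> and
  \<open>|\<beta>| \<le> 1\<close>, which certifies the extension built in (1) as a tetrablock
  unitary.\<close>

lemma scaleC_one [simp]: "1 *\<^sub>C x = x" for x :: "'a::complex_inner"
  using scaleR_scaleC[of 1 x] by simp

lemma scaleC_zero_left [simp]: "0 *\<^sub>C x = 0" for x :: "'a::complex_inner"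
  using scaleR_scaleC[of 0 x] by simp

lemma scaleC_zero_right [simp]: "c *\<^sub>C 0 = (0::'a::complex_inner)"
  using scaleC_add_right[of c 0 "0::'a"] by simp

lemma scaleC_minus_right: "c *\<^sub>C (- x) = - (c *\<^sub>C x)" for x :: "'a::complex_inner"
  using scaleC_add_right[of c x "- x"] by (simp add: eq_neg_iff_add_eq_0 add.commute)

lemma scaleC_minus_left: "(- c) *\<^sub>C x = - (c *\<^sub>C x)" for x :: "'a::complex_inner"
  using scaleC_add_left[of c "- c" x] by (simp add: eq_neg_iff_add_eq_0 add.commute)

lemma scaleC_diff_right: "c *\<^sub>C (x - y) = c *\<^sub>C x - c *\<^sub>C y" for x :: "'a::complex_inner"
  using scaleC_add_right[of c x "- y"] by (simp add: scaleC_minus_right)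

lemma scaleC_diff_left: "(c - d) *\<^sub>C x = c *\<^sub>C x - d *\<^sub>C x" for x :: "'a::complex_inner"
  using scaleC_add_left[of c "- d" x] by (simp add: scaleC_minus_left)

lemma scaleR_scaleC_commute: "r *\<^sub>R (c *\<^sub>C x) = c *\<^sub>C (r *\<^sub>R x)" for x :: "'a::complex_inner"
  by (simp add: scaleR_scaleC scaleC_scaleC mult.commute)

lemma bounded_linear_scaleC: "bounded_linear (\<lambda>x::'a::complex_inner. c *\<^sub>C x)"
  by (rule bounded_linear_intro[where K = "cmod c"])
    (simp_all add: scaleC_add_right scaleR_scaleC_commute norm_scaleC mult.commute)

lemma tendsto_scaleC:
  "(f \<longlongrightarrow> (l::'a::complex_inner)) F \<Longrightarrow> ((\<lambda>x. c *\<^sub>C f x) \<longlongrightarrow> c *\<^sub>C l) F"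
  by (rule bounded_linear.tendsto[OF bounded_linear_scaleC])

lemma cinner_add_right: "cinner x (y + z) = cinner x y + cinner x z"
  using cinner_commute[of x "y + z"] cinner_commute[of x y] cinner_commute[of x z]
  by (simp add: cinner_add_left)

lemma cinner_zero_left [simp]: "cinner 0 y = 0"
  using cinner_add_left[of 0 0 y] by simp

lemma cinner_zero_right [simp]: "cinner x 0 = 0"
  using cinner_add_right[of x 0 0] by simp

lemma cinner_minus_left: "cinner (- x) y = - cinner x y"
  using cinner_add_left[of x "- x" y] by (simp add: eq_neg_iff_add_eq_0 add.commute)

lemma cinner_minus_right: "cinner x (- y) = - cinner x y"
  using cinner_add_right[of x y "- y"] by (simp add: eq_neg_iff_add_eq_0 add.commute)

lemma cinner_diff_left: "cinner (x - y) z = cinner x z - cinner y z"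
  using cinner_add_left[of x "- y" z] by (simp add: cinner_minus_left)

lemma cinner_diff_right: "cinner x (y - z) = cinner x y - cinner x z"
  using cinner_add_right[of x y "- z"] by (simp add: cinner_minus_right)

lemma cinner_self: "cinner x x = complex_of_real ((norm x)\<^sup>2)"
proof -
  have "Im (cinner x x) = 0"
    using cinner_commute[of x x] by (simp add: complex_eq_iff)
  then show ?thesis
    by (simp add: complex_eq_iff inner_eq_Re_cinner[symmetric] power2_norm_eq_inner)
qed

text \<open>The complex inner product is determined by the real one; real orthogonality and real
  adjoints can therefore be upgraded to complex ones.\<close>

lemma cinner_eq_Complex: "cinner x y = Complex (inner x y) (inner x (\<i> *\<^sub>C y))"
  by (simp add: complex_eq_iff inner_eq_Re_cinner cinner_scaleC_right)

lemma inner_scaleC_right: "inner x (c *\<^sub>C y) = inner (cnj c *\<^sub>C x) y"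
  by (simp add: inner_eq_Re_cinner cinner_scaleC_right cinner_scaleC_left)

lemma bounded_bilinear_cinner: "bounded_bilinear (cinner :: 'a::complex_inner \<Rightarrow> 'a \<Rightarrow> complex)"
proof
  show "\<exists>K. \<forall>a b::'a. cmod (cinner a b) \<le> norm a * norm b * K"
    by (intro exI[of _ 1]) (simp add: norm_cinner_le)
qed (simp_all add: cinner_add_left cinner_add_right scaleR_scaleC cinner_scaleC_left
    cinner_scaleC_right scaleR_conv_of_real)

lemmas tendsto_cinner = bounded_bilinear.tendsto[OF bounded_bilinear_cinner]
lemmas cinner_sum_left = bounded_bilinear.sum_left[OF bounded_bilinear_cinner]
lemmas cinner_sum_right = bounded_bilinear.sum_right[OF bounded_bilinear_cinner]

lemma cinner_left_eqI: "(\<And>z. cinner x z = cinner y z) \<Longrightarrow> x = y"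
proof -
  assume "\<And>z. cinner x z = cinner y z"
  then have "cinner (x - y) (x - y) = 0" by (simp add: cinner_diff_left)
  then show "x = y" by (simp add: cinner_self)
qed

lemma inner_left_eqI: "(\<And>z. inner x z = inner y z) \<Longrightarrow> x = y" for x y :: "'a::real_inner"
proof -
  assume "\<And>z. inner x z = inner y z"
  then have "inner (x - y) (x - y) = 0" by (simp add: inner_diff_left)
  then show "x = y" by simp
qed

lemma norm_eq_from_cinner: "cinner x x = cinner y y \<Longrightarrow> norm x = norm y"
  unfolding cinner_self of_real_eq_iff by simp

text \<open>Polarisation: the difference of the two sides is sesquilinear and zero on the diagonal,
  hence zero. It upgrades identities of quadratic forms, which is what the estimates deliver, to
  operator identities.\<close>

lemma cinner_eq_from_form:
  fixes T R :: "'a::complex_inner \<Rightarrow> 'b::complex_inner"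
  assumes T: "clinear_on S T" and R: "clinear_on S R" and S: "closed_csubspace S"
    and eq: "\<And>x. x \<in> S \<Longrightarrow> cinner (T x) (G x) = cinner (R x) (H x)"
    and G: "clinear_on S G" and H: "clinear_on S H" and "x \<in> S" "y \<in> S"
  shows "cinner (T x) (G y) = cinner (R x) (H y)"
proof -
  define f where "f x y = cinner (T x) (G y) - cinner (R x) (H y)" for x y
  have add: "f (x + y) z = f x z + f y z" "f z (x + y) = f z x + f z y"
    if "x \<in> S" "y \<in> S" "z \<in> S" for x y z
    using that T R G H by (auto simp: f_def clinear_on_def cinner_add_left cinner_add_right)
  have sc: "f (c *\<^sub>C x) y = c * f x y" "f y (c *\<^sub>C x) = cnj c * f y x" if "x \<in> S" "y \<in> S" for c x y
    using that T R G H
    by (auto simp: f_def clinear_on_def cinner_scaleC_left cinner_scaleC_right algebra_simps)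
  have z: "f x x = 0" if "x \<in> S" for x using eq that by (simp add: f_def)
  have ix: "\<i> *\<^sub>C y \<in> S" and xy: "x + y \<in> S" "x + \<i> *\<^sub>C y \<in> S"
    using S assms(7,8) by (auto simp: closed_csubspace_def)
  \<comment> \<open>The diagonal at \<open>x + y\<close> and at \<open>x + \<i> y\<close> gives two
    independent linear equations for \<open>f x y\<close> and \<open>f y x\<close>.\<close>
  have "f x y + f y x = 0"
    using z[OF xy(1)] z[OF assms(7)] z[OF assms(8)] assms(7,8) xy by (simp add: add add.commute)
  moreover have "cnj \<i> * f x y + \<i> * f y x = 0"
    using z[OF xy(2)] z[OF assms(7)] z[OF ix] assms(7,8) xy ix by (simp add: add sc)
  ultimately have "f x y = 0"
    by (simp add: complex_eq_iff)
  then show ?thesis by (simp add: f_def)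
qed

lemma closed_csubspaceD:
  assumes "closed_csubspace S"
  shows "0 \<in> S" "x \<in> S \<Longrightarrow> y \<in> S \<Longrightarrow> x + y \<in> S" "x \<in> S \<Longrightarrow> c *\<^sub>C x \<in> S" "closed S"
    "x \<in> S \<Longrightarrow> - x \<in> S" "x \<in> S \<Longrightarrow> y \<in> S \<Longrightarrow> x - y \<in> S" "subspace S"
proof -
  show 1: "0 \<in> S" "x \<in> S \<Longrightarrow> y \<in> S \<Longrightarrow> x + y \<in> S" "x \<in> S \<Longrightarrow> c *\<^sub>C x \<in> S" "closed S" for x y c
    using assms by (auto simp: closed_csubspace_def)
  show 2: "- x \<in> S" if "x \<in> S" for x
    using 1(3)[OF that, of "-1"] by (simp add: scaleC_minus_left)
  show "x \<in> S \<Longrightarrow> y \<in> S \<Longrightarrow> x - y \<in> S"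
    using 1(2)[of x "- y"] 2 by simp
  show "subspace S"
    using 1 by (auto simp: subspace_def scaleR_scaleC)
qed

lemma closed_csubspace_UNIV [simp]: "closed_csubspace UNIV"
  by (simp add: closed_csubspace_def)

lemma closed_csubspaceI:
  "closed S \<Longrightarrow> 0 \<in> S \<Longrightarrow> (\<And>x y. x \<in> S \<Longrightarrow> y \<in> S \<Longrightarrow> x + y \<in> S) \<Longrightarrow>
    (\<And>c x. x \<in> S \<Longrightarrow> c *\<^sub>C x \<in> S) \<Longrightarrow> closed_csubspace S"
  by (auto simp: closed_csubspace_def)

section \<open>Orthogonal projections\<close>

lemma nearest_point_exists:
  fixes M :: "'a::{real_inner,complete_space} set"
  assumes M: "subspace M" "closed M"
  obtains y where "y \<in> M" "\<And>m. m \<in> M \<Longrightarrow> norm (x - y) \<le> norm (x - m)"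
proof -
  define d where "d = (INF m\<in>M. norm (x - m))"
  have ne: "M \<noteq> {}" using M subspace_0 by blast
  have bdd: "bdd_below ((\<lambda>m. norm (x - m)) ` M)" by (rule bdd_belowI2[of _ 0]) simp
  have d0: "0 \<le> d" unfolding d_def using ne by (intro cINF_greatest) auto
  have dle: "d \<le> norm (x - m)" if "m \<in> M" for m
    unfolding d_def using bdd that by (rule cINF_lower)
  have "\<exists>m\<in>M. norm (x - m) < d + 1 / real (Suc n)" for n
    using cINF_less_iff[OF ne bdd, of "d + 1 / real (Suc n)"] by (auto simp: d_def)
  then obtain f where f: "\<And>n. f n \<in> M" "\<And>n. norm (x - f n) < d + 1 / real (Suc n)"
    by metis
  have lim: "(\<lambda>n. norm (x - f n)) \<longlonglongrightarrow> d"
  proof (rule tendsto_sandwich[where f = "\<lambda>_. d"])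
    show "(\<lambda>n. d + 1 / real (Suc n)) \<longlonglongrightarrow> d"
      using tendsto_add[OF tendsto_const LIMSEQ_inverse_real_of_nat, of d] by (simp add: inverse_eq_divide)
    show "\<forall>\<^sub>F n in sequentially. norm (x - f n) \<le> d + 1 / real (Suc n)"
      using f(2) by (simp add: less_imp_le)
    show "\<forall>\<^sub>F n in sequentially. d \<le> norm (x - f n)" using dle f(1) by simp
  qed simp
  \<comment> \<open>Parallelogram law; the midpoint of \<open>f m\<close> and \<open>f n\<close>
    lies in \<open>M\<close>, hence at distance at least \<open>d\<close> from
    \<open>x\<close>.\<close>
  have par: "(norm (f m - f n))\<^sup>2 \<le> 2 * (norm (x - f m))\<^sup>2 + 2 * (norm (x - f n))\<^sup>2 - 4 * d\<^sup>2" for m n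
  proof -
    let ?h = "(1/2) *\<^sub>R (f m + f n)"
    have h: "?h \<in> M" using M f by (intro subspace_scale subspace_add) auto
    have "(norm (f m - f n))\<^sup>2 = 2 * (norm (x - f m))\<^sup>2 + 2 * (norm (x - f n))\<^sup>2 - 4 * (norm (x - ?h))\<^sup>2"
      by (simp add: power2_norm_eq_inner inner_diff_left inner_diff_right inner_add_left
          inner_add_right inner_commute field_simps)
    moreover have "d\<^sup>2 \<le> (norm (x - ?h))\<^sup>2" using dle[OF h] d0 by (intro power_mono)
    ultimately show ?thesis by simp
  qed
  have "Cauchy f"
  proof (rule metric_CauchyI)
    fix e :: real assume "0 < e"
    have "(\<lambda>n. (norm (x - f n))\<^sup>2) \<longlonglongrightarrow> d\<^sup>2" by (intro tendsto_power lim)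
    then obtain N where N: "\<And>n. n \<ge> N \<Longrightarrow> \<bar>(norm (x - f n))\<^sup>2 - d\<^sup>2\<bar> < e\<^sup>2 / 4"
    proof -
      have "0 < e\<^sup>2 / 4" using \<open>0 < e\<close> by simp
      from LIMSEQ_D[OF \<open>(\<lambda>n. (norm (x - f n))\<^sup>2) \<longlonglongrightarrow> d\<^sup>2\<close> this] that show ?thesis
        unfolding real_norm_def by blast
    qed
    have "norm (f m - f n) < e" if "m \<ge> N" "n \<ge> N" for m n
    proof -
      have "(norm (f m - f n))\<^sup>2 < e\<^sup>2"
        using par[of m n] N[OF that(1)] N[OF that(2)] unfolding abs_less_iff by linarith
      then show ?thesis by (rule power_less_imp_less_base) (use \<open>0 < e\<close> in simp)
    qed
    then show "\<exists>M. \<forall>m\<ge>M. \<forall>n\<ge>M. dist (f m) (f n) < e"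
      by (auto simp: dist_norm)
  qed
  then obtain y where y: "f \<longlonglongrightarrow> y" by (meson Cauchy_convergent convergent_def)
  have "y \<in> M" by (rule closed_sequentially[OF M(2) f(1) y])
  moreover have "norm (x - y) = d"
    using LIMSEQ_unique[OF tendsto_norm[OF tendsto_diff[OF tendsto_const y]] lim] by simp
  ultimately show ?thesis using dle that by auto
qed

lemma orthogonal_decomposition:
  fixes M :: "'a::{real_inner,complete_space} set"
  assumes M: "subspace M" "closed M"
  obtains y where "y \<in> M" "\<And>m. m \<in> M \<Longrightarrow> inner (x - y) m = 0"
proof -
  obtain y where y: "y \<in> M" "\<And>m. m \<in> M \<Longrightarrow> norm (x - y) \<le> norm (x - m)"
    using nearest_point_exists[OF M] by blast
  have "inner (x - y) m = 0" if m: "m \<in> M" for m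
  proof (cases "m = 0")
    case False
    \<comment> \<open>The coefficient of the multiple of \<open>m\<close> nearest to
      \<open>x - y\<close>.\<close>
    define t where "t = inner (x - y) m / inner m m"
    have "y + t *\<^sub>R m \<in> M" using M y m by (intro subspace_add subspace_scale)
    then have "(norm (x - y))\<^sup>2 \<le> (norm (x - (y + t *\<^sub>R m)))\<^sup>2"
      using y(2) by (intro power_mono) auto
    also have "x - (y + t *\<^sub>R m) = (x - y) - t *\<^sub>R m" by simp
    also have "(norm ((x - y) - t *\<^sub>R m))\<^sup>2 = (norm (x - y))\<^sup>2 - 2 * t * inner (x - y) m + t\<^sup>2 * inner m m"
      unfolding power2_norm_eq_inner
      by (simp add: inner_diff_left inner_diff_right inner_commute power2_eq_square algebra_simps)
    finally have "2 * t * inner (x - y) m \<le> t\<^sup>2 * inner m m" by simp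
    moreover have "inner m m > 0" using False by simp
    ultimately have "2 * (inner (x - y) m)\<^sup>2 \<le> (inner (x - y) m)\<^sup>2"
      by (simp add: t_def power2_eq_square field_simps)
    then show ?thesis by simp
  qed simp
  with y that show ?thesis by blast
qed

text \<open>The subspace contains \<open>\<i> m\<close> along with \<open>m\<close>, and this
  supplies the imaginary part.\<close>

lemma closed_csubspace_inner_eq_0:
  assumes "closed_csubspace M" "\<And>m. m \<in> M \<Longrightarrow> inner v m = 0" "m \<in> M"
  shows "cinner v m = 0"
  using assms(2)[OF assms(3)] assms(2)[OF closed_csubspaceD(3)[OF assms(1,3), of \<i>]]
  by (simp add: cinner_eq_Complex complex_eq_iff)

lemma orth_proj_unique:
  assumes M: "closed_csubspace M" and y: "y \<in> M" "\<And>m. m \<in> M \<Longrightarrow> cinner (x - y) m = 0"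
  shows "orth_proj M x = y"
  unfolding orth_proj_def
proof (rule the_equality)
  show "y \<in> M \<and> (\<forall>m\<in>M. cinner (x - y) m = 0)" using y by blast
  fix z assume z: "z \<in> M \<and> (\<forall>m\<in>M. cinner (x - z) m = 0)"
  have m: "y - z \<in> M" using y z closed_csubspaceD(6)[OF M] by simp
  have "cinner (y - z) (y - z) = cinner (x - z) (y - z) - cinner (x - y) (y - z)"
    by (simp add: cinner_diff_left)
  also have "\<dots> = 0" using y z m by simp
  finally show "z = y" by (simp add: cinner_self)
qed

context
  fixes M :: "'a::chilbert_space set"
  assumes M: "closed_csubspace M"
begin

lemma orth_proj:
  shows orth_proj_in: "orth_proj M x \<in> M"
    and orth_proj_orthogonal: "m \<in> M \<Longrightarrow> cinner (x - orth_proj M x) m = 0"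
proof -
  obtain y where y: "y \<in> M" "\<And>m. m \<in> M \<Longrightarrow> inner (x - y) m = 0"
    using orthogonal_decomposition[OF closed_csubspaceD(7,4)[OF M]] by blast
  then have c: "\<And>m. m \<in> M \<Longrightarrow> cinner (x - y) m = 0"
    using closed_csubspace_inner_eq_0[OF M] by blast
  have "orth_proj M x = y" by (rule orth_proj_unique[OF M y(1) c])
  with y c show "orth_proj M x \<in> M" "m \<in> M \<Longrightarrow> cinner (x - orth_proj M x) m = 0" by auto
qed

lemma orth_proj_id: "x \<in> M \<Longrightarrow> orth_proj M x = x"
  by (rule orth_proj_unique[OF M]) auto

lemma orth_proj_add: "orth_proj M (x + y) = orth_proj M x + orth_proj M y"
proof (rule orth_proj_unique[OF M])
  show "orth_proj M x + orth_proj M y \<in> M"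
    by (intro closed_csubspaceD(2)[OF M] orth_proj_in)
  fix m assume "m \<in> M"
  then show "cinner (x + y - (orth_proj M x + orth_proj M y)) m = 0"
    using orth_proj_orthogonal[of m x] orth_proj_orthogonal[of m y]
    by (simp only: add_diff_add cinner_add_left) simp
qed

lemma orth_proj_scaleC: "orth_proj M (c *\<^sub>C x) = c *\<^sub>C orth_proj M x"
proof (rule orth_proj_unique[OF M])
  show "c *\<^sub>C orth_proj M x \<in> M"
    by (intro closed_csubspaceD(3)[OF M] orth_proj_in)
  fix m assume "m \<in> M"
  then show "cinner (c *\<^sub>C x - c *\<^sub>C orth_proj M x) m = 0"
    using orth_proj_orthogonal[of m x]
    by (simp only: scaleC_diff_right[symmetric] cinner_scaleC_left) simp
qed

lemma cinner_orth_proj_left: "m \<in> M \<Longrightarrow> cinner (orth_proj M x) m = cinner x m"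
  using orth_proj_orthogonal[of m x] by (simp add: cinner_diff_left)

lemma cinner_orth_proj_right: "m \<in> M \<Longrightarrow> cinner m (orth_proj M x) = cinner m x"
  using cinner_orth_proj_left[of m x] cinner_commute[of m x] cinner_commute[of m "orth_proj M x"]
  by simp

lemma norm_orth_proj_pythagoras: "(norm x)\<^sup>2 = (norm (orth_proj M x))\<^sup>2 + (norm (x - orth_proj M x))\<^sup>2"
proof -
  have "inner (x - orth_proj M x) (orth_proj M x) = 0"
    using orth_proj_orthogonal[OF orth_proj_in] by (simp add: inner_eq_Re_cinner)
  then show ?thesis
    unfolding power2_norm_eq_inner by (simp add: inner_diff_left inner_diff_right inner_commute)
qed

lemma norm_orth_proj_le: "norm (orth_proj M x) \<le> norm x"
  by (rule power2_le_imp_le) (use norm_orth_proj_pythagoras[of x] in auto)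

end

lemma closed_cspan_closed_csubspace [simp]: "closed_csubspace (closed_cspan X)"
  unfolding closed_cspan_def closed_csubspace_def by (auto intro!: closed_Inter)

lemma closed_cspan_superset: "X \<subseteq> closed_cspan X"
  unfolding closed_cspan_def by blast

lemma closed_cspan_minimal: "closed_csubspace M \<Longrightarrow> X \<subseteq> M \<Longrightarrow> closed_cspan X \<subseteq> M"
  unfolding closed_cspan_def by blast

text \<open>The real Riesz theorem suffices: the real adjoint of a complex-linear operator is its complex
  adjoint.\<close>

lemma riesz_representation:
  fixes f :: "'a::{real_inner,complete_space} \<Rightarrow> real"
  assumes f: "bounded_linear f"
  obtains z where "\<And>x. f x = inner x z"
proof (cases "\<forall>x. f x = 0")
  case True
  then show ?thesis using that[of 0] by simp
next
  case False
  then obtain w where w: "f w \<noteq> 0" by blast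
  interpret f: bounded_linear f by (rule f)
  have sub: "subspace {x. f x = 0}" by (auto simp: subspace_def f.add f.scaleR)
  have cl: "closed {x. f x = 0}"
    using closed_Collect_eq[of f "\<lambda>_. 0"] f.continuous_on[OF continuous_on_id, of UNIV] by simp
  obtain y where y': "y \<in> {x. f x = 0}" "\<And>m. m \<in> {x. f x = 0} \<Longrightarrow> inner (w - y) m = 0"
    using orthogonal_decomposition[OF sub cl, of w] by blast
  then have y: "f y = 0" "\<And>m. f m = 0 \<Longrightarrow> inner (w - y) m = 0" by simp_all
  define u where "u = w - y"
  have fu: "f u \<noteq> 0" using w y by (simp add: u_def f.diff)
  have uu: "inner u u \<noteq> 0" using fu f.zero by auto
  have "f x = inner x ((f u / inner u u) *\<^sub>R u)" for x
  proof -
    \<comment> \<open>The kernel of \<open>f\<close> has codimension one: every \<open>x\<close>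
      differs from a multiple of \<open>u\<close> by a kernel vector, to which \<open>u\<close> is
      orthogonal.\<close>
    have "f (x - (f x / f u) *\<^sub>R u) = 0" using fu by (simp add: f.diff f.scaleR)
    then have "inner u (x - (f x / f u) *\<^sub>R u) = 0" using y(2) u_def by blast
    then show ?thesis using fu uu by (simp add: inner_diff_right inner_commute field_simps)
  qed
  then show ?thesis using that by blast
qed

instance chilbert_space \<subseteq> banach ..

section \<open>The algebra of bounded operators\<close>

text \<open>Operators on the whole space get a type of their own, so that sums, products, limits and
  norms come from type classes. Complex scalars enter as the operators
  \<open>bscal c\<close>.\<close>

typedef (overloaded) ('a::chilbert_space) bop =
  "{T :: 'a \<Rightarrow> 'a. bounded_linear T \<and> (\<forall>c x. T (c *\<^sub>C x) = c *\<^sub>C T x)}"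
  morphisms bapp Bop
  by (rule exI[of _ "\<lambda>_. 0"]) (simp add: bounded_linear_zero)

notation bapp (infixr "*\<^sub>V" 75)

setup_lifting type_definition_bop

lemma bounded_linear_bapp: "bounded_linear (bapp a)"
  using bapp[of a] by simp

lemma bapp_scaleC: "a *\<^sub>V (c *\<^sub>C x) = c *\<^sub>C (a *\<^sub>V x)"
  using bapp[of a] by simp

lemmas bapp_add = linear_add[OF bounded_linear.linear[OF bounded_linear_bapp]]
  and bapp_diff = linear_diff[OF bounded_linear.linear[OF bounded_linear_bapp]]
  and bapp_minus = linear_neg[OF bounded_linear.linear[OF bounded_linear_bapp]]
  and bapp_zero [simp] = linear_0[OF bounded_linear.linear[OF bounded_linear_bapp]]
  and bapp_scaleR = linear_scale[OF bounded_linear.linear[OF bounded_linear_bapp]]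
  and tendsto_bapp = bounded_linear.tendsto[OF bounded_linear_bapp]

lemma bop_eqI: "(\<And>x. a *\<^sub>V x = b *\<^sub>V x) \<Longrightarrow> a = b"
  by (metis bapp_inject ext)

instantiation bop :: (chilbert_space) real_normed_algebra
begin

lift_definition zero_bop :: "'a bop" is "\<lambda>_. 0"
  by (simp add: bounded_linear_zero)
lift_definition plus_bop :: "'a bop \<Rightarrow> 'a bop \<Rightarrow> 'a bop" is "\<lambda>f g x. f x + g x"
  by (simp add: bounded_linear_add scaleC_add_right)
lift_definition minus_bop :: "'a bop \<Rightarrow> 'a bop \<Rightarrow> 'a bop" is "\<lambda>f g x. f x - g x"
  by (simp add: bounded_linear_sub scaleC_diff_right)
lift_definition uminus_bop :: "'a bop \<Rightarrow> 'a bop" is "\<lambda>f x. - f x"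
  by (simp add: bounded_linear_minus scaleC_minus_right)
lift_definition times_bop :: "'a bop \<Rightarrow> 'a bop \<Rightarrow> 'a bop" is "\<lambda>f g x. f (g x)"
  by (simp add: bounded_linear_compose)
lift_definition scaleR_bop :: "real \<Rightarrow> 'a bop \<Rightarrow> 'a bop" is "\<lambda>r f x. r *\<^sub>R f x"
  by (simp add: bounded_linear_const_scaleR scaleR_scaleC_commute)
lift_definition norm_bop :: "'a bop \<Rightarrow> real" is onorm .

definition "sgn a = scaleR (inverse (norm a)) a" for a :: "'a bop"
definition "dist a b = norm (a - b)" for a b :: "'a bop"
definition "(uniformity :: ('a bop \<times> 'a bop) filter)
  = (INF e\<in>{0<..}. principal {(x, y). dist x y < e})"
definition "open U \<longleftrightarrow> (\<forall>x\<in>U. \<forall>\<^sub>F (x', y) in uniformity. x' = x \<longrightarrow> y \<in> U)" for U :: "'a bop set"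

instance
proof
  fix a b c :: "'a bop" and r s :: real
  show "a + b + c = a + (b + c)" "a + b = b + a" "0 + a = a" "- a + a = 0" "a - b = a + - b"
    "a * b * c = a * (b * c)" "(a + b) * c = a * c + b * c"
    "r *\<^sub>R (a + b) = r *\<^sub>R a + r *\<^sub>R b" "(r + s) *\<^sub>R a = r *\<^sub>R a + s *\<^sub>R a"
    "r *\<^sub>R s *\<^sub>R a = (r * s) *\<^sub>R a" "1 *\<^sub>R a = a" "r *\<^sub>R a * b = r *\<^sub>R (a * b)"
    by (transfer; simp add: fun_eq_iff scaleR_add_right scaleR_add_left)+
  show "a * (b + c) = a * b + a * c" "a * r *\<^sub>R b = r *\<^sub>R (a * b)"
    by (transfer; simp add: fun_eq_iff linear_add linear_scale bounded_linear.linear)+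
  show "dist a b = norm (a - b)" "sgn a = scaleR (inverse (norm a)) a"
    by (simp_all add: dist_bop_def sgn_bop_def)
  show "(uniformity :: ('a bop \<times> 'a bop) filter)
      = (INF e\<in>{0<..}. principal {(x, y). dist x y < e})"
    by (rule uniformity_bop_def)
  show "open U \<longleftrightarrow> (\<forall>x\<in>U. \<forall>\<^sub>F (x', y) in uniformity. x' = x \<longrightarrow> y \<in> U)" for U :: "'a bop set"
    by (rule open_bop_def)
  show "norm a = 0 \<longleftrightarrow> a = 0"
    by transfer (auto simp: onorm_eq_0)
  show "norm (a + b) \<le> norm a + norm b"
    by transfer (simp add: onorm_triangle)
  show "norm (r *\<^sub>R a) = \<bar>r\<bar> * norm a"
    by transfer (simp add: onorm_scaleR)
  show "norm (a * b) \<le> norm a * norm b"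
    by transfer (use onorm_compose in \<open>auto simp: comp_def\<close>)
qed

end

text \<open>On the zero space \<open>0 = 1\<close> and the identity has norm 0, so the operators
  form a monoid but not a unital normed algebra in the sense of the type class; only
  \<open>norm 1 \<le> 1\<close> holds in general.\<close>

instantiation bop :: (chilbert_space) monoid_mult
begin

lift_definition one_bop :: "'a bop" is "\<lambda>x. x"
  by simp

instance by standard (transfer; simp)+

end

lemma bop_simps [simp]:
  "0 *\<^sub>V x = 0" "1 *\<^sub>V x = x" "(a + b) *\<^sub>V x = a *\<^sub>V x + b *\<^sub>V x" "(a - b) *\<^sub>V x = a *\<^sub>V x - b *\<^sub>V x"
  "(- a) *\<^sub>V x = - (a *\<^sub>V x)" "(a * b) *\<^sub>V x = a *\<^sub>V b *\<^sub>V x" "(r *\<^sub>R a) *\<^sub>V x = r *\<^sub>R (a *\<^sub>V x)"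
  by (transfer; simp)+

lemma bapp_power: "(a ^ n) *\<^sub>V x = (bapp a ^^ n) x"
  by (induction n) simp_all

lemma norm_bapp: "norm (a *\<^sub>V x) \<le> norm a * norm x"
  by transfer (simp add: onorm)

lemma norm_bop_le: "0 \<le> c \<Longrightarrow> (\<And>x. norm (a *\<^sub>V x) \<le> c * norm x) \<Longrightarrow> norm a \<le> c"
  by transfer (simp add: onorm_bound)

lemma norm_one_bop_le: "norm (1 :: 'a::chilbert_space bop) \<le> 1"
  by (rule norm_bop_le) simp_all

lemma norm_power_bop_le: "norm (a ^ n) \<le> norm a ^ n" for a :: "'a::chilbert_space bop"
proof (induction n)
  case 0
  show ?case by (simp add: norm_one_bop_le)
next
  case (Suc n)
  have "norm (a ^ Suc n) \<le> norm a * norm (a ^ n)" by (simp add: norm_mult_ineq)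
  also have "\<dots> \<le> norm a * norm a ^ n" using Suc by (intro mult_left_mono) auto
  finally show ?case by simp
qed

lemma bapp_Bop:
  assumes "\<And>x y. f (x + y) = f x + f y" "\<And>c x. f (c *\<^sub>C x) = c *\<^sub>C f x" "\<And>x. norm (f x) \<le> norm x * K"
  shows "bapp (Bop f) = f"
proof -
  have "bounded_linear f"
    using assms by (intro bounded_linear_intro[where K = K]) (auto simp: scaleR_scaleC)
  then show ?thesis using assms(2) by (simp add: Bop_inverse)
qed

lemma bounded_linear_bapp_left: "bounded_linear (\<lambda>a. a *\<^sub>V x)"
  by (rule bounded_linear_intro[where K = "norm x"]) (simp_all add: norm_bapp)

text \<open>Completeness is inherited from the bounded real-linear maps; complex linearity of the
  limit follows from pointwise convergence.\<close>

instance bop :: (chilbert_space) banach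
proof
  fix X :: "nat \<Rightarrow> 'a bop"
  assume X: "Cauchy X"
  define B where "B n = Blinfun (bapp (X n))" for n
  have B: "blinfun_apply (B n) = bapp (X n)" for n
    by (simp add: B_def bounded_linear_Blinfun_apply bounded_linear_bapp)
  have nB: "norm (B n - B m) = norm (X n - X m)" for m n
  proof -
    have "blinfun_apply (B n - B m) = bapp (X n - X m)"
      by (simp add: fun_eq_iff blinfun.diff_left B)
    then show ?thesis by (simp add: norm_blinfun.rep_eq norm_bop.rep_eq)
  qed
  have "Cauchy B" using X by (simp add: Cauchy_def dist_norm nB)
  then obtain L where L: "B \<longlonglongrightarrow> L" by (meson Cauchy_convergent convergent_def)
  have pt: "(\<lambda>n. X n *\<^sub>V x) \<longlonglongrightarrow> blinfun_apply L x" for x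
    using blinfun.tendsto[OF L tendsto_const[of x]] by (simp add: B)
  have "blinfun_apply L (c *\<^sub>C x) = c *\<^sub>C blinfun_apply L x" for c x
    using LIMSEQ_unique[OF pt[of "c *\<^sub>C x"]] tendsto_scaleC[OF pt[of x], of c] by (simp add: bapp_scaleC)
  then have a: "bapp (Bop (blinfun_apply L)) = blinfun_apply L"
    by (intro Bop_inverse) (simp add: blinfun.bounded_linear_right)
  have "norm (X n - Bop (blinfun_apply L)) = norm (B n - L)" for n
  proof -
    have "blinfun_apply (B n - L) = bapp (X n - Bop (blinfun_apply L))"
      by (simp add: fun_eq_iff blinfun.diff_left B a)
    then show ?thesis by (simp add: norm_blinfun.rep_eq norm_bop.rep_eq)
  qed
  then have "X \<longlonglongrightarrow> Bop (blinfun_apply L)"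
    using L by (simp add: LIMSEQ_iff)
  then show "convergent X" by (auto simp: convergent_def)
qed

section \<open>Adjoints, complex scalars and normal operators\<close>

lemma inner_right_eqI: "(\<And>z. inner z x = inner z y) \<Longrightarrow> x = y" for x y :: "'a::real_inner"
  by (rule inner_left_eqI) (simp add: inner_commute)

definition adj :: "'a::chilbert_space bop \<Rightarrow> 'a bop" where
  "adj a = Bop (\<lambda>y. SOME z. \<forall>x. inner (a *\<^sub>V x) y = inner x z)"

lemma inner_adj: "inner (a *\<^sub>V x) y = inner x (adj a *\<^sub>V y)"
proof -
  define g where "g y = (SOME z. \<forall>x. inner (a *\<^sub>V x) y = inner x z)" for y
  have g: "inner (a *\<^sub>V x) y = inner x (g y)" for x y
  proof -
    have "bounded_linear (\<lambda>x. inner (a *\<^sub>V x) y)"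
      by (rule bounded_linear_compose[OF bounded_linear_inner_left bounded_linear_bapp])
    then obtain z where "\<And>x. inner (a *\<^sub>V x) y = inner x z"
      using riesz_representation by blast
    then have "\<exists>z. \<forall>x. inner (a *\<^sub>V x) y = inner x z" by blast
    from someI_ex[OF this] show ?thesis unfolding g_def by blast
  qed
  have add: "g (y + z) = g y + g z" for y z
    by (rule inner_right_eqI) (simp add: g[symmetric] inner_add_right)
  have sc: "g (c *\<^sub>C y) = c *\<^sub>C g y" for c y
    by (rule inner_right_eqI) (simp add: inner_scaleC_right g[symmetric] bapp_scaleC)
  have nm: "norm (g y) \<le> norm y * norm a" for y
  proof -
    have "(norm (g y))\<^sup>2 = inner (a *\<^sub>V g y) y" by (simp add: g power2_norm_eq_inner)
    also have "\<dots> \<le> norm (a *\<^sub>V g y) * norm y" by (rule norm_cauchy_schwarz)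
    also have "\<dots> \<le> norm a * norm (g y) * norm y" by (intro mult_right_mono norm_bapp) simp
    finally have "norm (g y) * norm (g y) \<le> (norm y * norm a) * norm (g y)"
      by (simp add: power2_eq_square mult_ac)
    then show ?thesis by (cases "g y = 0") auto
  qed
  have "bapp (adj a) = g"
    unfolding adj_def g_def[abs_def, symmetric] by (rule bapp_Bop[OF add sc nm])
  with g show ?thesis by simp
qed

lemma cinner_adj: "cinner (a *\<^sub>V x) y = cinner x (adj a *\<^sub>V y)"
  by (simp add: cinner_eq_Complex inner_adj bapp_scaleC)

lemma cinner_adj': "cinner (adj a *\<^sub>V x) y = cinner x (a *\<^sub>V y)"
  using cinner_adj[of a y x] cinner_commute[of x "a *\<^sub>V y"] cinner_commute[of "adj a *\<^sub>V x" y] by simp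

lemma inner_adj': "inner (adj a *\<^sub>V x) y = inner x (a *\<^sub>V y)"
  using cinner_adj'[of a x y] by (simp add: inner_eq_Re_cinner)

lemma adj_eqI:
  assumes "\<And>x y. inner (a *\<^sub>V x) y = inner x (b *\<^sub>V y)"
  shows "adj a = b"
proof (rule bop_eqI, rule inner_left_eqI)
  fix x z
  show "inner (adj a *\<^sub>V x) z = inner (b *\<^sub>V x) z"
    using assms[of z x] inner_adj'[of a x z] inner_commute[of "b *\<^sub>V x" z]
      inner_commute[of "a *\<^sub>V z" x] by simp
qed

definition bscal :: "complex \<Rightarrow> 'a::chilbert_space bop" where
  "bscal c = Bop (\<lambda>x. c *\<^sub>C x)"

lemma bapp_bscal [simp]: "bscal c *\<^sub>V x = c *\<^sub>C x"
proof -
  have "bapp (bscal c :: 'a bop) = (\<lambda>x. c *\<^sub>C x)"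
    unfolding bscal_def
    by (rule bapp_Bop[where K = "cmod c"])
      (simp_all add: scaleC_add_right scaleC_scaleC mult.commute norm_scaleC)
  then show ?thesis by simp
qed

lemma adj_simps [simp]:
  "adj (adj a) = a" "adj 0 = 0" "adj 1 = 1" "adj (a + b) = adj a + adj b"
  "adj (a - b) = adj a - adj b" "adj (- a) = - adj a" "adj (a * b) = adj b * adj a"
  "adj (r *\<^sub>R a) = r *\<^sub>R adj a" "adj (bscal c) = bscal (cnj c)"
  by (rule adj_eqI; simp add: inner_adj' inner_adj[symmetric] inner_add_left inner_add_right
      inner_diff_left inner_diff_right inner_scaleC_right)+

lemma adj_power: "adj (a ^ n) = adj a ^ n"
  by (induction n) (simp_all add: power_commutes)

lemma norm_adj [simp]: "norm (adj a) = norm a"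
proof -
  have le: "norm (adj a) \<le> norm a" for a :: "'a bop"
  proof (rule norm_bop_le)
    fix x
    have "(norm (adj a *\<^sub>V x))\<^sup>2 = inner (a *\<^sub>V adj a *\<^sub>V x) x"
      by (simp add: power2_norm_eq_inner inner_adj)
    also have "\<dots> \<le> norm (a *\<^sub>V adj a *\<^sub>V x) * norm x" by (rule norm_cauchy_schwarz)
    also have "\<dots> \<le> norm a * norm (adj a *\<^sub>V x) * norm x" by (intro mult_right_mono norm_bapp) simp
    finally have "norm (adj a *\<^sub>V x) * norm (adj a *\<^sub>V x) \<le> (norm a * norm x) * norm (adj a *\<^sub>V x)"
      by (simp add: power2_eq_square mult_ac)
    then show "norm (adj a *\<^sub>V x) \<le> norm a * norm x" by (cases "adj a *\<^sub>V x = 0") auto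
  qed simp
  from le[of a] le[of "adj a"] show ?thesis by simp
qed

lemma bscal_commute: "bscal c * a = a * bscal c"
  by (rule bop_eqI) (simp add: bapp_scaleC)

lemma bscal_simps: "bscal (c * d) = bscal c * bscal d" "bscal (c + d) = bscal c + bscal d"
  "bscal (c - d) = bscal c - bscal d" "bscal (- c) = - bscal c" "bscal 1 = 1" "bscal 0 = 0"
  "bscal (of_real r) = r *\<^sub>R 1"
  by (rule bop_eqI; simp add: scaleC_scaleC scaleC_add_left scaleC_diff_left scaleC_minus_left scaleR_scaleC)+

definition nrm :: "'a::chilbert_space bop \<Rightarrow> bool" where
  "nrm a \<longleftrightarrow> a * adj a = adj a * a"

lemma norm_nrm_adj: "nrm a \<Longrightarrow> norm (adj a *\<^sub>V x) = norm (a *\<^sub>V x)"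
proof -
  assume "nrm a"
  then have "a *\<^sub>V adj a *\<^sub>V x = adj a *\<^sub>V a *\<^sub>V x"
    by (metis nrm_def bop_simps(6))
  then have "inner (adj a *\<^sub>V x) (adj a *\<^sub>V x) = inner (a *\<^sub>V x) (a *\<^sub>V x)"
    by (simp add: inner_adj inner_adj')
  then show ?thesis by (simp add: norm_eq_sqrt_inner)
qed

section \<open>Positive operators and square roots\<close>

definition bpos :: "'a::chilbert_space bop \<Rightarrow> bool" where
  "bpos a \<longleftrightarrow> adj a = a \<and> (\<forall>x. 0 \<le> inner (a *\<^sub>V x) x)"

lemma bpos_adj: "bpos a \<Longrightarrow> adj a = a"
  by (simp add: bpos_def)

lemma bpos_inner: "bpos a \<Longrightarrow> 0 \<le> inner (a *\<^sub>V x) x"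
  by (simp add: bpos_def)

text \<open>The quadratic function \<open>t \<mapsto> <a (x + t y), x + t y>\<close> is nonnegative,
  so its discriminant is not positive.\<close>

lemma bpos_cauchy_schwarz:
  assumes "bpos a"
  shows "(inner (a *\<^sub>V x) y)\<^sup>2 \<le> inner (a *\<^sub>V x) x * inner (a *\<^sub>V y) y"
proof -
  have sym: "inner (a *\<^sub>V y) x = inner (a *\<^sub>V x) y"
    using inner_adj[of a y x] bpos_adj[OF assms] by (simp add: inner_commute)
  have q: "0 \<le> inner (a *\<^sub>V x) x + 2 * t * inner (a *\<^sub>V x) y + t\<^sup>2 * inner (a *\<^sub>V y) y" for t
    using bpos_inner[OF assms, of "x + t *\<^sub>R y"]
    by (simp add: bapp_add bapp_scaleR inner_add_left inner_add_right sym power2_eq_square algebra_simps)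
  let ?p = "inner (a *\<^sub>V x) x" and ?q = "inner (a *\<^sub>V x) y" and ?r = "inner (a *\<^sub>V y) y"
  show ?thesis
  proof (cases "?r = 0")
    case True
    have "?q = 0"
    proof (rule ccontr)
      assume "?q \<noteq> 0"
      \<comment> \<open>With vanishing leading coefficient the function is affine in
        \<open>t\<close>, and at this \<open>t\<close> it takes the value -1.\<close>
      then show False using q[of "- (?p + 1) / (2 * ?q)"] True by (simp add: field_simps)
    qed
    with True show ?thesis by simp
  next
    case False
    then have r: "?r > 0" using bpos_inner[OF assms, of y] by simp
    have "0 \<le> ?p - ?q\<^sup>2 / ?r"
      using q[of "- ?q / ?r"] r by (simp add: field_simps power2_eq_square)
    with r show ?thesis by (simp add: field_simps)
  qed
qed

text \<open>Cauchy-Schwarz for the form of \<open>a\<close> at \<open>x\<close> and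
  \<open>a x\<close>. It turns a small value of the form into a small vector
  \<open>a x\<close>.\<close>

lemma bpos_norm_sq_le:
  assumes "bpos a"
  shows "(norm (a *\<^sub>V x))\<^sup>2 \<le> norm a * inner (a *\<^sub>V x) x"
proof (cases "a *\<^sub>V x = 0")
  case False
  let ?y = "a *\<^sub>V x"
  have "((norm ?y)\<^sup>2)\<^sup>2 \<le> inner (a *\<^sub>V x) x * inner (a *\<^sub>V ?y) ?y"
    using bpos_cauchy_schwarz[OF assms, of x ?y] by (simp add: power2_norm_eq_inner)
  also have "\<dots> \<le> inner (a *\<^sub>V x) x * (norm a * (norm ?y)\<^sup>2)"
  proof (rule mult_left_mono)
    have "inner (a *\<^sub>V ?y) ?y \<le> norm (a *\<^sub>V ?y) * norm ?y" by (rule norm_cauchy_schwarz)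
    also have "\<dots> \<le> norm a * norm ?y * norm ?y" by (intro mult_right_mono norm_bapp) simp
    finally show "inner (a *\<^sub>V ?y) ?y \<le> norm a * (norm ?y)\<^sup>2" by (simp add: power2_eq_square mult.assoc)
  qed (rule bpos_inner[OF assms])
  finally have "(norm ?y)\<^sup>2 * (norm ?y)\<^sup>2 \<le> (norm a * inner (a *\<^sub>V x) x) * (norm ?y)\<^sup>2"
    by (simp add: power2_eq_square mult_ac)
  then show ?thesis by (rule mult_right_le_imp_le) (use False in simp)
qed (simp add: bpos_inner[OF assms])

lemma norm_le_one_if_bpos_compl:
  assumes "bpos a" "bpos (1 - a)"
  shows "norm a \<le> 1"
proof (rule norm_bop_le)
  fix x
  have le: "inner (a *\<^sub>V y) y \<le> (norm y)\<^sup>2" for y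
    using bpos_inner[OF assms(2), of y] by (simp add: inner_diff_left power2_norm_eq_inner)
  let ?y = "a *\<^sub>V x"
  have "((norm ?y)\<^sup>2)\<^sup>2 \<le> inner (a *\<^sub>V x) x * inner (a *\<^sub>V ?y) ?y"
    using bpos_cauchy_schwarz[OF assms(1), of x ?y] by (simp add: power2_norm_eq_inner)
  also have "\<dots> \<le> (norm x)\<^sup>2 * (norm ?y)\<^sup>2"
    by (intro mult_mono le bpos_inner[OF assms(1)]) simp
  finally have "(norm ?y)\<^sup>2 * (norm ?y)\<^sup>2 \<le> (norm x)\<^sup>2 * (norm ?y)\<^sup>2"
    by (simp add: power2_eq_square mult_ac)
  then have "(norm ?y)\<^sup>2 \<le> (norm x)\<^sup>2"
    using mult_right_le_imp_le[of "(norm ?y)\<^sup>2" "(norm ?y)\<^sup>2" "(norm x)\<^sup>2"]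
    by (cases "?y = 0") auto
  then show "norm ?y \<le> 1 * norm x" by simp
qed simp

lemma bpos_one_minus: "adj a = a \<Longrightarrow> norm a \<le> 1 \<Longrightarrow> bpos (1 - a)"
proof -
  assume a: "adj a = a" "norm a \<le> 1"
  have "inner (a *\<^sub>V x) x \<le> inner x x" for x
  proof -
    have "inner (a *\<^sub>V x) x \<le> norm (a *\<^sub>V x) * norm x" by (rule norm_cauchy_schwarz)
    also have "\<dots> \<le> norm a * norm x * norm x" by (intro mult_right_mono norm_bapp) simp
    also have "\<dots> \<le> 1 * norm x * norm x" by (intro mult_right_mono a) simp_all
    finally show ?thesis by (simp add: power2_norm_eq_inner[symmetric] power2_eq_square)
  qed
  with a show ?thesis by (simp add: bpos_def inner_diff_left)
qed

lemma bpos_adj_mult: "bpos (adj a * a)"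
  by (simp add: bpos_def inner_adj')

lemma bpos_add: "bpos a \<Longrightarrow> bpos b \<Longrightarrow> bpos (a + b)"
  by (simp add: bpos_def inner_add_left)

lemma bpos_scaleR: "bpos a \<Longrightarrow> 0 \<le> r \<Longrightarrow> bpos (r *\<^sub>R a)"
  by (simp add: bpos_def)

text \<open>The scalar iteration \<open>z' = (1 + z\<^sup>2) / 2\<close> majorises the increments of the operator iteration
  \<open>Z' = (C + Z\<^sup>2) / 2\<close>, whose limit \<open>Z\<close> satisfies \<open>(1 - Z)\<^sup>2 = 1 - C\<close>.\<close>

primrec sqrt_iter_real :: "nat \<Rightarrow> real" where
  "sqrt_iter_real 0 = 0"
| "sqrt_iter_real (Suc n) = (1 + (sqrt_iter_real n)\<^sup>2) / 2"

primrec sqrt_iter :: "'a::chilbert_space bop \<Rightarrow> nat \<Rightarrow> 'a bop" where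
  "sqrt_iter c 0 = 0"
| "sqrt_iter c (Suc n) = (1/2) *\<^sub>R (c + sqrt_iter c n * sqrt_iter c n)"

lemma sqrt_iter_real_bounds: "0 \<le> sqrt_iter_real n" "sqrt_iter_real n \<le> 1"
proof (induction n)
  case (Suc n)
  then have "(sqrt_iter_real n)\<^sup>2 \<le> 1" by (simp add: power_le_one)
  then show "0 \<le> sqrt_iter_real (Suc n)" "sqrt_iter_real (Suc n) \<le> 1" by simp_all
qed simp_all

lemma sqrt_iter_real_mono: "sqrt_iter_real n \<le> sqrt_iter_real (Suc n)"
proof -
  have "0 \<le> (1 - sqrt_iter_real n)\<^sup>2" by simp
  then show ?thesis by (simp add: power2_diff)
qed

lemma sqrt_iter_commute: "b * c = c * b \<Longrightarrow> b * sqrt_iter c n = sqrt_iter c n * b"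
proof (induction n)
  case (Suc n)
  have "b * (sqrt_iter c n * sqrt_iter c n) = sqrt_iter c n * sqrt_iter c n * b"
    using Suc by (metis mult.assoc)
  then show ?case using Suc by (simp add: algebra_simps)
qed simp

lemma sqrt_iter_adj: "adj c = c \<Longrightarrow> adj (sqrt_iter c n) = sqrt_iter c n"
  by (induction n) simp_all

lemma sqrt_iter_norm: "norm c \<le> 1 \<Longrightarrow> norm (sqrt_iter c n) \<le> sqrt_iter_real n"
proof (induction n)
  case (Suc n)
  have "norm (c + sqrt_iter c n * sqrt_iter c n) \<le> norm c + norm (sqrt_iter c n) * norm (sqrt_iter c n)"
    by (meson norm_mult_ineq norm_triangle_ineq add_left_mono order_trans)
  also have "\<dots> \<le> 1 + sqrt_iter_real n * sqrt_iter_real n"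
    using Suc sqrt_iter_real_bounds by (intro add_mono mult_mono) auto
  finally show ?case by (simp add: power2_eq_square)
qed simp

lemma sqrt_iter_diff:
  assumes "norm c \<le> 1"
  shows "norm (sqrt_iter c (Suc n) - sqrt_iter c n) \<le> sqrt_iter_real (Suc n) - sqrt_iter_real n"
proof (induction n)
  case 0
  then show ?case using assms by simp
next
  case (Suc n)
  let ?u = "sqrt_iter c (Suc n)" and ?v = "sqrt_iter c n"
  let ?x = "sqrt_iter_real (Suc n)" and ?y = "sqrt_iter_real n"
  have com: "?u * ?v = ?v * ?u"
    by (rule sqrt_iter_commute) (metis sqrt_iter_commute)
  have "sqrt_iter c (Suc (Suc n)) - ?u = (1/2) *\<^sub>R (?u * ?u - ?v * ?v)"
    unfolding sqrt_iter.simps(2)[of c "Suc n"] sqrt_iter.simps(2)[of c n, symmetric]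
    by (simp add: scaleR_add_right scaleR_diff_right)
  \<comment> \<open>The factorisation needs commuting iterates. The scalar iteration factors in the
    same way, which closes the induction.\<close>
  also have "?u * ?u - ?v * ?v = (?u - ?v) * (?u + ?v)"
    using com by (simp add: algebra_simps del: sqrt_iter.simps)
  finally have "norm (sqrt_iter c (Suc (Suc n)) - ?u) = norm ((?u - ?v) * (?u + ?v)) / 2"
    by (simp del: sqrt_iter.simps)
  also have "\<dots> \<le> (?x - ?y) * (?x + ?y) / 2"
  proof -
    have "norm ((?u - ?v) * (?u + ?v)) \<le> norm (?u - ?v) * norm (?u + ?v)" by (rule norm_mult_ineq)
    also have "\<dots> \<le> (?x - ?y) * (?x + ?y)"
    proof (rule mult_mono)
      show "norm (?u + ?v) \<le> ?x + ?y"
        by (rule order_trans[OF norm_triangle_ineq add_mono]) (rule sqrt_iter_norm[OF assms])+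
      show "0 \<le> ?x - ?y" using sqrt_iter_real_mono[of n] by simp
    qed (use Suc in auto)
    finally show ?thesis by simp
  qed
  also have "\<dots> = sqrt_iter_real (Suc (Suc n)) - ?x"
    by (simp add: power2_eq_square field_simps)
  finally show ?case .
qed

text \<open>The iterates are real polynomials in \<open>c\<close> and converge in norm;
  self-adjointness and commutation with everything that commutes with \<open>c\<close> therefore
  pass to the limit.\<close>

lemma sqrt_contraction_exists:
  assumes c: "norm c \<le> 1" "adj c = c"
  obtains z where "z + z = c + z * z" "adj z = z" "norm z \<le> 1" "\<And>b. b * c = c * b \<Longrightarrow> b * z = z * b"
proof -
  have "convergent sqrt_iter_real"
  proof (rule Bseq_mono_convergent)
    show "Bseq sqrt_iter_real"
      using sqrt_iter_real_bounds by (intro BseqI'[where K = 1]) simp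
    show "\<forall>m n. m \<le> n \<longrightarrow> sqrt_iter_real m \<le> sqrt_iter_real n"
      using lift_Suc_mono_le[of sqrt_iter_real, OF sqrt_iter_real_mono] by blast
  qed
  then have "Cauchy sqrt_iter_real" by (simp add: Cauchy_convergent_iff)
  have tail: "norm (sqrt_iter c (n + k) - sqrt_iter c n) \<le> sqrt_iter_real (n + k) - sqrt_iter_real n" for n k
  proof (induction k)
    case (Suc k)
    have "norm (sqrt_iter c (Suc (n + k)) - sqrt_iter c n)
        \<le> norm (sqrt_iter c (Suc (n + k)) - sqrt_iter c (n + k)) + norm (sqrt_iter c (n + k) - sqrt_iter c n)"
      using norm_triangle_ineq[of "sqrt_iter c (Suc (n + k)) - sqrt_iter c (n + k)"
          "sqrt_iter c (n + k) - sqrt_iter c n"] by (simp del: sqrt_iter.simps)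
    with Suc sqrt_iter_diff[OF c(1), of "n + k"] show ?case
      by (simp del: sqrt_iter.simps sqrt_iter_real.simps)
  qed simp
  have "Cauchy (sqrt_iter c)"
    unfolding Cauchy_altdef2 
  proof (intro allI impI)
    fix e :: real assume "0 < e"
    then obtain M where M: "\<And>m n. m \<ge> M \<Longrightarrow> n \<ge> M \<Longrightarrow> norm (sqrt_iter_real m - sqrt_iter_real n) < e"
      using CauchyD[OF \<open>Cauchy sqrt_iter_real\<close>] by blast
    have "dist (sqrt_iter c n) (sqrt_iter c M) < e" if "n \<ge> M" for n
    proof -
      have "norm (sqrt_iter c n - sqrt_iter c M) \<le> sqrt_iter_real n - sqrt_iter_real M"
        using tail[of M "n - M"] that by simp
      also have "\<dots> < e" using M[of n M] that by (simp add: abs_less_iff)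
      finally show ?thesis by (simp add: dist_norm)
    qed
    then show "\<exists>N. \<forall>n\<ge>N. dist (sqrt_iter c n) (sqrt_iter c N) < e" by blast
  qed
  then obtain z where z: "sqrt_iter c \<longlonglongrightarrow> z" by (meson Cauchy_convergent convergent_def)
  have "(\<lambda>n. sqrt_iter c (Suc n)) \<longlonglongrightarrow> (1/2) *\<^sub>R (c + z * z)"
    unfolding sqrt_iter.simps by (intro tendsto_intros z)
  then have "z = (1/2) *\<^sub>R (c + z * z)"
    using LIMSEQ_unique[OF LIMSEQ_Suc[OF z]] by blast
  then have "2 *\<^sub>R z = c + z * z" by (metis scaleR_half_double scaleR_2 scaleR_left_commute)
  then have 1: "z + z = c + z * z" by (simp add: scaleR_2)
  have "(\<lambda>n. adj (sqrt_iter c n)) \<longlonglongrightarrow> adj z"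
    using z by (simp add: LIMSEQ_iff flip: adj_simps(5))
  then have 2: "adj z = z"
    using LIMSEQ_unique z by (simp add: sqrt_iter_adj[OF c(2)]) blast
  have "norm (sqrt_iter c n) \<le> 1" for n
    using sqrt_iter_norm[OF c(1), of n] sqrt_iter_real_bounds(2)[of n] by linarith
  then have 3: "norm z \<le> 1" using LIMSEQ_le_const2[OF tendsto_norm[OF z]] by blast
  have "b * z = z * b" if "b * c = c * b" for b
    using LIMSEQ_unique[OF tendsto_mult_left[OF z, of b]] tendsto_mult_right[OF z, of b]
      sqrt_iter_commute[OF that] by simp
  with 1 2 3 that show ?thesis by blast
qed

lemma bpos_sqrt_exists:
  assumes a: "bpos a"
  obtains s where "bpos s" "s * s = a" "\<And>b. b * a = a * b \<Longrightarrow> b * s = s * b"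
proof -
  \<comment> \<open>The summand 1 keeps \<open>k\<close> positive when \<open>a = 0\<close>. Then
    \<open>a / k\<close> and \<open>1 - a / k\<close> are both positive contractions.\<close>
  define k where "k = norm a + 1"
  have k: "k > 0" by (simp add: k_def add_nonneg_pos)
  define c where "c = 1 - (1/k) *\<^sub>R a"
  have ka: "bpos ((1/k) *\<^sub>R a)" using a k by (simp add: bpos_scaleR)
  have "norm ((1/k) *\<^sub>R a) \<le> 1" using k by (simp add: k_def)
  then have cp: "bpos c" unfolding c_def using a by (intro bpos_one_minus) (simp_all add: bpos_adj)
  have "norm c \<le> 1" using cp ka by (intro norm_le_one_if_bpos_compl) (simp_all add: c_def)
  then obtain z where z: "z + z = c + z * z" "adj z = z" "norm z \<le> 1"
      "\<And>b. b * c = c * b \<Longrightarrow> b * z = z * b"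
    using sqrt_contraction_exists[of c] bpos_adj[OF cp] by blast
  define s where "s = sqrt k *\<^sub>R (1 - z)"
  have "bpos s" unfolding s_def using z(2,3) k by (intro bpos_scaleR bpos_one_minus) auto
  moreover have "s * s = a"
  proof -
    have "(1 - z) * (1 - z) = 1 - (z + z) + z * z" by (simp add: algebra_simps)
    also have "\<dots> = (1/k) *\<^sub>R a" by (simp add: z(1) c_def)
    finally show ?thesis using k by (simp add: s_def)
  qed
  moreover have "b * s = s * b" if "b * a = a * b" for b
  proof -
    have "b * c = c * b" using that by (simp add: c_def algebra_simps)
    from z(4)[OF this] show ?thesis by (simp add: s_def algebra_simps)
  qed
  ultimately show ?thesis using that by blast
qed

lemma bpos_zero_form: "bpos a \<Longrightarrow> inner (a *\<^sub>V x) x = 0 \<Longrightarrow> a *\<^sub>V x = 0"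
  using bpos_norm_sq_le[of a x] by simp

text \<open>The roots \<open>r\<close> and \<open>s\<close> are not known to commute. Each is
  compared with the root \<open>t\<close> obtained from the existence lemma, which commutes with
  everything that commutes with the square.\<close>

lemma bpos_sqrt_unique:
  assumes r: "bpos r" and s: "bpos s" and eq: "r * r = s * s"
  shows "r = s"
proof -
  obtain t where t: "bpos t" "t * t = r * r" "\<And>b. b * (r * r) = (r * r) * b \<Longrightarrow> b * t = t * b"
    using bpos_sqrt_exists[OF bpos_adj_mult[of r]] by (metis bpos_adj[OF r])
  have u: "u = t" if "bpos u" "u * u = r * r" for u
  proof -
    have ut: "u * t = t * u"
      by (rule t(3)) (metis that(2) mult.assoc)
    define d where "d = u - t"
    have d: "adj d = d" using that(1) t(1) by (simp add: d_def bpos_adj)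
    have "d *\<^sub>V x = 0" for x
    proof -
      let ?y = "d *\<^sub>V x"
      \<comment> \<open>On the range of \<open>u - t\<close> the sum of the positive operators
        \<open>u\<close> and \<open>t\<close> vanishes, so each of them does.\<close>
      have "(u + t) * d = 0" unfolding d_def using ut that(2) t(2) by (simp add: algebra_simps)
      then have "(u + t) *\<^sub>V ?y = 0" by (metis bop_simps(1,6))
      then have "inner (u *\<^sub>V ?y) ?y + inner (t *\<^sub>V ?y) ?y = 0"
        by (metis bop_simps(3) inner_add_left inner_zero_left)
      then have "inner (u *\<^sub>V ?y) ?y = 0" "inner (t *\<^sub>V ?y) ?y = 0"
        using bpos_inner[OF that(1), of ?y] bpos_inner[OF t(1), of ?y] by linarith+
      then have "u *\<^sub>V ?y = 0" "t *\<^sub>V ?y = 0" using bpos_zero_form[OF that(1)] bpos_zero_form[OF t(1)] by blast+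
      then have "d *\<^sub>V ?y = 0" by (simp add: d_def)
      then have "inner ?y ?y = 0" using inner_adj[of d x ?y] d by simp
      then show ?thesis by simp
    qed
    then have "d = 0" by (intro bop_eqI) simp
    then show ?thesis by (simp add: d_def)
  qed
  show ?thesis using u[OF r refl] u[OF s] eq by simp
qed

text \<open>With \<open>s\<close> the positive root of \<open>b\<close>, which also commutes with
  \<open>a\<close>, the form of \<open>a b\<close> at \<open>x\<close> is the form of
  \<open>a\<close> at \<open>s x\<close>.\<close>

lemma bpos_mult_commute:
  assumes a: "bpos a" and b: "bpos b" and ab: "a * b = b * a"
  shows "bpos (a * b)"
proof -
  obtain s where s: "bpos s" "s * s = b" "\<And>c. c * b = b * c \<Longrightarrow> c * s = s * c"
    using bpos_sqrt_exists[OF b] by blast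
  have "a * b = s * a * s" using s(2) s(3)[OF ab] by (metis mult.assoc)
  moreover have "inner ((s * a * s) *\<^sub>V x) x = inner (a *\<^sub>V s *\<^sub>V x) (s *\<^sub>V x)" for x
    using inner_adj[of s "a *\<^sub>V s *\<^sub>V x" x] bpos_adj[OF s(1)] by simp
  ultimately show ?thesis
    using bpos_inner[OF a] bpos_adj[OF a] bpos_adj[OF b] ab unfolding bpos_def adj_simps(7)
    by metis
qed

text \<open>The lower bound makes the range closed, and by self-adjointness the orthogonal
  complement of the range is the kernel, which is zero.\<close>

lemma bpos_invertible:
  assumes q: "adj q = q" and \<delta>: "0 < \<delta>" "\<And>x. \<delta> * norm x \<le> norm (q *\<^sub>V x)"
  obtains r where "q * r = 1" "r * q = 1"
proof -
  have inj: "q *\<^sub>V x = q *\<^sub>V y \<Longrightarrow> x = y" for x y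
    using \<delta>(2)[of "x - y"] \<delta>(1) by (simp add: bapp_diff mult_le_0_iff)
  have cl: "closed (range (bapp q))"
  proof (rule closed_sequential_limits[THEN iffD2], intro allI impI, elim conjE)
    fix f l assume f: "\<forall>n. f n \<in> range (bapp q)" and l: "f \<longlonglongrightarrow> l"
    from f have "\<forall>n. \<exists>x. f n = q *\<^sub>V x" by blast
    from choice[OF this] obtain g where g: "\<And>n. f n = q *\<^sub>V g n" by blast
    have "Cauchy g"
    proof (rule metric_CauchyI)
      fix e :: real assume "0 < e"
      then have "0 < \<delta> * e" using \<delta> by simp
      from metric_CauchyD[OF LIMSEQ_imp_Cauchy[OF l] this]
      obtain M where M: "\<And>m n. m \<ge> M \<Longrightarrow> n \<ge> M \<Longrightarrow> dist (f m) (f n) < \<delta> * e" by blast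
      have "dist (g m) (g n) < e" if "m \<ge> M" "n \<ge> M" for m n
      proof -
        have "\<delta> * norm (g m - g n) < \<delta> * e"
          using \<delta>(2)[of "g m - g n"] M[OF that] by (simp add: dist_norm g bapp_diff)
        then show ?thesis using \<delta> by (simp add: dist_norm)
      qed
      then show "\<exists>M. \<forall>m\<ge>M. \<forall>n\<ge>M. dist (g m) (g n) < e" by blast
    qed
    then obtain x where x: "g \<longlonglongrightarrow> x" by (meson Cauchy_convergent convergent_def)
    have "f \<longlonglongrightarrow> q *\<^sub>V x" using tendsto_bapp[OF x, of q] by (simp add: g[symmetric])
    with l LIMSEQ_unique show "l \<in> range (bapp q)" by blast
  qed
  have sub: "subspace (range (bapp q))"
    by (rule subspaceI)
      (auto intro: range_eqI[of _ _ 0] simp: bapp_add[symmetric] bapp_scaleR[symmetric])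
  have surj: "\<exists>x. q *\<^sub>V x = y" for y
  proof -
    obtain z where z: "z \<in> range (bapp q)" "\<And>m. m \<in> range (bapp q) \<Longrightarrow> inner (y - z) m = 0"
      using orthogonal_decomposition[OF sub cl] by blast
    have *: "inner (q *\<^sub>V (y - z)) w = 0" for w
      using z(2)[of "q *\<^sub>V w"] inner_adj[of q "y - z" w] q by simp
    have "q *\<^sub>V (y - z) = q *\<^sub>V 0" by (rule inner_left_eqI) (simp only: bapp_zero inner_zero_left *)
    from inj[OF this] have "y = z" by simp
    with z(1) show ?thesis by blast
  qed
  define g where "g y = (SOME x. q *\<^sub>V x = y)" for y
  have g: "q *\<^sub>V g y = y" for y unfolding g_def by (rule someI_ex[OF surj])
  have "bapp (Bop g) = g"
  proof (rule bapp_Bop)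
    show "g (x + y) = g x + g y" for x y by (rule inj) (simp add: g bapp_add)
    show "g (c *\<^sub>C x) = c *\<^sub>C g x" for c x by (rule inj) (simp add: g bapp_scaleC)
    show "norm (g x) \<le> norm x * (1 / \<delta>)" for x
      using \<delta>(2)[of "g x"] \<delta>(1) by (simp add: g field_simps)
  qed
  then have ag: "Bop g *\<^sub>V y = g y" for y by simp
  have "q * Bop g = 1" by (rule bop_eqI) (simp add: ag g)
  moreover have "Bop g * q = 1"
  proof (rule bop_eqI)
    show "(Bop g * q) *\<^sub>V x = 1 *\<^sub>V x" for x
      by (rule inj) (simp add: ag g)
  qed
  ultimately show ?thesis using that by blast
qed

section \<open>Joint approximate eigenvectors\<close>

text \<open>For positive \<open>y\<close> this says that 0 is an approximate eigenvalue. Since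
  positive operators add up, one such condition on a sum expresses that all summands have common
  approximate null vectors.\<close>

definition approx_null :: "'a::chilbert_space bop \<Rightarrow> bool" where
  "approx_null y \<longleftrightarrow> (\<forall>\<epsilon>>0. \<exists>x. norm x = 1 \<and> inner (y *\<^sub>V x) x < \<epsilon>)"

lemma inner_bapp_le: "\<bar>inner (a *\<^sub>V x) x\<bar> \<le> norm a * (norm x)\<^sup>2"
proof -
  have "\<bar>inner (a *\<^sub>V x) x\<bar> \<le> norm (a *\<^sub>V x) * norm x" by (rule Cauchy_Schwarz_ineq2)
  also have "\<dots> \<le> norm a * norm x * norm x" by (intro mult_right_mono norm_bapp) simp
  finally show ?thesis by (simp add: power2_eq_square mult.assoc)
qed

lemma form_le_from_unit:
  assumes "\<And>x. norm x = 1 \<Longrightarrow> inner (a *\<^sub>V x) x \<le> m"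
  shows "inner (a *\<^sub>V x) x \<le> m * (norm x)\<^sup>2"
proof (cases "x = 0")
  case False
  let ?u = "(1 / norm x) *\<^sub>R x"
  have "inner (a *\<^sub>V ?u) ?u \<le> m" using False by (intro assms) simp
  then show ?thesis using False by (simp add: bapp_scaleR power2_eq_square field_simps)
qed simp

text \<open>The approximate joint eigenvalue \<open>\<mu>\<close> is the limit for \<open>t \<rightarrow> \<infinity>\<close> of the top of the
  spectrum of the penalised operator \<open>X - tY\<close>.\<close>

lemma approx_null_extend_selfadjoint:
  fixes X Y :: "'a::chilbert_space bop"
  assumes Y: "bpos Y" and X: "adj X = X" and XY: "X * Y = Y * X" and null: "approx_null Y"
  obtains \<mu> where "approx_null (Y + (X - \<mu> *\<^sub>R 1) * (X - \<mu> *\<^sub>R 1))"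
proof -
  define R where "R = norm X"
  \<comment> \<open>Penalties are powers of two so that consecutive ones differ by a factor 2:
    convergence of the suprema \<open>m n\<close> then bounds the penalty term itself.\<close>
  define Z where "Z n = X - (2 ^ n) *\<^sub>R Y" for n :: nat
  define S where "S n = (\<lambda>x. inner (Z n *\<^sub>V x) x) ` {x. norm x = 1}" for n
  define m where "m n = Sup (S n)" for n
  have Z_inner: "inner (Z n *\<^sub>V x) x = inner (X *\<^sub>V x) x - 2 ^ n * inner (Y *\<^sub>V x) x" for n x
    by (simp add: Z_def inner_diff_left)
  have Yp: "0 \<le> inner (Y *\<^sub>V x) x" for x by (rule bpos_inner[OF Y])
  have X_le: "\<bar>inner (X *\<^sub>V x) x\<bar> \<le> R" if "norm x = 1" for x
    using inner_bapp_le[of X x] that by (simp add: R_def)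
  have S_le: "s \<le> R" if s: "s \<in> S n" for s n
  proof -
    obtain x where x: "norm x = 1" "s = inner (Z n *\<^sub>V x) x" using s by (auto simp: S_def)
    have "0 \<le> 2 ^ n * inner (Y *\<^sub>V x) x" using Yp by simp
    with x X_le[OF x(1)] show ?thesis by (simp add: Z_inner)
  qed
  have bdd: "bdd_above (S n)" for n using S_le by (intro bdd_aboveI[of _ R]) blast
  have ne: "S n \<noteq> {}" for n
  proof -
    obtain x :: 'a where "norm x = 1"
      using null zero_less_one unfolding approx_null_def by blast
    then show ?thesis by (auto simp: S_def)
  qed
  have mem: "inner (Z n *\<^sub>V x) x \<le> m n" if "norm x = 1" for n x
    unfolding m_def by (rule cSup_upper[OF _ bdd]) (use that in \<open>auto simp: S_def\<close>)
  have m_le: "m n \<le> R" for n unfolding m_def by (rule cSup_least[OF ne S_le])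
  have m_ge: "- R \<le> m n" for n
  proof (rule field_le_epsilon)
    fix e :: real assume "0 < e"
    then have "0 < e / 2 ^ n" by simp
    then obtain x where x: "norm x = 1" "inner (Y *\<^sub>V x) x < e / 2 ^ n"
      using null unfolding approx_null_def by blast
    then have "2 ^ n * inner (Y *\<^sub>V x) x < e" by (simp add: field_simps)
    with mem[OF x(1), of n] X_le[OF x(1)] show "- R \<le> m n + e" by (simp add: Z_inner)
  qed
  have dec: "m (Suc n) \<le> m n" for n
    unfolding m_def[of "Suc n"]
  proof (rule cSup_least[OF ne])
    fix s assume "s \<in> S (Suc n)"
    then obtain x where x: "norm x = 1" "s = inner (Z (Suc n) *\<^sub>V x) x" by (auto simp: S_def)
    have "0 \<le> 2 ^ n * inner (Y *\<^sub>V x) x" using Yp by simp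
    then have "s \<le> inner (Z n *\<^sub>V x) x" unfolding x(2) Z_inner power_Suc mult.assoc by linarith
    with mem[OF x(1)] show "s \<le> m n" by (meson order_trans)
  qed
  obtain \<mu> where \<mu>: "m \<longlonglongrightarrow> \<mu>"
    by (rule decseq_convergent[of m "- R"]) (simp_all add: m_ge decseq_SucI dec)
  have R0: "0 \<le> R" by (simp add: R_def)
  have "\<exists>x. norm x = 1 \<and> inner ((Y + (X - \<mu> *\<^sub>R 1) * (X - \<mu> *\<^sub>R 1)) *\<^sub>V x) x < \<epsilon>" if \<epsilon>: "0 < \<epsilon>" for \<epsilon>
  proof -
    \<comment> \<open>The final estimate is \<open>4 \<eta> + 20 R \<eta> + 2 \<eta>\<close>,
      rounded up to \<open>(7 + 20 R) \<eta>\<close>.\<close>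
    define \<eta> where "\<eta> = min 1 (\<epsilon> / (7 + 20 * R))"
    have R7: "0 < 7 + 20 * R" using R0 by simp
    then have \<eta>: "0 < \<eta>" "\<eta> \<le> 1" "\<eta> \<le> \<epsilon> / (7 + 20 * R)"
      using \<epsilon> by (simp_all add: \<eta>_def)
    from \<eta>(3) have \<eta>3: "(7 + 20 * R) * \<eta> \<le> \<epsilon>"
      using R7 by (simp only: pos_le_divide_eq mult.commute)
    have "(\<lambda>n. m n - m (Suc n)) \<longlonglongrightarrow> 0"
      using tendsto_diff[OF \<mu> LIMSEQ_Suc[OF \<mu>]] by simp
    then have "\<forall>\<^sub>F n in sequentially. m n - m (Suc n) < \<eta>"
      by (rule order_tendstoD) (rule \<eta>)
    moreover have "\<forall>\<^sub>F n in sequentially. dist (m (Suc n)) \<mu> < \<eta>"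
      by (rule tendstoD[OF LIMSEQ_Suc[OF \<mu>] \<eta>(1)])
    ultimately have "\<forall>\<^sub>F n in sequentially. m n - m (Suc n) < \<eta> \<and> dist (m (Suc n)) \<mu> < \<eta>"
      by (rule eventually_conj)
    then obtain n where n: "m n - m (Suc n) < \<eta>" "\<bar>m (Suc n) - \<mu>\<bar> < \<eta>"
      by (auto simp: eventually_sequentially dist_real_def)
    define t :: real where "t = 2 ^ Suc n"
    define m' where "m' = m (Suc n)"
    define G where "G = m' *\<^sub>R 1 - Z (Suc n)"
    have t: "1 \<le> t" by (simp add: t_def one_le_power del: power_Suc)
    have Gp: "bpos G"
      using form_le_from_unit[OF mem[of _ "Suc n"]] X bpos_adj[OF Y]
      by (simp add: bpos_def G_def inner_diff_left m'_def power2_norm_eq_inner Z_def)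
    \<comment> \<open>A near-maximiser up to \<open>\<theta>\<close> has
      \<open>norm (G x) ^ 2 \<le> norm G * \<theta> \<le> \<eta> ^ 2\<close>; the summand 1 avoids
      division by zero.\<close>
    define \<theta> where "\<theta> = min \<eta> (\<eta>\<^sup>2 / (norm G + 1))"
    have nG: "0 < norm G + 1" by (simp add: add_nonneg_pos)
    have \<theta>: "0 < \<theta>" "\<theta> \<le> \<eta>" using \<eta> nG by (simp_all add: \<theta>_def)
    have \<theta>3: "norm G * \<theta> \<le> \<eta>\<^sup>2"
    proof -
      have "norm G * \<theta> \<le> (norm G + 1) * \<theta>" using \<theta> by (intro mult_right_mono) auto
      also have "\<dots> \<le> (norm G + 1) * (\<eta>\<^sup>2 / (norm G + 1))"
        using nG by (intro mult_left_mono) (auto simp: \<theta>_def)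
      finally show ?thesis using nG by simp
    qed
    have "\<exists>s\<in>S (Suc n). m' - \<theta> < s"
      using less_cSup_iff[OF ne bdd, of "m' - \<theta>" "Suc n"] \<theta>(1) by (simp add: m'_def m_def)
    then obtain x where x: "norm x = 1" "m' - \<theta> < inner (Z (Suc n) *\<^sub>V x) x"
      by (auto simp: S_def)
    define y where "y = inner (Y *\<^sub>V x) x"
    have y0: "0 \<le> y" using Yp by (simp add: y_def)
    have nx: "inner x x = 1" using x(1) by (simp add: power2_norm_eq_inner[symmetric])
    have "inner (G *\<^sub>V x) x < \<theta>" using x nx by (simp add: G_def inner_diff_left)
    then have "(norm (G *\<^sub>V x))\<^sup>2 \<le> norm G * \<theta>"
      using bpos_norm_sq_le[OF Gp, of x] mult_left_mono[of "inner (G *\<^sub>V x) x" \<theta> "norm G"] by simp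
    with \<theta>3 have "(norm (G *\<^sub>V x))\<^sup>2 \<le> \<eta>\<^sup>2" by linarith
    then have Gx: "norm (G *\<^sub>V x) \<le> \<eta>" by (rule power2_le_imp_le) (use \<eta>(1) in simp)
    \<comment> \<open>The same vector tested against the halved penalty: subtracting the two bounds
      gives \<open>t / 2 * y < 2 \<eta>\<close>.\<close>
    have "inner (X *\<^sub>V x) x - (t / 2) * y \<le> m n"
      using mem[OF x(1), of n] by (simp add: Z_inner t_def y_def)
    moreover have "m' - \<theta> < inner (X *\<^sub>V x) x - t * y"
      using x(2) by (simp only: Z_inner t_def y_def)
    ultimately have ty: "t * y < 4 * \<eta>"
      using n(1) \<theta>(2) by (simp add: m'_def)
    moreover have "y \<le> t * y" using t y0 by (simp add: mult_le_cancel_right1)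
    ultimately have y4: "y < 4 * \<eta>" by simp
    define v where "v = (X - m' *\<^sub>R 1) *\<^sub>V x"
    have v: "v = t *\<^sub>R (Y *\<^sub>V x) - G *\<^sub>V x" by (simp add: v_def G_def Z_def t_def)
    have m'R: "\<bar>m'\<bar> \<le> R" using m_le[of "Suc n"] m_ge[of "Suc n"] by (simp add: m'_def)
    have nv: "norm v \<le> 2 * R"
    proof -
      have "norm v \<le> norm (X *\<^sub>V x) + norm (m' *\<^sub>R x)" using norm_triangle_ineq4[of "X *\<^sub>V x" "m' *\<^sub>R x"] by (simp add: v_def)
      also have "\<dots> \<le> R + R"
      proof (rule add_mono)
        show "norm (X *\<^sub>V x) \<le> R" using norm_bapp[of X x] x(1) by (simp add: R_def)
        show "norm (m' *\<^sub>R x) \<le> R" using m'R x(1) by simp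
      qed
      finally show ?thesis by simp
    qed
    \<comment> \<open>Commutation of \<open>X\<close> and \<open>Y\<close> enters here: the product
      of the positive operators \<open>Y\<close> and \<open>2 R - (X - m')\<close> is
      positive.\<close>
    have vY: "inner v (Y *\<^sub>V x) \<le> 2 * R * y"
    proof -
      let ?W = "(2 * R) *\<^sub>R 1 - (X - m' *\<^sub>R 1)"
      have W: "bpos ?W"
        unfolding bpos_def
      proof (intro conjI allI)
        show "adj ?W = ?W" using X by simp
        fix z
        have "inner (X *\<^sub>V z) z \<le> R * (norm z)\<^sup>2" using inner_bapp_le[of X z] by (simp add: R_def)
        moreover have "- m' * (norm z)\<^sup>2 \<le> R * (norm z)\<^sup>2" using m'R by (intro mult_right_mono) auto
        ultimately show "0 \<le> inner (?W *\<^sub>V z) z"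
          by (simp add: inner_diff_left power2_norm_eq_inner)
      qed
      have "Y * ?W = ?W * Y" using XY by (simp add: algebra_simps)
      then have "bpos (Y * ?W)" by (rule bpos_mult_commute[OF Y W])
      then have "0 \<le> inner ((Y * ?W) *\<^sub>V x) x" by (rule bpos_inner)
      also have "\<dots> = inner (?W *\<^sub>V x) (Y *\<^sub>V x)"
        using inner_adj[of Y "?W *\<^sub>V x" x] bpos_adj[OF Y] by simp
      also have "\<dots> = 2 * R * y - inner v (Y *\<^sub>V x)"
        using inner_commute[of x "Y *\<^sub>V x"] by (simp add: v_def y_def inner_diff_left)
      finally show ?thesis by simp
    qed
    \<comment> \<open>Only \<open>t * y\<close> is known to be small, not
      \<open>t * norm (Y x)\<close>. So \<open>v\<close> is paired with its own expansion instead of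
      being estimated term by term.\<close>
    have "(norm v)\<^sup>2 = t * inner v (Y *\<^sub>V x) - inner v (G *\<^sub>V x)"
    proof -
      have "(norm v)\<^sup>2 = inner v (t *\<^sub>R (Y *\<^sub>V x) - G *\<^sub>V x)"
        by (simp add: v[symmetric] power2_norm_eq_inner)
      then show ?thesis by (simp add: inner_diff_right)
    qed
    also have "\<dots> \<le> t * (2 * R * y) + 2 * R * \<eta>"
    proof -
      have "- inner v (G *\<^sub>V x) \<le> norm v * norm (G *\<^sub>V x)"
        using norm_cauchy_schwarz[of "- v" "G *\<^sub>V x"] by simp
      also have "\<dots> \<le> 2 * R * \<eta>" using nv Gx R0 by (intro mult_mono) auto
      finally have "- inner v (G *\<^sub>V x) \<le> 2 * R * \<eta>" .
      moreover have "t * inner v (Y *\<^sub>V x) \<le> t * (2 * R * y)" using vY t by (intro mult_left_mono) auto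
      ultimately show ?thesis by linarith
    qed
    also have "\<dots> \<le> 10 * R * \<eta>"
      using mult_left_mono[OF less_imp_le[OF ty], of "2 * R"] R0 by (simp add: algebra_simps)
    finally have v10: "(norm v)\<^sup>2 \<le> 10 * R * \<eta>" .
    define w where "w = (X - \<mu> *\<^sub>R 1) *\<^sub>V x"
    have "norm w \<le> norm v + \<eta>"
    proof -
      have "w = v + (m' - \<mu>) *\<^sub>R x" by (simp add: w_def v_def scaleR_left_diff_distrib)
      then have "norm w \<le> norm v + norm ((m' - \<mu>) *\<^sub>R x)" by (simp only: norm_triangle_ineq)
      also have "\<dots> \<le> norm v + \<eta>" using n(2) x(1) by (simp add: m'_def)
      finally show ?thesis .
    qed
    then have "(norm w)\<^sup>2 \<le> (norm v + \<eta>)\<^sup>2" by (intro power_mono) auto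
    also have "\<dots> \<le> 2 * (norm v)\<^sup>2 + 2 * \<eta>\<^sup>2"
      using sum_squares_bound[of "norm v" \<eta>] by (simp add: power2_sum)
    also have "\<dots> \<le> 20 * R * \<eta> + 2 * \<eta>"
    proof -
      have "\<eta>\<^sup>2 \<le> \<eta>"
        using mult_left_mono[OF \<eta>(2) less_imp_le[OF \<eta>(1)]] by (simp add: power2_eq_square)
      with v10 show ?thesis by linarith
    qed
    finally have "(norm w)\<^sup>2 \<le> 20 * R * \<eta> + 2 * \<eta>" .
    then have "y + (norm w)\<^sup>2 < (7 + 20 * R) * \<eta>" using y4 \<eta>(1) by (simp add: algebra_simps)
    moreover have "inner ((Y + (X - \<mu> *\<^sub>R 1) * (X - \<mu> *\<^sub>R 1)) *\<^sub>V x) x = y + (norm w)\<^sup>2"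
      using inner_adj[of "X - \<mu> *\<^sub>R 1" w x] X
      by (simp only: bop_simps(3,6) y_def w_def inner_add_left power2_norm_eq_inner) simp
    ultimately show ?thesis using x(1) \<eta>3 by (intro exI[of _ x]) simp
  qed
  then show ?thesis using that[of \<mu>] by (simp only: approx_null_def) blast
qed

lemma bpos_adj_mult_self: "adj a = a \<Longrightarrow> bpos (a * a)"
  using bpos_adj_mult[of a] by simp

text \<open>Real and imaginary part of \<open>N\<close> are treated one after the other; normality
  makes them commute, so the penalty added for the first still commutes with the second.\<close>

lemma approx_null_extend_normal:
  fixes N Y :: "'a::chilbert_space bop"
  assumes Y: "bpos Y" and N: "nrm N" and YN: "Y * N = N * Y" and null: "approx_null Y"
  obtains z where "approx_null (Y + adj (N - bscal z) * (N - bscal z))"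
proof -
  \<comment> \<open>Since \<open>Y\<close> is self-adjoint, taking adjoints suffices here and
    Fuglede's theorem is not involved.\<close>
  have YN': "Y * adj N = adj N * Y"
    using arg_cong[OF YN, of adj] bpos_adj[OF Y] by simp
  have NN: "N * adj N = adj N * N" using N by (simp add: nrm_def)
  define X1 where "X1 = (1/2) *\<^sub>R (N + adj N)"
  define X2 where "X2 = (1/2) *\<^sub>R (bscal (- \<i>) * (N - adj N))"
  have a1: "adj X1 = X1" by (simp add: X1_def add.commute)
  have a2: "adj X2 = X2"
  proof -
    have "(adj N - N) * bscal \<i> = bscal (- \<i>) * (N - adj N)"
      by (rule bop_eqI) (simp add: bapp_scaleC scaleC_minus_left scaleC_diff_right)
    then show ?thesis by (simp add: X2_def)
  qed
  have c1: "X1 * Y = Y * X1" using YN YN' by (simp add: X1_def algebra_simps)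
  have c2: "X2 * Y = Y * X2"
  proof -
    have "(N - adj N) * Y = Y * (N - adj N)" using YN YN' by (simp add: algebra_simps)
    then have "bscal (- \<i>) * (N - adj N) * Y = Y * (bscal (- \<i>) * (N - adj N))"
      by (metis bscal_commute mult.assoc)
    then show ?thesis by (simp add: X2_def)
  qed
  have c3: "X2 * X1 = X1 * X2"
  proof -
    have "(N - adj N) * (N + adj N) = (N + adj N) * (N - adj N)" using NN by (simp add: algebra_simps)
    then have "bscal (- \<i>) * (N - adj N) * (N + adj N) = (N + adj N) * (bscal (- \<i>) * (N - adj N))"
      by (metis bscal_commute mult.assoc)
    then show ?thesis by (simp add: X1_def X2_def)
  qed
  obtain u where u: "approx_null (Y + (X1 - u *\<^sub>R 1) * (X1 - u *\<^sub>R 1))"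
    using approx_null_extend_selfadjoint[OF Y a1 c1 null] .
  let ?A = "X1 - u *\<^sub>R 1"
  have A: "adj ?A = ?A" using a1 by simp
  have cA: "X2 * ?A = ?A * X2" using c3 by (simp add: algebra_simps)
  have "X2 * (Y + ?A * ?A) = (Y + ?A * ?A) * X2"
    unfolding distrib_left distrib_right c2 by (metis cA mult.assoc)
  then obtain v where v: "approx_null (Y + ?A * ?A + (X2 - v *\<^sub>R 1) * (X2 - v *\<^sub>R 1))"
    using approx_null_extend_selfadjoint[OF bpos_add[OF Y bpos_adj_mult_self[OF A]] a2 _ u] by blast
  let ?B = "X2 - v *\<^sub>R 1"
  let ?z = "Complex u v"
  have B: "adj ?B = ?B" using a2 by simp
  have dec: "(N - bscal ?z) *\<^sub>V x = ?A *\<^sub>V x + \<i> *\<^sub>C (?B *\<^sub>V x)" for x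
  proof -
    have half: "(1/2) *\<^sub>R w + (1/2) *\<^sub>R w = w" for w :: 'a
      by (simp flip: scaleR_add_left)
    have X2x: "\<i> *\<^sub>C (X2 *\<^sub>V x) = (1/2) *\<^sub>R (N *\<^sub>V x - adj N *\<^sub>V x)"
      unfolding X2_def by (simp add: scaleR_scaleC_commute[symmetric] scaleC_scaleC)
    have X1x: "X1 *\<^sub>V x = (1/2) *\<^sub>R (N *\<^sub>V x) + (1/2) *\<^sub>R (adj N *\<^sub>V x)"
      by (simp add: X1_def scaleR_add_right)
    have "X1 *\<^sub>V x + \<i> *\<^sub>C (X2 *\<^sub>V x) = (1/2) *\<^sub>R (N *\<^sub>V x) + (1/2) *\<^sub>R (N *\<^sub>V x)"
      unfolding X1x X2x by (simp add: scaleR_diff_right)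
    then have h: "X1 *\<^sub>V x + \<i> *\<^sub>C (X2 *\<^sub>V x) = N *\<^sub>V x" by (simp only: half)
    have "?z = of_real u + \<i> * of_real v" by (simp add: complex_eq_iff)
    then have z: "?z *\<^sub>C x = u *\<^sub>R x + \<i> *\<^sub>C (v *\<^sub>R x)"
      by (simp add: scaleC_add_left scaleR_scaleC scaleC_scaleC)
    show ?thesis
      by (simp add: z h[symmetric] scaleC_diff_right)
  qed
  \<comment> \<open>The factor 2 comes from \<open>(a + b) ^ 2 \<le> 2 a ^ 2 + 2 b ^ 2\<close> for
    the real and imaginary parts, and is absorbed by testing with \<open>e / 2\<close>.\<close>
  have "inner ((Y + adj (N - bscal ?z) * (N - bscal ?z)) *\<^sub>V x) x
      \<le> 2 * inner ((Y + ?A * ?A + ?B * ?B) *\<^sub>V x) x" for x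
  proof -
    let ?a = "norm (?A *\<^sub>V x)" and ?b = "norm (?B *\<^sub>V x)"
    have "norm ((N - bscal ?z) *\<^sub>V x) \<le> ?a + ?b"
      unfolding dec using norm_triangle_ineq[of "?A *\<^sub>V x" "\<i> *\<^sub>C (?B *\<^sub>V x)"] by (simp only: norm_scaleC) simp
    then have "(norm ((N - bscal ?z) *\<^sub>V x))\<^sup>2 \<le> (?a + ?b)\<^sup>2" by (intro power_mono) auto
    also have "\<dots> \<le> 2 * ?a\<^sup>2 + 2 * ?b\<^sup>2" using sum_squares_bound[of ?a ?b] by (simp add: power2_sum)
    finally have "inner (adj (N - bscal ?z) *\<^sub>V (N - bscal ?z) *\<^sub>V x) x \<le> 2 * ?a\<^sup>2 + 2 * ?b\<^sup>2"
      by (simp only: inner_adj' power2_norm_eq_inner)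
    moreover have "?a\<^sup>2 = inner (?A *\<^sub>V ?A *\<^sub>V x) x"
      using inner_adj[of ?A "?A *\<^sub>V x" x] A by (simp only: power2_norm_eq_inner)
    moreover have "?b\<^sup>2 = inner (?B *\<^sub>V ?B *\<^sub>V x) x"
      using inner_adj[of ?B "?B *\<^sub>V x" x] B by (simp only: power2_norm_eq_inner)
    moreover have "y + n \<le> 2 * (y + p + q)"
      if "n \<le> 2 * a + 2 * b" "a = p" "b = q" "0 \<le> y" for n a b p q y :: real
      using that by simp
    ultimately show ?thesis
      using bpos_inner[OF Y, of x] unfolding bop_simps(3,6) inner_add_left by blast
  qed
  moreover have "\<exists>x. norm x = 1 \<and> inner ((Y + ?A * ?A + ?B * ?B) *\<^sub>V x) x < e / 2" if "0 < e" for e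
    using v that unfolding approx_null_def by (meson half_gt_zero)
  ultimately have "approx_null (Y + adj (N - bscal ?z) * (N - bscal ?z))"
    unfolding approx_null_def by (smt (verit) field_sum_of_halves)
  then show ?thesis by (rule that)
qed

text \<open>The positive operator \<open>norm N ^ 2 - adj N * N\<close> has approximate null
  vectors. They can be chosen as approximate eigenvectors of \<open>N\<close> as well, and then the
  modulus of the eigenvalue is both close to \<open>norm N\<close> and bounded by the numerical
  radius.\<close>

lemma norm_le_of_numerical_radius:
  fixes N :: "'a::chilbert_space bop"
  assumes N: "nrm N" and w: "\<And>x. cmod (cinner (N *\<^sub>V x) x) \<le> (norm x)\<^sup>2"
  shows "norm N \<le> 1"
proof (rule ccontr)
  assume "\<not> norm N \<le> 1"
  then have n1: "1 < norm N" by simp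
  define Y where "Y = (norm N)\<^sup>2 *\<^sub>R 1 - adj N * N"
  have Y_inner: "inner (Y *\<^sub>V x) x = (norm N)\<^sup>2 * (norm x)\<^sup>2 - (norm (N *\<^sub>V x))\<^sup>2" for x
    by (simp add: Y_def inner_diff_left inner_adj' power2_norm_eq_inner)
  have Y: "bpos Y"
  proof -
    have "(norm (N *\<^sub>V x))\<^sup>2 \<le> (norm N)\<^sup>2 * (norm x)\<^sup>2" for x
      using power_mono[OF norm_bapp[of N x], of 2] by (simp add: power_mult_distrib)
    then show ?thesis by (simp add: bpos_def Y_inner) (simp add: Y_def)
  qed
  have NN: "N * adj N = adj N * N" using N by (simp add: nrm_def)
  have YN: "Y * N = N * Y"
    unfolding Y_def by (simp add: algebra_simps) (metis NN mult.assoc)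
  have "approx_null Y"
    unfolding approx_null_def
  proof (intro allI impI, rule ccontr)
    fix \<epsilon> :: real assume "0 < \<epsilon>" and no: "\<nexists>x. norm x = 1 \<and> inner (Y *\<^sub>V x) x < \<epsilon>"
    \<comment> \<open>Capped at 1 so that \<open>norm N ^ 2 - e\<close> stays positive under the
      square root.\<close>
    define e where "e = min \<epsilon> 1"
    have e: "0 < e" "e \<le> 1" "e \<le> \<epsilon>" using \<open>0 < \<epsilon>\<close> by (auto simp: e_def)
    have n2: "1 < (norm N)\<^sup>2" using n1 by (simp add: one_less_power)
    have "inner ((adj N * N) *\<^sub>V x) x \<le> (norm N)\<^sup>2 - e" if "norm x = 1" for x
    proof -
      have "\<not> inner (Y *\<^sub>V x) x < \<epsilon>" using no that by blast
      then show ?thesis using e(3) Y_inner[of x] that by (simp add: inner_adj' power2_norm_eq_inner)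
    qed
    then have le: "inner ((adj N * N) *\<^sub>V x) x \<le> ((norm N)\<^sup>2 - e) * (norm x)\<^sup>2" for x
      by (rule form_le_from_unit)
    have "norm N \<le> sqrt ((norm N)\<^sup>2 - e)"
    proof (rule norm_bop_le)
      fix x
      have "(norm (N *\<^sub>V x))\<^sup>2 \<le> ((norm N)\<^sup>2 - e) * (norm x)\<^sup>2"
        using le[of x] by (simp add: inner_adj' power2_norm_eq_inner)
      also have "\<dots> = (sqrt ((norm N)\<^sup>2 - e) * norm x)\<^sup>2"
        using n2 e by (simp add: power_mult_distrib)
      finally show "norm (N *\<^sub>V x) \<le> sqrt ((norm N)\<^sup>2 - e) * norm x"
        by (rule power2_le_imp_le) (use n2 e in simp)
    qed (use n2 e in auto)
    also have "\<dots> < sqrt ((norm N)\<^sup>2)" using e by (intro real_sqrt_less_mono) simp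
    finally show False by simp
  qed
  then obtain z where z: "approx_null (Y + adj (N - bscal z) * (N - bscal z))"
    using approx_null_extend_normal[OF Y N YN] by blast
  \<comment> \<open>Chosen so that \<open>(1 + 2 \<eta>) ^ 2 + \<eta> ^ 2 \<le> 1 + 9 \<eta>\<close>
    falls short of \<open>norm N ^ 2\<close>.\<close>
  define \<eta> where "\<eta> = min 1 (((norm N)\<^sup>2 - 1) / 10)"
  have "0 < (norm N)\<^sup>2 - 1" using n1 by (simp add: one_less_power)
  then have \<eta>: "0 < \<eta>" "\<eta> \<le> 1" "10 * \<eta> \<le> (norm N)\<^sup>2 - 1" by (auto simp: \<eta>_def min_def)
  then have "0 < \<eta>\<^sup>2" by simp
  then obtain x where x: "norm x = 1" "inner ((Y + adj (N - bscal z) * (N - bscal z)) *\<^sub>V x) x < \<eta>\<^sup>2"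
    using z unfolding approx_null_def by blast
  let ?r = "(N - bscal z) *\<^sub>V x"
  have sum: "inner (Y *\<^sub>V x) x + (norm ?r)\<^sup>2 < \<eta>\<^sup>2"
    using x(2) by (simp only: bop_simps(3,6) inner_add_left inner_adj' power2_norm_eq_inner)
  then have "(norm ?r)\<^sup>2 < \<eta>\<^sup>2" using bpos_inner[OF Y, of x] by linarith
  then have r: "norm ?r < \<eta>" using \<eta>(1) by (meson less_imp_le power_less_imp_less_base)
  have Nx: "N *\<^sub>V x = ?r + z *\<^sub>C x" by simp
  have "z = cinner (N *\<^sub>V x) x - cinner ?r x"
    using x(1) by (simp add: cinner_diff_left cinner_scaleC_left cinner_self)
  then have "cmod z \<le> cmod (cinner (N *\<^sub>V x) x) + cmod (cinner ?r x)"
    using norm_triangle_ineq4 by metis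
  also have "\<dots> \<le> 1 + \<eta>"
    using w[of x] norm_cinner_le[of ?r x] r x(1) by (simp only: power_one mult_1_right)
  finally have "cmod z \<le> 1 + \<eta>" .
  moreover have "norm (N *\<^sub>V x) \<le> norm ?r + cmod z"
    unfolding Nx using norm_triangle_ineq[of ?r "z *\<^sub>C x"] x(1) by (simp only: norm_scaleC mult_1_right)
  ultimately have "norm (N *\<^sub>V x) \<le> 1 + 2 * \<eta>" using r by linarith
  then have "(norm (N *\<^sub>V x))\<^sup>2 \<le> (1 + 2 * \<eta>)\<^sup>2" by (intro power_mono) auto
  moreover have "(norm N)\<^sup>2 - (norm (N *\<^sub>V x))\<^sup>2 < \<eta>\<^sup>2"
    using sum Y_inner[of x] zero_le_power2[of "norm ?r"] unfolding x(1) power_one mult_1_right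
    by linarith
  moreover have "(1 + 2 * \<eta>)\<^sup>2 + \<eta>\<^sup>2 \<le> 1 + 9 * \<eta>"
    using \<eta> mult_left_mono[of \<eta> 1 \<eta>] by (simp add: power2_eq_square algebra_simps)
  ultimately show False using \<eta> by linarith
qed

text \<open>The penalties \<open>adj (N - z) * (N - z)\<close> are added one operator at a time.
  Each enlarged sum has to commute with the next operator, whence the commutation relations with
  adjoints among the hypotheses.\<close>

lemma joint_approximate_eigenvalue:
  fixes N1 N2 N3 Y :: "'a::chilbert_space bop"
  assumes Y: "bpos Y" and N: "nrm N1" "nrm N2" "nrm N3"
    and YN: "Y * N1 = N1 * Y" "Y * N2 = N2 * Y" "Y * N3 = N3 * Y"
    and c: "N1 * N2 = N2 * N1" "N1 * N3 = N3 * N1" "N2 * N3 = N3 * N2"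
      "adj N1 * N2 = N2 * adj N1" "adj N1 * N3 = N3 * adj N1" "adj N2 * N3 = N3 * adj N2"
    and null: "approx_null Y"
  obtains z1 z2 z3 where "\<And>\<epsilon>. 0 < \<epsilon> \<Longrightarrow> \<exists>x. norm x = 1 \<and> inner (Y *\<^sub>V x) x < \<epsilon>
    \<and> norm (N1 *\<^sub>V x - z1 *\<^sub>C x) < \<epsilon> \<and> norm (N2 *\<^sub>V x - z2 *\<^sub>C x) < \<epsilon> \<and> norm (N3 *\<^sub>V x - z3 *\<^sub>C x) < \<epsilon>"
proof -
  have sq: "adj (A - bscal z) * (A - bscal z) * M = M * (adj (A - bscal z) * (A - bscal z))"
    if "A * M = M * A" "adj A * M = M * adj A" for A M :: "'a bop" and z
  proof -
    have "(A - bscal z) * M = M * (A - bscal z)" "adj (A - bscal z) * M = M * adj (A - bscal z)"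
      using that by (simp_all add: left_diff_distrib right_diff_distrib bscal_commute)
    then show ?thesis by (metis mult.assoc)
  qed
  obtain z1 where z1: "approx_null (Y + adj (N1 - bscal z1) * (N1 - bscal z1))" (is "approx_null ?Y1")
    using approx_null_extend_normal[OF Y N(1) YN(1) null] .
  have Y1: "bpos ?Y1" by (intro bpos_add Y bpos_adj_mult)
  have Y1N: "?Y1 * N2 = N2 * ?Y1" "?Y1 * N3 = N3 * ?Y1"
    by (simp_all only: distrib_left distrib_right YN sq[OF c(1,4)] sq[OF c(2,5)])
  obtain z2 where z2: "approx_null (?Y1 + adj (N2 - bscal z2) * (N2 - bscal z2))" (is "approx_null ?Y2")
    using approx_null_extend_normal[OF Y1 N(2) Y1N(1) z1] .
  have Y2: "bpos ?Y2" by (intro bpos_add[OF Y1] bpos_adj_mult)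
  have Y2N: "?Y2 * N3 = N3 * ?Y2"
    by (simp only: distrib_left[of N3 ?Y1] distrib_right[of ?Y1 _ N3] Y1N sq[OF c(3,6)])
  obtain z3 where z3: "approx_null (?Y2 + adj (N3 - bscal z3) * (N3 - bscal z3))"
    using approx_null_extend_normal[OF Y2 N(3) Y2N z2] .
  show ?thesis
  proof (rule that)
    fix \<epsilon> :: real assume \<epsilon>: "0 < \<epsilon>"
    \<comment> \<open>\<open>\<epsilon>\<close> serves the form of \<open>Y\<close>, and
      \<open>\<epsilon> ^ 2\<close> the squared residuals.\<close>
    then have "0 < min \<epsilon> (\<epsilon>\<^sup>2)" by simp
    then obtain x where x: "norm x = 1"
      "inner ((?Y2 + adj (N3 - bscal z3) * (N3 - bscal z3)) *\<^sub>V x) x < min \<epsilon> (\<epsilon>\<^sup>2)"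
      using z3 unfolding approx_null_def by blast
    have s: "inner (Y *\<^sub>V x) x + (norm ((N1 - bscal z1) *\<^sub>V x))\<^sup>2 + (norm ((N2 - bscal z2) *\<^sub>V x))\<^sup>2
        + (norm ((N3 - bscal z3) *\<^sub>V x))\<^sup>2 < min \<epsilon> (\<epsilon>\<^sup>2)"
      using x(2) by (simp only: bop_simps(3,6) inner_add_left inner_adj' power2_norm_eq_inner)
    note nn = zero_le_power2[of "norm ((N1 - bscal z1) *\<^sub>V x)"] zero_le_power2[of "norm ((N2 - bscal z2) *\<^sub>V x)"]
      zero_le_power2[of "norm ((N3 - bscal z3) *\<^sub>V x)"] bpos_inner[OF Y, of x]
    have "(norm ((N1 - bscal z1) *\<^sub>V x))\<^sup>2 < \<epsilon>\<^sup>2" "(norm ((N2 - bscal z2) *\<^sub>V x))\<^sup>2 < \<epsilon>\<^sup>2"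
      "(norm ((N3 - bscal z3) *\<^sub>V x))\<^sup>2 < \<epsilon>\<^sup>2" "inner (Y *\<^sub>V x) x < \<epsilon>"
      using s nn by linarith+
    then show "\<exists>x. norm x = 1 \<and> inner (Y *\<^sub>V x) x < \<epsilon>
      \<and> norm (N1 *\<^sub>V x - z1 *\<^sub>C x) < \<epsilon> \<and> norm (N2 *\<^sub>V x - z2 *\<^sub>C x) < \<epsilon> \<and> norm (N3 *\<^sub>V x - z3 *\<^sub>C x) < \<epsilon>"
      using x(1) \<epsilon> power_less_imp_less_base[of _ 2 \<epsilon>] by (intro exI[of _ x]) simp
  qed
qed

section \<open>Uniform boundedness\<close>

text \<open>Gliding hump: \<open>hump u n\<close> accumulates \<open>\<plusminus>3\<^sup>-\<^sup>n u\<^sub>n\<close> with the sign that does not decrease the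
  modulus of the inner product with \<open>u\<^sub>n\<close>.\<close>

primrec hump :: "(nat \<Rightarrow> 'a::real_inner) \<Rightarrow> nat \<Rightarrow> 'a" where
  "hump u 0 = 0"
| "hump u (Suc n) = hump u n + ((if 0 \<le> inner (hump u n) (u n) then 1 else -1) * (1/3) ^ n) *\<^sub>R u n"

text \<open>If the norms were unbounded, a subsequence would grow faster than \<open>4 ^ k\<close>,
  which beats the weights \<open>3 ^ -k\<close> in the sum of the humps.\<close>

lemma weakly_bounded_imp_bounded:
  fixes v :: "nat \<Rightarrow> 'a::{real_inner,complete_space}"
  assumes wb: "\<And>w. \<exists>C. \<forall>n. \<bar>inner w (v n)\<bar> \<le> C"
  shows "\<exists>C. \<forall>n. norm (v n) \<le> C"
proof (rule ccontr)
  assume "\<nexists>C. \<forall>n. norm (v n) \<le> C"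
  then have "\<forall>k. \<exists>n. norm (v n) > 4 ^ k" by (meson not_le)
  from choice[OF this] obtain f where f: "\<And>k. norm (v (f k)) > 4 ^ k" by blast
  define u where "u k = (1 / norm (v (f k))) *\<^sub>R v (f k)" for k
  have pos: "norm (v (f k)) > 0" for k
    using f[of k] by (meson less_trans zero_less_numeral zero_less_power)
  have u: "norm (u k) = 1" "v (f k) = norm (v (f k)) *\<^sub>R u k" for k
    using pos[of k] by (simp_all add: u_def)
  have uu: "inner (u k) (u k) = 1" for k using u(1)[of k] by (simp add: power2_norm_eq_inner[symmetric])
  let ?h = "hump u"
  have step: "norm (?h (k + n) - ?h k) \<le> (3/2) * (1/3) ^ k * (1 - (1/3) ^ n)" for k n
  proof (induction n)
    case (Suc n)
    have "norm (?h (k + Suc n) - ?h k) \<le> norm (?h (k + Suc n) - ?h (k + n)) + norm (?h (k + n) - ?h k)"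
      using norm_triangle_ineq[of "?h (k + Suc n) - ?h (k + n)" "?h (k + n) - ?h k"]
      by (simp del: hump.simps add_Suc_right)
    also have "norm (?h (k + Suc n) - ?h (k + n)) = (1/3) ^ k * (1/3) ^ n"
      by (simp add: u(1) power_add)
    finally show ?case using Suc by (simp add: field_simps)
  qed simp
  have step': "norm (?h n - ?h k) \<le> (3/2) * (1/3) ^ k" if "k \<le> n" for k n
  proof -
    have "(3/2) * (1/3) ^ k * (1 - (1/3) ^ (n - k)) \<le> (3/2) * (1/3::real) ^ k * 1"
      by (intro mult_left_mono) auto
    with step[of k "n - k"] show ?thesis
      unfolding le_add_diff_inverse[OF that] mult_1_right by (rule order_trans)
  qed
  have "Cauchy ?h"
    unfolding Cauchy_altdef2
  proof (intro allI impI)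
    fix e :: real assume "0 < e"
    have "(\<lambda>k. (3/2) * (1/3::real) ^ k) \<longlonglongrightarrow> (3/2) * 0"
      by (intro tendsto_intros LIMSEQ_power_zero) simp
    from order_tendstoD(2)[OF this, of e] obtain N where "(3/2) * (1/3::real) ^ N < e"
      using \<open>0 < e\<close> by (auto simp: eventually_sequentially)
    then have "\<forall>n\<ge>N. dist (?h n) (?h N) < e"
      using step'[of N] by (fastforce simp: dist_norm)
    then show "\<exists>N. \<forall>n\<ge>N. dist (?h n) (?h N) < e" by blast
  qed
  then obtain w where w: "?h \<longlonglongrightarrow> w" by (meson Cauchy_convergent convergent_def)
  have near: "norm (w - ?h k) \<le> (3/2) * (1/3) ^ k" for k
    by (rule tendsto_upperbound[OF tendsto_norm[OF tendsto_diff[OF w tendsto_const]]])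
      (use step'[of k] in \<open>auto simp: eventually_sequentially\<close>)
  obtain C where C: "\<And>n. \<bar>inner w (v n)\<bar> \<le> C" using wb by blast
  have "(4/3) ^ k \<le> 2 * C" for k
  proof -
    have "(1/3) ^ k \<le> \<bar>inner (?h (Suc k)) (u k)\<bar>"
    proof -
      have "0 < (1/3::real) ^ k" by simp
      then show ?thesis by (auto simp: inner_add_left uu abs_if)
    qed
    also have "\<dots> \<le> \<bar>inner w (u k)\<bar> + \<bar>inner (w - ?h (Suc k)) (u k)\<bar>"
      by (simp add: inner_diff_left del: hump.simps)
    \<comment> \<open>All humps after the \<open>k\<close>-th together weigh at most half of the
      \<open>k\<close>-th, so half of it survives in the limit \<open>w\<close>.\<close>
    also have "\<bar>inner (w - ?h (Suc k)) (u k)\<bar> \<le> (1/2) * (1/3) ^ k"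
      using Cauchy_Schwarz_ineq2[of "w - ?h (Suc k)" "u k"] near[of "Suc k"] u(1)[of k]
      by (simp del: hump.simps)
    finally have "(1/2) * (1/3) ^ k \<le> \<bar>inner w (u k)\<bar>" by simp
    then have "4 ^ k * ((1/2) * (1/3) ^ k) \<le> norm (v (f k)) * \<bar>inner w (u k)\<bar>"
      using f[of k] by (intro mult_mono) auto
    also have "\<dots> = \<bar>inner w (v (f k))\<bar>" by (subst (2) u(2)) (simp add: abs_mult)
    finally have "4 ^ k * ((1/2) * (1/3) ^ k) \<le> C" using C[of "f k"] by linarith
    moreover have "(4/3::real) ^ k = 4 ^ k * (1/3) ^ k" by (simp flip: power_mult_distrib)
    ultimately show ?thesis by simp
  qed
  moreover obtain k where "2 * C < (4/3) ^ k" using real_arch_pow[of "4/3"] by auto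
  ultimately show False by (meson not_le)
qed

section \<open>Fuglede's theorem\<close>

text \<open>The exponential series, set up without the class of unital normed algebras because of
  the zero space.\<close>

definition bexp :: "'a::chilbert_space bop \<Rightarrow> 'a bop" where
  "bexp a = suminf (\<lambda>n. a ^ n /\<^sub>R fact n)"

lemma summable_norm_bexp: "summable (\<lambda>n. norm (a ^ n /\<^sub>R fact n))" for a :: "'a::chilbert_space bop"
proof (rule summable_comparison_test')
  show "summable (\<lambda>n. inverse (fact n) * norm a ^ n)" by (rule summable_exp)
  show "norm (norm (a ^ n /\<^sub>R fact n)) \<le> inverse (fact n) * norm a ^ n" for n
    by (simp add: norm_power_bop_le mult_left_mono)
qed

lemma bexp_sums: "(\<lambda>n. a ^ n /\<^sub>R fact n) sums bexp a" for a :: "'a::chilbert_space bop"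
  unfolding bexp_def by (intro summable_sums summable_norm_cancel[OF summable_norm_bexp])

lemma bexp_zero: "bexp 0 = (1 :: 'a::chilbert_space bop)"
proof -
  have "(\<lambda>n. (0::'a bop) ^ n /\<^sub>R fact n) sums ((0::'a bop) ^ 0 /\<^sub>R fact 0)"
  proof -
    have "(0::'a bop) ^ n = 0" if "n \<noteq> 0" for n using that by (cases n) simp_all
    then show ?thesis
      using sums_finite[of "{0::nat}" "\<lambda>n. (0::'a bop) ^ n /\<^sub>R fact n"] by simp
  qed
  with bexp_sums[of "0::'a bop"] show ?thesis by (simp add: sums_iff)
qed

lemma bexp_commute:
  assumes "x * a = a * x"
  shows "x * bexp a = bexp a * x"
proof -
  have p: "x * a ^ n = a ^ n * x" for n
    by (induction n) (use assms in \<open>simp_all, metis mult.assoc\<close>)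
  have "(\<lambda>n. x * (a ^ n /\<^sub>R fact n)) sums (x * bexp a)"
    by (rule bounded_linear.sums[OF bounded_linear_mult_right bexp_sums])
  moreover have "(\<lambda>n. a ^ n /\<^sub>R fact n * x) sums (bexp a * x)"
    by (rule bounded_linear.sums[OF bounded_linear_mult_left bexp_sums])
  ultimately show ?thesis by (simp add: p sums_unique2)
qed

lemma bounded_linear_adj: "bounded_linear adj"
  by (rule bounded_linear_intro[where K = 1]) simp_all

lemma adj_bexp: "adj (bexp a) = bexp (adj a)"
proof -
  have "(\<lambda>n. adj (a ^ n /\<^sub>R fact n)) sums adj (bexp a)"
    by (rule bounded_linear.sums[OF bounded_linear_adj bexp_sums])
  with bexp_sums[of "adj a"] show ?thesis by (simp add: adj_power sums_unique2)
qed

text \<open>The binomial theorem for commuting operators in normalised form. Multiplying the term of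
  degree \<open>n + 1\<close> by \<open>n + 1 = i + (n + 1 - i)\<close> splits it into
  \<open>a\<close> times and \<open>b\<close> times the term of degree \<open>n\<close>.\<close>

lemma exp_term_add:
  fixes a b :: "'a::chilbert_space bop"
  assumes ab: "a * b = b * a"
  shows "(a + b) ^ n /\<^sub>R fact n = (\<Sum>i\<le>n. a ^ i /\<^sub>R fact i * (b ^ (n - i) /\<^sub>R fact (n - i)))"
proof (induction n)
  case (Suc n)
  define S where "S x i = (x ^ i /\<^sub>R fact i :: 'a bop)" for x i
  define T where "T n = (\<Sum>i\<le>n. S a i * S b (n - i))" for n
  have S: "real (Suc i) *\<^sub>R S x (Suc i) = x * S x i" for x i
  proof -
    have "real (Suc i) * inverse (fact (Suc i)) = inverse (fact i)"
      by (simp add: field_simps del: of_nat_Suc)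
    then show ?thesis by (simp add: S_def del: of_nat_Suc fact_Suc)
  qed
  have com: "b * S a i = S a i * b" for i
  proof -
    have "b * a ^ i = a ^ i * b" by (induction i) (use ab in \<open>simp_all, metis mult.assoc\<close>)
    then show ?thesis by (simp add: S_def)
  qed
  have 1: "(\<Sum>i\<le>Suc n. real i *\<^sub>R (S a i * S b (Suc n - i))) = a * T n"
  proof -
    have "(\<Sum>i\<le>Suc n. real i *\<^sub>R (S a i * S b (Suc n - i)))
        = (\<Sum>i\<le>n. (real (Suc i) *\<^sub>R S a (Suc i)) * S b (n - i))"
      by (subst sum.atMost_Suc_shift) (simp del: of_nat_Suc)
    also have "\<dots> = a * T n" by (simp only: S T_def sum_distrib_left mult.assoc)
    finally show ?thesis .
  qed
  have 2: "(\<Sum>i\<le>Suc n. real (Suc n - i) *\<^sub>R (S a i * S b (Suc n - i))) = b * T n"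
  proof -
    have "(\<Sum>i\<le>Suc n. real (Suc n - i) *\<^sub>R (S a i * S b (Suc n - i)))
        = (\<Sum>i\<le>n. S a i * (real (Suc (n - i)) *\<^sub>R S b (Suc (n - i))))"
      unfolding sum.atMost_Suc
      by (simp add: Suc_diff_le del: of_nat_Suc of_nat_diff) (simp only: Suc_diff_le[symmetric])?
    also have "\<dots> = (\<Sum>i\<le>n. b * (S a i * S b (n - i)))"
      by (intro sum.cong refl) (simp only: S com[symmetric] mult.assoc[symmetric])
    finally show ?thesis by (simp only: T_def sum_distrib_left)
  qed
  have "real (Suc n) *\<^sub>R T (Suc n)
      = (\<Sum>i\<le>Suc n. (real i + real (Suc n - i)) *\<^sub>R (S a i * S b (Suc n - i)))"
    unfolding T_def scaleR_sum_right by (intro sum.cong refl) (simp add: of_nat_diff)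
  also have "\<dots> = a * T n + b * T n"
    by (simp only: scaleR_add_left sum.distrib 1 2)
  also have "\<dots> = (a + b) * S (a + b) n"
    using Suc by (simp add: T_def S_def algebra_simps)
  also have "\<dots> = real (Suc n) *\<^sub>R S (a + b) (Suc n)" by (simp only: S)
  finally have "T (Suc n) = S (a + b) (Suc n)" by (simp del: of_nat_Suc)
  then show ?case by (simp add: T_def S_def)
qed simp

lemma bexp_add:
  assumes "a * b = b * a"
  shows "bexp (a + b) = bexp a * bexp b"
  using Cauchy_product_sums[OF summable_norm_bexp[of a] summable_norm_bexp[of b]]
    bexp_sums[of "a + b"]
  unfolding exp_term_add[OF assms, symmetric] bexp_def[symmetric] by (rule sums_unique2[rotated])

lemma norm_bexp_skew_le:
  assumes "adj k = - k"
  shows "norm (bexp k) \<le> 1"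
proof (rule norm_bop_le)
  fix x
  have "adj (bexp k) * bexp k = 1"
    using bexp_add[of "- k" k] by (simp add: adj_bexp assms bexp_zero)
  then have "adj (bexp k) *\<^sub>V bexp k *\<^sub>V x = x" by (metis bop_simps(2,6))
  then have "(norm (bexp k *\<^sub>V x))\<^sup>2 = (norm x)\<^sup>2"
    by (simp add: power2_norm_eq_inner inner_adj)
  then show "norm (bexp k *\<^sub>V x) \<le> 1 * norm x" by simp
qed simp

text \<open>Rosenblum's argument: \<open>exp(\<lambda>N\<^sup>*) X exp(-\<lambda>N\<^sup>*) = exp(\<lambda>N\<^sup>* - \<lambda>\<^sup>*N) X exp(\<lambda>\<^sup>*N - \<lambda>N\<^sup>*)\<close> is
  a bounded entire function of \<open>\<lambda>\<close>, hence constant, and its derivative at \<open>0\<close> is \<open>N\<^sup>*X - XN\<^sup>*\<close>.\<close>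

theorem fuglede:
  fixes N X :: "'a::chilbert_space bop"
  assumes N: "nrm N" and XN: "X * N = N * X"
  shows "X * adj N = adj N * X"
proof -
  define M where "M l = bscal l * adj N" for l
  define G where "G l = bexp (M l) * (X * bexp (- M l))" for l
  have M_adj: "adj (M l) = bscal (cnj l) * N" for l
    by (simp add: M_def bscal_commute)
  have MM: "M l * adj (M l) = adj (M l) * M l" for l
  proof -
    have "M l * adj (M l) = bscal l * bscal (cnj l) * (adj N * N)"
      unfolding M_adj unfolding M_def by (metis bscal_commute mult.assoc)
    also have "\<dots> = bscal (cnj l) * bscal l * (N * adj N)"
      using N by (simp add: nrm_def bscal_simps[symmetric] mult.commute)
    also have "\<dots> = adj (M l) * M l"
      unfolding M_adj unfolding M_def by (metis bscal_commute mult.assoc)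
    finally show ?thesis .
  qed
  have bound: "norm (G l) \<le> norm X" for l
  proof -
    \<comment> \<open>\<open>M l = K + A\<close>, with \<open>K\<close> skew-adjoint and
      \<open>A\<close> a multiple of \<open>N\<close>. Since \<open>A\<close> commutes with
      \<open>X\<close>, the factors \<open>bexp A\<close> and \<open>bexp (- A)\<close> on either
      side of \<open>X\<close> cancel, and the contractions \<open>bexp K\<close> and
      \<open>bexp (- K)\<close> remain.\<close>
    define A where "A = adj (M l)"
    define K where "K = M l - A"
    have KA: "K * A = A * K" using MM[of l] by (simp add: K_def A_def algebra_simps)
    have skew: "adj K = - K" "adj (- K) = - (- K)" by (simp_all add: K_def A_def)
    have XA: "X * A = A * X"
      unfolding A_def M_adj using XN by (metis bscal_commute mult.assoc)
    have e1: "bexp (M l) = bexp K * bexp A"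
      using bexp_add[OF KA] by (simp add: K_def)
    have e2: "bexp (- M l) = bexp (- A) * bexp (- K)"
    proof -
      have "- M l = - A + - K" by (simp add: K_def)
      moreover have "(- A) * (- K) = (- K) * (- A)" using KA by simp
      ultimately show ?thesis using bexp_add by metis
    qed
    have e3: "bexp A * bexp (- A) = 1"
      using bexp_add[of A "- A"] by (simp add: bexp_zero)
    have "G l = bexp K * (bexp A * X) * (bexp (- A) * bexp (- K))"
      by (simp add: G_def e1 e2 mult.assoc)
    also have "bexp A * X = X * bexp A" using bexp_commute[OF XA] by simp
    also have "bexp K * (X * bexp A) * (bexp (- A) * bexp (- K))
        = bexp K * X * (bexp A * bexp (- A)) * bexp (- K)"
      by (simp add: mult.assoc)
    finally have G: "G l = bexp K * X * bexp (- K)" by (simp add: e3)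
    have "norm (G l) \<le> norm (bexp K) * norm X * norm (bexp (- K))"
      unfolding G
      by (rule order_trans[OF norm_mult_ineq mult_right_mono[OF norm_mult_ineq norm_ge_zero]])
    also have "\<dots> \<le> 1 * norm X * 1"
      by (intro mult_mono norm_bexp_skew_le skew) simp_all
    finally show ?thesis by simp
  qed
  \<comment> \<open>The coefficient of \<open>l ^ k\<close> in the Cauchy product for
    \<open>G l\<close>; in particular \<open>c 1 = adj N * X - X * adj N\<close>.\<close>
  define c where "c k = (\<Sum>i\<le>k. (adj N ^ i /\<^sub>R fact i) * (X * ((- adj N) ^ (k - i) /\<^sub>R fact (k - i))))" for k
  have powM: "M l ^ i = bscal (l ^ i) * adj N ^ i" "(- M l) ^ i = bscal (l ^ i) * (- adj N) ^ i" for l i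
  proof -
    have "(bscal l * Z) ^ i = bscal (l ^ i) * Z ^ i" for Z :: "'a bop"
    proof (induction i)
      case (Suc i)
      have "(bscal l * Z) ^ Suc i = bscal l * (Z * bscal (l ^ i)) * Z ^ i"
        by (simp add: Suc mult.assoc)
      also have "\<dots> = bscal l * bscal (l ^ i) * (Z * Z ^ i)"
        by (simp only: bscal_commute[symmetric, of Z "l ^ i"] mult.assoc)
      finally show ?case by (simp add: bscal_simps)
    qed (simp add: bscal_simps)
    from this[of "adj N"] this[of "- adj N"]
    show "M l ^ i = bscal (l ^ i) * adj N ^ i" "(- M l) ^ i = bscal (l ^ i) * (- adj N) ^ i"
      by (simp_all add: M_def)
  qed
  have series: "(\<lambda>k. bscal (l ^ k) * c k) sums G l" for l
  proof -
    have s: "summable (\<lambda>n. norm (X * ((- M l) ^ n /\<^sub>R fact n)))"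
    proof (rule summable_comparison_test')
      show "summable (\<lambda>n. norm X * norm ((- M l) ^ n /\<^sub>R fact n))"
        by (intro summable_mult summable_norm_bexp)
      show "norm (norm (X * ((- M l) ^ n /\<^sub>R fact n))) \<le> norm X * norm ((- M l) ^ n /\<^sub>R fact n)" for n
        by (simp only: real_norm_def abs_norm_cancel norm_mult_ineq)
    qed
    have "suminf (\<lambda>n. X * ((- M l) ^ n /\<^sub>R fact n)) = X * bexp (- M l)"
      using bounded_linear.sums[OF bounded_linear_mult_right bexp_sums[of "- M l"], of X]
      by (simp add: sums_iff)
    with Cauchy_product_sums[OF summable_norm_bexp[of "M l"] s]
    have "(\<lambda>k. \<Sum>i\<le>k. (M l ^ i /\<^sub>R fact i) * (X * ((- M l) ^ (k - i) /\<^sub>R fact (k - i)))) sums G l"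
      by (simp add: G_def bexp_def)
    moreover have "(\<Sum>i\<le>k. (M l ^ i /\<^sub>R fact i) * (X * ((- M l) ^ (k - i) /\<^sub>R fact (k - i)))) = bscal (l ^ k) * c k" for k
      unfolding c_def sum_distrib_left
    proof (intro sum.cong refl)
      fix i assume "i \<in> {..k}"
      then have k: "l ^ i * l ^ (k - i) = l ^ k" by (simp flip: power_add)
      have "M l ^ i * (X * (- M l) ^ (k - i)) = bscal (l ^ i) * bscal (l ^ (k - i)) * (adj N ^ i * (X * (- adj N) ^ (k - i)))"
      proof -
        have s: "Z * (bscal c * W) = bscal c * (Z * W)" for Z W :: "'a bop" and c
          by (metis bscal_commute mult.assoc)
        show ?thesis
          unfolding powM s[of X "l ^ (k - i)"] s[of "adj N ^ i" "l ^ (k - i)"] mult.assoc by (rule refl)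
      qed
      also have "\<dots> = bscal (l ^ k) * (adj N ^ i * (X * (- adj N) ^ (k - i)))"
        by (simp only: bscal_simps(1)[symmetric] k)
      finally show "(M l ^ i /\<^sub>R fact i) * (X * ((- M l) ^ (k - i) /\<^sub>R fact (k - i)))
          = bscal (l ^ k) * ((adj N ^ i /\<^sub>R fact i) * (X * ((- adj N) ^ (k - i) /\<^sub>R fact (k - i))))"
        by simp
    qed
    ultimately show ?thesis by simp
  qed
  have "cinner (c 1 *\<^sub>V x) y = 0" for x y
  proof -
    define a where "a k = cinner (c k *\<^sub>V x) y" for k
    define f where "f l = cinner (G l *\<^sub>V x) y" for l
    have bl: "bounded_linear (\<lambda>b. cinner (b *\<^sub>V x) y)"
      by (rule bounded_linear_compose[OF bounded_bilinear.bounded_linear_left[OF bounded_bilinear_cinner]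
            bounded_linear_bapp_left])
    have fs: "(\<lambda>k. a k * l ^ k) sums f l" for l
      using bounded_linear.sums[OF bl series[of l]]
      by (simp add: a_def f_def cinner_scaleC_left mult.commute)
    then have f: "f = (\<lambda>l. suminf (\<lambda>k. a k * l ^ k))" by (simp add: fun_eq_iff sums_iff)
    have der: "(f has_field_derivative suminf (\<lambda>k. diffs a k * l ^ k)) (at l)" for l
      unfolding f by (rule termdiffs_strong_converges_everywhere) (rule sums_summable[OF fs])
    then have "f holomorphic_on UNIV"
      by (auto simp: holomorphic_on_def field_differentiable_def)
    moreover have "bounded (range f)"
      unfolding bounded_iff
    proof (intro exI ballI)
      fix z assume "z \<in> range f"
      then obtain l where z: "z = f l" by blast
      have "cmod z \<le> norm (G l *\<^sub>V x) * norm y" unfolding z f_def by (rule norm_cinner_le)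
      also have "\<dots> \<le> norm (G l) * norm x * norm y" by (intro mult_right_mono norm_bapp) simp
      also have "\<dots> \<le> norm X * norm x * norm y" by (intro mult_right_mono bound) simp_all
      finally show "cmod z \<le> norm X * norm x * norm y" .
    qed
    ultimately have "f constant_on UNIV" by (rule Liouville_theorem)
    then obtain d where "f = (\<lambda>_. d)" by (auto simp: constant_on_def fun_eq_iff)
    \<comment> \<open>The derivative of the constant function \<open>f\<close> at 0; the power
      series at 0 reduces it to \<open>diffs a 0\<close>, which is \<open>a 1\<close>.\<close>
    then have "suminf (\<lambda>k. diffs a k * 0 ^ k) = 0"
      using der[of 0] DERIV_unique[OF _ DERIV_const] by metis
    then have "diffs a 0 = 0" by (simp only: powser_zero)
    then show ?thesis by (simp add: diffs_def a_def)
  qed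
  then have "c 1 *\<^sub>V x = 0" for x by (metis cinner_left_eqI cinner_zero_left)
  then have "c 1 = 0" by (intro bop_eqI) simp
  then show ?thesis by (simp add: c_def)
qed

section \<open>Operators on closed subspaces\<close>

text \<open>Composing with the projection extends \<open>T\<close> by zero on the orthogonal
  complement of \<open>S\<close>. Products and adjoints on \<open>S\<close> become products and
  adjoints of bounded operators, with \<open>bproj S\<close> as the unit.\<close>

definition ext :: "'a::chilbert_space set \<Rightarrow> ('a \<Rightarrow> 'a) \<Rightarrow> 'a bop" where
  "ext S T = Bop (\<lambda>x. T (orth_proj S x))"

lemma operator_onD:
  assumes "operator_on S T"
  shows "closed_csubspace S" "x \<in> S \<Longrightarrow> T x \<in> S" "x \<in> S \<Longrightarrow> y \<in> S \<Longrightarrow> T (x + y) = T x + T y"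
    "x \<in> S \<Longrightarrow> T (c *\<^sub>C x) = c *\<^sub>C T x" "clinear_on S T"
  using assms by (auto simp: operator_on_def clinear_on_def)

lemma operator_on_cong:
  assumes T: "operator_on S T" and eq: "\<And>x. x \<in> S \<Longrightarrow> R x = T x"
  shows "operator_on S R"
proof -
  note S = operator_onD(1)[OF T]
  obtain C where "\<And>x. x \<in> S \<Longrightarrow> norm (T x) \<le> C * norm x"
    using T by (auto simp: operator_on_def)
  then have "\<forall>x\<in>S. norm (R x) \<le> C * norm x" by (simp add: eq)
  moreover have "clinear_on S R"
    unfolding clinear_on_def
    by (simp add: eq closed_csubspaceD(2,3)[OF S] operator_onD(3,4)[OF T])
  moreover have "R ` S \<subseteq> S" using operator_onD(2)[OF T] eq by auto
  ultimately show ?thesis using S unfolding operator_on_def by blast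
qed

lemma bapp_ext_proj:
  assumes "operator_on S T"
  shows "ext S T *\<^sub>V x = T (orth_proj S x)"
proof -
  obtain C where C: "\<And>x. x \<in> S \<Longrightarrow> norm (T x) \<le> C * norm x"
    using assms by (auto simp: operator_on_def)
  note S = operator_onD(1)[OF assms]
  have "bapp (Bop (\<lambda>x. T (orth_proj S x))) = (\<lambda>x. T (orth_proj S x))"
  proof (rule bapp_Bop)
    show "norm (T (orth_proj S x)) \<le> norm x * \<bar>C\<bar>" for x
    proof -
      have "norm (T (orth_proj S x)) \<le> C * norm (orth_proj S x)" by (rule C[OF orth_proj_in[OF S]])
      also have "\<dots> \<le> \<bar>C\<bar> * norm x"
        by (intro mult_mono norm_orth_proj_le[OF S]) auto
      finally show ?thesis by (simp add: mult.commute)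
    qed
  qed (simp_all add: orth_proj_add[OF S] orth_proj_scaleC[OF S] operator_onD[OF assms] orth_proj_in[OF S])
  then show ?thesis by (simp add: ext_def)
qed

lemma bapp_ext: "operator_on S T \<Longrightarrow> x \<in> S \<Longrightarrow> ext S T *\<^sub>V x = T x"
  by (simp add: bapp_ext_proj orth_proj_id operator_onD(1))

lemma ext_in: "operator_on S T \<Longrightarrow> ext S T *\<^sub>V x \<in> S"
  by (simp add: bapp_ext_proj orth_proj_in operator_onD)

lemma operator_on_id: "closed_csubspace S \<Longrightarrow> operator_on S (\<lambda>x. x)"
  by (auto simp: operator_on_def clinear_on_def intro: exI[of _ 1])

lemma operator_on_UNIV_bapp [simp]: "operator_on UNIV (bapp a)"
  unfolding operator_on_def clinear_on_def
  by (auto simp: bapp_add bapp_scaleC intro!: exI[of _ "norm a"] norm_bapp)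

lemma operator_on_bapp: "closed_csubspace S \<Longrightarrow> (\<And>x. x \<in> S \<Longrightarrow> a *\<^sub>V x \<in> S) \<Longrightarrow> operator_on S (bapp a)"
  unfolding operator_on_def clinear_on_def
  by (auto simp: bapp_add bapp_scaleC intro!: exI[of _ "norm a"] norm_bapp)

definition bproj :: "'a::chilbert_space set \<Rightarrow> 'a bop" where
  "bproj S = ext S (\<lambda>x. x)"

context
  fixes S :: "'a::chilbert_space set"
  assumes S: "closed_csubspace S"
begin

lemma bapp_bproj: "bproj S *\<^sub>V x = orth_proj S x"
  by (simp add: bproj_def bapp_ext_proj[OF operator_on_id[OF S]])

lemma bproj_in: "bproj S *\<^sub>V x \<in> S"
  by (simp add: bapp_bproj orth_proj_in[OF S])

lemma bproj_id: "x \<in> S \<Longrightarrow> bproj S *\<^sub>V x = x"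
  by (simp add: bapp_bproj orth_proj_id[OF S])

lemma adj_bproj: "adj (bproj S) = bproj S"
proof (rule adj_eqI)
  fix x y
  have "cinner (bproj S *\<^sub>V x) y = cinner (orth_proj S x) (orth_proj S y)"
    using cinner_orth_proj_right[OF S orth_proj_in[OF S]] by (simp add: bapp_bproj)
  also have "\<dots> = cinner x (bproj S *\<^sub>V y)"
    using cinner_orth_proj_left[OF S orth_proj_in[OF S]] by (simp add: bapp_bproj)
  finally show "inner (bproj S *\<^sub>V x) y = inner x (bproj S *\<^sub>V y)"
    by (simp add: inner_eq_Re_cinner)
qed

lemma bproj_mult_self: "bproj S * bproj S = bproj S"
  by (rule bop_eqI) (simp add: bproj_id bproj_in)

end

context
  fixes S :: "'a::chilbert_space set" and T :: "'a \<Rightarrow> 'a"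
  assumes T: "operator_on S T"
begin

lemma ext_mult_bproj: "ext S T * bproj S = ext S T"
proof (rule bop_eqI)
  note S = operator_onD(1)[OF T]
  show "(ext S T * bproj S) *\<^sub>V x = ext S T *\<^sub>V x" for x
    by (simp add: bapp_bproj[OF S] bapp_ext_proj[OF T] orth_proj_id[OF S] orth_proj_in[OF S])
qed

lemma bproj_mult_ext: "bproj S * ext S T = ext S T"
  by (rule bop_eqI) (simp add: bproj_id[OF operator_onD(1)[OF T]] ext_in[OF T])

lemma adj_ext_mult_bproj: "adj (ext S T) * bproj S = adj (ext S T)"
  using arg_cong[OF bproj_mult_ext, of adj] by (simp add: adj_bproj operator_onD(1)[OF T])

lemma bproj_mult_adj_ext: "bproj S * adj (ext S T) = adj (ext S T)"
  using arg_cong[OF ext_mult_bproj, of adj] by (simp add: adj_bproj operator_onD(1)[OF T])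

lemma adj_ext_in: "adj (ext S T) *\<^sub>V x \<in> S"
  by (metis bproj_in[OF operator_onD(1)[OF T]] bproj_mult_adj_ext bop_simps(6))

lemma adjoint_on_eq:
  assumes "z \<in> S" "\<And>x. x \<in> S \<Longrightarrow> cinner (T x) y = cinner x z"
  shows "adjoint_on S T y = z"
  unfolding adjoint_on_def
proof (rule the_equality)
  show "z \<in> S \<and> (\<forall>x\<in>S. cinner (T x) y = cinner x z)" using assms by blast
  fix w assume w: "w \<in> S \<and> (\<forall>x\<in>S. cinner (T x) y = cinner x w)"
  have d: "w - z \<in> S" using w assms(1) closed_csubspaceD(6)[OF operator_onD(1)[OF T]] by blast
  have "cinner (w - z) (w - z) = 0"
    using w assms(2) d by (simp add: cinner_diff_right)
  then show "w = z" by (simp add: cinner_self)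
qed

lemma adjoint_on_ext:
  assumes "y \<in> S"
  shows "adjoint_on S T y = adj (ext S T) *\<^sub>V y"
  by (rule adjoint_on_eq) (simp_all add: adj_ext_in cinner_adj[symmetric] bapp_ext[OF T])

lemma cinner_adjoint_on:
  assumes "x \<in> S" "y \<in> S"
  shows "cinner (T x) y = cinner x (adjoint_on S T y)"
  by (simp add: adjoint_on_ext assms cinner_adj[symmetric] bapp_ext[OF T])

lemma adjoint_on_operator: "operator_on S (adjoint_on S T)"
proof -
  have "operator_on S (bapp (adj (ext S T)))"
    by (rule operator_on_bapp[OF operator_onD(1)[OF T]]) (rule adj_ext_in)
  then show ?thesis by (rule operator_on_cong) (rule adjoint_on_ext)
qed

lemma adj_ext: "adj (ext S T) = ext S (adjoint_on S T)"
proof (rule bop_eqI)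
  fix x
  note S = operator_onD(1)[OF T]
  have "adj (ext S T) *\<^sub>V x = adj (ext S T) *\<^sub>V bproj S *\<^sub>V x"
    by (metis adj_ext_mult_bproj bop_simps(6))
  then show "adj (ext S T) *\<^sub>V x = ext S (adjoint_on S T) *\<^sub>V x"
    by (simp add: bapp_ext_proj[OF adjoint_on_operator] bapp_bproj[OF S] adjoint_on_ext orth_proj_in[OF S])
qed

end

lemma ext_mult:
  assumes "operator_on S T" "operator_on S R"
  shows "ext S T * ext S R = ext S (\<lambda>x. T (R x))" "operator_on S (\<lambda>x. T (R x))"
proof -
  have "operator_on S (bapp (ext S T * ext S R))"
    by (rule operator_on_bapp[OF operator_onD(1)[OF assms(1)]]) (simp add: ext_in[OF assms(1)])
  then show o: "operator_on S (\<lambda>x. T (R x))"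
    by (rule operator_on_cong) (simp add: bapp_ext[OF assms(1)] bapp_ext[OF assms(2)] operator_onD(2)[OF assms(2)])
  show "ext S T * ext S R = ext S (\<lambda>x. T (R x))"
  proof (rule bop_eqI)
    fix x
    show "(ext S T * ext S R) *\<^sub>V x = ext S (\<lambda>x. T (R x)) *\<^sub>V x"
      using orth_proj_in[OF operator_onD(1)[OF assms(1)], of x]
      by (simp add: bapp_ext_proj[OF o] bapp_ext_proj[OF assms(2)] bapp_ext[OF assms(1)] operator_onD(2)[OF assms(2)])
  qed
qed

lemma ext_cong:
  assumes "operator_on S T" "operator_on S R" "\<And>x. x \<in> S \<Longrightarrow> T x = R x"
  shows "ext S T = ext S R"
  by (rule bop_eqI)
    (simp add: bapp_ext_proj[OF assms(1)] bapp_ext_proj[OF assms(2)] assms(3) orth_proj_in[OF operator_onD(1)[OF assms(1)]])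

lemma ext_commute:
  assumes "operator_on S T" "operator_on S R" "\<And>x. x \<in> S \<Longrightarrow> T (R x) = R (T x)"
  shows "ext S T * ext S R = ext S R * ext S T"
  by (simp add: ext_mult assms) (rule ext_cong; simp add: ext_mult assms)

lemma nrm_ext: "normal_on S T \<Longrightarrow> nrm (ext S T)"
proof -
  assume n: "normal_on S T"
  then have T: "operator_on S T" by (simp add: normal_on_def)
  have "ext S T * ext S (adjoint_on S T) = ext S (adjoint_on S T) * ext S T"
    using n by (intro ext_commute T adjoint_on_operator) (simp_all add: normal_on_def)
  then show ?thesis by (simp add: nrm_def adj_ext[OF T])
qed

section \<open>Exactness of Koszul complexes\<close>

lemma koszul_exact_cong:
  assumes S: "closed_csubspace S"
    and eq: "\<And>x. x \<in> S \<Longrightarrow> T1 x = R1 x" "\<And>x. x \<in> S \<Longrightarrow> T2 x = R2 x" "\<And>x. x \<in> S \<Longrightarrow> T3 x = R3 x"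
  shows "koszul_exact S T1 T2 T3 = koszul_exact S R1 R2 R3"
  unfolding koszul_exact_def by (simp add: eq cong: ball_cong bex_cong)

text \<open>The contracting homotopy is \<open>s\<^sub>i = m\<^sub>i\<^sup>* r\<close> with \<open>r\<close> the inverse of
  \<open>\<Sum>m\<^sub>i\<^sup>* m\<^sub>i\<close> on \<open>S\<close>.\<close>

lemma koszul_exact_if_bounded_below:
  fixes m1 m2 m3 :: "'a::chilbert_space bop"
  assumes S: "closed_csubspace S"
    and e: "\<And>m. m \<in> {m1, m2, m3} \<Longrightarrow> bproj S * m = m \<and> m * bproj S = m"
    and com: "\<And>m n. m \<in> {m1, m2, m3} \<Longrightarrow> n \<in> {m1, m2, m3} \<Longrightarrow> m * n = n * m \<and> adj m * n = n * adj m"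
    and \<delta>: "0 < \<delta>" "\<And>x. x \<in> S \<Longrightarrow> \<delta> * norm x \<le> norm (m1 *\<^sub>V x) + norm (m2 *\<^sub>V x) + norm (m3 *\<^sub>V x)"
  shows "koszul_exact S (bapp m1) (bapp m2) (bapp m3)"
proof -
  define p where "p = bproj S"
  \<comment> \<open>The summand \<open>1 - p\<close> makes \<open>q\<close> invertible on the whole
    space without changing it on \<open>S\<close>.\<close>
  define q where "q = adj m1 * m1 + adj m2 * m2 + adj m3 * m3 + (1 - p)"
  have pa: "adj p = p" and pp: "p * p = p"
    by (simp_all add: p_def adj_bproj[OF S] bproj_mult_self[OF S])
  have pm: "p * m = m" "m * p = m" "p * adj m = adj m" "adj m * p = adj m" if "m \<in> {m1, m2, m3}" for m
  proof -
    show 1: "p * m = m" "m * p = m" using e[OF that] by (simp_all add: p_def)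
    show "p * adj m = adj m" "adj m * p = adj m"
      using arg_cong[OF 1(1), of adj] arg_cong[OF 1(2), of adj] pa by simp_all
  qed
  have qa: "adj q = q" by (simp add: q_def pa)
  \<comment> \<open>\<open>\<delta> ^ 2 / 3\<close> stems from
    \<open>(a + b + c) ^ 2 \<le> 3 (a ^ 2 + b ^ 2 + c ^ 2)\<close> on \<open>S\<close>; on the
    complement \<open>q\<close> is the identity.\<close>
  define k where "k = min (\<delta>\<^sup>2 / 3) 1"
  have k: "0 < k" using \<delta>(1) by (simp add: k_def)
  have "k * norm x \<le> norm (q *\<^sub>V x)" for x
  proof -
    let ?a = "norm (m1 *\<^sub>V x)" and ?b = "norm (m2 *\<^sub>V x)" and ?c = "norm (m3 *\<^sub>V x)"
    have mp: "m *\<^sub>V p *\<^sub>V x = m *\<^sub>V x" if "m \<in> {m1, m2, m3}" for m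
      using pm(2)[OF that] by (metis bop_simps(6))
    have "\<delta> * norm (p *\<^sub>V x) \<le> ?a + ?b + ?c"
      using \<delta>(2)[of "p *\<^sub>V x"] by (simp add: mp) (simp add: p_def bproj_in[OF S])
    then have "(\<delta> * norm (p *\<^sub>V x))\<^sup>2 \<le> (?a + ?b + ?c)\<^sup>2" using \<delta>(1) by (intro power_mono) auto
    also have "\<dots> \<le> 3 * (?a\<^sup>2 + ?b\<^sup>2 + ?c\<^sup>2)"
      using sum_squares_bound[of ?a ?b] sum_squares_bound[of ?a ?c] sum_squares_bound[of ?b ?c]
      by (simp add: power2_eq_square algebra_simps)
    finally have le: "\<delta>\<^sup>2 / 3 * (norm (p *\<^sub>V x))\<^sup>2 \<le> ?a\<^sup>2 + ?b\<^sup>2 + ?c\<^sup>2"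
      by (simp add: power_mult_distrib)
    have px: "inner (p *\<^sub>V x) x = (norm (p *\<^sub>V x))\<^sup>2"
      using inner_adj[of p "p *\<^sub>V x" x] pa pp by (metis bop_simps(6) power2_norm_eq_inner)
    have "k * (norm x)\<^sup>2 = k * (norm (p *\<^sub>V x))\<^sup>2 + k * inner (x - p *\<^sub>V x) x"
      by (simp add: inner_diff_left px power2_norm_eq_inner algebra_simps)
    also have "\<dots> \<le> (?a\<^sup>2 + ?b\<^sup>2 + ?c\<^sup>2) + inner (x - p *\<^sub>V x) x"
    proof (rule add_mono)
      have "k * (norm (p *\<^sub>V x))\<^sup>2 \<le> \<delta>\<^sup>2 / 3 * (norm (p *\<^sub>V x))\<^sup>2"
        by (intro mult_right_mono) (auto simp: k_def)
      with le show "k * (norm (p *\<^sub>V x))\<^sup>2 \<le> ?a\<^sup>2 + ?b\<^sup>2 + ?c\<^sup>2" by linarith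
      have "(norm (p *\<^sub>V x))\<^sup>2 \<le> (norm x)\<^sup>2"
        unfolding p_def bapp_bproj[OF S] by (intro power_mono norm_orth_proj_le[OF S]) simp
      then have "0 \<le> inner (x - p *\<^sub>V x) x"
        by (simp add: inner_diff_left px power2_norm_eq_inner)
      then show "k * inner (x - p *\<^sub>V x) x \<le> inner (x - p *\<^sub>V x) x"
        by (simp add: k_def mult_left_le_one_le \<delta>(1) mult_le_cancel_right1)
    qed
    also have "\<dots> = inner (q *\<^sub>V x) x"
      by (simp add: q_def inner_add_left inner_adj' power2_norm_eq_inner)
    also have "\<dots> \<le> norm (q *\<^sub>V x) * norm x" by (rule norm_cauchy_schwarz)
    finally have "(k * norm x) * norm x \<le> norm (q *\<^sub>V x) * norm x" by (simp add: power2_eq_square mult.assoc)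
    then show ?thesis by (cases "x = 0") auto
  qed
  then obtain r where r: "q * r = 1" "r * q = 1" using bpos_invertible[OF qa k] by blast
  have r_commute: "r * m = m * r" if "q * m = m * q" for m
  proof -
    have "r * m = r * (m * q) * r" using r by (simp add: mult.assoc)
    also have "\<dots> = (r * q) * m * r" using that by (simp add: mult.assoc)
    finally show ?thesis using r by simp
  qed
  have mm: "(adj n * n) * m = m * (adj n * n)" if "m \<in> {m1, m2, m3}" "n \<in> {m1, m2, m3}" for m n
    using com[OF that(2) that(1)] by (metis mult.assoc)
  have qm: "q * m = m * q" if "m \<in> {m1, m2, m3}" for m
    using mm[OF that] pm[OF that] by (simp add: q_def distrib_left distrib_right left_diff_distrib right_diff_distrib)
  have rm: "r * m = m * r" if "m \<in> {m1, m2, m3}" for m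
    by (rule r_commute[OF qm[OF that]])
  have "q * p = p * q"
  proof -
    have "(adj n * n) * p = p * (adj n * n)" if "n \<in> {m1, m2, m3}" for n
      using pm[OF that] by (metis mult.assoc)
    then show ?thesis
      by (simp add: q_def distrib_left distrib_right left_diff_distrib right_diff_distrib)
  qed
  then have rp: "r * p = p * r" by (rule r_commute)
  define s where "s m = adj m * r" for m
  have s_in: "s m *\<^sub>V x \<in> S" if "m \<in> {m1, m2, m3}" for m x
    using bproj_in[OF S] pm(3)[OF that] by (metis s_def bop_simps(6) p_def)
  have m_in: "m *\<^sub>V x \<in> S" if "m \<in> {m1, m2, m3}" for m x
    using bproj_in[OF S] pm(1)[OF that] by (metis bop_simps(6) p_def)
  \<comment> \<open>Because every \<open>m\<close> commutes with every \<open>s n\<close>, the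
    single identity \<open>sum\<close> provides the homotopy identities in all degrees.\<close>
  have ms: "m *\<^sub>V s n *\<^sub>V x = s n *\<^sub>V m *\<^sub>V x" if "m \<in> {m1, m2, m3}" "n \<in> {m1, m2, m3}" for m n x
  proof -
    have "m * s n = s n * m" using com[OF that(2) that(1)] rm[OF that(1)] by (metis s_def mult.assoc)
    then show ?thesis by (metis bop_simps(6))
  qed
  have sum: "m1 *\<^sub>V s m1 *\<^sub>V x + m2 *\<^sub>V s m2 *\<^sub>V x + m3 *\<^sub>V s m3 *\<^sub>V x = x" if "x \<in> S" for x
  proof -
    have "m1 * s m1 + m2 * s m2 + m3 * s m3 + (1 - p) * r = q * r"
      using com by (simp add: q_def s_def distrib_right mult.assoc[symmetric])
    then have "(m1 * s m1 + m2 * s m2 + m3 * s m3 + (1 - p) * r) *\<^sub>V x = x" using r by simp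
    moreover have "p *\<^sub>V r *\<^sub>V x = r *\<^sub>V x"
    proof -
      have "p *\<^sub>V r *\<^sub>V x = r *\<^sub>V p *\<^sub>V x" using rp by (metis bop_simps(6))
      then show ?thesis using bproj_id[OF S that] by (simp add: p_def)
    qed
    ultimately show ?thesis by simp
  qed
  have sum': "s m1 *\<^sub>V m1 *\<^sub>V x + s m2 *\<^sub>V m2 *\<^sub>V x + s m3 *\<^sub>V m3 *\<^sub>V x = x" if "x \<in> S" for x
    using sum[OF that] by (simp add: ms)
  note Sc = closed_csubspaceD[OF S]
  have m123: "m1 \<in> {m1, m2, m3}" "m2 \<in> {m1, m2, m3}" "m3 \<in> {m1, m2, m3}" by auto
  show ?thesis
    unfolding koszul_exact_def
  proof (intro conjI ballI impI)
    fix x assume "x \<in> S" "m1 *\<^sub>V x = 0 \<and> m2 *\<^sub>V x = 0 \<and> m3 *\<^sub>V x = 0"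
    then show "x = 0" using sum'[of x] by simp
  next
    fix x1 x2 x3 assume x: "x1 \<in> S" "x2 \<in> S" "x3 \<in> S" and
      "m1 *\<^sub>V x2 - m2 *\<^sub>V x1 = 0 \<and> m1 *\<^sub>V x3 - m3 *\<^sub>V x1 = 0 \<and> m2 *\<^sub>V x3 - m3 *\<^sub>V x2 = 0"
    then have h: "m1 *\<^sub>V x2 = m2 *\<^sub>V x1" "m1 *\<^sub>V x3 = m3 *\<^sub>V x1" "m2 *\<^sub>V x3 = m3 *\<^sub>V x2" by simp_all
    let ?x = "s m1 *\<^sub>V x1 + s m2 *\<^sub>V x2 + s m3 *\<^sub>V x3"
    have "m1 *\<^sub>V ?x = x1" using sum'[OF x(1)] by (simp add: bapp_add ms h)
    moreover have "m2 *\<^sub>V ?x = x2" using sum'[OF x(2)] by (simp add: bapp_add ms h[symmetric])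
    moreover have "m3 *\<^sub>V ?x = x3" using sum'[OF x(3)] by (simp add: bapp_add ms h[symmetric])
    moreover have "?x \<in> S" by (intro Sc s_in m123)
    ultimately show "\<exists>x\<in>S. x1 = m1 *\<^sub>V x \<and> x2 = m2 *\<^sub>V x \<and> x3 = m3 *\<^sub>V x" by metis
  next
    fix y12 y13 y23 assume y: "y12 \<in> S" "y13 \<in> S" "y23 \<in> S" and
      h: "m1 *\<^sub>V y23 - m2 *\<^sub>V y13 + m3 *\<^sub>V y12 = 0"
    \<comment> \<open>Applying \<open>s n\<close> to the cycle condition expresses the one term
      \<open>s n (n y)\<close> that the chosen preimage fails to produce directly.\<close>
    have h3: "s n *\<^sub>V m1 *\<^sub>V y23 - s n *\<^sub>V m2 *\<^sub>V y13 + s n *\<^sub>V m3 *\<^sub>V y12 = 0" for n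
      using arg_cong[OF h, of "bapp (s n)"] by (simp add: bapp_add bapp_diff)
    let ?x1 = "- (s m2 *\<^sub>V y12 + s m3 *\<^sub>V y13)" and ?x2 = "s m1 *\<^sub>V y12 - s m3 *\<^sub>V y23"
      and ?x3 = "s m1 *\<^sub>V y13 + s m2 *\<^sub>V y23"
    have "m1 *\<^sub>V ?x2 - m2 *\<^sub>V ?x1 = y12"
    proof -
      have "s m3 *\<^sub>V m3 *\<^sub>V y12 = s m3 *\<^sub>V m2 *\<^sub>V y13 - s m3 *\<^sub>V m1 *\<^sub>V y23"
        using h3[of m3] by (simp add: algebra_simps)
      with sum'[OF y(1)] show ?thesis
        by (simp add: bapp_add bapp_diff bapp_minus ms algebra_simps)
    qed
    moreover have "m1 *\<^sub>V ?x3 - m3 *\<^sub>V ?x1 = y13"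
    proof -
      have "s m2 *\<^sub>V m2 *\<^sub>V y13 = s m2 *\<^sub>V m1 *\<^sub>V y23 + s m2 *\<^sub>V m3 *\<^sub>V y12"
        using h3[of m2] by (simp add: algebra_simps)
      with sum'[OF y(2)] show ?thesis
        by (simp add: bapp_add bapp_diff bapp_minus ms algebra_simps)
    qed
    moreover have "m2 *\<^sub>V ?x3 - m3 *\<^sub>V ?x2 = y23"
    proof -
      have "s m1 *\<^sub>V m1 *\<^sub>V y23 = s m1 *\<^sub>V m2 *\<^sub>V y13 - s m1 *\<^sub>V m3 *\<^sub>V y12"
        using h3[of m1] by (simp add: algebra_simps)
      with sum'[OF y(3)] show ?thesis
        by (simp add: bapp_add bapp_diff bapp_minus ms algebra_simps)
    qed
    moreover have "?x1 \<in> S" "?x2 \<in> S" "?x3 \<in> S" by (intro Sc s_in m123)+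
    ultimately show "\<exists>x1\<in>S. \<exists>x2\<in>S. \<exists>x3\<in>S. y12 = m1 *\<^sub>V x2 - m2 *\<^sub>V x1 \<and>
        y13 = m1 *\<^sub>V x3 - m3 *\<^sub>V x1 \<and> y23 = m2 *\<^sub>V x3 - m3 *\<^sub>V x2" by metis
  next
    fix z assume z: "z \<in> S"
    have "z = m1 *\<^sub>V (s m1 *\<^sub>V z) - m2 *\<^sub>V (- (s m2 *\<^sub>V z)) + m3 *\<^sub>V (s m3 *\<^sub>V z)"
      using sum[OF z] by (simp add: bapp_minus)
    moreover have "s m1 *\<^sub>V z \<in> S" "- (s m2 *\<^sub>V z) \<in> S" "s m3 *\<^sub>V z \<in> S" by (intro Sc s_in m123)+
    ultimately show "\<exists>y12\<in>S. \<exists>y13\<in>S. \<exists>y23\<in>S. z = m1 *\<^sub>V y23 - m2 *\<^sub>V y13 + m3 *\<^sub>V y12" by blast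
  qed
qed

text \<open>Without a lower bound there are vectors of growing norm with bounded images.
  Surjectivity of the last Koszul map writes the projection of any \<open>w\<close> onto
  \<open>S\<close> in terms of the ranges of the \<open>m\<close>, so that \<open>inner w\<close>
  stays bounded on these vectors, contrary to the uniform boundedness principle.\<close>

lemma bounded_below_if_koszul_exact:
  fixes m1 m2 m3 :: "'a::chilbert_space bop"
  assumes S: "closed_csubspace S" and ex: "koszul_exact S (bapp m1) (bapp m2) (bapp m3)"
    and n: "nrm m1" "nrm m2" "nrm m3"
  shows "\<exists>\<delta>>0. \<forall>x\<in>S. \<delta> * norm x \<le> norm (m1 *\<^sub>V x) + norm (m2 *\<^sub>V x) + norm (m3 *\<^sub>V x)"
proof (rule ccontr)
  assume no: "\<not> ?thesis"
  let ?f = "\<lambda>x. norm (m1 *\<^sub>V x) + norm (m2 *\<^sub>V x) + norm (m3 *\<^sub>V x)"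
  have "\<forall>k. \<exists>x\<in>S. ?f x < 1 / real (Suc k) * norm x"
  proof
    fix k
    have "\<not> (\<forall>x\<in>S. 1 / real (Suc k) * norm x \<le> ?f x)"
      using no by (metis of_nat_0_less_iff zero_less_Suc zero_less_divide_1_iff)
    then show "\<exists>x\<in>S. ?f x < 1 / real (Suc k) * norm x" by (auto simp: not_le)
  qed
  then have "\<forall>k. \<exists>x. x \<in> S \<and> ?f x < 1 / real (Suc k) * norm x" by blast
  from choice[OF this] obtain x where x: "\<And>k. x k \<in> S" "\<And>k. ?f (x k) < 1 / real (Suc k) * norm (x k)"
    by blast
  have x0: "norm (x k) > 0" for k
    using x(2)[of k] by (cases "x k = 0") auto
  \<comment> \<open>Rescaled to norm \<open>k + 1\<close>, while the images still sum to less than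
    1.\<close>
  define v where "v k = (real (Suc k) / norm (x k)) *\<^sub>R x k" for k
  have vS: "v k \<in> S" for k
    unfolding v_def scaleR_scaleC by (rule closed_csubspaceD(3)[OF S x(1)])
  have nv: "norm (v k) = real (Suc k)" for k using x0[of k] by (simp add: v_def)
  have fv: "?f (v k) < 1" for k
  proof -
    have "?f (v k) = (real (Suc k) / norm (x k)) * ?f (x k)"
      using x0[of k] by (simp add: v_def bapp_scaleR distrib_left)
    also have "\<dots> < (real (Suc k) / norm (x k)) * (1 / real (Suc k) * norm (x k))"
      by (rule mult_strict_left_mono[OF x(2)]) (use x0[of k] in simp)
    also have "\<dots> = 1" using x0[of k] by (simp del: of_nat_Suc)
    finally show ?thesis .
  qed
  have "\<exists>C. \<forall>k. \<bar>inner w (v k)\<bar> \<le> C" for w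
  proof -
    have "\<forall>z\<in>S. \<exists>y12\<in>S. \<exists>y13\<in>S. \<exists>y23\<in>S. z = m1 *\<^sub>V y23 - m2 *\<^sub>V y13 + m3 *\<^sub>V y12"
      using ex unfolding koszul_exact_def by (elim conjE)
    from bspec[OF this orth_proj_in[OF S, of w]]
    obtain y12 y13 y23 where y: "orth_proj S w = m1 *\<^sub>V y23 - m2 *\<^sub>V y13 + m3 *\<^sub>V y12"
      by blast
    \<comment> \<open>Moving \<open>m\<close> across produces its adjoint; normality converts the
      bound on \<open>m (v k)\<close> into one on \<open>adj m (v k)\<close>.\<close>
    have b: "\<bar>inner (m *\<^sub>V y) (v k)\<bar> \<le> norm y" if "nrm m" "norm (m *\<^sub>V v k) \<le> 1" for m y k
    proof -
      have "\<bar>inner (m *\<^sub>V y) (v k)\<bar> \<le> norm y * norm (adj m *\<^sub>V v k)"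
        unfolding inner_adj by (rule Cauchy_Schwarz_ineq2)
      also have "\<dots> \<le> norm y * 1" unfolding norm_nrm_adj[OF that(1)] by (intro mult_left_mono that) simp
      finally show ?thesis by simp
    qed
    have "\<bar>inner w (v k)\<bar> \<le> norm y23 + norm y13 + norm y12" for k
    proof -
      have le: "norm (m1 *\<^sub>V v k) \<le> 1" "norm (m2 *\<^sub>V v k) \<le> 1" "norm (m3 *\<^sub>V v k) \<le> 1"
        using fv[of k] norm_ge_zero[of "m1 *\<^sub>V v k"] norm_ge_zero[of "m2 *\<^sub>V v k"]
          norm_ge_zero[of "m3 *\<^sub>V v k"] by linarith+
      have "inner w (v k) = inner (orth_proj S w) (v k)"
        using cinner_orth_proj_left[OF S vS] by (simp add: inner_eq_Re_cinner)
      also have "\<dots> = inner (m1 *\<^sub>V y23) (v k) - inner (m2 *\<^sub>V y13) (v k) + inner (m3 *\<^sub>V y12) (v k)"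
        unfolding y by (simp only: inner_add_left inner_diff_left)
      finally show ?thesis
        using b[OF n(1) le(1), of y23] b[OF n(2) le(2), of y13] b[OF n(3) le(3), of y12] by linarith
    qed
    then show ?thesis by blast
  qed
  then obtain C where "\<And>k. norm (v k) \<le> C" using weakly_bounded_imp_bounded by metis
  moreover obtain k where "C < real (Suc k)" using reals_Archimedean2 less_Suc_eq of_nat_less_iff
    by (metis less_trans of_nat_less_iff lessI)
  ultimately show False by (metis nv not_le)
qed

section \<open>Spectral inequalities for commuting normal operators\<close>

text \<open>An affine function evaluated at a triple of operators. Affine functions suffice since,
  for fixed \<open>z\<close>, both sides of the tetrablock inequalities are moduli of such.\<close>

definition lin3 :: "'a::chilbert_space bop \<Rightarrow> 'a bop \<Rightarrow> 'a bop \<Rightarrow> complex \<Rightarrow> complex \<Rightarrow> complex \<Rightarrow> complex \<Rightarrow> 'a bop" where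
  "lin3 u1 u2 u3 a0 a1 a2 a3 = bscal a0 + bscal a1 * u1 + bscal a2 * u2 + bscal a3 * u3"

lemma lin3_commute:
  assumes "X * u1 = u1 * X" "X * u2 = u2 * X" "X * u3 = u3 * X"
  shows "X * lin3 u1 u2 u3 a0 a1 a2 a3 = lin3 u1 u2 u3 a0 a1 a2 a3 * X"
proof -
  have "X * (bscal c * u) = bscal c * u * X" if "X * u = u * X" for c u
    using that by (metis bscal_commute mult.assoc)
  with assms show ?thesis
    by (simp add: lin3_def distrib_left distrib_right bscal_commute[symmetric, of X])
qed

lemma lin3_approx:
  assumes "norm (u1 *\<^sub>V x - z1 *\<^sub>C x) \<le> \<epsilon>" "norm (u2 *\<^sub>V x - z2 *\<^sub>C x) \<le> \<epsilon>" "norm (u3 *\<^sub>V x - z3 *\<^sub>C x) \<le> \<epsilon>"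
  shows "norm (lin3 u1 u2 u3 a0 a1 a2 a3 *\<^sub>V x - (a0 + a1 * z1 + a2 * z2 + a3 * z3) *\<^sub>C x)
    \<le> (cmod a1 + cmod a2 + cmod a3) * \<epsilon>"
proof -
  have "lin3 u1 u2 u3 a0 a1 a2 a3 *\<^sub>V x - (a0 + a1 * z1 + a2 * z2 + a3 * z3) *\<^sub>C x
      = a1 *\<^sub>C (u1 *\<^sub>V x - z1 *\<^sub>C x) + a2 *\<^sub>C (u2 *\<^sub>V x - z2 *\<^sub>C x) + a3 *\<^sub>C (u3 *\<^sub>V x - z3 *\<^sub>C x)"
    by (simp add: lin3_def scaleC_add_left scaleC_diff_right scaleC_scaleC)
  also have "norm \<dots> \<le> norm (a1 *\<^sub>C (u1 *\<^sub>V x - z1 *\<^sub>C x)) + norm (a2 *\<^sub>C (u2 *\<^sub>V x - z2 *\<^sub>C x)) + norm (a3 *\<^sub>C (u3 *\<^sub>V x - z3 *\<^sub>C x))"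
    by (rule order_trans[OF norm_triangle_ineq add_right_mono[OF norm_triangle_ineq]])
  also have "\<dots> \<le> cmod a1 * \<epsilon> + cmod a2 * \<epsilon> + cmod a3 * \<epsilon>"
    unfolding norm_scaleC by (intro add_mono mult_left_mono assms) auto
  finally show ?thesis by (simp add: distrib_right)
qed

text \<open>If the inequality fails, the form of \<open>adj b * b - adj a * a\<close> has a negative
  infimum \<open>q\<close> over unit vectors. Near-minimisers can be chosen as joint approximate
  eigenvectors, the joint eigenvalue lies in \<open>K\<close> by the lower bounds off
  \<open>K\<close>, and there the scalar inequality contradicts \<open>q < 0\<close>.\<close>

lemma joint_spectral_inequality:
  fixes u1 u2 u3 :: "'a::chilbert_space bop"
  assumes n: "nrm u1" "nrm u2" "nrm u3"
    and c: "u1 * u2 = u2 * u1" "u1 * u3 = u3 * u1" "u2 * u3 = u3 * u2"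
    and below: "\<And>z1 z2 z3. (z1, z2, z3) \<notin> K \<Longrightarrow>
      \<exists>\<delta>>0. \<forall>x. \<delta> * norm x \<le> norm (u1 *\<^sub>V x - z1 *\<^sub>C x) + norm (u2 *\<^sub>V x - z2 *\<^sub>C x) + norm (u3 *\<^sub>V x - z3 *\<^sub>C x)"
    and K: "\<And>z1 z2 z3. (z1, z2, z3) \<in> K \<Longrightarrow>
      cmod (a0 + a1 * z1 + a2 * z2 + a3 * z3) \<le> cmod (b0 + b1 * z1 + b2 * z2 + b3 * z3)"
  shows "norm (lin3 u1 u2 u3 a0 a1 a2 a3 *\<^sub>V x) \<le> norm (lin3 u1 u2 u3 b0 b1 b2 b3 *\<^sub>V x)"
proof (rule ccontr)
  assume neg: "\<not> ?thesis"
  define a where "a = lin3 u1 u2 u3 a0 a1 a2 a3"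
  define b where "b = lin3 u1 u2 u3 b0 b1 b2 b3"
  define Q where "Q = adj b * b - adj a * a"
  have Q_inner: "inner (Q *\<^sub>V y) y = (norm (b *\<^sub>V y))\<^sup>2 - (norm (a *\<^sub>V y))\<^sup>2" for y
    by (simp add: Q_def inner_diff_left inner_adj' power2_norm_eq_inner)
  define S where "S = (\<lambda>y. inner (Q *\<^sub>V y) y) ` {y. norm y = 1}"
  define q where "q = Inf S"
  have "x \<noteq> 0" using neg by auto
  define x0 where "x0 = (1 / norm x) *\<^sub>R x"
  have x0: "norm x0 = 1" using \<open>x \<noteq> 0\<close> by (simp add: x0_def)
  have "norm (b *\<^sub>V x0) < norm (a *\<^sub>V x0)"
    using neg \<open>x \<noteq> 0\<close> by (simp add: x0_def bapp_scaleR a_def b_def divide_strict_right_mono)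
  then have "(norm (b *\<^sub>V x0))\<^sup>2 < (norm (a *\<^sub>V x0))\<^sup>2" by (intro power_strict_mono) auto
  then have Qx0: "inner (Q *\<^sub>V x0) x0 < 0" by (simp add: Q_inner)
  have bdd: "bdd_below S"
  proof (rule bdd_belowI)
    fix s assume "s \<in> S"
    then obtain y where "norm y = 1" "s = inner (Q *\<^sub>V y) y" by (auto simp: S_def)
    then show "- norm Q \<le> s" using inner_bapp_le[of Q y] by simp
  qed
  have ne: "S \<noteq> {}" using x0 by (auto simp: S_def)
  have q_le: "q \<le> inner (Q *\<^sub>V y) y" if "norm y = 1" for y
    unfolding q_def by (rule cInf_lower[OF _ bdd]) (use that in \<open>auto simp: S_def\<close>)
  have q0: "q < 0" using q_le[OF x0] Qx0 by linarith
  define Y where "Y = Q - q *\<^sub>R 1"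
  have Y_inner: "inner (Y *\<^sub>V y) y = inner (Q *\<^sub>V y) y - q * (norm y)\<^sup>2" for y
    by (simp add: Y_def inner_diff_left power2_norm_eq_inner)
  have Y: "bpos Y"
    unfolding bpos_def
  proof (intro conjI allI)
    show "adj Y = Y" by (simp add: Y_def Q_def)
    have "inner ((- Q) *\<^sub>V y) y \<le> - q * (norm y)\<^sup>2" for y
      by (rule form_le_from_unit) (simp add: q_le)
    then show "0 \<le> inner (Y *\<^sub>V y) y" for y by (simp add: Y_inner)
  qed
  have null: "approx_null Y"
    unfolding approx_null_def
  proof (intro allI impI)
    fix \<epsilon> :: real assume "0 < \<epsilon>"
    then have "\<exists>s\<in>S. s < q + \<epsilon>" using cInf_less_iff[OF ne bdd, of "q + \<epsilon>"] by (simp add: q_def)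
    then show "\<exists>y. norm y = 1 \<and> inner (Y *\<^sub>V y) y < \<epsilon>" by (auto simp: S_def Y_inner)
  qed
  \<comment> \<open>Only commutation among the \<open>u\<close> is given; commutation with the
    adjoints is needed for \<open>Y\<close> to commute with the triple.\<close>
  note fug = fuglede[OF n(1), of u2, OF c(1)[symmetric]] fuglede[OF n(1), of u3, OF c(2)[symmetric]]
    fuglede[OF n(2), of u3, OF c(3)[symmetric]] fuglede[OF n(2), of u1, OF c(1)]
    fuglede[OF n(3), of u1, OF c(2)] fuglede[OF n(3), of u2, OF c(3)]
    n[unfolded nrm_def]
  have lin_com: "lin3 u1 u2 u3 e0 e1 e2 e3 * u = u * lin3 u1 u2 u3 e0 e1 e2 e3"
    "adj (lin3 u1 u2 u3 e0 e1 e2 e3) * u = u * adj (lin3 u1 u2 u3 e0 e1 e2 e3)"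
    if "u \<in> {u1, u2, u3}" for u e0 e1 e2 e3
  proof -
    show "lin3 u1 u2 u3 e0 e1 e2 e3 * u = u * lin3 u1 u2 u3 e0 e1 e2 e3"
      by (rule lin3_commute[symmetric]) (use that c in auto)
    have "adj u * lin3 u1 u2 u3 e0 e1 e2 e3 = lin3 u1 u2 u3 e0 e1 e2 e3 * adj u"
      by (rule lin3_commute) (use that fug in auto)
    from arg_cong[OF this, of adj]
    show "adj (lin3 u1 u2 u3 e0 e1 e2 e3) * u = u * adj (lin3 u1 u2 u3 e0 e1 e2 e3)" by simp
  qed
  have cm: "x * y * u = u * (x * y)" if "x * u = u * x" "y * u = u * y" for x y u :: "'a bop"
    using that by (metis mult.assoc)
  have YN: "Y * u = u * Y" if "u \<in> {u1, u2, u3}" for u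
  proof -
    have "(adj b * b) * u = u * (adj b * b)" "(adj a * a) * u = u * (adj a * a)"
      unfolding a_def b_def by (intro cm lin_com that)+
    then show ?thesis by (simp add: Y_def Q_def algebra_simps)
  qed
  obtain z1 z2 z3 where z: "\<And>\<epsilon>. 0 < \<epsilon> \<Longrightarrow> \<exists>x. norm x = 1 \<and> inner (Y *\<^sub>V x) x < \<epsilon>
    \<and> norm (u1 *\<^sub>V x - z1 *\<^sub>C x) < \<epsilon> \<and> norm (u2 *\<^sub>V x - z2 *\<^sub>C x) < \<epsilon> \<and> norm (u3 *\<^sub>V x - z3 *\<^sub>C x) < \<epsilon>"
  proof (rule joint_approximate_eigenvalue[OF Y n _ _ _ c _ _ _ null])
    show "Y * u1 = u1 * Y" "Y * u2 = u2 * Y" "Y * u3 = u3 * Y" by (simp_all add: YN)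
    show "adj u1 * u2 = u2 * adj u1" "adj u1 * u3 = u3 * adj u1" "adj u2 * u3 = u3 * adj u2"
      using fug by simp_all
  qed blast
  have "(z1, z2, z3) \<in> K"
  proof (rule ccontr)
    assume "(z1, z2, z3) \<notin> K"
    from below[OF this] obtain \<delta> where d: "0 < \<delta>"
      "\<And>x. \<delta> * norm x \<le> norm (u1 *\<^sub>V x - z1 *\<^sub>C x) + norm (u2 *\<^sub>V x - z2 *\<^sub>C x) + norm (u3 *\<^sub>V x - z3 *\<^sub>C x)"
      by blast
    from d(1) have "0 < \<delta> / 3" by simp
    from z[OF this] obtain y where "norm y = 1" "norm (u1 *\<^sub>V y - z1 *\<^sub>C y) < \<delta> / 3"
      "norm (u2 *\<^sub>V y - z2 *\<^sub>C y) < \<delta> / 3" "norm (u3 *\<^sub>V y - z3 *\<^sub>C y) < \<delta> / 3" by blast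
    with d(2)[of y] show False by simp
  qed
  from K[OF this] have ab: "cmod (a0 + a1 * z1 + a2 * z2 + a3 * z3) \<le> cmod (b0 + b1 * z1 + b2 * z2 + b3 * z3)"
    (is "cmod ?za \<le> cmod ?zb") .
  define M where "M = (cmod a1 + cmod a2 + cmod a3) + (cmod b1 + cmod b2 + cmod b3)"
  define R where "R = norm a + norm b"
  have M0: "0 \<le> M" and R0: "0 \<le> R" by (simp_all add: M_def R_def)
  then have MR: "0 < M * R + 1" by (simp add: add_nonneg_pos)
  \<comment> \<open>The approximation error in the form is at most
    \<open>M * \<epsilon> * R + \<epsilon>\<close>, which this choice makes equal to
    \<open>- q\<close>.\<close>
  define \<epsilon> where "\<epsilon> = - q / (M * R + 1)"
  have e0: "0 < \<epsilon>" unfolding \<epsilon>_def using q0 MR by (intro divide_pos_pos) simp_all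
  obtain y where y: "norm y = 1" "inner (Y *\<^sub>V y) y < \<epsilon>" and
    yu: "norm (u1 *\<^sub>V y - z1 *\<^sub>C y) < \<epsilon>" "norm (u2 *\<^sub>V y - z2 *\<^sub>C y) < \<epsilon>" "norm (u3 *\<^sub>V y - z3 *\<^sub>C y) < \<epsilon>"
    using z[OF e0] by blast
  note la = lin3_approx[OF yu[THEN less_imp_le], of a0 a1 a2 a3, folded a_def]
  note lb = lin3_approx[OF yu[THEN less_imp_le], of b0 b1 b2 b3, folded b_def]
  have "norm (a *\<^sub>V y) - cmod ?za \<le> norm (a *\<^sub>V y - ?za *\<^sub>C y)"
    using norm_triangle_ineq2[of "a *\<^sub>V y" "?za *\<^sub>C y"] y(1) by (simp only: norm_scaleC mult_1_right)
  moreover have "cmod ?zb - norm (b *\<^sub>V y) \<le> norm (b *\<^sub>V y - ?zb *\<^sub>C y)"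
    using norm_triangle_ineq3[of "b *\<^sub>V y" "?zb *\<^sub>C y"] y(1) by (simp only: norm_scaleC mult_1_right abs_le_iff) simp
  ultimately have d: "norm (a *\<^sub>V y) - norm (b *\<^sub>V y) \<le> M * \<epsilon>"
    using la lb ab by (simp add: M_def distrib_right)
  have s: "norm (a *\<^sub>V y) + norm (b *\<^sub>V y) \<le> R"
    using norm_bapp[of a y] norm_bapp[of b y] y(1) by (simp add: R_def)
  have "(norm (a *\<^sub>V y))\<^sup>2 - (norm (b *\<^sub>V y))\<^sup>2 = (norm (a *\<^sub>V y) - norm (b *\<^sub>V y)) * (norm (a *\<^sub>V y) + norm (b *\<^sub>V y))"
    by (simp add: power2_eq_square algebra_simps)
  also have "\<dots> \<le> M * \<epsilon> * (norm (a *\<^sub>V y) + norm (b *\<^sub>V y))" by (intro mult_right_mono d) simp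
  also have "\<dots> \<le> M * \<epsilon> * R" using M0 e0 by (intro mult_left_mono s) simp
  finally have "- q < M * \<epsilon> * R + \<epsilon>" using y(2) y(1) by (simp add: Y_inner Q_inner)
  also have "\<dots> = (M * R + 1) * \<epsilon>" by (simp add: algebra_simps)
  also have "\<dots> = - q" using MR by (simp add: \<epsilon>_def)
  finally show False by simp
qed

section \<open>The tetrablock and its distinguished boundary\<close>

lemma norm_sq_vec2: "(norm (v :: complex^2))\<^sup>2 = (cmod (v $ 1))\<^sup>2 + (cmod (v $ 2))\<^sup>2"
  by (simp add: norm_vec_def L2_set_def sum_2 real_sqrt_pow2)

lemma bounded_linear_matrix_vec2: "bounded_linear ((*v) (M :: complex^2^2))"
proof -
  have "M *v (r *\<^sub>R x) = r *\<^sub>R (M *v x)" for r and x :: "complex^2"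
    by (simp add: vec_eq_iff matrix_vector_mult_def scaleR_sum_right)
  then have "linear ((*v) M)" by (intro linearI matrix_vector_right_distrib)
  then show ?thesis by (simp only: linear_conv_bounded_linear)
qed

text \<open>For \<open>v = (1 - a\<^sub>2\<^sub>2 z, z a\<^sub>2\<^sub>1)\<close> one has \<open>M v = (a\<^sub>1\<^sub>1 - z det M, a\<^sub>2\<^sub>1)\<close>.\<close>

lemma tetrablock_ineq:
  assumes "(x1, x2, x3) \<in> tetrablock" "cmod z \<le> 1"
  shows "cmod (x1 - z * x3) \<le> cmod (1 - z * x2)" "cmod (x2 - z * x3) \<le> cmod (1 - z * x1)"
proof -
  obtain M :: "complex^2^2" where M: "x1 = M $ 1 $ 1" "x2 = M $ 2 $ 2" "x3 = det M"
    "transpose M = M" "onorm ((*v) M) < 1"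
    using assms(1) by (auto simp: tetrablock_def)
  have sym: "M $ 1 $ 2 = M $ 2 $ 1"  proof -
    have "M $ 1 $ 2 = transpose M $ 2 $ 1" by (simp add: transpose_def)
    then show ?thesis by (simp only: M(4))
  qed
  have le: "norm (M *v v) \<le> norm v" for v
  proof -
    have "norm (M *v v) \<le> onorm ((*v) M) * norm v" by (rule onorm[OF bounded_linear_matrix_vec2])
    also have "\<dots> \<le> 1 * norm v" using M(5) by (intro mult_right_mono) auto
    finally show ?thesis by simp
  qed
  \<comment> \<open>The second component of \<open>M v\<close> and the remaining component of
    \<open>v\<close> differ by the factor \<open>z\<close> of modulus at most 1 and can be discarded
    from the norm inequality.\<close>
  have key: "cmod p \<le> cmod q"
    if "(norm (M *v v))\<^sup>2 = (cmod p)\<^sup>2 + (cmod (M $ 2 $ 1))\<^sup>2"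
      "(norm v)\<^sup>2 = (cmod q)\<^sup>2 + (cmod (z * M $ 2 $ 1))\<^sup>2" for v p q
  proof -
    have "(cmod (z * M $ 2 $ 1))\<^sup>2 \<le> (cmod (M $ 2 $ 1))\<^sup>2"
      using assms(2) by (intro power_mono) (auto simp: norm_mult mult_left_le_one_le)
    moreover have "(norm (M *v v))\<^sup>2 \<le> (norm v)\<^sup>2" by (intro power_mono le) simp
    ultimately have "(cmod p)\<^sup>2 \<le> (cmod q)\<^sup>2" using that by linarith
    then show ?thesis by (rule power2_le_imp_le) simp
  qed
  have d: "det M = M $ 1 $ 1 * M $ 2 $ 2 - M $ 2 $ 1 * M $ 2 $ 1"
    by (simp add: det_2 sym)
  show "cmod (x1 - z * x3) \<le> cmod (1 - z * x2)"
    by (rule key[of "vector [1 - z * M $ 2 $ 2, z * M $ 2 $ 1]"])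
      (simp_all add: norm_sq_vec2 matrix_vector_mult_def sum_2 M d sym algebra_simps)
  show "cmod (x2 - z * x3) \<le> cmod (1 - z * x1)"
    by (rule key[of "vector [z * M $ 2 $ 1, 1 - z * M $ 1 $ 1]"])
      (simp_all add: norm_sq_vec2 matrix_vector_mult_def sum_2 M d sym algebra_simps)
qed

lemma closure_tetrablock_ineq:
  assumes "(x1, x2, x3) \<in> closure tetrablock" "cmod z \<le> 1"
  shows "cmod (x1 - z * x3) \<le> cmod (1 - z * x2)" "cmod (x2 - z * x3) \<le> cmod (1 - z * x1)"
proof -
  let ?A = "{x. cmod (fst x - z * snd (snd x)) \<le> cmod (1 - z * fst (snd x))}"
  let ?B = "{x. cmod (fst (snd x) - z * snd (snd x)) \<le> cmod (1 - z * fst x)}"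
  have "closed ?A" "closed ?B"
    by (intro closed_Collect_le continuous_intros)+
  moreover have "tetrablock \<subseteq> ?A" "tetrablock \<subseteq> ?B"
    using tetrablock_ineq assms(2) by auto
  ultimately have "closure tetrablock \<subseteq> ?A" "closure tetrablock \<subseteq> ?B"
    by (simp_all only: closure_minimal)
  with assms(1) show "cmod (x1 - z * x3) \<le> cmod (1 - z * x2)" "cmod (x2 - z * x3) \<le> cmod (1 - z * x1)"
    by auto
qed

lemma cmod_le_if_Re_rotations_le:
  assumes "\<And>z. cmod z = 1 \<Longrightarrow> Re (z * c) \<le> r"
  shows "cmod c \<le> r"
proof (cases "c = 0")
  case True
  then show ?thesis using assms[of 1] by simp
next
  case False
  have "cnj (sgn c) * c = of_real (cmod c)"
    using False complex_norm_square[of c]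
    by (simp add: sgn_div_norm scaleR_conv_of_real field_simps power2_eq_square)
  moreover have "cmod (cnj (sgn c)) = 1" using False by (simp add: norm_sgn)
  ultimately show ?thesis using assms[of "cnj (sgn c)"] by simp
qed

lemma cmod_diff_sq: "(cmod (a - b))\<^sup>2 = (cmod a)\<^sup>2 + (cmod b)\<^sup>2 - 2 * Re (b * cnj a)"
  by (simp only: cmod_power2 minus_complex.simps times_complex.simps cnj.simps)
    (simp add: power2_eq_square algebra_simps)

text \<open>Squaring the inequalities for \<open>|z| = 1\<close> leaves a single term linear in
  \<open>z\<close>, and rotating \<open>z\<close> turns it into a modulus. The two right-hand sides
  add up to \<open>1 - |x3| ^ 2\<close>, so both moduli vanish when \<open>|x3| = 1\<close>.\<close>

lemma closure_tetrablock_gap: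
  assumes "(x1, x2, x3) \<in> closure tetrablock"
  shows "cmod (x2 - x3 * cnj x1) \<le> (1 + (cmod x2)\<^sup>2 - (cmod x1)\<^sup>2 - (cmod x3)\<^sup>2) / 2"
    "cmod (x1 - x3 * cnj x2) \<le> (1 + (cmod x1)\<^sup>2 - (cmod x2)\<^sup>2 - (cmod x3)\<^sup>2) / 2"
proof -
  have "Re (z * (v - w * cnj u)) \<le> (1 + (cmod v)\<^sup>2 - (cmod u)\<^sup>2 - (cmod w)\<^sup>2) / 2"
    if "cmod (u - z * w) \<le> cmod (1 - z * v)" "cmod z = 1" for u v w z
  proof -
    have "(cmod (u - z * w))\<^sup>2 \<le> (cmod (1 - z * v))\<^sup>2" using that(1) by (intro power_mono) auto
    then have "(cmod u)\<^sup>2 + (cmod w)\<^sup>2 - 2 * Re (z * w * cnj u) \<le> 1 + (cmod v)\<^sup>2 - 2 * Re (z * v)"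
      by (simp only: cmod_diff_sq norm_mult that(2) mult_1_left complex_cnj_one mult_1_right
          norm_one power_one)
    moreover have "Re (z * (v - w * cnj u)) = Re (z * v) - Re (z * w * cnj u)"
      by (simp only: right_diff_distrib mult.assoc minus_complex.simps)
    ultimately show ?thesis by argo
  qed
  then show "cmod (x2 - x3 * cnj x1) \<le> (1 + (cmod x2)\<^sup>2 - (cmod x1)\<^sup>2 - (cmod x3)\<^sup>2) / 2"
    "cmod (x1 - x3 * cnj x2) \<le> (1 + (cmod x1)\<^sup>2 - (cmod x2)\<^sup>2 - (cmod x3)\<^sup>2) / 2"
    using closure_tetrablock_ineq[OF assms] by (intro cmod_le_if_Re_rotations_le; simp)+
qed

lemma closure_tetrablock_le_one:
  assumes "(x1, x2, x3) \<in> closure tetrablock"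
  shows "cmod x1 \<le> 1" "cmod x2 \<le> 1" "cmod x3 \<le> 1"
proof -
  show "cmod x1 \<le> 1" "cmod x2 \<le> 1" using closure_tetrablock_ineq[OF assms, of 0] by simp_all
  have "(cmod x3)\<^sup>2 \<le> 1\<^sup>2"
    using closure_tetrablock_gap[OF assms] norm_ge_zero[of "x2 - x3 * cnj x1"]
      norm_ge_zero[of "x1 - x3 * cnj x2"] unfolding power_one by argo
  then show "cmod x3 \<le> 1" by (rule power2_le_imp_le) simp
qed

lemma closure_tetrablock_unimodular:
  assumes "(x1, x2, x3) \<in> closure tetrablock" "cmod x3 = 1"
  shows "x1 = cnj x2 * x3"
proof -
  have "cmod (x1 - x3 * cnj x2) \<le> 0"
    using closure_tetrablock_gap[OF assms(1)] norm_ge_zero[of "x2 - x3 * cnj x1"]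
    unfolding assms(2) power_one by argo
  then show ?thesis by (simp add: mult.commute)
qed

lemma compact_closure_tetrablock: "compact (closure tetrablock)"
proof -
  have "norm x \<le> 3" if "x \<in> closure tetrablock" for x
  proof (cases x)
    case (fields x1 x2 x3)
    have "norm (x1, x2, x3) \<le> norm x1 + norm (x2, x3)" by (rule norm_Pair_le)
    also have "\<dots> \<le> norm x1 + (norm x2 + norm x3)" by (intro add_left_mono norm_Pair_le)
    also have "\<dots> \<le> 3" using closure_tetrablock_le_one[of x1 x2 x3] that fields by simp
    finally show ?thesis using fields by simp
  qed
  then have "bounded (closure tetrablock)" unfolding bounded_iff by blast
  then show ?thesis by (simp add: compact_eq_bounded_closed)
qed

lemma zero_in_tetrablock: "(0, 0, 0) \<in> tetrablock"
proof -
  have "((*v) (0 :: complex^2^2)) = (\<lambda>_. 0)"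
    by (auto simp: fun_eq_iff matrix_vector_mult_def vec_eq_iff)
  then have "onorm ((*v) (0 :: complex^2^2)) < 1" by (simp add: onorm_zero)
  moreover have "transpose (0 :: complex^2^2) = 0" by (simp add: transpose_def vec_eq_iff)
  ultimately show ?thesis
    unfolding tetrablock_def by (intro CollectI exI[of _ "0 :: complex^2^2"]) (simp add: det_2)
qed

text \<open>The matrix is \<open>r\<close> times a symmetric unitary matrix with diagonal
  \<open>cnj \<beta> * c\<close>, \<open>\<beta>\<close> and determinant \<open>c\<close>.\<close>

lemma scaled_boundary_point_in_tetrablock:
  assumes c: "cmod c = 1" and b: "cmod \<beta> \<le> 1" and r: "0 \<le> r" "r < 1"
  shows "(of_real r * (cnj \<beta> * c), of_real r * \<beta>, of_real (r\<^sup>2) * c) \<in> tetrablock"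
proof -
  \<comment> \<open>The off-diagonal entry is forced by the determinant:
    \<open>c |\<beta>| ^ 2 - w ^ 2 = c\<close>.\<close>
  define w where "w = csqrt (- c * of_real (1 - (cmod \<beta>)\<^sup>2))"
  have w2: "w * w = - c * of_real (1 - (cmod \<beta>)\<^sup>2)"
    using power2_csqrt by (simp add: w_def power2_eq_square[symmetric])
  have b1: "(cmod \<beta>)\<^sup>2 \<le> 1" using b by (simp add: power_le_one)
  have wn: "(cmod w)\<^sup>2 = 1 - (cmod \<beta>)\<^sup>2"
  proof -
    have "cmod (w * w) = 1 - (cmod \<beta>)\<^sup>2" unfolding w2 using c b1 by (simp only: norm_mult norm_minus_cancel norm_of_real) simp
    then show ?thesis by (simp add: norm_mult power2_eq_square)
  qed
  \<comment> \<open>Orthogonality of the two columns of the unitary matrix, up to the factor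
    \<open>cnj \<beta>\<close>.\<close>
  have wc: "c * cnj w + w = 0"
  proof (cases "w = 0")
    case False
    have "w * w = - c * (w * cnj w)"
      unfolding w2 complex_norm_square[symmetric] wn by simp
    then have "w * (c * cnj w + w) = 0" by (simp add: algebra_simps)
    with False show ?thesis by (metis mult_eq_0_iff)
  qed simp
  have cc: "c * cnj c = 1" using c by (simp add: complex_norm_square[symmetric])
  define M :: "complex^2^2" where
    "M = vector [vector [of_real r * (cnj \<beta> * c), of_real r * w], vector [of_real r * w, of_real r * \<beta>]]"
  have Mi: "M $ 1 $ 1 = of_real r * (cnj \<beta> * c)" "M $ 1 $ 2 = of_real r * w"
    "M $ 2 $ 1 = of_real r * w" "M $ 2 $ 2 = of_real r * \<beta>"
    by (simp_all add: M_def)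
  have "norm (M *v v) \<le> r * norm v" for v
  proof -
    define p q where "p = v $ 1" and "q = v $ 2"
    have "(norm (M *v v))\<^sup>2 = (cmod (of_real r * (cnj \<beta> * c * p + w * q)))\<^sup>2 + (cmod (of_real r * (w * p + \<beta> * q)))\<^sup>2"
      by (simp add: norm_sq_vec2 matrix_vector_mult_def sum_2 Mi p_def q_def algebra_simps)
    also have "\<dots> = r\<^sup>2 * ((cmod (cnj \<beta> * c * p + w * q))\<^sup>2 + (cmod (w * p + \<beta> * q))\<^sup>2)"
      by (simp only: norm_mult power_mult_distrib norm_of_real power2_abs distrib_left[of "r\<^sup>2"])
    also have "(cmod (cnj \<beta> * c * p + w * q))\<^sup>2 + (cmod (w * p + \<beta> * q))\<^sup>2 = (cmod p)\<^sup>2 + (cmod q)\<^sup>2"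
    proof -
      let ?R = "\<lambda>x. complex_of_real ((cmod x)\<^sup>2)"
      have bw: "w * cnj w + \<beta> * cnj \<beta> = 1"
        using wn by (simp add: complex_norm_square[symmetric] flip: of_real_add)
      have "?R (cnj \<beta> * c * p + w * q) + ?R (w * p + \<beta> * q)
          = (\<beta> * cnj \<beta> * (c * cnj c) + w * cnj w) * (p * cnj p) + (w * cnj w + \<beta> * cnj \<beta>) * (q * cnj q)
            + cnj \<beta> * p * cnj q * (c * cnj w + w) + \<beta> * cnj p * q * cnj (c * cnj w + w)"
        unfolding complex_norm_square by (simp add: algebra_simps)
      also have "\<dots> = ?R p + ?R q"
        unfolding wc cc complex_norm_square using bw by (simp add: add.commute)
      finally show ?thesis by (simp only: of_real_add[symmetric] of_real_eq_iff)
    qed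
    also have "r\<^sup>2 * ((cmod p)\<^sup>2 + (cmod q)\<^sup>2) = (r * norm v)\<^sup>2"
      by (simp add: power_mult_distrib norm_sq_vec2 p_def q_def)
    finally show ?thesis by (rule power2_le_imp_le[OF eq_refl]) (simp add: r)
  qed
  then have "onorm ((*v) M) \<le> r" by (intro onorm_bound r)
  then have "onorm ((*v) M) < 1" using r by simp
  moreover have "transpose M = M" by (simp add: transpose_def vec_eq_iff forall_2 Mi)
  moreover have "det M = of_real (r\<^sup>2) * c"
  proof -
    have "det M = of_real (r\<^sup>2) * (c * (\<beta> * cnj \<beta>) - w * w)"
      by (simp add: det_2 Mi power2_eq_square algebra_simps)
    also have "c * (\<beta> * cnj \<beta>) - w * w = c"
      unfolding w2 by (simp add: complex_norm_square[symmetric] algebra_simps)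
    finally show ?thesis .
  qed
  ultimately show ?thesis
    unfolding tetrablock_def by (intro CollectI exI[of _ M]) (simp add: Mi)
qed

lemma boundary_point_in_closure:
  assumes c: "cmod c = 1" and b: "cmod \<beta> \<le> 1"
  shows "(cnj \<beta> * c, \<beta>, c) \<in> closure tetrablock"
  unfolding closure_sequential
proof (intro exI conjI allI)
  define r where "r n = 1 - 1 / real (Suc n)" for n
  have r: "r \<longlonglongrightarrow> 1"
    using tendsto_diff[OF tendsto_const LIMSEQ_inverse_real_of_nat, of 1] by (simp add: r_def[abs_def] inverse_eq_divide)
  show "(of_real (r n) * (cnj \<beta> * c), of_real (r n) * \<beta>, of_real ((r n)\<^sup>2) * c) \<in> tetrablock" for n
    by (rule scaled_boundary_point_in_tetrablock[OF c b]) (simp_all add: r_def)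
  have "(\<lambda>n. (of_real (r n) * (cnj \<beta> * c), of_real (r n) * \<beta>, of_real ((r n)\<^sup>2) * c))
      \<longlonglongrightarrow> (of_real 1 * (cnj \<beta> * c), of_real 1 * \<beta>, of_real (1\<^sup>2) * c)"
    by (intro tendsto_intros r)
  then show "(\<lambda>n. (of_real (r n) * (cnj \<beta> * c), of_real (r n) * \<beta>, of_real ((r n)\<^sup>2) * c))
      \<longlonglongrightarrow> (cnj \<beta> * c, \<beta>, c)" by simp
qed

section \<open>Entire functions of three variables as test functions in the algebra\<close>

definition holo3 :: "(complex \<times> complex \<times> complex \<Rightarrow> complex) \<Rightarrow> bool" where
  "holo3 f \<longleftrightarrow> (\<forall>z. \<exists>d1 d2 d3.
    (f has_derivative (\<lambda>(h1, h2, h3). d1 * h1 + d2 * h2 + d3 * h3)) (at z))"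

lemma holo3_in_algebra: "holo3 f \<Longrightarrow> f \<in> tetrablock_algebra"
proof -
  assume h: "holo3 f"
  have "isCont f z" for z
    using h has_derivative_continuous unfolding holo3_def by blast
  then have "continuous_on (closure tetrablock) f"
    by (intro continuous_at_imp_continuous_on) blast
  with h show ?thesis unfolding holo3_def tetrablock_algebra_def by blast
qed

lemma holo3_const: "holo3 (\<lambda>_. c)"
proof -
  have "((\<lambda>_. c) has_derivative (\<lambda>(h1, h2, h3). 0 * h1 + 0 * h2 + 0 * h3)) (at z)"
    for z :: "complex \<times> complex \<times> complex"
    by (rule has_derivative_eq_rhs[OF has_derivative_const]) auto
  then show ?thesis unfolding holo3_def by blast
qed

lemma holo3_coord: "holo3 fst" "holo3 (\<lambda>x. fst (snd x))" "holo3 (\<lambda>x. snd (snd x))"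
proof -
  have "(fst has_derivative (\<lambda>(h1, h2, h3). 1 * h1 + 0 * h2 + 0 * h3)) (at z)"
    "((\<lambda>x. fst (snd x)) has_derivative (\<lambda>(h1, h2, h3). 0 * h1 + 1 * h2 + 0 * h3)) (at z)"
    "((\<lambda>x. snd (snd x)) has_derivative (\<lambda>(h1, h2, h3). 0 * h1 + 0 * h2 + 1 * h3)) (at z)"
    for z :: "complex \<times> complex \<times> complex"
    by (auto intro!: derivative_eq_intros simp: case_prod_beta)
  then show "holo3 fst" "holo3 (\<lambda>x. fst (snd x))" "holo3 (\<lambda>x. snd (snd x))"
    unfolding holo3_def by blast+
qed

lemma holo3_diff:
  assumes "holo3 f" "holo3 g"
  shows "holo3 (\<lambda>x. f x - g x)"
  unfolding holo3_def
proof
  fix z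
  obtain a1 a2 a3 b1 b2 b3 where
    f: "(f has_derivative (\<lambda>(h1, h2, h3). a1 * h1 + a2 * h2 + a3 * h3)) (at z)" and
    g: "(g has_derivative (\<lambda>(h1, h2, h3). b1 * h1 + b2 * h2 + b3 * h3)) (at z)"
    using assms unfolding holo3_def by metis
  have "((\<lambda>x. f x - g x) has_derivative
      (\<lambda>(h1, h2, h3). (a1 - b1) * h1 + (a2 - b2) * h2 + (a3 - b3) * h3)) (at z)"
    by (rule has_derivative_eq_rhs[OF has_derivative_diff[OF f g]]) (auto simp: fun_eq_iff algebra_simps)
  then show "\<exists>d1 d2 d3. ((\<lambda>x. f x - g x) has_derivative (\<lambda>(h1, h2, h3). d1 * h1 + d2 * h2 + d3 * h3)) (at z)"
    by blast
qed

lemma holo3_mult: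
  assumes "holo3 f" "holo3 g"
  shows "holo3 (\<lambda>x. f x * g x)"
  unfolding holo3_def
proof
  fix z
  obtain a1 a2 a3 b1 b2 b3 where
    f: "(f has_derivative (\<lambda>(h1, h2, h3). a1 * h1 + a2 * h2 + a3 * h3)) (at z)" and
    g: "(g has_derivative (\<lambda>(h1, h2, h3). b1 * h1 + b2 * h2 + b3 * h3)) (at z)"
    using assms unfolding holo3_def by metis
  have "((\<lambda>x. f x * g x) has_derivative
      (\<lambda>(h1, h2, h3). (f z * b1 + a1 * g z) * h1 + (f z * b2 + a2 * g z) * h2 + (f z * b3 + a3 * g z) * h3)) (at z)"
    by (rule has_derivative_eq_rhs[OF has_derivative_mult[OF f g]]) (auto simp: fun_eq_iff algebra_simps)
  then show "\<exists>d1 d2 d3. ((\<lambda>x. f x * g x) has_derivative (\<lambda>(h1, h2, h3). d1 * h1 + d2 * h2 + d3 * h3)) (at z)"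
    by blast
qed

lemma holo3_power: "holo3 f \<Longrightarrow> holo3 (\<lambda>x. f x ^ n)"
  by (induction n) (auto intro: holo3_const holo3_mult)

text \<open>On \<open>x\<^sub>3 = c\<close> the closed tetrablock consists of the points \<open>(c\<beta>\<^sup>*, \<beta>, c)\<close>, where
  \<open>g = 1 - \<bar>x\<^sub>2 - \<beta>\<^sub>0\<bar>\<^sup>2 / 8\<close> is the restriction of a polynomial. The factor \<open>((1 + c\<^sup>* x\<^sub>3) / 2)\<^sup>N\<close>
  makes the rest of the closed tetrablock irrelevant.\<close>

theorem boundary_point_in_distinguished_boundary:
  assumes c: "cmod c = 1" and b: "cmod \<beta> \<le> 1"
  shows "(cnj \<beta> * c, \<beta>, c) \<in> distinguished_boundary"
  unfolding distinguished_boundary_def shilov_boundary_def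
proof (rule InterI, rule ccontr)
  let ?X = "closure tetrablock" and ?b = "(cnj \<beta> * c, \<beta>, c)"
  fix C assume "C \<in> {C. C \<subseteq> ?X \<and> closed C \<and> (\<forall>f\<in>tetrablock_algebra. \<forall>z\<in>?X. \<exists>w\<in>C. cmod (f z) \<le> cmod (f w))}"
  then have C: "C \<subseteq> ?X" "closed C" and norming: "\<And>f z. f \<in> tetrablock_algebra \<Longrightarrow> z \<in> ?X \<Longrightarrow> \<exists>w\<in>C. cmod (f z) \<le> cmod (f w)"
    by auto
  assume notin: "?b \<notin> C"
  have cc: "cnj c * c = 1" using c by (simp add: complex_norm_square[symmetric] mult.commute)
  \<comment> \<open>\<open>h = (1 + cnj c * x3) / 2\<close>, of modulus at most 1 on the closed
    tetrablock and equal to 1 exactly where \<open>x3 = c\<close> there.\<close>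
  define h where "h x = (1 / 2) * (1 - (- cnj c) * snd (snd x))" for x :: "complex \<times> complex \<times> complex"
  \<comment> \<open>On \<open>x3 = c\<close> the factor \<open>cnj c * x1 - cnj \<beta>\<close> is
    the conjugate of \<open>x2 - \<beta>\<close>. Since \<open>|x2 - \<beta>| ^ 2 \<le> 4\<close>,
    the constant \<open>1 / 8\<close> keeps \<open>g\<close> between \<open>1 / 2\<close> and
    1.\<close>
  define g where "g x = 1 - (1 / 8) * ((fst (snd x) - \<beta>) * (cnj c * fst x - cnj \<beta>))"
    for x :: "complex \<times> complex \<times> complex"
  have hg: "holo3 h" "holo3 g"
    unfolding h_def[abs_def] g_def[abs_def]
    by (intro holo3_mult holo3_diff holo3_const holo3_coord)+
  have h1: "cmod (h x) \<le> 1" if "x \<in> ?X" for x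
  proof -
    have "cmod (1 - (- cnj c) * snd (snd x)) \<le> cmod 1 + cmod ((- cnj c) * snd (snd x))" by (rule norm_triangle_ineq4)
    also have "\<dots> \<le> 2" using closure_tetrablock_le_one[of "fst x" "fst (snd x)" "snd (snd x)"] that c
      by (simp add: norm_mult)
    finally show ?thesis by (simp add: h_def norm_mult)
  qed
  have g_lt: "cmod (g x) < 1" if x: "x \<in> C" and "cmod (h x) = 1" for x
  proof -
    obtain x1 x2 x3 where xx: "x = (x1, x2, x3)" by (cases x)
    have xX: "(x1, x2, x3) \<in> ?X" using x C xx by auto
    have "cmod (1 + cnj c * x3) = 2" using that(2) by (simp add: h_def xx norm_mult)
    moreover have "cmod (cnj c * x3) \<le> 1" using closure_tetrablock_le_one[OF xX] c by (simp add: norm_mult)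
    \<comment> \<open>Equality in the triangle inequality, exploited through the parallelogram law
      for 1 and \<open>cnj c * x3\<close>.\<close>
    ultimately have "(cmod (cnj c * x3 - 1))\<^sup>2 \<le> 0"
    proof -
      let ?y = "cnj c * x3"
      assume "cmod (1 + ?y) = 2" "cmod ?y \<le> 1"
      then have "(cmod (1 + ?y))\<^sup>2 = 4" "(cmod ?y)\<^sup>2 \<le> 1" by (simp_all add: power_le_one)
      moreover have "(cmod (1 + ?y))\<^sup>2 + (cmod (?y - 1))\<^sup>2 = 2 + 2 * (cmod ?y)\<^sup>2"
        unfolding cmod_power2 by (simp add: power2_eq_square algebra_simps)
      ultimately show ?thesis by linarith
    qed
    then have "cnj c * x3 = 1" by simp
    then have x3: "x3 = c" using c cc by (metis mult.assoc mult.commute mult_1_left mult_1_right)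
    have x1: "x1 = cnj x2 * c" using closure_tetrablock_unimodular[OF xX] c x3 by simp
    have "cnj c * x1 = cnj x2" using cc by (simp add: x1 mult.left_commute)
    then have gx: "g x = of_real (1 - (cmod (x2 - \<beta>))\<^sup>2 / 8)"
    proof -
      have "g x = 1 - (1 / 8) * ((x2 - \<beta>) * cnj (x2 - \<beta>))"
        using \<open>cnj c * x1 = cnj x2\<close> by (simp add: g_def xx)
      then show ?thesis unfolding complex_norm_square[symmetric] by simp
    qed
    have ne: "x2 \<noteq> \<beta>" using notin x xx x1 x3 by auto
    have "cmod (x2 - \<beta>) \<le> cmod x2 + cmod \<beta>" by (rule norm_triangle_ineq4)
    also have "\<dots> \<le> 2" using closure_tetrablock_le_one[OF xX] b by simp
    finally have "(cmod (x2 - \<beta>))\<^sup>2 \<le> 2\<^sup>2" by (intro power_mono) auto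
    moreover have "0 < (cmod (x2 - \<beta>))\<^sup>2" using ne by simp
    ultimately show ?thesis unfolding gx norm_of_real by simp
  qed
  have "compact C" using compact_closure_tetrablock C by (metis compact_Int_closed inf.absorb_iff2)
  have cont: "continuous_on A h" "continuous_on A g" for A
    unfolding h_def[abs_def] g_def[abs_def] by (intro continuous_intros)+
  have "bounded (g ` C)"
    by (intro compact_imp_bounded compact_continuous_image cont \<open>compact C\<close>)
  then obtain G where G: "0 < G" "\<And>x. x \<in> C \<Longrightarrow> cmod (g x) \<le> G"
    unfolding bounded_pos by auto
  \<comment> \<open>A point where \<open>|h ^ N * g|\<close> reaches 1 must lie in \<open>K\<close>.
    On this compact set \<open>|h|\<close> stays below a bound less than 1, so such points cannot
    exist for large \<open>N\<close>.\<close>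
  define K where "K = C \<inter> {x. 1 \<le> cmod (g x)}"
  have "closed {x. 1 \<le> cmod (g x)}"
    by (intro closed_Collect_le continuous_intros cont)
  then have K: "compact K" unfolding K_def by (rule compact_Int_closed[OF \<open>compact C\<close>])
  have bX: "?b \<in> ?X" by (rule boundary_point_in_closure[OF c b])
  have "\<exists>w\<in>C. 1 \<le> cmod (h w) ^ N * cmod (g w)" for N
  proof -
    have "(\<lambda>x. h x ^ N * g x) \<in> tetrablock_algebra"
      by (intro holo3_in_algebra holo3_mult holo3_power hg)
    from norming[OF this bX] obtain w where "w \<in> C" "cmod (h ?b ^ N * g ?b) \<le> cmod (h w ^ N * g w)" by blast
    moreover have "h ?b = 1" "g ?b = 1" using cc by (simp_all add: h_def g_def)
    ultimately show ?thesis by (auto simp: norm_mult norm_power)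
  qed
  then obtain w where w: "\<And>N. w N \<in> C" "\<And>N. 1 \<le> cmod (h (w N)) ^ N * cmod (g (w N))" by metis
  have wK: "w N \<in> K" for N
  proof -
    have "1 \<le> cmod (h (w N)) ^ N * cmod (g (w N))" by (rule w)
    also have "\<dots> \<le> 1 * cmod (g (w N))"
    proof (intro mult_right_mono power_le_one)
      show "cmod (h (w N)) \<le> 1" using h1[of "w N"] w(1)[of N] C(1) by blast
    qed auto
    finally show ?thesis using w(1) by (simp add: K_def)
  qed
  then obtain y where y: "y \<in> K" "\<And>x. x \<in> K \<Longrightarrow> cmod (h x) \<le> cmod (h y)"
    using continuous_attains_sup[OF K, of "\<lambda>x. cmod (h x)"] cont(1) continuous_on_norm by blast
  have hy: "cmod (h y) < 1"
  proof -
    have "y \<in> C" "1 \<le> cmod (g y)" using y(1) by (auto simp: K_def)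
    then show ?thesis using h1[of y] g_lt[of y] C(1) by fastforce
  qed
  have "(\<lambda>N. cmod (h y) ^ N * G) \<longlonglongrightarrow> 0 * G"
    by (intro tendsto_intros LIMSEQ_power_zero) (use hy in simp)
  then have "\<forall>\<^sub>F N in sequentially. cmod (h y) ^ N * G < 1"
    by (intro order_tendstoD(2)) auto
  then obtain N where N: "cmod (h y) ^ N * G < 1" by (auto simp: eventually_sequentially)
  have "cmod (h (w N)) ^ N * cmod (g (w N)) \<le> cmod (h y) ^ N * G"
    using y(2)[OF wK] G w(1) by (intro mult_mono power_mono) auto
  with N w(2)[of N] show False by simp
qed

lemma distinguished_boundary_subset: "distinguished_boundary \<subseteq> closure tetrablock"
  unfolding distinguished_boundary_def shilov_boundary_def by (rule Inter_lower) auto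

section \<open>Tetrablock contractions and unitaries\<close>

lemma bapp_ext_UNIV: "operator_on UNIV T \<Longrightarrow> bapp (ext UNIV T) = T"
  by (simp add: fun_eq_iff bapp_ext)

section \<open>Affine polynomials and linear fractions of a triple\<close>

definition linpoly :: "complex \<Rightarrow> complex \<Rightarrow> complex \<Rightarrow> complex \<Rightarrow> poly3" where
  "linpoly c0 c1 c2 c3 = Poly_Mapping.single (0, 0, 0) c0 + Poly_Mapping.single (1, 0, 0) c1
    + Poly_Mapping.single (0, 1, 0) c2 + Poly_Mapping.single (0, 0, 1) c3"

lemma linpoly_keys: "Poly_Mapping.keys (linpoly c0 c1 c2 c3) \<subseteq> {(0,0,0), (1,0,0), (0,1,0), (0,0,1)}"
  by (auto simp: in_keys_iff linpoly_def lookup_add lookup_single when_def split: if_splits)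

lemma linpoly_lookup:
  "Poly_Mapping.lookup (linpoly c0 c1 c2 c3) (0, 0, 0) = c0"
  "Poly_Mapping.lookup (linpoly c0 c1 c2 c3) (Suc 0, 0, 0) = c1"
  "Poly_Mapping.lookup (linpoly c0 c1 c2 c3) (0, Suc 0, 0) = c2"
  "Poly_Mapping.lookup (linpoly c0 c1 c2 c3) (0, 0, Suc 0) = c3"
  by (simp_all add: linpoly_def lookup_add lookup_single)

lemma linpoly_sum:
  fixes f :: "nat \<times> nat \<times> nat \<Rightarrow> complex \<Rightarrow> 'a::comm_monoid_add"
  assumes "\<And>k. f k 0 = 0"
  shows "(\<Sum>k\<in>Poly_Mapping.keys (linpoly c0 c1 c2 c3). f k (Poly_Mapping.lookup (linpoly c0 c1 c2 c3) k))
    = f (0,0,0) c0 + f (1,0,0) c1 + f (0,1,0) c2 + f (0,0,1) c3"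
proof -
  have "(\<Sum>k\<in>Poly_Mapping.keys (linpoly c0 c1 c2 c3). f k (Poly_Mapping.lookup (linpoly c0 c1 c2 c3) k))
      = (\<Sum>k\<in>{(0,0,0), (1,0,0), (0,1,0), (0,0,1)}. f k (Poly_Mapping.lookup (linpoly c0 c1 c2 c3) k))"
    by (rule sum.mono_neutral_left) (use linpoly_keys assms in \<open>auto simp: in_keys_iff\<close>)
  then show ?thesis by (simp add: linpoly_lookup add.assoc)
qed

lemma poly3_eval_linpoly:
  "poly3_eval (linpoly c0 c1 c2 c3) (z1, z2, z3) = c0 + c1 * z1 + c2 * z2 + c3 * z3"
  using linpoly_sum[of "\<lambda>(i, j, k) c. c * z1 ^ i * z2 ^ j * z3 ^ k" c0 c1 c2 c3]
  by (simp add: poly3_eval_def case_prod_beta)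

lemma poly3_op_linpoly:
  "poly3_op (linpoly c0 c1 c2 c3) T1 T2 T3 x = c0 *\<^sub>C x + c1 *\<^sub>C T1 x + c2 *\<^sub>C T2 x + c3 *\<^sub>C T3 x"
  using linpoly_sum[of "\<lambda>(i, j, k) c. c *\<^sub>C (T1 ^^ i) ((T2 ^^ j) ((T3 ^^ k) x))" c0 c1 c2 c3]
  by (simp add: poly3_op_def case_prod_beta)

text \<open>The rational function is evaluated at the vector \<open>q(T) x\<close>, where the
  inverse function returns \<open>x\<close> as soon as \<open>q(T)\<close> is injective.\<close>

lemma spectral_set_linear_fraction:
  assumes K: "spectral_set K UNIV T1 T2 T3" "K \<noteq> {}"
    and q0: "\<And>z1 z2 z3. (z1, z2, z3) \<in> K \<Longrightarrow> b0 + b1 * z1 + b2 * z2 + b3 * z3 \<noteq> 0"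
    and le: "\<And>z1 z2 z3. (z1, z2, z3) \<in> K \<Longrightarrow>
      cmod (a0 + a1 * z1 + a2 * z2 + a3 * z3) \<le> cmod (b0 + b1 * z1 + b2 * z2 + b3 * z3)"
    and inj: "inj (\<lambda>x. b0 *\<^sub>C x + b1 *\<^sub>C T1 x + b2 *\<^sub>C T2 x + b3 *\<^sub>C T3 x)"
  shows "norm (a0 *\<^sub>C x + a1 *\<^sub>C T1 x + a2 *\<^sub>C T2 x + a3 *\<^sub>C T3 x)
    \<le> norm (b0 *\<^sub>C x + b1 *\<^sub>C T1 x + b2 *\<^sub>C T2 x + b3 *\<^sub>C T3 x)"
proof -
  let ?p = "linpoly a0 a1 a2 a3" and ?q = "linpoly b0 b1 b2 b3"
  have qop: "poly3_op ?q T1 T2 T3 = (\<lambda>x. b0 *\<^sub>C x + b1 *\<^sub>C T1 x + b2 *\<^sub>C T2 x + b3 *\<^sub>C T3 x)"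
    by (simp add: fun_eq_iff poly3_op_linpoly)
  have ne: "poly3_eval ?q z \<noteq> 0" if "z \<in> K" for z
    using that q0 by (cases z) (simp add: poly3_eval_linpoly)
  have le1: "cmod (poly3_eval ?p z / poly3_eval ?q z) \<le> 1" if "z \<in> K" for z
    using that ne[OF that] le by (cases z) (simp add: poly3_eval_linpoly norm_divide divide_le_eq)
  let ?y = "poly3_op ?q T1 T2 T3 x"
  have "norm (rational3_op UNIV ?p ?q T1 T2 T3 ?y) \<le> (SUP z\<in>K. cmod (poly3_eval ?p z / poly3_eval ?q z)) * norm ?y"
    using K(1) ne unfolding spectral_set_def by blast
  also have "\<dots> \<le> 1 * norm ?y"
    by (intro mult_right_mono cSUP_least K(2) le1) auto
  also have "rational3_op UNIV ?p ?q T1 T2 T3 ?y = poly3_op ?p T1 T2 T3 x"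
    using inv_f_f[OF inj, of x] unfolding rational3_op_def qop by simp
  finally show ?thesis by (simp add: poly3_op_linpoly)
qed

lemma closure_tetrablock_nonempty: "closure tetrablock \<noteq> {}"
  using zero_in_tetrablock by auto

context
  fixes A B P :: "'h::chilbert_space bop"
  assumes contr: "tetrablock_contraction UNIV (bapp A) (bapp B) (bapp P)"
begin

lemma contraction_spectral_set: "spectral_set (closure tetrablock) UNIV (bapp A) (bapp B) (bapp P)"
  using contr by (simp add: tetrablock_contraction_def)

lemma contraction_commute: "A * B = B * A" "A * P = P * A" "B * P = P * B"
  using contr
  by (auto simp: tetrablock_contraction_def commuting_triple_on_def commutator_def intro!: bop_eqI)

lemma contraction_norm_le:
  "norm (A *\<^sub>V x) \<le> norm x" "norm (B *\<^sub>V x) \<le> norm x"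
proof -
  note lf = spectral_set_linear_fraction[OF contraction_spectral_set closure_tetrablock_nonempty,
      where ?b0.0 = 1 and ?b1.0 = 0 and ?b2.0 = 0 and ?b3.0 = 0]
  show "norm (A *\<^sub>V x) \<le> norm x"
    using lf[where ?a0.0 = 0 and ?a1.0 = 1 and ?a2.0 = 0 and ?a3.0 = 0 and x = x] closure_tetrablock_le_one by (simp add: inj_def)
  show "norm (B *\<^sub>V x) \<le> norm x"
    using lf[where ?a0.0 = 0 and ?a1.0 = 0 and ?a2.0 = 1 and ?a3.0 = 0 and x = x] closure_tetrablock_le_one by (simp add: inj_def)
qed

text \<open>For \<open>|z| < 1\<close> the denominators are zero-free on the closed tetrablock and
  the corresponding operators injective. Both can fail on the unit circle, which
  \<open>contraction_ineq\<close> reaches by a radial limit.\<close>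

lemma contraction_ineq_interior:
  assumes z: "cmod z < 1"
  shows "norm (A *\<^sub>V x - z *\<^sub>C (P *\<^sub>V x)) \<le> norm (x - z *\<^sub>C (B *\<^sub>V x))"
    "norm (B *\<^sub>V x - z *\<^sub>C (P *\<^sub>V x)) \<le> norm (x - z *\<^sub>C (A *\<^sub>V x))"
proof -
  note lf = spectral_set_linear_fraction[OF contraction_spectral_set closure_tetrablock_nonempty]
  have ne: "1 - z * w \<noteq> 0" if "cmod w \<le> 1" for w
  proof
    assume "1 - z * w = 0"
    then have "cmod z * cmod w = 1" by (simp add: norm_mult[symmetric])
    moreover have "cmod z * cmod w \<le> cmod z * 1" using that by (intro mult_left_mono) auto
    ultimately show False using z by simp
  qed
  have inj: "inj (\<lambda>x. x - z *\<^sub>C (T *\<^sub>V x))" if T: "\<And>x. norm (T *\<^sub>V x) \<le> norm x" for T :: "'h bop"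
  proof (rule injI)
    fix x y assume "x - z *\<^sub>C (T *\<^sub>V x) = y - z *\<^sub>C (T *\<^sub>V y)"
    then have e: "x - y = z *\<^sub>C (T *\<^sub>V (x - y))"
      by (simp add: bapp_diff scaleC_diff_right algebra_simps)
    have "norm (x - y) = cmod z * norm (T *\<^sub>V (x - y))" by (subst e) (rule norm_scaleC)
    also have "\<dots> \<le> cmod z * norm (x - y)" by (intro mult_left_mono T) simp
    finally have "(1 - cmod z) * norm (x - y) \<le> 0" by (simp add: algebra_simps)
    then show "x = y" using z by (simp add: mult_le_0_iff)
  qed
  show "norm (A *\<^sub>V x - z *\<^sub>C (P *\<^sub>V x)) \<le> norm (x - z *\<^sub>C (B *\<^sub>V x))"
    using lf[where ?b0.0 = 1 and ?b1.0 = 0 and ?b2.0 = "- z" and ?b3.0 = 0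
        and ?a0.0 = 0 and ?a1.0 = 1 and ?a2.0 = 0 and ?a3.0 = "- z" and x = x]
      closure_tetrablock_le_one closure_tetrablock_ineq[of _ _ _ z] ne z inj[OF contraction_norm_le(2)]
    by (simp add: scaleC_minus_left)
  show "norm (B *\<^sub>V x - z *\<^sub>C (P *\<^sub>V x)) \<le> norm (x - z *\<^sub>C (A *\<^sub>V x))"
    using lf[where ?b0.0 = 1 and ?b1.0 = "- z" and ?b2.0 = 0 and ?b3.0 = 0
        and ?a0.0 = 0 and ?a1.0 = 0 and ?a2.0 = 1 and ?a3.0 = "- z" and x = x]
      closure_tetrablock_le_one closure_tetrablock_ineq[of _ _ _ z] ne z inj[OF contraction_norm_le(1)]
    by (simp add: scaleC_minus_left)
qed

lemma contraction_ineq: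
  assumes z: "cmod z = 1"
  shows "norm (A *\<^sub>V x - z *\<^sub>C (P *\<^sub>V x)) \<le> norm (x - z *\<^sub>C (B *\<^sub>V x))"
    "norm (B *\<^sub>V x - z *\<^sub>C (P *\<^sub>V x)) \<le> norm (x - z *\<^sub>C (A *\<^sub>V x))"
proof -
  define r where "r n = 1 - 1 / real (Suc n)" for n
  have r: "r \<longlonglongrightarrow> 1"
    using tendsto_diff[OF tendsto_const LIMSEQ_inverse_real_of_nat, of 1]
    by (simp add: r_def[abs_def] inverse_eq_divide)
  have lim: "(\<lambda>n. norm (u - r n *\<^sub>R (z *\<^sub>C v))) \<longlonglongrightarrow> norm (u - z *\<^sub>C v)" for u v :: 'h
    using tendsto_norm[OF tendsto_diff[OF tendsto_const tendsto_scaleR[OF r tendsto_const]], of u "z *\<^sub>C v"] by simp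
  have "0 \<le> r n" "r n < 1" for n by (simp_all add: r_def)
  then have rz: "cmod (of_real (r n) * z) < 1" for n by (simp add: norm_mult z)
  have i: "norm (A *\<^sub>V x - r n *\<^sub>R (z *\<^sub>C (P *\<^sub>V x))) \<le> norm (x - r n *\<^sub>R (z *\<^sub>C (B *\<^sub>V x)))"
    "norm (B *\<^sub>V x - r n *\<^sub>R (z *\<^sub>C (P *\<^sub>V x))) \<le> norm (x - r n *\<^sub>R (z *\<^sub>C (A *\<^sub>V x)))" for n
    using contraction_ineq_interior[OF rz[of n], of x] by (simp_all add: scaleR_scaleC scaleC_scaleC)
  show "norm (A *\<^sub>V x - z *\<^sub>C (P *\<^sub>V x)) \<le> norm (x - z *\<^sub>C (B *\<^sub>V x))"
    by (rule LIMSEQ_le[OF lim lim]) (use i in blast)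
  show "norm (B *\<^sub>V x - z *\<^sub>C (P *\<^sub>V x)) \<le> norm (x - z *\<^sub>C (A *\<^sub>V x))"
    by (rule LIMSEQ_le[OF lim lim]) (use i in blast)
qed

end

lemma norm_diff_scaleC_sq:
  "(norm (u - z *\<^sub>C w))\<^sup>2 = (norm u)\<^sup>2 + (cmod z)\<^sup>2 * (norm w)\<^sup>2 - 2 * Re (z * cinner w u)"
proof -
  have "complex_of_real ((norm (u - z *\<^sub>C w))\<^sup>2)
      = of_real ((norm u)\<^sup>2) + of_real ((cmod z)\<^sup>2) * of_real ((norm w)\<^sup>2) - (z * cinner w u + cnj (z * cinner w u))"
    using cinner_commute[of u w] complex_norm_square[of z]
    by (simp only: cinner_self[symmetric] cinner_diff_left cinner_diff_right cinner_scaleC_left cinner_scaleC_right)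
      (simp add: algebra_simps)
  also have "\<dots> = complex_of_real ((norm u)\<^sup>2 + (cmod z)\<^sup>2 * (norm w)\<^sup>2 - 2 * Re (z * cinner w u))"
    by (simp add: complex_eq_iff)
  finally show ?thesis by (simp only: of_real_eq_iff)
qed

text \<open>The vector counterpart of \<open>closure_tetrablock_gap\<close>: square, isolate the
  term linear in \<open>z\<close>, rotate.\<close>

lemma form_gap:
  assumes "\<And>z. cmod z = 1 \<Longrightarrow> norm (u - z *\<^sub>C w) \<le> norm (y - z *\<^sub>C v)"
  shows "cmod (cinner v y - cinner w u) \<le> ((norm y)\<^sup>2 + (norm v)\<^sup>2 - (norm u)\<^sup>2 - (norm w)\<^sup>2) / 2"
proof (rule cmod_le_if_Re_rotations_le)
  fix z assume z: "cmod z = 1"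
  have "(norm (u - z *\<^sub>C w))\<^sup>2 \<le> (norm (y - z *\<^sub>C v))\<^sup>2" by (intro power_mono assms z) simp
  then have "(norm u)\<^sup>2 + (norm w)\<^sup>2 - 2 * Re (z * cinner w u) \<le> (norm y)\<^sup>2 + (norm v)\<^sup>2 - 2 * Re (z * cinner v y)"
    by (simp only: norm_diff_scaleC_sq z power_one mult_1_left)
  moreover have "Re (z * (cinner v y - cinner w u)) = Re (z * cinner v y) - Re (z * cinner w u)"
    by (simp only: right_diff_distrib minus_complex.simps)
  ultimately show "Re (z * (cinner v y - cinner w u)) \<le> ((norm y)\<^sup>2 + (norm v)\<^sup>2 - (norm u)\<^sup>2 - (norm w)\<^sup>2) / 2"
    by argo
qed

text \<open>In the sum of the two gaps the norms of \<open>A x\<close> and \<open>B x\<close>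
  cancel. The left-hand terms are the forms of \<open>B - adj A * P\<close> and
  \<open>A - adj B * P\<close>, and the right-hand side is the form of
  \<open>1 - adj P * P\<close>.\<close>

lemma contraction_form_gap:
  fixes A B P :: "'h::chilbert_space bop"
  assumes "tetrablock_contraction UNIV (bapp A) (bapp B) (bapp P)"
  shows "cmod (cinner (B *\<^sub>V x) x - cinner (P *\<^sub>V x) (A *\<^sub>V x)) + cmod (cinner (A *\<^sub>V x) x - cinner (P *\<^sub>V x) (B *\<^sub>V x))
    \<le> (norm x)\<^sup>2 - (norm (P *\<^sub>V x))\<^sup>2"
proof -
  have "cmod (cinner (B *\<^sub>V x) x - cinner (P *\<^sub>V x) (A *\<^sub>V x))
      \<le> ((norm x)\<^sup>2 + (norm (B *\<^sub>V x))\<^sup>2 - (norm (A *\<^sub>V x))\<^sup>2 - (norm (P *\<^sub>V x))\<^sup>2) / 2"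
    by (rule form_gap) (rule contraction_ineq(1)[OF assms])
  moreover have "cmod (cinner (A *\<^sub>V x) x - cinner (P *\<^sub>V x) (B *\<^sub>V x))
      \<le> ((norm x)\<^sup>2 + (norm (A *\<^sub>V x))\<^sup>2 - (norm (B *\<^sub>V x))\<^sup>2 - (norm (P *\<^sub>V x))\<^sup>2) / 2"
    by (rule form_gap) (rule contraction_ineq(2)[OF assms])
  ultimately show ?thesis by argo
qed

lemma ext_shift:
  assumes "operator_on L U" "x \<in> L"
  shows "(ext L U - bscal z * bproj L) *\<^sub>V x = U x - z *\<^sub>C x"
  using assms by (simp add: bapp_ext bproj_id operator_onD(1))

lemma nrm_shift:
  assumes n: "nrm u" and p: "u * p = u" "p * u = u" "adj p = p" "p * p = p"
  shows "nrm (u - bscal z * p)"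
proof -
  have q: "p * adj u = adj u" "adj u * p = adj u"
    using arg_cong[OF p(1), of adj] arg_cong[OF p(2), of adj] p(3) by simp_all
  have s: "x * (bscal c * y) = bscal c * (x * y)" for x y :: "'a bop" and c
    by (metis bscal_commute mult.assoc)
  have ad: "adj (u - bscal z * p) = adj u - bscal (cnj z) * p"
    using p(3) by (simp add: bscal_commute)
  show ?thesis
    unfolding nrm_def ad
    by (simp only: left_diff_distrib right_diff_distrib s[of u] s[of "adj u"] mult.assoc p q
        s[of p] n[unfolded nrm_def])
      (simp add: bscal_simps(1)[symmetric] mult.assoc[symmetric] mult.commute[of z])
qed

text \<open>On \<open>L\<close> the bound is Koszul exactness. On the complement the extensions
  vanish and the shifted operators are scalars. The two parts are orthogonal, so each is dominated
  by the whole.\<close>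

lemma unitary_bounded_below:
  fixes L :: "'a::chilbert_space set"
  assumes U: "tetrablock_unitary L U1 U2 U3" and z: "(z1, z2, z3) \<notin> closure tetrablock"
  shows "\<exists>\<delta>>0. \<forall>x. \<delta> * norm x \<le> norm (ext L U1 *\<^sub>V x - z1 *\<^sub>C x) + norm (ext L U2 *\<^sub>V x - z2 *\<^sub>C x)
    + norm (ext L U3 *\<^sub>V x - z3 *\<^sub>C x)"
proof -
  have n: "normal_on L U1" "normal_on L U2" "normal_on L U3"
    and ts: "taylor_spectrum L U1 U2 U3 \<subseteq> closure tetrablock"
    using U distinguished_boundary_subset by (auto simp: tetrablock_unitary_def)
  then have o: "operator_on L U1" "operator_on L U2" "operator_on L U3" by (auto simp: normal_on_def)
  note L = operator_onD(1)[OF o(1)]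
  have "koszul_exact L (\<lambda>x. U1 x - z1 *\<^sub>C x) (\<lambda>x. U2 x - z2 *\<^sub>C x) (\<lambda>x. U3 x - z3 *\<^sub>C x)"
    using ts z by (auto simp: taylor_spectrum_def)
  then have ex: "koszul_exact L (bapp (ext L U1 - bscal z1 * bproj L)) (bapp (ext L U2 - bscal z2 * bproj L))
      (bapp (ext L U3 - bscal z3 * bproj L))"
    by (rule iffD1[OF koszul_exact_cong[OF L], rotated -1]) (simp_all only: ext_shift[OF o(1)] ext_shift[OF o(2)] ext_shift[OF o(3)])
  have nm: "nrm (ext L U - bscal c * bproj L)" if "normal_on L U" for U c
  proof -
    have o: "operator_on L U" using that by (simp add: normal_on_def)
    show ?thesis
      by (rule nrm_shift[OF nrm_ext[OF that] ext_mult_bproj[OF o] bproj_mult_ext[OF o] adj_bproj[OF L] bproj_mult_self[OF L]])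
  qed
  obtain \<delta> where \<delta>0: "0 < \<delta>" and \<delta>1: "\<forall>x\<in>L. \<delta> * norm x \<le> norm ((ext L U1 - bscal z1 * bproj L) *\<^sub>V x)
      + norm ((ext L U2 - bscal z2 * bproj L) *\<^sub>V x) + norm ((ext L U3 - bscal z3 * bproj L) *\<^sub>V x)"
    using bounded_below_if_koszul_exact[OF L ex nm[OF n(1)] nm[OF n(2)] nm[OF n(3)]] by blast
  have \<delta>: "0 < \<delta>" "\<And>x. x \<in> L \<Longrightarrow> \<delta> * norm x \<le> norm (U1 x - z1 *\<^sub>C x) + norm (U2 x - z2 *\<^sub>C x) + norm (U3 x - z3 *\<^sub>C x)"
    using \<delta>0 bspec[OF \<delta>1] by (simp_all only: ext_shift[OF o(1)] ext_shift[OF o(2)] ext_shift[OF o(3)])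
  define l where "l = cmod z1 + cmod z2 + cmod z3"
  \<comment> \<open>The bound on the complement needs a nonzero \<open>z\<close>; the extension by
    zero does no harm since the origin lies in the tetrablock.\<close>
  have "\<not> (z1 = 0 \<and> z2 = 0 \<and> z3 = 0)"
    using z zero_in_tetrablock closure_subset by blast
  then have l: "0 < l" unfolding l_def by (smt (verit) norm_eq_zero norm_ge_zero)
  define d where "d = min \<delta> l / 2"
  have "d * norm x \<le> norm (ext L U1 *\<^sub>V x - z1 *\<^sub>C x) + norm (ext L U2 *\<^sub>V x - z2 *\<^sub>C x) + norm (ext L U3 *\<^sub>V x - z3 *\<^sub>C x)" for x
  proof -
    define y where "y = orth_proj L x"
    define w where "w = x - y"
    have y: "y \<in> L" by (simp add: y_def orth_proj_in[OF L])
    have w: "cinner m w = 0" if "m \<in> L" for m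
    proof -
      have "cinner w m = 0" unfolding w_def y_def by (rule orth_proj_orthogonal[OF L that])
      then show ?thesis by (subst cinner_commute) simp
    qed
    have b: "norm (U y - c *\<^sub>C y) \<le> norm (ext L U *\<^sub>V x - c *\<^sub>C x)" "cmod c * norm w \<le> norm (ext L U *\<^sub>V x - c *\<^sub>C x)"
      if "operator_on L U" for U c
    proof -
      have m: "U y - c *\<^sub>C y \<in> L"
        by (intro closed_csubspaceD(3,6)[OF L] operator_onD(2)[OF that] y)
      have e: "ext L U *\<^sub>V x - c *\<^sub>C x = (U y - c *\<^sub>C y) - c *\<^sub>C w"
        by (simp add: bapp_ext_proj[OF that] y_def w_def scaleC_diff_right)
      have "inner (U y - c *\<^sub>C y) (c *\<^sub>C w) = 0"
        using w[OF m] by (simp add: inner_eq_Re_cinner cinner_scaleC_right)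
      then have sq: "(norm (ext L U *\<^sub>V x - c *\<^sub>C x))\<^sup>2 = (norm (U y - c *\<^sub>C y))\<^sup>2 + (cmod c * norm w)\<^sup>2"
        unfolding e norm_scaleC[symmetric] power2_norm_eq_inner
        by (simp add: inner_diff_left[of _ "c *\<^sub>C w"] inner_diff_right[of _ _ "c *\<^sub>C w"] inner_commute)
      show "norm (U y - c *\<^sub>C y) \<le> norm (ext L U *\<^sub>V x - c *\<^sub>C x)"
        by (rule power2_le_imp_le) (simp_all add: sq)
      show "cmod c * norm w \<le> norm (ext L U *\<^sub>V x - c *\<^sub>C x)"
        by (rule power2_le_imp_le) (simp_all add: sq)
    qed
    let ?s = "norm (ext L U1 *\<^sub>V x - z1 *\<^sub>C x) + norm (ext L U2 *\<^sub>V x - z2 *\<^sub>C x) + norm (ext L U3 *\<^sub>V x - z3 *\<^sub>C x)"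
    have "\<delta> * norm y \<le> ?s" using \<delta>(2)[OF y] b(1)[OF o(1), of z1] b(1)[OF o(2), of z2] b(1)[OF o(3), of z3] by linarith
    moreover have "l * norm w \<le> ?s"
      using b(2)[OF o(1), of z1] b(2)[OF o(2), of z2] b(2)[OF o(3), of z3] by (simp add: l_def distrib_right)
    moreover have "min \<delta> l * norm x \<le> \<delta> * norm y + l * norm w"
    proof -
      have "norm x \<le> norm y + norm w" using norm_triangle_ineq[of y w] by (simp add: w_def)
      then have "min \<delta> l * norm x \<le> min \<delta> l * (norm y + norm w)" using \<delta>(1) l by (intro mult_left_mono) auto
      also have "\<dots> \<le> \<delta> * norm y + l * norm w" unfolding distrib_left by (intro add_mono mult_right_mono) auto
      finally show ?thesis .
    qed
    ultimately show ?thesis by (simp add: d_def)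
  qed
  moreover have "0 < d" using \<delta>(1) l by (simp add: d_def)
  ultimately show ?thesis by blast
qed

lemma unitary_ineq:
  fixes L :: "'a::chilbert_space set"
  assumes U: "tetrablock_unitary L U1 U2 U3" and x: "x \<in> L" and z: "cmod z = 1"
  shows "norm (U1 x - z *\<^sub>C U3 x) \<le> norm (x - z *\<^sub>C U2 x)" "norm (U2 x - z *\<^sub>C U3 x) \<le> norm (x - z *\<^sub>C U1 x)"
proof -
  have n: "normal_on L U1" "normal_on L U2" "normal_on L U3" and ct: "commuting_triple_on L U1 U2 U3"
    using U by (auto simp: tetrablock_unitary_def)
  then have o: "operator_on L U1" "operator_on L U2" "operator_on L U3" by (auto simp: normal_on_def)
  have c: "ext L U1 * ext L U2 = ext L U2 * ext L U1" "ext L U1 * ext L U3 = ext L U3 * ext L U1"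
    "ext L U2 * ext L U3 = ext L U3 * ext L U2"
    using ct by (auto intro!: ext_commute o simp: commuting_triple_on_def commutator_def)
  note js = joint_spectral_inequality[OF nrm_ext[OF n(1)] nrm_ext[OF n(2)] nrm_ext[OF n(3)] c
      unitary_bounded_below[OF U]]
  have "norm (lin3 (ext L U1) (ext L U2) (ext L U3) 0 1 0 (- z) *\<^sub>V x)
      \<le> norm (lin3 (ext L U1) (ext L U2) (ext L U3) 1 0 (- z) 0 *\<^sub>V x)"
    by (rule js) (use closure_tetrablock_ineq(1)[of _ _ _ z] z in simp_all)
  then show "norm (U1 x - z *\<^sub>C U3 x) \<le> norm (x - z *\<^sub>C U2 x)"
    by (simp add: lin3_def bapp_ext o x scaleC_minus_left)
  have "norm (lin3 (ext L U1) (ext L U2) (ext L U3) 0 0 1 (- z) *\<^sub>V x)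
      \<le> norm (lin3 (ext L U1) (ext L U2) (ext L U3) 1 (- z) 0 0 *\<^sub>V x)"
    by (rule js) (use closure_tetrablock_ineq(2)[of _ _ _ z] z in simp_all)
  then show "norm (U2 x - z *\<^sub>C U3 x) \<le> norm (x - z *\<^sub>C U1 x)"
    by (simp add: lin3_def bapp_ext o x scaleC_minus_left)
qed

text \<open>When the third component preserves norms, the two form gaps of the unitary extension are
  bounded by quantities with sum zero. Both vanish, and polarisation gives the relations.\<close>

lemma tetrablock_isometry_adjoint_relations:
  fixes t :: "'u::chilbert_space itself" and S :: "'k::complex_inner set"
  assumes iso: "tetrablock_isometry t S W1 W2 W3" and W3: "\<And>x. x \<in> S \<Longrightarrow> norm (W3 x) = norm x"
    and x: "x \<in> S" and y: "y \<in> S"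
  shows "cinner (W2 x) y = cinner (W3 x) (W1 y)" "cinner (W1 x) y = cinner (W3 x) (W2 y)"
proof -
  obtain L :: "'u set" and U1 U2 U3 J where U: "tetrablock_unitary L U1 U2 U3"
    and J: "isometric_embedding S L J"
    and JU: "\<And>x. x \<in> S \<Longrightarrow> U1 (J x) = J (W1 x) \<and> U2 (J x) = J (W2 x) \<and> U3 (J x) = J (W3 x)"
    and ct: "commuting_triple_on S W1 W2 W3"
    using iso unfolding tetrablock_isometry_def by blast
  have o: "operator_on S W1" "operator_on S W2" "operator_on S W3"
    using ct by (auto simp: commuting_triple_on_def)
  note S = operator_onD(1)[OF o(1)]
  have Ji: "cinner (J x) (J y) = cinner x y" "J x \<in> L" if "x \<in> S" "y \<in> S" for x y
    using J that by (auto simp: isometric_embedding_def)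
  have Jn: "norm (J x) = norm x" if "x \<in> S" for x
    using Ji(1)[OF that that] by (rule norm_eq_from_cinner)
  have form: "cinner (W2 x) x = cinner (W3 x) (W1 x)" "cinner (W1 x) x = cinner (W3 x) (W2 x)" if x: "x \<in> S" for x
  proof -
    have Wx: "W1 x \<in> S" "W2 x \<in> S" "W3 x \<in> S" using x operator_onD(2) o by blast+
    have JUx: "U1 (J x) = J (W1 x)" "U2 (J x) = J (W2 x)" "U3 (J x) = J (W3 x)" using JU[OF x] by auto
    have "norm (U3 (J x)) = norm (J x)" by (simp add: JUx Jn Wx x W3)
    then have g: "cmod (cinner (U2 (J x)) (J x) - cinner (U3 (J x)) (U1 (J x))) \<le> 0"
      "cmod (cinner (U1 (J x)) (J x) - cinner (U3 (J x)) (U2 (J x))) \<le> 0"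
    proof -
      have "cmod (cinner (U2 (J x)) (J x) - cinner (U3 (J x)) (U1 (J x)))
          \<le> ((norm (J x))\<^sup>2 + (norm (U2 (J x)))\<^sup>2 - (norm (U1 (J x)))\<^sup>2 - (norm (U3 (J x)))\<^sup>2) / 2"
        by (rule form_gap) (rule unitary_ineq(1)[OF U Ji(2)[OF x x]])
      moreover have "cmod (cinner (U1 (J x)) (J x) - cinner (U3 (J x)) (U2 (J x)))
          \<le> ((norm (J x))\<^sup>2 + (norm (U1 (J x)))\<^sup>2 - (norm (U2 (J x)))\<^sup>2 - (norm (U3 (J x)))\<^sup>2) / 2"
        by (rule form_gap) (rule unitary_ineq(2)[OF U Ji(2)[OF x x]])
      moreover note norm_ge_zero[of "cinner (U2 (J x)) (J x) - cinner (U3 (J x)) (U1 (J x))"]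
        norm_ge_zero[of "cinner (U1 (J x)) (J x) - cinner (U3 (J x)) (U2 (J x))"]
      ultimately show "cmod (cinner (U2 (J x)) (J x) - cinner (U3 (J x)) (U1 (J x))) \<le> 0"
        "cmod (cinner (U1 (J x)) (J x) - cinner (U3 (J x)) (U2 (J x))) \<le> 0"
        unfolding \<open>norm (U3 (J x)) = norm (J x)\<close> by argo+
    qed
    show "cinner (W2 x) x = cinner (W3 x) (W1 x)" "cinner (W1 x) x = cinner (W3 x) (W2 x)"
      using g by (simp_all add: JUx Ji Wx x)
  qed
  have id: "clinear_on S (\<lambda>x. x)" by (simp add: clinear_on_def)
  note lin = operator_onD(5)[OF o(1)] operator_onD(5)[OF o(2)] operator_onD(5)[OF o(3)]
  show "cinner (W2 x) y = cinner (W3 x) (W1 y)"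
    by (rule cinner_eq_from_form[OF lin(2,3) S _ id lin(1) x y]) (rule form)
  show "cinner (W1 x) y = cinner (W3 x) (W2 y)"
    by (rule cinner_eq_from_form[OF lin(1,3) S _ id lin(2) x y]) (rule form)
qed

text \<open>The \<open>R\<close> are the adjoints, given explicitly. A point off \<open>bE\<close>
  violates one of its defining conditions, and each violation gives a lower bound by hand, which
  makes the Koszul complex exact there.\<close>

lemma tetrablock_unitaryI:
  fixes L :: "'a::chilbert_space set"
  assumes o: "operator_on L U1" "operator_on L U2" "operator_on L U3"
    and r: "operator_on L R1" "operator_on L R2" "operator_on L R3"
    and adj: "\<And>x y. x \<in> L \<Longrightarrow> y \<in> L \<Longrightarrow> cinner (U1 x) y = cinner x (R1 y)"
      "\<And>x y. x \<in> L \<Longrightarrow> y \<in> L \<Longrightarrow> cinner (U2 x) y = cinner x (R2 y)"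
      "\<And>x y. x \<in> L \<Longrightarrow> y \<in> L \<Longrightarrow> cinner (U3 x) y = cinner x (R3 y)"
    and com: "\<And>X Y x. X \<in> {U1, U2, U3, R1, R2, R3} \<Longrightarrow> Y \<in> {U1, U2, U3, R1, R2, R3} \<Longrightarrow> x \<in> L \<Longrightarrow> X (Y x) = Y (X x)"
    and U3: "\<And>x. x \<in> L \<Longrightarrow> norm (U3 x) = norm x" and U2: "\<And>x. x \<in> L \<Longrightarrow> norm (U2 x) \<le> norm x"
    and U1: "\<And>x. x \<in> L \<Longrightarrow> U1 x = R2 (U3 x)"
  shows "tetrablock_unitary L U1 U2 U3"
proof -
  note L = operator_onD(1)[OF o(1)]
  have adj_on: "adjoint_on L U1 y = R1 y" "adjoint_on L U2 y = R2 y" "adjoint_on L U3 y = R3 y" if "y \<in> L" for y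
    by (rule adjoint_on_eq[OF o(1) operator_onD(2)[OF r(1) that] adj(1)[OF _ that]]
        adjoint_on_eq[OF o(2) operator_onD(2)[OF r(2) that] adj(2)[OF _ that]]
        adjoint_on_eq[OF o(3) operator_onD(2)[OF r(3) that] adj(3)[OF _ that]]; assumption)+
  have nn: "normal_on L U1" "normal_on L U2" "normal_on L U3"
    using o com by (auto simp: normal_on_def adj_on operator_onD(2))
  have ct: "commuting_triple_on L U1 U2 U3"
    using o com by (auto simp: commuting_triple_on_def commutator_def)
  have a_ext: "adj (ext L U1) = ext L R1" "adj (ext L U2) = ext L R2" "adj (ext L U3) = ext L R3"
    unfolding adj_ext[OF o(1)] adj_ext[OF o(2)] adj_ext[OF o(3)]
    by (rule ext_cong[OF adjoint_on_operator[OF o(1)] r(1) adj_on(1)]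
        ext_cong[OF adjoint_on_operator[OF o(2)] r(2) adj_on(2)]
        ext_cong[OF adjoint_on_operator[OF o(3)] r(3) adj_on(3)]; assumption)+
  define p where "p = bproj L"
  have pp: "adj p = p" "p * p = p" by (simp_all add: p_def adj_bproj[OF L] bproj_mult_self[OF L])
  have "koszul_exact L (\<lambda>x. U1 x - z1 *\<^sub>C x) (\<lambda>x. U2 x - z2 *\<^sub>C x) (\<lambda>x. U3 x - z3 *\<^sub>C x)"
    if z: "(z1, z2, z3) \<notin> distinguished_boundary" for z1 z2 z3
  proof -
    define m where "m U c = ext L U - bscal c * p" for U c
    have mx: "m U c *\<^sub>V x = U x - c *\<^sub>C x" if "operator_on L U" "x \<in> L" for U c x
      using ext_shift[OF that] by (simp add: m_def p_def)
    have mp: "p * m U c = m U c" "m U c * p = m U c" if "operator_on L U" for U c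
    proof -
      show "m U c * p = m U c"
        using ext_mult_bproj[OF that] pp by (simp add: m_def left_diff_distrib mult.assoc p_def[symmetric])
      have "p * (bscal c * p) = bscal c * p" using pp by (metis bscal_commute mult.assoc)
      then show "p * m U c = m U c"
        using bproj_mult_ext[OF that] by (simp add: m_def right_diff_distrib p_def[symmetric])
    qed
    have ma: "adj (m U1 c) = m R1 (cnj c)" "adj (m U2 c) = m R2 (cnj c)" "adj (m U3 c) = m R3 (cnj c)" for c
      by (simp_all add: m_def a_ext pp bscal_commute)
    have ops: "operator_on L X" if "X \<in> {U1, U2, U3, R1, R2, R3}" for X using that o r by auto
    have mm: "m X c * m Y d = m Y d * m X c" if XY: "X \<in> {U1, U2, U3, R1, R2, R3}" "Y \<in> {U1, U2, U3, R1, R2, R3}" for X Y c d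
    proof (rule bop_eqI)
      fix x
      let ?y = "p *\<^sub>V x"
      have y: "?y \<in> L" by (simp add: p_def bproj_in[OF L])
      have oX: "operator_on L X" and oY: "operator_on L Y" using XY ops by blast+
      have e: "m X c *\<^sub>V m Y d *\<^sub>V ?y = m Y d *\<^sub>V m X c *\<^sub>V ?y"
      proof -
        have i: "X ?y \<in> L" "Y ?y \<in> L" "Y ?y - d *\<^sub>C ?y \<in> L" "X ?y - c *\<^sub>C ?y \<in> L"
          by (intro closed_csubspaceD(3,6)[OF L] operator_onD(2)[OF oX] operator_onD(2)[OF oY] y)+
        have lin: "T (u - k *\<^sub>C v) = T u - k *\<^sub>C T v" if "operator_on L T" "u \<in> L" "v \<in> L" for T u v k
          using operator_onD(3)[OF that(1,2), of "(- k) *\<^sub>C v"] operator_onD(4)[OF that(1,3), of "- k"]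
            closed_csubspaceD(3)[OF L that(3), of "- k"] by (simp add: scaleC_minus_left)
        show ?thesis
          using com[OF XY y] i y
          by (simp add: mx oX oY lin scaleC_diff_right scaleC_scaleC algebra_simps)
      qed
      have "T *\<^sub>V p *\<^sub>V x = T *\<^sub>V x" if "T * p = T" for T using that by (metis bop_simps(6))
      then show "(m X c * m Y d) *\<^sub>V x = (m Y d * m X c) *\<^sub>V x"
        using e mp(2)[OF oX, of c] mp(2)[OF oY, of d] by (metis bop_simps(6))
    qed
    have below: "\<exists>\<delta>>0. \<forall>x\<in>L. \<delta> * norm x \<le> norm (m U1 z1 *\<^sub>V x) + norm (m U2 z2 *\<^sub>V x) + norm (m U3 z3 *\<^sub>V x)"
    proof -
      \<comment> \<open>The three ways to leave the set \<open>x1 = cnj x2 * x3\<close>,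
        \<open>|x3| = 1\<close>, \<open>|x2| \<le> 1\<close>, which is contained in
        \<open>distinguished_boundary\<close>.\<close>
      consider "cmod z3 \<noteq> 1" | "cmod z2 > 1" | "z1 \<noteq> cnj z2 * z3"
        using z boundary_point_in_distinguished_boundary[of z3 z2] by fastforce
      then show ?thesis
      proof cases
        case 1
        have le: "\<bar>1 - cmod z3\<bar> * norm x \<le> norm (m U3 z3 *\<^sub>V x)" if x: "x \<in> L" for x
        proof -
          have "\<bar>1 - cmod z3\<bar> * norm x = \<bar>norm (U3 x) - norm (z3 *\<^sub>C x)\<bar>"
            using x by (simp add: U3 norm_scaleC abs_mult[of _ "norm x", symmetric, simplified] left_diff_distrib)
          also have "\<dots> \<le> norm (U3 x - z3 *\<^sub>C x)" by (rule norm_triangle_ineq3)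
          finally show ?thesis by (simp only: mx[OF o(3) x])
        qed
        show ?thesis
        proof (intro exI conjI ballI)
          show "0 < \<bar>1 - cmod z3\<bar>" using 1 by simp
          fix x assume "x \<in> L"
          from le[OF this] show "\<bar>1 - cmod z3\<bar> * norm x
              \<le> norm (m U1 z1 *\<^sub>V x) + norm (m U2 z2 *\<^sub>V x) + norm (m U3 z3 *\<^sub>V x)"
            by (intro add_increasing add_nonneg_nonneg norm_ge_zero)
        qed
      next
        case 2
        have le: "(cmod z2 - 1) * norm x \<le> norm (m U2 z2 *\<^sub>V x)" if x: "x \<in> L" for x
          using norm_triangle_ineq2[of "z2 *\<^sub>C x" "U2 x"] U2[OF x]
          by (simp add: mx[OF o(2) x] norm_scaleC left_diff_distrib norm_minus_commute)
        show ?thesis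
        proof (intro exI conjI ballI)
          show "0 < cmod z2 - 1" using 2 by simp
          fix x assume "x \<in> L"
          from le[OF this] show "(cmod z2 - 1) * norm x
              \<le> norm (m U1 z1 *\<^sub>V x) + norm (m U2 z2 *\<^sub>V x) + norm (m U3 z3 *\<^sub>V x)"
            by (intro add_increasing2[OF norm_ge_zero] add_increasing[OF norm_ge_zero])
        qed
      next
        case 3
        define g where "g = z1 - cnj z2 * z3"
        have g: "0 < cmod g" using 3 by (simp add: g_def)
        have "cmod g / (1 + cmod z3) * norm x \<le> norm (m U1 z1 *\<^sub>V x) + norm (m U2 z2 *\<^sub>V x) + norm (m U3 z3 *\<^sub>V x)" if x: "x \<in> L" for x
        proof -
          have nr: "nrm (m U2 z2)" unfolding nrm_def ma by (rule mm) auto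
          have R2m: "norm (R2 x - cnj z2 *\<^sub>C x) = norm (m U2 z2 *\<^sub>V x)"
            using norm_nrm_adj[OF nr, of x] by (simp only: ma mx[OF r(2) x])
          have R2c: "norm (R2 v) \<le> norm v" if v: "v \<in> L" for v
          proof -
            have "nrm (ext L U2)" by (rule nrm_ext[OF nn(2)])
            from norm_nrm_adj[OF this, of v] show ?thesis
              using U2[OF v] by (simp add: a_ext bapp_ext o r v)
          qed
          have xx: "U3 x \<in> L" "z3 *\<^sub>C x \<in> L" "U3 x - z3 *\<^sub>C x \<in> L"
            by (intro closed_csubspaceD(3,6)[OF L] operator_onD(2)[OF o(3)] x)+
          have R2d: "R2 (U3 x - z3 *\<^sub>C x) = R2 (U3 x) - z3 *\<^sub>C R2 x"
            using bapp_ext[OF r(2)] xx x bapp_diff[of "ext L R2" "U3 x" "z3 *\<^sub>C x"] by (simp add: operator_onD(4)[OF r(2)])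
          \<comment> \<open>The relation \<open>U1 = R2 U3\<close> telescoped around the scalars, so
            that \<open>g x\<close> is a combination of residuals; normality bounds the residual of
            \<open>R2\<close> by that of \<open>U2\<close>.\<close>
          have "g *\<^sub>C x = R2 (U3 x - z3 *\<^sub>C x) + z3 *\<^sub>C (R2 x - cnj z2 *\<^sub>C x) - (U1 x - z1 *\<^sub>C x)"
            by (simp add: R2d U1[OF x] g_def scaleC_diff_left scaleC_diff_right scaleC_scaleC mult.commute)
          then have "cmod g * norm x = norm (R2 (U3 x - z3 *\<^sub>C x) + z3 *\<^sub>C (R2 x - cnj z2 *\<^sub>C x) - (U1 x - z1 *\<^sub>C x))"
            by (simp only: norm_scaleC[symmetric])
          also have "\<dots> \<le> norm (R2 (U3 x - z3 *\<^sub>C x)) + norm (z3 *\<^sub>C (R2 x - cnj z2 *\<^sub>C x)) + norm (U1 x - z1 *\<^sub>C x)"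
            by (rule order_trans[OF norm_triangle_ineq4 add_right_mono[OF norm_triangle_ineq]])
          also have "\<dots> \<le> norm (m U3 z3 *\<^sub>V x) + cmod z3 * norm (m U2 z2 *\<^sub>V x) + norm (m U1 z1 *\<^sub>V x)"
            using R2c[OF xx(3)] by (simp add: norm_scaleC R2m mx[OF o(3) x] mx[OF o(1) x])
          also have "\<dots> \<le> (1 + cmod z3) * (norm (m U1 z1 *\<^sub>V x) + norm (m U2 z2 *\<^sub>V x) + norm (m U3 z3 *\<^sub>V x))"
            by (simp add: algebra_simps add_increasing add_increasing2)
          finally show ?thesis by (simp add: divide_le_eq mult.commute add_pos_nonneg)
        qed
        moreover have "0 < cmod g / (1 + cmod z3)" using g by (simp add: add_pos_nonneg)
        ultimately show ?thesis by blast
      qed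
    qed
    have "koszul_exact L (bapp (m U1 z1)) (bapp (m U2 z2)) (bapp (m U3 z3))"
    proof -
      from below obtain \<delta> where \<delta>: "0 < \<delta>" "\<And>x. x \<in> L \<Longrightarrow> \<delta> * norm x \<le> norm (m U1 z1 *\<^sub>V x) + norm (m U2 z2 *\<^sub>V x) + norm (m U3 z3 *\<^sub>V x)" by blast
      show ?thesis
      proof (rule koszul_exact_if_bounded_below[OF L _ _ \<delta>])
        fix u assume "u \<in> {m U1 z1, m U2 z2, m U3 z3}"
        then show "bproj L * u = u \<and> u * bproj L = u"
          using mp o by (auto simp: p_def)
      next
        fix u v assume "u \<in> {m U1 z1, m U2 z2, m U3 z3}" "v \<in> {m U1 z1, m U2 z2, m U3 z3}"
        then show "u * v = v * u \<and> adj u * v = v * adj u"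
          by (elim insertE emptyE; simp only: ma; intro conjI mm; simp)
      qed
    qed
    then show ?thesis
      by (rule iffD1[OF koszul_exact_cong[OF L], rotated -1]) (simp_all only: mx[OF o(1)] mx[OF o(2)] mx[OF o(3)])
  qed
  then have "taylor_spectrum L U1 U2 U3 \<subseteq> distinguished_boundary"
    unfolding taylor_spectrum_def by blast
  with nn ct show ?thesis by (simp add: tetrablock_unitary_def)
qed

section \<open>Square summable sequences\<close>

definition ell2_cons :: "'a::complex_inner \<Rightarrow> 'a ell2 \<Rightarrow> 'a ell2" where
  "ell2_cons h x = Abs_ell2 (case_nat h (ell2_nth x))"

definition ell2_tl :: "'a::complex_inner ell2 \<Rightarrow> 'a ell2" where
  "ell2_tl x = Abs_ell2 (\<lambda>n. ell2_nth x (Suc n))"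

definition ell2_map :: "'a::chilbert_space bop \<Rightarrow> 'a ell2 \<Rightarrow> 'a ell2" where
  "ell2_map a x = Abs_ell2 (\<lambda>n. a *\<^sub>V ell2_nth x n)"

lemma ell2_nth_cons: "ell2_nth (ell2_cons h x) = case_nat h (ell2_nth x)"
  unfolding ell2_cons_def
  by (rule ell2_nth_Abs, subst summable_Suc_iff[symmetric]) (simp add: summable_ell2)

lemma ell2_nth_cons_simps [simp]:
  "ell2_nth (ell2_cons h x) 0 = h" "ell2_nth (ell2_cons h x) (Suc n) = ell2_nth x n"
  by (simp_all add: ell2_nth_cons)

lemma ell2_nth_tl [simp]: "ell2_nth (ell2_tl x) n = ell2_nth x (Suc n)"
  unfolding ell2_tl_def
  by (subst ell2_nth_Abs) (simp_all add: summable_Suc_iff[of "\<lambda>n. (norm (ell2_nth x n))\<^sup>2"] summable_ell2)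

lemma ell2_nth_map [simp]: "ell2_nth (ell2_map a x) n = a *\<^sub>V ell2_nth x n"
  unfolding ell2_map_def
proof (subst ell2_nth_Abs)
  show "summable (\<lambda>n. (norm (a *\<^sub>V ell2_nth x n))\<^sup>2)"
  proof (rule summable_comparison_test')
    show "summable (\<lambda>n. (norm a)\<^sup>2 * (norm (ell2_nth x n))\<^sup>2)" by (intro summable_mult summable_ell2)
    show "norm ((norm (a *\<^sub>V ell2_nth x n))\<^sup>2) \<le> (norm a)\<^sup>2 * (norm (ell2_nth x n))\<^sup>2" for n
      using power_mono[OF norm_bapp[of a "ell2_nth x n"], of 2] by (simp add: power_mult_distrib)
  qed
qed simp

lemma ell2_cons_eqI: "ell2_nth x 0 = ell2_nth y 0 \<Longrightarrow> ell2_tl x = ell2_tl y \<Longrightarrow> x = y"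
  by (rule ell2_eqI) (metis ell2_nth_tl not0_implies_Suc)

lemma ell2_cons_tl [simp]: "ell2_cons (ell2_nth x 0) (ell2_tl x) = x" "ell2_tl (ell2_cons h x) = x"
proof -
  show t: "ell2_tl (ell2_cons h x) = x" for h x by (rule ell2_eqI) simp
  show "ell2_cons (ell2_nth x 0) (ell2_tl x) = x" by (rule ell2_cons_eqI) (simp_all add: t)
qed

lemma ell2_cons_eq_iff [simp]: "ell2_cons h x = ell2_cons g y \<longleftrightarrow> h = g \<and> x = y"
  by (metis ell2_cons_tl(2) ell2_nth_cons_simps(1))

lemma ell2_cons_linear: "ell2_cons h x + ell2_cons g y = ell2_cons (h + g) (x + y)"
  "ell2_cons h x - ell2_cons g y = ell2_cons (h - g) (x - y)"
  "c *\<^sub>C ell2_cons h x = ell2_cons (c *\<^sub>C h) (c *\<^sub>C x)"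
  by (rule ell2_eqI, case_tac n; simp add: ell2_nth_simps)+

lemma ell2_tl_linear: "ell2_tl (x + y) = ell2_tl x + ell2_tl y" "ell2_tl (x - y) = ell2_tl x - ell2_tl y"
  "ell2_tl (c *\<^sub>C x) = c *\<^sub>C ell2_tl x" "ell2_tl 0 = 0"
  by (rule ell2_eqI; simp add: ell2_nth_simps)+

lemma ell2_map_linear: "ell2_map a (x + y) = ell2_map a x + ell2_map a y"
  "ell2_map a (x - y) = ell2_map a x - ell2_map a y"
  "ell2_map a (c *\<^sub>C x) = c *\<^sub>C ell2_map a x" "ell2_map a 0 = 0"
  "ell2_map (a + b) x = ell2_map a x + ell2_map b x"
  "ell2_map a (ell2_map b x) = ell2_map (a * b) x"
  "ell2_map a (ell2_cons h x) = ell2_cons (a *\<^sub>V h) (ell2_map a x)"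
  "ell2_tl (ell2_map a x) = ell2_map a (ell2_tl x)"
         apply (rule ell2_eqI; simp add: ell2_nth_simps bapp_add bapp_diff bapp_scaleC; fail)+
   apply (rule ell2_eqI, case_tac n; simp)
  apply (rule ell2_eqI; simp)
  done

lemma cinner_ell2_split: "cinner x y = cinner (ell2_nth x 0) (ell2_nth y 0) + cinner (ell2_tl x) (ell2_tl y)"
  unfolding cinner_ell2_def ell2_nth_tl
  using suminf_split_head[OF summable_sq_cinner[OF summable_ell2[of x] summable_ell2[of y]]] by simp

lemma cinner_cons [simp]: "cinner (ell2_cons h x) (ell2_cons g y) = cinner h g + cinner x y"
  by (subst cinner_ell2_split) simp

lemma cinner_ell2_map: "cinner (ell2_map a x) y = cinner x (ell2_map (adj a) y)"
  unfolding cinner_ell2_def by (simp add: cinner_adj)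

lemma norm_ell2_split: "(norm x)\<^sup>2 = (norm (ell2_nth x 0))\<^sup>2 + (norm (ell2_tl x))\<^sup>2"
  for x :: "'a::complex_inner ell2"
  using cinner_ell2_split[of x x] by (simp only: cinner_self of_real_add[symmetric] of_real_eq_iff)

lemma norm_cons: "(norm (ell2_cons h x))\<^sup>2 = (norm h)\<^sup>2 + (norm x)\<^sup>2"
  using norm_ell2_split[of "ell2_cons h x"] by simp

lemma norm_tl_le: "norm (ell2_tl x) \<le> norm x"
  by (rule power2_le_imp_le) (use norm_ell2_split[of x] in simp_all)

lemma norm_ell2_map_le: "norm (ell2_map a x) \<le> norm a * norm x"
proof (rule power2_le_imp_le)
  have "(norm (ell2_map a x))\<^sup>2 \<le> suminf (\<lambda>n. (norm a)\<^sup>2 * (norm (ell2_nth x n))\<^sup>2)"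
    unfolding norm_ell2_sq
  proof (rule suminf_le)
    show "(norm (ell2_nth (ell2_map a x) n))\<^sup>2 \<le> (norm a)\<^sup>2 * (norm (ell2_nth x n))\<^sup>2" for n
      using power_mono[OF norm_bapp[of a "ell2_nth x n"], of 2] by (simp add: power_mult_distrib)
  qed (intro summable_mult summable_ell2)+
  also have "\<dots> = (norm a * norm x)\<^sup>2"
    by (simp add: suminf_mult summable_ell2 norm_ell2_sq power_mult_distrib)
  finally show "(norm (ell2_map a x))\<^sup>2 \<le> (norm a * norm x)\<^sup>2" .
qed simp

lemma bounded_linear_ell2_nth: "bounded_linear (\<lambda>x. ell2_nth x n)"
  by (rule bounded_linear_intro[where K = 1]) (simp_all add: ell2_nth_simps norm_ell2_nth_le)

lemma closed_csubspace_ell2: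
  assumes "\<And>n. closed_csubspace (M n)"
  shows "closed_csubspace {x. \<forall>n. ell2_nth x n \<in> M n}"
proof (rule closed_csubspaceI)
  have "{x. \<forall>n. ell2_nth x n \<in> M n} = (\<Inter>n. (\<lambda>x. ell2_nth x n) -` M n)" by auto
  moreover have "closed ((\<lambda>x. ell2_nth x n) -` M n)" for n
    by (rule continuous_closed_vimage[OF closed_csubspaceD(4)[OF assms]])
      (rule linear_continuous_at[OF bounded_linear_ell2_nth])
  ultimately show "closed {x. \<forall>n. ell2_nth x n \<in> M n}" by auto
qed (simp_all add: ell2_nth_simps closed_csubspaceD(1,2,3)[OF assms])

lemma ell2_nth_funpow_tl: "ell2_nth ((ell2_tl ^^ n) x) m = ell2_nth x (n + m)"
  by (induction n arbitrary: m) simp_all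

lemma norm_funpow_tl_tendsto: "(\<lambda>n. norm ((ell2_tl ^^ n) x)) \<longlonglongrightarrow> 0"
proof -
  let ?f = "\<lambda>n. (norm (ell2_nth x n))\<^sup>2"
  have "(norm ((ell2_tl ^^ n) x))\<^sup>2 = (norm x)\<^sup>2 - sum ?f {..<n}" for n
    unfolding norm_ell2_sq ell2_nth_funpow_tl
    using suminf_minus_initial_segment[OF summable_ell2[of x], of n] by (simp add: add.commute)
  moreover have "(\<lambda>n. (norm x)\<^sup>2 - sum ?f {..<n}) \<longlonglongrightarrow> (norm x)\<^sup>2 - (norm x)\<^sup>2"
    unfolding norm_ell2_sq by (intro tendsto_diff tendsto_const summable_LIMSEQ summable_ell2)
  ultimately have "(\<lambda>n. (norm ((ell2_tl ^^ n) x))\<^sup>2) \<longlonglongrightarrow> 0" by simp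
  from tendsto_real_sqrt[OF this] show ?thesis by simp
qed

section \<open>Extending a commutant along the unitary extension of an isometry\<close>

lemma isometric_cinner:
  fixes V :: "'a::complex_inner \<Rightarrow> 'a"
  assumes V: "clinear_on S V" and S: "closed_csubspace S" and n: "\<And>x. x \<in> S \<Longrightarrow> norm (V x) = norm x"
    and "x \<in> S" "y \<in> S"
  shows "cinner (V x) (V y) = cinner x y"
  by (rule cinner_eq_from_form[where T = V and G = V and R = "\<lambda>x. x" and H = "\<lambda>x. x", OF V _ S _ V _ assms(4,5)])
    (simp_all add: clinear_on_def cinner_self n)

lemma funpow_operator_on: "operator_on S T \<Longrightarrow> operator_on S (T ^^ n)"
  for S :: "'a::chilbert_space set"
proof (induction n)
  case 0
  then show ?case using operator_on_id[OF operator_onD(1)[OF 0]] by (simp add: id_def)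
next
  case (Suc n)
  then have "operator_on S (\<lambda>x. T ((T ^^ n) x))" using ext_mult(2)[of S T "T ^^ n"] by simp
  then show ?case by (simp add: comp_def)
qed

lemma operator_on_diff:
  assumes "operator_on S T" "x \<in> S" "y \<in> S"
  shows "T (x - y) = T x - T y"
proof -
  note S = operator_onD(1)[OF assms(1)]
  have "T (x + (- 1) *\<^sub>C y) = T x + (- 1) *\<^sub>C T y"
    using assms closed_csubspaceD(3)[OF S, of y "- 1"] by (simp add: operator_onD(3,4))
  then show ?thesis by (simp add: scaleC_minus_left)
qed

lemma operator_on_tendsto:
  fixes S :: "'a::chilbert_space set"
  assumes "operator_on S T" "\<And>n. f n \<in> S" "f \<longlonglongrightarrow> l" "l \<in> S"
  shows "(\<lambda>n. T (f n)) \<longlonglongrightarrow> T l"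
  using tendsto_bapp[OF assms(3), of "ext S T"] by (simp add: bapp_ext assms)

text \<open>The unitary extension of an isometry is written down explicitly, on sequences with
  zeroth entry in \<open>K\<close> and later entries in the wandering subspace \<open>E\<close>, the
  kernel of the adjoint.\<close>

locale isometry_extension =
  fixes K :: "'b::chilbert_space set" and V :: "'b \<Rightarrow> 'b"
  assumes V: "operator_on K V" and V_norm: "\<And>x. x \<in> K \<Longrightarrow> norm (V x) = norm x"
begin

abbreviation "V' \<equiv> adjoint_on K V"

definition E :: "'b set" where "E = {x \<in> K. V' x = 0}"

definition L :: "'b ell2 set" where
  "L = {x. \<forall>n. ell2_nth x n \<in> (case n of 0 \<Rightarrow> K | Suc _ \<Rightarrow> E)}"

text \<open>As \<open>K\<close> is the orthogonal sum of \<open>V K\<close> and \<open>E\<close>,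
  the vectors \<open>V k + e\<close> fill \<open>K\<close> isometrically: shifting the
  \<open>E\<close>-entries towards \<open>K\<close> repairs the missing part of the range of
  \<open>V\<close>.\<close>

definition U :: "'b ell2 \<Rightarrow> 'b ell2" where
  "U x = ell2_cons (V (ell2_nth x 0) + ell2_nth x 1) (ell2_tl (ell2_tl x))"

definition U' :: "'b ell2 \<Rightarrow> 'b ell2" where
  "U' x = ell2_cons (V' (ell2_nth x 0)) (ell2_cons (ell2_nth x 0 - V (V' (ell2_nth x 0))) (ell2_tl x))"

abbreviation incl :: "'b \<Rightarrow> 'b ell2" where "incl k \<equiv> ell2_cons k 0"

lemma K: "closed_csubspace K"
  by (rule operator_onD(1)[OF V])

lemma V'_op: "operator_on K V'"
  by (rule adjoint_on_operator[OF V])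

lemma V_cinner: "x \<in> K \<Longrightarrow> y \<in> K \<Longrightarrow> cinner (V x) (V y) = cinner x y"
  by (rule isometric_cinner[OF operator_onD(5)[OF V] K V_norm])

lemma V'V: "x \<in> K \<Longrightarrow> V' (V x) = x"
  by (rule adjoint_on_eq[OF V]) (simp_all add: V_cinner)

lemma E: "closed_csubspace E"
proof -
  have "E = K \<inter> {x. ext K V' *\<^sub>V x = 0}" by (auto simp: E_def bapp_ext[OF V'_op])
  moreover have "closed {x. ext K V' *\<^sub>V x = 0}"
    using closed_Collect_eq[of "bapp (ext K V')" "\<lambda>_. 0"]
      bounded_linear.continuous_on[OF bounded_linear_bapp continuous_on_id, of UNIV "ext K V'"] by simp
  ultimately have "closed E" using closed_csubspaceD(4)[OF K] by auto
  then show ?thesis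
    by (rule closed_csubspaceI)
      (auto simp: E_def closed_csubspaceD(1,2,3)[OF K] bapp_ext[OF V'_op, symmetric] bapp_add bapp_scaleC)
qed

lemma L: "closed_csubspace L"
  unfolding L_def by (rule closed_csubspace_ell2) (simp add: K E split: nat.split)

lemma LD:
  assumes "x \<in> L"
  shows "ell2_nth x 0 \<in> K" "ell2_nth x (Suc n) \<in> E" "ell2_nth x (Suc n) \<in> K" "V' (ell2_nth x (Suc n)) = 0"
proof -
  have *: "ell2_nth x n \<in> (case n of 0 \<Rightarrow> K | Suc _ \<Rightarrow> E)" for n using assms by (simp add: L_def)
  show "ell2_nth x 0 \<in> K" using *[of 0] by simp
  show "ell2_nth x (Suc n) \<in> E" using *[of "Suc n"] by simp
  then show "ell2_nth x (Suc n) \<in> K" "V' (ell2_nth x (Suc n)) = 0" by (simp_all add: E_def)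
qed

lemma LI: "ell2_nth x 0 \<in> K \<Longrightarrow> (\<And>n. ell2_nth x (Suc n) \<in> E) \<Longrightarrow> x \<in> L"
  by (simp add: L_def split: nat.split)

lemma U_in: "x \<in> L \<Longrightarrow> U x \<in> L"
  by (rule LI) (simp_all add: U_def LD operator_onD(2)[OF V] closed_csubspaceD(2)[OF K])

lemma VV'_compl: "x \<in> K \<Longrightarrow> x - V (V' x) \<in> E"
  by (simp add: E_def closed_csubspaceD(6)[OF K] operator_onD(2)[OF V] operator_onD(2)[OF V'_op]
      operator_on_diff[OF V'_op] V'V)

lemma U'_in: "x \<in> L \<Longrightarrow> U' x \<in> L"
proof (rule LI)
  assume x: "x \<in> L"
  show "ell2_nth (U' x) 0 \<in> K" by (simp add: U'_def LD(1)[OF x] operator_onD(2)[OF V'_op])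
  show "ell2_nth (U' x) (Suc n) \<in> E" for n
    by (cases n) (simp_all add: U'_def VV'_compl LD[OF x])
qed

lemma UU': "x \<in> L \<Longrightarrow> U (U' x) = x"
  by (simp add: U_def U'_def)

lemma U'U: "x \<in> L \<Longrightarrow> U' (U x) = x"
  by (rule ell2_cons_eqI, simp_all add: U_def U'_def LD operator_onD(2)[OF V] operator_onD(3)[OF V'_op] V'V)
    (rule ell2_cons_eqI, simp_all)

lemma U_cinner:
  assumes x: "x \<in> L" and y: "y \<in> L"
  shows "cinner (U x) (U y) = cinner x y"
proof -
  have a: "cinner (V u) w = 0" if "u \<in> K" "w \<in> E" for u w
    using cinner_adjoint_on[OF V, of u w] that by (simp add: E_def)
  have b: "cinner w (V u) = 0" if "u \<in> K" "w \<in> E" for u w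
    using a[OF that] cinner_commute[of w "V u"] by simp
  show ?thesis
    unfolding cinner_ell2_split[of x y] cinner_ell2_split[of "ell2_tl x" "ell2_tl y"]
    using LD(1,2)[OF x] LD(1,2)[OF y]
    by (simp add: U_def cinner_add_left cinner_add_right V_cinner a b)
qed

lemma U_norm: "x \<in> L \<Longrightarrow> norm (U x) = norm x"
  by (rule norm_eq_from_cinner) (rule U_cinner)

lemma U'_norm: "x \<in> L \<Longrightarrow> norm (U' x) = norm x"
  using U_norm[of "U' x"] by (simp add: U'_in UU')

lemma U_op: "operator_on L U"
proof -
  have "clinear_on L U"
    unfolding clinear_on_def
    by (auto simp: U_def ell2_nth_simps ell2_tl_linear ell2_cons_linear LD operator_onD(3,4)[OF V]
        scaleC_add_right)
  then show ?thesis
    using L U_in U_norm unfolding operator_on_def by (auto intro!: exI[of _ 1])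
qed

lemma U'_op: "operator_on L U'"
proof -
  have "U' (x + y) = U' x + U' y" if "x \<in> L" "y \<in> L" for x y
  proof -
    have "U (U' x + U' y) = x + y"
      using that by (simp add: operator_onD(3)[OF U_op] U'_in UU')
    then show ?thesis
      using U'U[of "U' x + U' y"] that by (simp add: closed_csubspaceD(2)[OF L] U'_in)
  qed
  moreover have "U' (c *\<^sub>C x) = c *\<^sub>C U' x" if "x \<in> L" for c x
  proof -
    have "U (c *\<^sub>C U' x) = c *\<^sub>C x"
      using that by (simp add: operator_onD(4)[OF U_op] U'_in UU')
    then show ?thesis
      using U'U[of "c *\<^sub>C U' x"] that by (simp add: closed_csubspaceD(3)[OF L] U'_in)
  qed
  ultimately have "clinear_on L U'" by (simp add: clinear_on_def)
  then show ?thesis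
    using L U'_in U'_norm unfolding operator_on_def by (auto intro!: exI[of _ 1])
qed

lemma incl_in: "k \<in> K \<Longrightarrow> incl k \<in> L"
  by (rule LI) (simp_all add: ell2_nth_simps closed_csubspaceD(1)[OF E])

lemma incl_linear: "incl (h + k) = incl h + incl k" "incl (c *\<^sub>C h) = c *\<^sub>C incl h"
  "incl (h - k) = incl h - incl k"
  by (simp_all add: ell2_cons_linear)

lemma norm_incl: "norm (incl k) = norm k"
  using norm_cons[of k 0] by simp

lemma U_incl: "k \<in> K \<Longrightarrow> U (incl k) = incl (V k)"
  by (simp add: U_def ell2_nth_simps ell2_tl_linear numeral_eq_Suc)

lemma pow_in: "x \<in> L \<Longrightarrow> (U ^^ n) x \<in> L" "x \<in> L \<Longrightarrow> (U' ^^ n) x \<in> L"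
  by (induction n) (simp_all add: U_in U'_in)

lemma pow_norm: "x \<in> L \<Longrightarrow> norm ((U ^^ n) x) = norm x" "x \<in> L \<Longrightarrow> norm ((U' ^^ n) x) = norm x"
  by (induction n) (simp_all add: U_norm U'_norm pow_in)

lemma pow_U'U: "x \<in> L \<Longrightarrow> (U' ^^ n) ((U ^^ n) x) = x"
proof (induction n arbitrary: x)
  case (Suc n)
  have "(U' ^^ Suc n) ((U ^^ Suc n) x) = (U' ^^ n) (U' (U ((U ^^ n) x)))"
    by (simp add: funpow_swap1)
  then show ?case using Suc by (simp add: U'U pow_in)
qed simp

lemma pow_U'_U: "x \<in> L \<Longrightarrow> (U' ^^ n) (U x) = U ((U' ^^ n) x)"
  by (induction n) (simp_all add: UU' U'U pow_in)

lemma pow_U'_cinner: "x \<in> L \<Longrightarrow> y \<in> L \<Longrightarrow> cinner ((U' ^^ n) x) ((U' ^^ n) y) = cinner x y"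
  by (rule isometric_cinner[OF operator_onD(5)[OF funpow_operator_on[OF U'_op]] L pow_norm(2)])

section \<open>Extension of operators that commute with the isometry\<close>

definition cut :: "nat \<Rightarrow> 'b ell2 \<Rightarrow> 'b" where
  "cut n x = ell2_nth ((U ^^ n) x) 0"

lemma cut_in: "x \<in> L \<Longrightarrow> cut n x \<in> K"
  unfolding cut_def by (intro LD(1) pow_in)

lemma cut_linear:
  "x \<in> L \<Longrightarrow> y \<in> L \<Longrightarrow> cut n (x + y) = cut n x + cut n y"
  "x \<in> L \<Longrightarrow> cut n (c *\<^sub>C x) = c *\<^sub>C cut n x"
  by (simp_all add: cut_def operator_onD(3,4)[OF funpow_operator_on[OF U_op]] ell2_nth_simps)

lemma norm_cut_le: "x \<in> L \<Longrightarrow> norm (cut n x) \<le> norm x"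
  unfolding cut_def using norm_ell2_nth_le[of "(U ^^ n) x" 0] by (simp add: pow_norm)

lemma cut_U: "cut n (U x) = cut (Suc n) x"
  by (simp add: cut_def funpow_swap1)

lemma cut_incl: "k \<in> K \<Longrightarrow> (U ^^ n) (incl k) = incl ((V ^^ n) k) \<and> (V ^^ n) k \<in> K"
  by (induction n) (simp_all add: U_incl operator_onD(2)[OF V])

lemma tl_pow_U: "ell2_tl ((U ^^ n) x) = (ell2_tl ^^ n) (ell2_tl x)"
  by (induction n) (simp_all add: U_def)

text \<open>The operator \<open>U^-n T Q U^n\<close>, where \<open>Q\<close> projects onto the
  zeroth coordinate; \<open>extend T\<close> is its strong limit.\<close>

definition approx :: "('b \<Rightarrow> 'b) \<Rightarrow> nat \<Rightarrow> 'b ell2 \<Rightarrow> 'b ell2" where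
  "approx T n x = (U' ^^ n) (incl (T (cut n x)))"

text \<open>The vectors \<open>U\<^sup>-\<^sup>n k\<close> with \<open>k \<in> K\<close> are dense.\<close>

lemma approx_id_tendsto:
  assumes x: "x \<in> L"
  shows "(\<lambda>n. approx (\<lambda>k. k) n x) \<longlonglongrightarrow> x"
proof -
  have "norm (approx (\<lambda>k. k) n x - x) = norm ((ell2_tl ^^ n) (ell2_tl x))" for n
  proof -
    let ?y = "(U ^^ n) x"
    have y: "?y \<in> L" and i: "incl (cut n x) \<in> L" by (simp_all add: pow_in x incl_in cut_in)
    have "approx (\<lambda>k. k) n x - x = (U' ^^ n) (incl (cut n x) - ?y)"
      using operator_on_diff[OF funpow_operator_on[OF U'_op] i y] by (simp add: approx_def pow_U'U x)
    then have "norm (approx (\<lambda>k. k) n x - x) = norm (incl (cut n x) - ?y)"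
      using closed_csubspaceD(6)[OF L i y] by (simp add: pow_norm)
    also have "incl (cut n x) - ?y = ell2_cons 0 (- ell2_tl ?y)"
      by (rule ell2_cons_eqI) (simp_all add: cut_def ell2_nth_simps ell2_tl_linear)
    also have "norm \<dots> = norm (ell2_tl ?y)"
      using norm_cons[of 0 "- ell2_tl ?y"] by simp
    finally show ?thesis by (simp add: tl_pow_U)
  qed
  then have "(\<lambda>n. norm (approx (\<lambda>k. k) n x - x)) \<longlonglongrightarrow> 0"
    using norm_funpow_tl_tendsto by simp
  then show ?thesis by (simp add: LIM_zero_iff tendsto_norm_zero_iff)
qed

definition extend :: "('b \<Rightarrow> 'b) \<Rightarrow> 'b ell2 \<Rightarrow> 'b ell2" where
  "extend T x = lim (\<lambda>n. approx T n x)"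

context
  fixes T :: "'b \<Rightarrow> 'b"
  assumes T: "operator_on K T" and TV: "\<And>k. k \<in> K \<Longrightarrow> T (V k) = V (T k)"
begin

lemma approx_in: "x \<in> L \<Longrightarrow> approx T n x \<in> L"
  by (simp add: approx_def pow_in incl_in operator_onD(2)[OF T] cut_in)

lemma T_pow_V: "k \<in> K \<Longrightarrow> T ((V ^^ n) k) = (V ^^ n) (T k)"
  by (induction n) (simp_all add: TV cut_incl)

lemma approx_shift:
  assumes "k \<in> K"
  shows "(U' ^^ n) (incl k) = (U' ^^ (n + m)) (incl ((V ^^ m) k))"
  unfolding funpow_add comp_def
  using pow_U'U[OF incl_in[OF assms], of m] cut_incl[OF assms, of m] by simp

text \<open>As \<open>T\<close> commutes with \<open>V\<close>, approximants of different order can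
  be written with the same power of \<open>U'\<close>. Their difference is then \<open>T\<close>
  applied to the difference for the identity, which tends to 0.\<close>

lemma approx_tendsto:
  assumes x: "x \<in> L"
  shows "(\<lambda>n. approx T n x) \<longlonglongrightarrow> extend T x"
proof -
  obtain C where C: "\<And>k. k \<in> K \<Longrightarrow> norm (T k) \<le> C * norm k" using T by (auto simp: operator_on_def)
  let ?a = "\<lambda>n. approx (\<lambda>k. k) n x"
  have diff: "norm (approx T (n + m) x - approx T n x) \<le> \<bar>C\<bar> * norm (?a (n + m) - ?a n)" for n m
  proof -
    let ?k = "cut (n + m) x" and ?l = "(V ^^ m) (cut n x)"
    have kl: "?k \<in> K" "?l \<in> K" by (simp_all add: cut_in x cut_incl)
    have d: "(U' ^^ (n + m)) (incl u) - (U' ^^ (n + m)) (incl w) = (U' ^^ (n + m)) (incl (u - w))"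
      if "u \<in> K" "w \<in> K" for u w
      using operator_on_diff[OF funpow_operator_on[OF U'_op] incl_in incl_in] that by (simp add: incl_linear)
    have "approx T (n + m) x - approx T n x = (U' ^^ (n + m)) (incl (T ?k - T ?l))"
      unfolding approx_def approx_shift[OF operator_onD(2)[OF T cut_in[OF x]], of n n m]
      using d[of "T ?k" "T ?l"] kl cut_incl[OF operator_onD(2)[OF T cut_in[OF x]], of m]
      by (simp add: T_pow_V cut_in x operator_onD(2)[OF T])
    then have "norm (approx T (n + m) x - approx T n x) = norm (T (?k - ?l))"
      using kl by (simp add: pow_norm incl_in closed_csubspaceD(6)[OF K] operator_onD(2)[OF T] norm_incl
          operator_on_diff[OF T])
    also have "\<dots> \<le> \<bar>C\<bar> * norm (?k - ?l)"
      using C[OF closed_csubspaceD(6)[OF K kl]] by (smt (verit) mult_right_mono norm_ge_zero)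
    also have "norm (?k - ?l) = norm (?a (n + m) - ?a n)"
    proof -
      have "?a (n + m) - ?a n = (U' ^^ (n + m)) (incl (?k - ?l))"
        unfolding approx_def approx_shift[OF cut_in[OF x], of n n m] using d[OF kl] .
      then show ?thesis
        using kl by (simp add: pow_norm incl_in closed_csubspaceD(6)[OF K] norm_incl)
    qed
    finally show ?thesis .
  qed
  have "Cauchy (\<lambda>n. approx T n x)"
    unfolding Cauchy_altdef2
  proof (intro allI impI)
    fix e :: real assume e: "0 < e"
    then have "0 < e / (\<bar>C\<bar> + 1)" by simp
    with LIMSEQ_imp_Cauchy[OF approx_id_tendsto[OF x]]
    obtain N where N: "\<And>n. n \<ge> N \<Longrightarrow> norm (?a n - ?a N) < e / (\<bar>C\<bar> + 1)"
      unfolding Cauchy_altdef2 dist_norm by blast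
    have "norm (approx T n x - approx T N x) < e" if n: "n \<ge> N" for n
    proof -
      have "norm (approx T n x - approx T N x) \<le> \<bar>C\<bar> * norm (?a n - ?a N)"
        using diff[of N "n - N"] n by simp
      also have "\<dots> \<le> (\<bar>C\<bar> + 1) * norm (?a n - ?a N)" by (intro mult_right_mono) auto
      also have "\<dots> < (\<bar>C\<bar> + 1) * (e / (\<bar>C\<bar> + 1))" by (intro mult_strict_left_mono N n) simp
      also have "\<dots> = e" by simp
      finally show ?thesis .
    qed
    then show "\<exists>N. \<forall>n\<ge>N. dist (approx T n x) (approx T N x) < e" by (auto simp: dist_norm)
  qed
  then show ?thesis
    unfolding extend_def by (simp add: Cauchy_convergent_iff convergent_LIMSEQ_iff)
qed

lemma extend_in: "x \<in> L \<Longrightarrow> extend T x \<in> L"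
  by (rule closed_sequentially[OF closed_csubspaceD(4)[OF L] approx_in approx_tendsto])

lemma extend_norm_le:
  assumes C: "0 \<le> C" "\<And>k. k \<in> K \<Longrightarrow> norm (T k) \<le> C * norm k" and x: "x \<in> L"
  shows "norm (extend T x) \<le> C * norm x"
proof (rule LIMSEQ_le_const2[OF tendsto_norm[OF approx_tendsto[OF x]]], intro exI allI impI)
  fix n
  have "norm (approx T n x) = norm (T (cut n x))"
    by (simp add: approx_def pow_norm incl_in cut_in x operator_onD(2)[OF T] norm_incl)
  also have "\<dots> \<le> C * norm (cut n x)" by (rule C(2)[OF cut_in[OF x]])
  also have "\<dots> \<le> C * norm x" by (intro mult_left_mono norm_cut_le x C(1))
  finally show "norm (approx T n x) \<le> C * norm x" .
qed

lemma extend_op: "operator_on L (extend T)"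
proof -
  have "extend T (x + y) = extend T x + extend T y" if "x \<in> L" "y \<in> L" for x y
  proof (rule LIMSEQ_unique[OF approx_tendsto])
    have "approx T n (x + y) = approx T n x + approx T n y" for n
      using that by (simp add: approx_def cut_linear operator_onD(3)[OF T] cut_in incl_linear
          operator_onD(3)[OF funpow_operator_on[OF U'_op]] incl_in operator_onD(2)[OF T])
    then show "(\<lambda>n. approx T n (x + y)) \<longlonglongrightarrow> extend T x + extend T y"
      using tendsto_add[OF approx_tendsto[OF that(1)] approx_tendsto[OF that(2)]] by simp
  qed (simp add: closed_csubspaceD(2)[OF L] that)
  moreover have "extend T (c *\<^sub>C x) = c *\<^sub>C extend T x" if "x \<in> L" for c x
  proof (rule LIMSEQ_unique[OF approx_tendsto])
    have "approx T n (c *\<^sub>C x) = c *\<^sub>C approx T n x" for n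
      using that by (simp add: approx_def cut_linear operator_onD(4)[OF T] cut_in incl_linear
          operator_onD(4)[OF funpow_operator_on[OF U'_op]] incl_in operator_onD(2)[OF T])
    then show "(\<lambda>n. approx T n (c *\<^sub>C x)) \<longlonglongrightarrow> c *\<^sub>C extend T x"
      using tendsto_scaleC[OF approx_tendsto[OF that], of c] by simp
  qed (simp add: closed_csubspaceD(3)[OF L] that)
  ultimately have "clinear_on L (extend T)" by (simp add: clinear_on_def)
  moreover obtain C where C: "\<And>k. k \<in> K \<Longrightarrow> norm (T k) \<le> C * norm k" using T by (auto simp: operator_on_def)
  have "norm (T k) \<le> \<bar>C\<bar> * norm k" if "k \<in> K" for k
    using C[OF that] by (smt (verit) mult_right_mono norm_ge_zero)
  then have "\<forall>x\<in>L. norm (extend T x) \<le> \<bar>C\<bar> * norm x" using extend_norm_le[of "\<bar>C\<bar>"] by simp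
  ultimately show ?thesis
    using L extend_in unfolding operator_on_def by blast
qed

lemma extend_incl:
  assumes k: "k \<in> K"
  shows "extend T (incl k) = incl (T k)"
proof (rule LIMSEQ_unique[OF approx_tendsto[OF incl_in[OF k]]])
  have "approx T n (incl k) = incl (T k)" for n
    using pow_U'U[OF incl_in[OF operator_onD(2)[OF T k]], of n] cut_incl[OF k, of n]
      cut_incl[OF operator_onD(2)[OF T k], of n]
    by (simp add: approx_def cut_def T_pow_V k)
  then show "(\<lambda>n. approx T n (incl k)) \<longlonglongrightarrow> incl (T k)" by simp
qed

lemma extend_U:
  assumes x: "x \<in> L"
  shows "extend T (U x) = U (extend T x)"
proof (rule LIMSEQ_unique[OF approx_tendsto[OF U_in[OF x]]])
  have "approx T n (U x) = U (approx T (Suc n) x)" for n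
  proof -
    have i: "incl (T (cut (Suc n) x)) \<in> L" by (simp add: incl_in cut_in x operator_onD(2)[OF T])
    have "U (approx T (Suc n) x) = U (U' ((U' ^^ n) (incl (T (cut (Suc n) x)))))"
      by (simp add: approx_def)
    also have "\<dots> = (U' ^^ n) (incl (T (cut (Suc n) x)))" by (rule UU') (rule pow_in(2)[OF i])
    finally show ?thesis by (simp add: approx_def cut_U)
  qed
  then show "(\<lambda>n. approx T n (U x)) \<longlonglongrightarrow> U (extend T x)"
    using operator_on_tendsto[OF U_op, of "\<lambda>n. approx T (Suc n) x", OF _ LIMSEQ_Suc[OF approx_tendsto[OF x]]]
    by (simp add: approx_in x extend_in)
qed

lemma extend_U':
  assumes x: "x \<in> L"
  shows "extend T (U' x) = U' (extend T x)"
  using extend_U[OF U'_in[OF x]] U'U[OF extend_in[OF U'_in[OF x]]] by (simp add: UU' x)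

lemma extend_pow_U':
  "x \<in> L \<Longrightarrow> extend T ((U' ^^ n) x) = (U' ^^ n) (extend T x)"
  by (induction n) (simp_all add: extend_U' pow_in)

end

lemma extend_commute:
  assumes T: "operator_on K T" "\<And>k. k \<in> K \<Longrightarrow> T (V k) = V (T k)"
    and R: "operator_on K R" "\<And>k. k \<in> K \<Longrightarrow> R (V k) = V (R k)"
    and TR: "\<And>k. k \<in> K \<Longrightarrow> T (R k) = R (T k)" and x: "x \<in> L"
  shows "extend T (extend R x) = extend R (extend T x)"
proof -
  have lim: "(\<lambda>n. (U' ^^ n) (incl (T (R (cut n x))))) \<longlonglongrightarrow> extend T (extend R x)"
    if T: "operator_on K T" "\<And>k. k \<in> K \<Longrightarrow> T (V k) = V (T k)"
      and R: "operator_on K R" "\<And>k. k \<in> K \<Longrightarrow> R (V k) = V (R k)" for T R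
  proof -
    have "(\<lambda>n. extend T (approx R n x)) \<longlonglongrightarrow> extend T (extend R x)"
      by (rule operator_on_tendsto[OF extend_op[OF T] _ approx_tendsto[OF R x] extend_in[OF R x]])
        (assumption | rule approx_in[OF R x])+
    moreover have "extend T (approx R n x) = (U' ^^ n) (incl (T (R (cut n x))))" for n
      unfolding approx_def
      by (simp add: extend_pow_U'[OF T] extend_incl[OF T] incl_in operator_onD(2)[OF R(1)] cut_in x)
    ultimately show ?thesis by simp
  qed
  have "(\<lambda>n. (U' ^^ n) (incl (T (R (cut n x))))) \<longlonglongrightarrow> extend R (extend T x)"
    using lim[OF R T] by (simp add: TR cut_in x)
  then show ?thesis using LIMSEQ_unique[OF lim[OF T R]] by blast
qed

text \<open>Formulated with \<open>V\<close> on the right so that the relation makes sense inside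
  \<open>K\<close>. It passes to the limit since the powers of \<open>U'\<close> preserve inner
  products and commute with \<open>U\<close>; with \<open>U\<close> invertible it then determines
  the adjoint of \<open>extend T\<close>.\<close>

lemma extend_cinner:
  assumes T: "operator_on K T" "\<And>k. k \<in> K \<Longrightarrow> T (V k) = V (T k)"
    and R: "operator_on K R" "\<And>k. k \<in> K \<Longrightarrow> R (V k) = V (R k)"
    and TR: "\<And>k l. k \<in> K \<Longrightarrow> l \<in> K \<Longrightarrow> cinner (T k) l = cinner (V k) (R l)"
    and x: "x \<in> L" and y: "y \<in> L"
  shows "cinner (extend T x) y = cinner (U x) (extend R y)"
proof -
  let ?a = "\<lambda>n x. approx (\<lambda>k. k) n x"
  have "(\<lambda>n. cinner (approx T n x) (?a n y)) \<longlonglongrightarrow> cinner (extend T x) y"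
    by (rule tendsto_cinner[OF approx_tendsto[OF T x] approx_id_tendsto[OF y]])
  moreover have "(\<lambda>n. cinner (U (?a n x)) (approx R n y)) \<longlonglongrightarrow> cinner (U x) (extend R y)"
  proof (rule tendsto_cinner[OF _ approx_tendsto[OF R y]])
    have "?a n x \<in> L" for n by (simp add: approx_def pow_in incl_in cut_in x)
    then show "(\<lambda>n. U (?a n x)) \<longlonglongrightarrow> U x"
      by (rule operator_on_tendsto[OF U_op _ approx_id_tendsto[OF x] x])
  qed
  moreover have "cinner (approx T n x) (?a n y) = cinner (U (?a n x)) (approx R n y)" for n
  proof -
    have k: "cut n x \<in> K" "cut n y \<in> K" by (simp_all add: cut_in x y)
    have "U (?a n x) = (U' ^^ n) (incl (V (cut n x)))"
      using pow_U'_U[OF incl_in[OF k(1)], of n] U_incl[OF k(1)] by (simp add: approx_def)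
    then show ?thesis
      using k by (simp add: approx_def pow_U'_cinner incl_in operator_onD(2)[OF T(1)]
          operator_onD(2)[OF R(1)] operator_onD(2)[OF V] TR)
  qed
  ultimately show ?thesis using LIMSEQ_unique by fastforce
qed

end

text \<open>On the extension space the adjoints are \<open>U2 U'\<close> for \<open>U1\<close> and
  \<open>U1 U'\<close> for \<open>U2\<close>. Normality thus reduces to commutation of the extended
  operators with each other and with \<open>U\<close>, and no further enlargement of the space is
  called for.\<close>

theorem tetrablock_isometryI:
  fixes K :: "'b::chilbert_space set"
  assumes ct: "commuting_triple_on K T1 T2 T3"
    and T3: "\<And>x. x \<in> K \<Longrightarrow> norm (T3 x) = norm x" and T2: "\<And>x. x \<in> K \<Longrightarrow> norm (T2 x) \<le> norm x"
    and T1: "\<And>x y. x \<in> K \<Longrightarrow> y \<in> K \<Longrightarrow> cinner (T1 x) y = cinner (T3 x) (T2 y)"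
  shows "tetrablock_isometry TYPE('b ell2) K T1 T2 T3"
proof -
  have o: "operator_on K T1" "operator_on K T2" "operator_on K T3"
    and c: "\<And>k. k \<in> K \<Longrightarrow> T1 (T2 k) = T2 (T1 k)" "\<And>k. k \<in> K \<Longrightarrow> T1 (T3 k) = T3 (T1 k)"
      "\<And>k. k \<in> K \<Longrightarrow> T2 (T3 k) = T3 (T2 k)"
    using ct by (auto simp: commuting_triple_on_def commutator_def)
  interpret isometry_extension K T3 by unfold_locales (use o T3 in auto)
  have T2': "cinner (T2 k) l = cinner (T3 k) (T1 l)" if "k \<in> K" "l \<in> K" for k l
  proof -
    \<comment> \<open>The companion relation follows from \<open>T1\<close> by inserting
      \<open>T3 k\<close> and cancelling the isometry.\<close>
    have "cinner (T1 l) (T3 k) = cinner (T3 l) (T3 (T2 k))"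
      using that by (simp add: T1 operator_onD(2)[OF o(3)] c)
    also have "\<dots> = cinner l (T2 k)" using that by (simp add: V_cinner operator_onD(2)[OF o(2)])
    finally show ?thesis
      using cinner_commute[of "T3 k" "T1 l"] cinner_commute[of "T2 k" l] by simp
  qed
  define U1 where "U1 = extend T1"
  define U2 where "U2 = extend T2"
  have op: "operator_on L U1" "operator_on L U2"
    unfolding U1_def U2_def by (intro extend_op o c; assumption)+
  have inn: "U1 x \<in> L" "U2 x \<in> L" if "x \<in> L" for x using that op operator_onD(2) by blast+
  have com: "U1 (U2 x) = U2 (U1 x)" "U1 (U x) = U (U1 x)" "U2 (U x) = U (U2 x)"
    "U1 (U' x) = U' (U1 x)" "U2 (U' x) = U' (U2 x)" if "x \<in> L" for x
    unfolding U1_def U2_def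
    using extend_commute[OF o(1) c(2) o(2) c(3) c(1) that] extend_U[OF o(1) c(2) that] extend_U[OF o(2) c(3) that]
      extend_U'[OF o(1) c(2) that] extend_U'[OF o(2) c(3) that] by simp_all
  have ci: "cinner (U1 x) y = cinner (U x) (U2 y)" "cinner (U2 x) y = cinner (U x) (U1 y)"
    if "x \<in> L" "y \<in> L" for x y
    unfolding U1_def U2_def
    by (rule extend_cinner[OF o(1) c(2) o(2) c(3) T1 that] extend_cinner[OF o(2) c(3) o(1) c(2) T2' that]; assumption)+
  have adjs: "cinner (U1 x) y = cinner x (U2 (U' y))" "cinner (U2 x) y = cinner x (U1 (U' y))"
    "cinner (U x) y = cinner x (U' y)" if "x \<in> L" "y \<in> L" for x y
  proof -
    show "cinner (U x) y = cinner x (U' y)"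
      using U_cinner[OF that(1) U'_in[OF that(2)]] by (simp add: UU' that)
    have "cinner (U1 x) y = cinner x (U' (U2 y))" "cinner (U2 x) y = cinner x (U' (U1 y))"
      using U_cinner[OF that(1) U'_in[OF inn(2)[OF that(2)]]] U_cinner[OF that(1) U'_in[OF inn(1)[OF that(2)]]]
      by (simp_all add: ci that UU' inn)
    then show "cinner (U1 x) y = cinner x (U2 (U' y))" "cinner (U2 x) y = cinner x (U1 (U' y))"
      by (simp_all add: com that)
  qed
  have "tetrablock_unitary L U1 U2 U"
  proof (rule tetrablock_unitaryI[OF op U_op ext_mult(2)[OF op(2) U'_op] ext_mult(2)[OF op(1) U'_op] U'_op adjs])
    fix X Y x assume "X \<in> {U1, U2, U, \<lambda>x. U2 (U' x), \<lambda>x. U1 (U' x), U'}"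
      "Y \<in> {U1, U2, U, \<lambda>x. U2 (U' x), \<lambda>x. U1 (U' x), U'}" and x: "x \<in> L"
    then show "X (Y x) = Y (X x)"
      by (elim insertE emptyE; simp add: com inn U_in U'_in UU' U'U)
  next
    fix x assume x: "x \<in> L"
    show "norm (U x) = norm x" by (rule U_norm[OF x])
    show "norm (U2 x) \<le> norm x"
      using extend_norm_le[OF o(2) c(3), of 1 x] T2 x by (simp add: U2_def)
    show "U1 x = U1 (U' (U x))" by (simp add: U'U x)
  qed
  moreover have "isometric_embedding K L incl"
    unfolding isometric_embedding_def clinear_on_def
    by (auto simp: incl_linear incl_in)
  moreover have "U1 (incl x) = incl (T1 x) \<and> U2 (incl x) = incl (T2 x) \<and> U (incl x) = incl (T3 x)" if "x \<in> K" for x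
    unfolding U1_def U2_def
    using extend_incl[OF o(1) c(2) that] extend_incl[OF o(2) c(3) that] U_incl[OF that] by simp
  ultimately show ?thesis
    using ct unfolding tetrablock_isometry_def by blast
qed

section \<open>Closed spans and unitaries from Gram matrices\<close>

lemma closed_csubspace_closure:
  assumes 0: "0 \<in> C" and add: "\<And>x y. x \<in> C \<Longrightarrow> y \<in> C \<Longrightarrow> x + y \<in> C"
    and scale: "\<And>c x. x \<in> C \<Longrightarrow> c *\<^sub>C x \<in> C"
  shows "closed_csubspace (closure C)"
proof (rule closed_csubspaceI)
  show "0 \<in> closure C" using 0 closure_subset by blast
  fix x y c assume x: "x \<in> closure C"
  then obtain f where f: "\<And>n. f n \<in> C" "f \<longlonglongrightarrow> x" by (auto simp: closure_sequential)
  show "c *\<^sub>C x \<in> closure C"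
    unfolding closure_sequential using f scale tendsto_scaleC[OF f(2), of c]
    by (intro exI[of _ "\<lambda>n. c *\<^sub>C f n"]) auto
  assume "y \<in> closure C"
  then obtain g where g: "\<And>n. g n \<in> C" "g \<longlonglongrightarrow> y" by (auto simp: closure_sequential)
  show "x + y \<in> closure C"
    unfolding closure_sequential using f g add tendsto_add[OF f(2) g(2)]
    by (intro exI[of _ "\<lambda>n. f n + g n"]) auto
qed simp

text \<open>The relation between equal linear combinations of the \<open>x i\<close> and of the
  \<open>y i\<close>. A relation avoids choosing coefficients, which are not unique; equality of the
  Gram matrices makes it single-valued.\<close>

inductive paired_span :: "('i \<Rightarrow> 'a::complex_inner) \<Rightarrow> ('i \<Rightarrow> 'b::complex_inner) \<Rightarrow> 'a \<Rightarrow> 'b \<Rightarrow> bool"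
  for x y where
  zero: "paired_span x y 0 0"
| base: "paired_span x y (x i) (y i)"
| add: "paired_span x y u v \<Longrightarrow> paired_span x y u' v' \<Longrightarrow> paired_span x y (u + u') (v + v')"
| scale: "paired_span x y u v \<Longrightarrow> paired_span x y (c *\<^sub>C u) (c *\<^sub>C v)"

lemma paired_span_swap: "paired_span x y u v \<Longrightarrow> paired_span y x v u"
  by (induction rule: paired_span.induct) (auto intro: paired_span.intros)

lemma paired_span_gram:
  assumes gram: "\<And>i j. cinner (x i) (x j) = cinner (y i) (y j)"
    and uv: "paired_span x y u v" and uv': "paired_span x y u' v'"
  shows "cinner u u' = cinner v v'"
proof -
  have b: "cinner (x i) u' = cinner (y i) v'" for i
    using uv' by (induction rule: paired_span.induct)
      (simp_all add: gram cinner_add_right cinner_scaleC_right)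
  show ?thesis
    using uv by (induction rule: paired_span.induct) (simp_all add: b cinner_add_left cinner_scaleC_left)
qed

lemma paired_span_in: "paired_span x y u v \<Longrightarrow> v \<in> closed_cspan (range y)"
proof (induction rule: paired_span.induct)
  case (base i)
  show ?case by (rule subsetD[OF closed_cspan_superset]) simp
qed (simp_all add: closed_csubspaceD(1,2,3)[OF closed_cspan_closed_csubspace])

lemma paired_span_diff_norm:
  assumes gram: "\<And>i j. cinner (x i) (x j) = cinner (y i) (y j)"
    and uv: "paired_span x y u v" and uv': "paired_span x y u' v'"
  shows "norm (u - u') = norm (v - v')"
proof -
  have "paired_span x y (u + (- 1) *\<^sub>C u') (v + (- 1) *\<^sub>C v')"
    by (intro paired_span.intros uv uv')
  then have "paired_span x y (u - u') (v - v')" by (simp add: scaleC_minus_left)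
  from paired_span_gram[OF gram this this] show ?thesis by (rule norm_eq_from_cinner)
qed

definition paired_limit :: "('i \<Rightarrow> 'a::complex_inner) \<Rightarrow> ('i \<Rightarrow> 'b::complex_inner) \<Rightarrow> 'a \<Rightarrow> 'b \<Rightarrow> bool" where
  "paired_limit x y u v \<longleftrightarrow> (\<exists>f g. (\<forall>n. paired_span x y (f n) (g n)) \<and> f \<longlonglongrightarrow> u \<and> g \<longlonglongrightarrow> v)"

lemma paired_limit_exists:
  fixes x :: "'i \<Rightarrow> 'a::complex_inner" and y :: "'i \<Rightarrow> 'b::chilbert_space"
  assumes gram: "\<And>i j. cinner (x i) (x j) = cinner (y i) (y j)" and u: "u \<in> closed_cspan (range x)"
  shows "\<exists>v. paired_limit x y u v"
proof -
  let ?C = "{u. \<exists>v. paired_span x y u v}"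
  have "closed_csubspace (closure ?C)"
    by (rule closed_csubspace_closure) (auto intro: paired_span.intros)
  moreover have "range x \<subseteq> closure ?C"
    using closure_subset[of ?C] by (auto intro: paired_span.base)
  ultimately have "u \<in> closure ?C" using closed_cspan_minimal u by blast
  then obtain f where f: "\<forall>n. \<exists>v. paired_span x y (f n) v" "f \<longlonglongrightarrow> u"
    by (auto simp: closure_sequential)
  from choice[OF f(1)] obtain g where g: "\<And>n. paired_span x y (f n) (g n)" by blast
  have "Cauchy g"
    using LIMSEQ_imp_Cauchy[OF f(2)] paired_span_diff_norm[OF gram g g] by (simp add: Cauchy_def dist_norm)
  then obtain v where "g \<longlonglongrightarrow> v" by (meson Cauchy_convergent convergent_def)
  with f(2) g show ?thesis unfolding paired_limit_def by blast
qed

lemma paired_limit_gram: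
  assumes gram: "\<And>i j. cinner (x i) (x j) = cinner (y i) (y j)"
    and "paired_limit x y u v" "paired_limit x y u' v'"
  shows "cinner u u' = cinner v v'"
proof -
  obtain f g where fg: "\<And>n. paired_span x y (f n) (g n)" "f \<longlonglongrightarrow> u" "g \<longlonglongrightarrow> v"
    using assms(2) unfolding paired_limit_def by blast
  obtain f' g' where fg': "\<And>n. paired_span x y (f' n) (g' n)" "f' \<longlonglongrightarrow> u'" "g' \<longlonglongrightarrow> v'"
    using assms(3) unfolding paired_limit_def by blast
  have "cinner (f n) (f' n) = cinner (g n) (g' n)" for n by (rule paired_span_gram[OF gram fg(1) fg'(1)])
  then have "(\<lambda>n. cinner (g n) (g' n)) \<longlonglongrightarrow> cinner u u'"
    using tendsto_cinner[OF fg(2) fg'(2)] by simp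
  then show ?thesis using LIMSEQ_unique tendsto_cinner[OF fg(3) fg'(3)] by blast
qed

lemma paired_limit_unique:
  assumes gram: "\<And>i j. cinner (x i) (x j) = cinner (y i) (y j)"
    and uv: "paired_limit x y u v" and uw: "paired_limit x y u w"
  shows "v = w"
proof -
  have "cinner (v - w) (v - w) = 0"
    using paired_limit_gram[OF gram uv uv] paired_limit_gram[OF gram uv uw]
      paired_limit_gram[OF gram uw uv] paired_limit_gram[OF gram uw uw]
    by (simp add: cinner_diff_left cinner_diff_right)
  then show ?thesis by (simp add: cinner_self)
qed

lemma paired_limit_linear:
  "paired_limit x y u v \<Longrightarrow> paired_limit x y u' v' \<Longrightarrow> paired_limit x y (u + u') (v + v')"
  "paired_limit x y u v \<Longrightarrow> paired_limit x y (c *\<^sub>C u) (c *\<^sub>C v)"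
proof -
  assume "paired_limit x y u v"
  then obtain f g where fg: "\<And>n. paired_span x y (f n) (g n)" "f \<longlonglongrightarrow> u" "g \<longlonglongrightarrow> v"
    unfolding paired_limit_def by blast
  show "paired_limit x y (c *\<^sub>C u) (c *\<^sub>C v)"
    unfolding paired_limit_def
    by (rule exI[of _ "\<lambda>n. c *\<^sub>C f n"], rule exI[of _ "\<lambda>n. c *\<^sub>C g n"])
      (simp add: fg tendsto_scaleC paired_span.scale)
  assume "paired_limit x y u' v'"
  then obtain f' g' where fg': "\<And>n. paired_span x y (f' n) (g' n)" "f' \<longlonglongrightarrow> u'" "g' \<longlonglongrightarrow> v'"
    unfolding paired_limit_def by blast
  show "paired_limit x y (u + u') (v + v')"
    unfolding paired_limit_def
    by (rule exI[of _ "\<lambda>n. f n + f' n"], rule exI[of _ "\<lambda>n. g n + g' n"])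
      (simp add: fg fg' tendsto_add paired_span.add)
qed

lemma paired_limit_swap: "paired_limit x y u v \<Longrightarrow> paired_limit y x v u"
  unfolding paired_limit_def using paired_span_swap by blast

lemma paired_limit_in: "paired_limit x y u v \<Longrightarrow> v \<in> closed_cspan (range y)"
  unfolding paired_limit_def
  using closed_sequentially[OF closed_csubspaceD(4)[OF closed_cspan_closed_csubspace]] paired_span_in by blast

lemma gram_unitary:
  fixes x :: "'i \<Rightarrow> 'a::chilbert_space" and y :: "'i \<Rightarrow> 'b::chilbert_space"
  assumes gram: "\<And>i j. cinner (x i) (x j) = cinner (y i) (y j)"
  obtains U where "isometric_embedding (closed_cspan (range x)) (closed_cspan (range y)) U"
    "U ` closed_cspan (range x) = closed_cspan (range y)" "\<And>i. U (x i) = y i"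
proof -
  let ?S = "closed_cspan (range x)" and ?L = "closed_cspan (range y)"
  define U where "U u = (SOME v. paired_limit x y u v)" for u
  have U: "paired_limit x y u (U u)" if "u \<in> ?S" for u
    unfolding U_def by (rule someI_ex[OF paired_limit_exists[OF gram that]])
  have Ueq: "U u = v" if "paired_limit x y u v" for u v
  proof -
    have "u \<in> ?S" using paired_limit_in[OF paired_limit_swap[OF that]] .
    from paired_limit_unique[OF gram U[OF this] that] show ?thesis .
  qed
  note S = closed_csubspaceD[OF closed_cspan_closed_csubspace]
  have "isometric_embedding ?S ?L U"
    unfolding isometric_embedding_def clinear_on_def
  proof (intro conjI ballI allI image_subsetI)
    fix u assume u: "u \<in> ?S"
    show "U u \<in> ?L" by (rule paired_limit_in[OF U[OF u]])
    show "U (c *\<^sub>C u) = c *\<^sub>C U u" for c by (rule Ueq[OF paired_limit_linear(2)[OF U[OF u]]])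
    fix v assume v: "v \<in> ?S"
    show "U (u + v) = U u + U v" by (rule Ueq[OF paired_limit_linear(1)[OF U[OF u] U[OF v]]])
    show "cinner (U u) (U v) = cinner u v" using paired_limit_gram[OF gram U[OF u] U[OF v]] by simp
  qed
  moreover have "U ` ?S = ?L"
  proof
    show "U ` ?S \<subseteq> ?L" using paired_limit_in U by blast
    show "?L \<subseteq> U ` ?S"
    proof
      fix w assume "w \<in> ?L"
      then obtain u where "paired_limit y x w u"
        using paired_limit_exists[of y x w] gram by metis
      then have *: "paired_limit x y u w" by (rule paired_limit_swap)
      then have "u \<in> ?S" using paired_limit_in[OF paired_limit_swap] by blast
      then show "w \<in> U ` ?S" using Ueq[OF *] by blast
    qed
  qed
  moreover have "U (x i) = y i" for i
  proof (rule Ueq)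
    show "paired_limit x y (x i) (y i)"
      unfolding paired_limit_def
      by (rule exI[of _ "\<lambda>_. x i"], rule exI[of _ "\<lambda>_. y i"]) (simp add: paired_span.base)
  qed
  ultimately show ?thesis using that by blast
qed

lemma eq_on_closed_cspan:
  fixes f g :: "'a::complex_inner \<Rightarrow> 'b::complex_inner"
  assumes f: "clinear_on (closed_cspan X) f" "\<And>x. x \<in> closed_cspan X \<Longrightarrow> norm (f x) \<le> C * norm x"
    and g: "clinear_on (closed_cspan X) g" "\<And>x. x \<in> closed_cspan X \<Longrightarrow> norm (g x) \<le> C' * norm x"
    and eq: "\<And>x. x \<in> X \<Longrightarrow> f x = g x" and x: "x \<in> closed_cspan X"
  shows "f x = g x"
proof -
  let ?S = "closed_cspan X"
  note S = closed_csubspaceD[OF closed_cspan_closed_csubspace[of X]]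
  have lim: "(\<lambda>n. h (s n)) \<longlonglongrightarrow> h l"
    if h: "clinear_on ?S h" "\<And>x. x \<in> ?S \<Longrightarrow> norm (h x) \<le> C * norm x" and s: "\<And>n. s n \<in> ?S" "s \<longlonglongrightarrow> l" "l \<in> ?S"
    for h :: "'a \<Rightarrow> 'b" and C s l
  proof -
    have d: "h (s n) - h l = h (s n - l)" for n
    proof -
      have "h (s n + (- 1) *\<^sub>C l) = h (s n) + (- 1) *\<^sub>C h l"
        using h(1) s(1) s(3) S(3)[OF s(3), of "- 1"] by (simp only: clinear_on_def)
      then show ?thesis by (simp add: scaleC_minus_left)
    qed
    have "(\<lambda>n. h (s n) - h l) \<longlonglongrightarrow> 0"
    proof (rule Lim_null_comparison)
      show "\<forall>\<^sub>F n in sequentially. norm (h (s n) - h l) \<le> C * norm (s n - l)"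
        unfolding d by (intro always_eventually allI h(2) S(6) s(1) s(3))
      show "(\<lambda>n. C * norm (s n - l)) \<longlonglongrightarrow> 0"
        using tendsto_mult_left[OF tendsto_norm_zero[OF LIM_zero[OF s(2)]], of C] by simp
    qed
    then show ?thesis by (simp add: LIM_zero_iff)
  qed
  let ?M = "{x \<in> ?S. f x = g x}"
  have "closed ?M"
    unfolding closed_sequential_limits
  proof (intro allI impI, elim conjE)
    fix s l assume s: "\<forall>n. s n \<in> ?M" "s \<longlonglongrightarrow> l"
    then have sS: "\<And>n. s n \<in> ?S" by blast
    have l: "l \<in> ?S" by (rule closed_sequentially[OF S(4) sS s(2)])
    have "(\<lambda>n. f (s n)) = (\<lambda>n. g (s n))" using s(1) by auto
    then have "f l = g l" using LIMSEQ_unique lim[OF f sS s(2) l] lim[OF g sS s(2) l] by metis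
    with l show "l \<in> ?M" by blast
  qed
  then have "closed_csubspace ?M"
  proof (rule closed_csubspaceI)
    have "f 0 = 0" "g 0 = 0"
      using f(2)[OF S(1)] g(2)[OF S(1)] by simp_all
    then show "0 \<in> ?M" using S(1) by simp
  qed (use f(1) g(1) S(2,3) in \<open>simp_all add: clinear_on_def\<close>)
  moreover have "X \<subseteq> ?M" using eq closed_cspan_superset by blast
  ultimately show ?thesis using closed_cspan_minimal x by blast
qed

lemma isometric_embedding_norm:
  "isometric_embedding S L J \<Longrightarrow> x \<in> S \<Longrightarrow> norm (J x) = norm x"
  by (rule norm_eq_from_cinner) (simp add: isometric_embedding_def)

lemma isometric_embedding_range:
  fixes J :: "'h::chilbert_space \<Rightarrow> 'k::complex_inner"
  assumes J: "isometric_embedding UNIV S J"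
  shows "closed_csubspace (range J)"
proof (rule closed_csubspaceI)
  have lin: "J (x + y) = J x + J y" "J (c *\<^sub>C x) = c *\<^sub>C J x" for x y c
    using J by (simp_all add: isometric_embedding_def clinear_on_def)
  have diff: "norm (J x - J y) = norm (x - y)" for x y
    using isometric_embedding_norm[OF J, of "x + (- 1) *\<^sub>C y"] by (simp only: lin UNIV_I) (simp add: scaleC_minus_left)
  show "closed (range J)"
    unfolding closed_sequential_limits
  proof (intro allI impI, elim conjE)
    fix s l assume s: "\<forall>n. s n \<in> range J" "s \<longlonglongrightarrow> l"
    then have "\<forall>n. \<exists>x. s n = J x" by blast
    from choice[OF this] obtain t where t: "\<And>n. s n = J (t n)" by blast
    have "Cauchy t"
      using LIMSEQ_imp_Cauchy[OF s(2)] by (simp add: Cauchy_def dist_norm t diff)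
    then obtain x where x: "t \<longlonglongrightarrow> x" by (meson Cauchy_convergent convergent_def)
    have "(\<lambda>n. norm (J (t n) - J x)) \<longlonglongrightarrow> 0"
      unfolding diff by (rule tendsto_norm_zero[OF LIM_zero[OF x]])
    moreover have "s = (\<lambda>n. J (t n))" using t by (simp add: fun_eq_iff)
    ultimately have "s \<longlonglongrightarrow> J x" by (simp add: LIM_zero_iff tendsto_norm_zero_iff)
    then show "l \<in> range J" using LIMSEQ_unique s(2) by blast
  qed
  show "0 \<in> range J" using lin(2)[of 0 0] by (metis rangeI scaleC_zero_left)
  show "x + y \<in> range J" if "x \<in> range J" "y \<in> range J" for x y
    using that by (auto simp: lin(1)[symmetric])
  show "c *\<^sub>C x \<in> range J" if "x \<in> range J" for c x
    using that by (auto simp: lin(2)[symmetric])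
qed

text \<open>Common powers of the isometry cancel, and the remaining one-sided power compresses to a
  power of \<open>Q\<close>.\<close>

lemma isometric_pow_gram:
  fixes W :: "'k::complex_inner \<Rightarrow> 'k"
  assumes W: "\<And>x y. x \<in> S \<Longrightarrow> y \<in> S \<Longrightarrow> cinner (W x) (W y) = cinner x y" "\<And>x. x \<in> S \<Longrightarrow> W x \<in> S"
    and J: "\<And>h. J h \<in> S" and dil: "\<And>m h g. cinner ((W ^^ m) (J h)) (J g) = cinner ((Q ^^ m) h) g"
  shows "cinner ((W ^^ k) (J h)) ((W ^^ l) (J g))
    = (if l \<le> k then cinner ((Q ^^ (k - l)) h) g else cnj (cinner ((Q ^^ (l - k)) g) h))"
proof -
  have pS: "(W ^^ m) (J h) \<in> S" for m h by (induction m) (simp_all add: W J)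
  have *: "cinner ((W ^^ (m + l)) (J h)) ((W ^^ l) (J g)) = cinner ((Q ^^ m) h) g" for m l h g
    by (induction l) (simp_all add: W pS dil)
  show ?thesis
  proof (cases "l \<le> k")
    case True
    then show ?thesis using *[of "k - l" l h g] by simp
  next
    case False
    then show ?thesis
      using *[of "l - k" k g h] cinner_commute[of "(W ^^ k) (J h)" "(W ^^ l) (J g)"] by simp
  qed
qed

section \<open>Contractivity of two-term Toeplitz operators\<close>

text \<open>A discrete form of Parseval's identity: for polynomials, averaging over sufficiently
  many roots of unity replaces integration over the circle.\<close>

lemma parseval_roots_of_unity:
  fixes c :: "nat \<Rightarrow> 'a::complex_inner"
  assumes M: "0 < M"
  shows "(\<Sum>j<M. (norm (\<Sum>n<M. (cis (2 * pi * real j / real M)) ^ n *\<^sub>C c n))\<^sup>2) = real M * (\<Sum>n<M. (norm (c n))\<^sup>2)"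
proof -
  define w where "w j = cis (2 * pi * real j / real M)" for j
  have w_pow: "w j ^ n = w n ^ j" for j n
    unfolding w_def Complex.DeMoivre by (rule arg_cong[where f = cis]) simp
  have ort: "(\<Sum>j<M. w j ^ n * cnj (w j ^ m)) = (if n = m then of_nat M else 0)" if nm: "n < M" "m < M" for n m
  proof -
    define r where "r = w n * cnj (w m)"
    have "(\<Sum>j<M. w j ^ n * cnj (w j ^ m)) = (\<Sum>j<M. r ^ j)"
      by (simp only: w_pow[of _ n] w_pow[of _ m] r_def power_mult_distrib complex_cnj_power)
    also have "\<dots> = (if n = m then of_nat M else 0)"
    proof (cases "n = m")
      case True
      then have "r = 1" by (simp add: r_def w_def cis_cnj cis_mult)
      with True show ?thesis by simp
    next
      case False
      have "r \<noteq> 1"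
      proof
        assume "r = 1"
        then have "w n * (cnj (w m) * w m) = w m" by (simp add: r_def mult.assoc[symmetric])
        then have "w n = w m" by (simp add: w_def cis_cnj cis_mult)
        moreover have "inj_on w {..<M}"
          using Complex.bij_betw_roots_unity[OF M] unfolding w_def[abs_def] bij_betw_def by simp
        ultimately show False using nm False by (auto simp: inj_on_def)
      qed
      moreover have "r ^ M = 1"
      proof -
        have "w k ^ M = 1" for k using M by (simp add: w_def Complex.DeMoivre cis_multiple_2pi)
        then show ?thesis by (simp add: r_def power_mult_distrib flip: complex_cnj_power)
      qed
      ultimately show ?thesis using False by (simp add: geometric_sum)
    qed
    finally show ?thesis .
  qed
  have "complex_of_real (\<Sum>j<M. (norm (\<Sum>n<M. w j ^ n *\<^sub>C c n))\<^sup>2)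
      = (\<Sum>j<M. \<Sum>n<M. \<Sum>m<M. w j ^ n * cnj (w j ^ m) * cinner (c n) (c m))"
    unfolding of_real_sum
    by (intro sum.cong refl)
      (simp only: cinner_self[symmetric] cinner_sum_left cinner_sum_right cinner_scaleC_left
        cinner_scaleC_right mult.assoc sum_distrib_left, subst sum.swap, simp only: mult.left_commute)
  also have "\<dots> = (\<Sum>n<M. \<Sum>m<M. \<Sum>j<M. w j ^ n * cnj (w j ^ m) * cinner (c n) (c m))"
    by (subst sum.swap) (rule sum.cong[OF refl], rule sum.swap)
  also have "\<dots> = (\<Sum>n<M. \<Sum>m<M. (if n = m then of_nat M else 0) * cinner (c n) (c m))"
    by (intro sum.cong refl) (simp only: sum_distrib_right[symmetric] ort lessThan_iff)
  also have "\<dots> = (\<Sum>n<M. of_nat M * cinner (c n) (c n))"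
    by (intro sum.cong refl) (simp add: if_distrib[of "\<lambda>x. x * _"] cong: if_cong)
  also have "\<dots> = complex_of_real (real M * (\<Sum>n<M. (norm (c n))\<^sup>2))"
    by (simp add: cinner_self sum_distrib_left)
  finally show ?thesis unfolding of_real_eq_iff w_def .
qed

text \<open>Multiplication of a vector polynomial by the symbol \<open>b + z a\<close> does not
  increase its norm at any point of the circle; Parseval turns this into the inequality for
  coefficients.\<close>

lemma two_term_toeplitz_finite:
  fixes a b :: "'a::chilbert_space bop" and d :: "nat \<Rightarrow> 'a"
  assumes ab: "\<And>z v. cmod z = 1 \<Longrightarrow> norm (b *\<^sub>V v + z *\<^sub>C (a *\<^sub>V v)) \<le> norm v"
  shows "(\<Sum>n<N. (norm (a *\<^sub>V d n + b *\<^sub>V d (Suc n)))\<^sup>2) \<le> (\<Sum>n<Suc N. (norm (d n))\<^sup>2)"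
proof -
  define e where "e n = (if n < Suc N then d n else 0)" for n
  \<comment> \<open>The coefficients of \<open>(b + z a) p(z)\<close>, where \<open>p\<close> has
    the truncated coefficients \<open>e\<close>.\<close>
  define c where "c n = (case n of 0 \<Rightarrow> 0 | Suc k \<Rightarrow> a *\<^sub>V e k) + b *\<^sub>V e n" for n
  \<comment> \<open>The product has degree \<open>N + 1\<close>, so \<open>N + 2\<close> roots of
    unity determine its coefficients without wrap-around.\<close>
  let ?M = "Suc (Suc N)"
  define w where "w j = cis (2 * pi * real j / real ?M)" for j
  have key: "(norm (\<Sum>n<?M. w j ^ n *\<^sub>C c n))\<^sup>2 \<le> (norm (\<Sum>n<?M. w j ^ n *\<^sub>C e n))\<^sup>2" for j
  proof -
    define p where "p = (\<Sum>n<?M. w j ^ n *\<^sub>C e n)"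
    have lin: "f *\<^sub>V (\<Sum>n\<in>I. w j ^ n *\<^sub>C e n) = (\<Sum>n\<in>I. w j ^ n *\<^sub>C (f *\<^sub>V e n))" for f :: "'a bop" and I
      by (simp add: linear_sum[OF bounded_linear.linear[OF bounded_linear_bapp]] bapp_scaleC)
    have p': "p = (\<Sum>n<Suc N. w j ^ n *\<^sub>C e n)"
      unfolding p_def by (subst sum.lessThan_Suc) (simp add: e_def)
    have "(\<Sum>n<?M. w j ^ n *\<^sub>C (case n of 0 \<Rightarrow> 0 | Suc k \<Rightarrow> a *\<^sub>V e k)) = (\<Sum>n<Suc N. w j ^ Suc n *\<^sub>C (a *\<^sub>V e n))"
      by (subst sum.lessThan_Suc_shift) simp
    also have "\<dots> = w j *\<^sub>C (a *\<^sub>V p)"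
      by (simp only: p' lin linear_sum[OF bounded_linear.linear[OF bounded_linear_scaleC], of "w j"]
          scaleC_scaleC power_Suc)
    finally have "(\<Sum>n<?M. w j ^ n *\<^sub>C c n) = b *\<^sub>V p + w j *\<^sub>C (a *\<^sub>V p)"
      unfolding c_def scaleC_add_right sum.distrib p_def lin by (simp add: add.commute)
    then have "norm (\<Sum>n<?M. w j ^ n *\<^sub>C c n) \<le> norm p" using ab[of "w j" p] by (simp add: w_def)
    then show ?thesis unfolding p_def by (intro power_mono) auto
  qed
  have "real ?M * (\<Sum>n<?M. (norm (c n))\<^sup>2) \<le> real ?M * (\<Sum>n<?M. (norm (e n))\<^sup>2)"
  proof -
    have "(\<Sum>j<?M. (norm (\<Sum>n<?M. w j ^ n *\<^sub>C c n))\<^sup>2) \<le> (\<Sum>j<?M. (norm (\<Sum>n<?M. w j ^ n *\<^sub>C e n))\<^sup>2)"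
      by (intro sum_mono key)
    then show ?thesis
      unfolding w_def parseval_roots_of_unity[OF zero_less_Suc] .
  qed
  then have le: "(\<Sum>n<?M. (norm (c n))\<^sup>2) \<le> (\<Sum>n<?M. (norm (e n))\<^sup>2)"
    by (simp only: mult_le_cancel_left_pos of_nat_0_less_iff zero_less_Suc)
  have "(\<Sum>n<N. (norm (a *\<^sub>V d n + b *\<^sub>V d (Suc n)))\<^sup>2) = (\<Sum>n<N. (norm (c (Suc n)))\<^sup>2)"
    by (intro sum.cong refl) (simp add: c_def e_def)
  also have "\<dots> \<le> (\<Sum>n<Suc N. (norm (c (Suc n)))\<^sup>2)" by simp
  also have "\<dots> \<le> (\<Sum>n<?M. (norm (c n))\<^sup>2)"
    by (subst (2) sum.lessThan_Suc_shift) simp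
  also note le
  also have "(\<Sum>n<?M. (norm (e n))\<^sup>2) = (\<Sum>n<Suc N. (norm (d n))\<^sup>2)"
    by (subst sum.lessThan_Suc) (simp add: e_def)
  finally show ?thesis .
qed

lemma two_term_toeplitz_contraction:
  fixes a b :: "'a::chilbert_space bop"
  assumes "\<And>z v. cmod z = 1 \<Longrightarrow> norm (b *\<^sub>V v + z *\<^sub>C (a *\<^sub>V v)) \<le> norm v"
  shows "norm (ell2_map a x + ell2_map b (ell2_tl x)) \<le> norm x"
proof (rule power2_le_imp_le)
  show "(norm (ell2_map a x + ell2_map b (ell2_tl x)))\<^sup>2 \<le> (norm x)\<^sup>2"
    unfolding norm_ell2_sq[of "ell2_map a x + ell2_map b (ell2_tl x)"]
  proof (rule suminf_le_const[OF summable_ell2])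
    fix N
    have "(\<Sum>n<N. (norm (ell2_nth (ell2_map a x + ell2_map b (ell2_tl x)) n))\<^sup>2) \<le> (\<Sum>n<Suc N. (norm (ell2_nth x n))\<^sup>2)"
      using two_term_toeplitz_finite[OF assms, where N = N and d = "ell2_nth x"]
      by (simp add: ell2_nth_simps)
    also have "\<dots> \<le> (norm x)\<^sup>2" by (rule sum_norm_ell2_le)
    finally show "(\<Sum>n<N. (norm (ell2_nth (ell2_map a x + ell2_map b (ell2_tl x)) n))\<^sup>2) \<le> (norm x)\<^sup>2" .
  qed
qed simp

section \<open>The defect operator\<close>

lemma ext_UNIV_bapp: "ext UNIV (bapp a) = a"
  by (rule bop_eqI) (simp add: bapp_ext)

lemma cinner_bpos_self:
  assumes "bpos a"
  shows "cinner (a *\<^sub>V x) x \<in> \<real>\<^sub>\<ge>\<^sub>0"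
proof -
  have "cinner (a *\<^sub>V x) x = cnj (cinner (a *\<^sub>V x) x)"
    using cinner_adj[of a x x] cinner_commute[of x "a *\<^sub>V x"] bpos_adj[OF assms] by simp
  then have "Im (cinner (a *\<^sub>V x) x) = 0" by (simp add: complex_eq_iff)
  then show ?thesis
    using bpos_inner[OF assms, of x] by (simp add: complex_nonneg_Reals_iff inner_eq_Re_cinner)
qed

text \<open>In a complex space a real-valued form forces self-adjointness, by polarisation.\<close>

lemma bpos_if_form_nonneg:
  assumes "\<And>x. cinner (a *\<^sub>V x) x \<in> \<real>\<^sub>\<ge>\<^sub>0"
  shows "bpos a"
proof -
  have re: "Im (cinner (a *\<^sub>V x) x) = 0" "0 \<le> Re (cinner (a *\<^sub>V x) x)" for x
    using assms[of x] by (simp_all add: complex_nonneg_Reals_iff)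
  have eq: "cinner (a *\<^sub>V x) x = cinner x (a *\<^sub>V x)" for x
    using cinner_commute[of x "a *\<^sub>V x"] re(1)[of x] by (simp add: complex_eq_iff)
  have lin: "clinear_on UNIV (bapp a)" "clinear_on UNIV (\<lambda>x::'a. x)"
    by (simp_all add: clinear_on_def bapp_add bapp_scaleC)
  have "cinner (a *\<^sub>V x) y = cinner x (a *\<^sub>V y)" for x y
    by (rule cinner_eq_from_form[OF lin closed_csubspace_UNIV _ lin(2,1)]) (simp_all add: eq)
  then have "adj a = a" by (intro adj_eqI) (simp add: inner_eq_Re_cinner)
  then show ?thesis using re(2) by (simp add: bpos_def inner_eq_Re_cinner)
qed

text \<open>The description behind \<open>defect_op\<close> ranges over functions. A candidate is
  bounded, hence a \<open>bop\<close>, positive by its form, and the uniqueness of positive roots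
  applies.\<close>

lemma defect_op_exists:
  assumes P: "\<And>x. norm (P *\<^sub>V x) \<le> norm x"
  obtains D where "bpos D" "D * D = 1 - adj P * P" "defect_op (bapp P) = bapp D"
proof -
  have "bpos (1 - adj P * P)"
    using power_mono[OF P] by (simp add: bpos_def inner_diff_left inner_adj' power2_norm_eq_inner[symmetric])
  then obtain D where D: "bpos D" "D * D = 1 - adj P * P" using bpos_sqrt_exists by blast
  have adjP: "adjoint_on UNIV (bapp P) y = adj P *\<^sub>V y" for y
    by (simp add: adjoint_on_ext ext_UNIV_bapp)
  have DD: "D *\<^sub>V D *\<^sub>V x = x - adj P *\<^sub>V P *\<^sub>V x" for x
    using arg_cong[OF D(2), of "\<lambda>a. a *\<^sub>V x"] by simp
  have "defect_op (bapp P) = bapp D"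
    unfolding defect_op_def
  proof (rule the_equality)
    show "operator_on UNIV (bapp D) \<and> (\<forall>x. cinner (D *\<^sub>V x) x \<in> \<real>\<^sub>\<ge>\<^sub>0) \<and>
        (\<forall>x. D *\<^sub>V D *\<^sub>V x = x - adjoint_on UNIV (bapp P) (P *\<^sub>V x))"
      by (simp add: adjP DD cinner_bpos_self[OF D(1)])
    fix R assume R: "operator_on UNIV R \<and> (\<forall>x. cinner (R x) x \<in> \<real>\<^sub>\<ge>\<^sub>0) \<and>
        (\<forall>x. R (R x) = x - adjoint_on UNIV (bapp P) (P *\<^sub>V x))"
    define r where "r = ext UNIV R"
    have r: "bapp r = R" using R by (simp add: r_def bapp_ext_UNIV)
    have "bpos r" using R by (intro bpos_if_form_nonneg) (simp add: r)
    moreover have "r * r = D * D"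
      by (rule bop_eqI) (use R in \<open>simp add: r DD adjP\<close>)
    ultimately have "r = D" using bpos_sqrt_unique D(1) by blast
    with r show "R = bapp D" by simp
  qed
  with D that show ?thesis by blast
qed

section \<open>The model space\<close>

locale tetrablock_model =
  fixes A B P :: "'h::chilbert_space bop" and F1 F2 :: "'h \<Rightarrow> 'h"
  assumes contr: "tetrablock_contraction UNIV (bapp A) (bapp B) (bapp P)"
    and fund: "fundamental_operators (bapp A) (bapp B) (bapp P) F1 F2"
begin

definition D :: "'h bop" where "D = ext UNIV (defect_op (bapp P))"

abbreviation "DP \<equiv> defect_space (bapp P)"
abbreviation "f1 \<equiv> ext DP F1"
abbreviation "f2 \<equiv> ext DP F2"

lemma P_norm: "norm (P *\<^sub>V x) \<le> norm x"
proof (rule power2_le_imp_le)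
  show "(norm (P *\<^sub>V x))\<^sup>2 \<le> (norm x)\<^sup>2"
    using contraction_form_gap[OF contr, of x]
      norm_ge_zero[of "cinner (B *\<^sub>V x) x - cinner (P *\<^sub>V x) (A *\<^sub>V x)"]
      norm_ge_zero[of "cinner (A *\<^sub>V x) x - cinner (P *\<^sub>V x) (B *\<^sub>V x)"] by argo
qed simp

lemma D: "bpos D" "D * D = 1 - adj P * P" "defect_op (bapp P) = bapp D"
proof -
  obtain D' where "bpos D'" "D' * D' = 1 - adj P * P" "defect_op (bapp P) = bapp D'"
    using defect_op_exists[OF P_norm] .
  moreover from this have "D = D'" by (simp add: D_def ext_UNIV_bapp)
  ultimately show "bpos D" "D * D = 1 - adj P * P" "defect_op (bapp P) = bapp D" by simp_all
qed

lemma D_adj: "adj D = D" by (rule bpos_adj[OF D(1)])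

lemma norm_D: "(norm (D *\<^sub>V x))\<^sup>2 = (norm x)\<^sup>2 - (norm (P *\<^sub>V x))\<^sup>2"
proof -
  have "(norm (D *\<^sub>V x))\<^sup>2 = inner ((D * D) *\<^sub>V x) x"
    using inner_adj[of D "D *\<^sub>V x" x] by (simp add: D_adj power2_norm_eq_inner)
  then show ?thesis by (simp add: D(2) inner_diff_left inner_adj' power2_norm_eq_inner)
qed

lemma DP_eq: "DP = closure (range (bapp D))"
  by (simp add: defect_space_def D(3))

lemma DP: "closed_csubspace DP"
  unfolding DP_eq
proof (rule closed_csubspace_closure)
  show "0 \<in> range (bapp D)" by (rule range_eqI[of _ _ 0]) simp
  fix x y c assume "x \<in> range (bapp D)" "y \<in> range (bapp D)"
  then obtain u w where "x = D *\<^sub>V u" "y = D *\<^sub>V w" by blast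
  then have 1: "x + y = D *\<^sub>V (u + w)" and 2: "c *\<^sub>C x = D *\<^sub>V (c *\<^sub>C u)"
    by (simp_all add: bapp_add bapp_scaleC)
  show "x + y \<in> range (bapp D)" unfolding 1 by (rule rangeI)
  show "c *\<^sub>C x \<in> range (bapp D)" unfolding 2 by (rule rangeI)
qed

lemma D_in: "D *\<^sub>V x \<in> DP"
  unfolding DP_eq by (rule subsetD[OF closure_subset], rule rangeI)

lemma DP_eqI:
  assumes "u \<in> DP" "v \<in> DP" "\<And>g. cinner u (D *\<^sub>V g) = cinner v (D *\<^sub>V g)"
  shows "u = v"
proof -
  have d: "u - v \<in> DP" by (rule closed_csubspaceD(6)[OF DP assms(1,2)])
  then obtain s where s: "\<And>n. s n \<in> range (bapp D)" "s \<longlonglongrightarrow> u - v"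
    unfolding DP_eq closure_sequential by blast
  have "cinner (u - v) (s n) = 0" for n
    using s(1)[of n] assms(3) by (auto simp: cinner_diff_left)
  then have "cinner (u - v) (u - v) = 0"
    using LIMSEQ_unique[OF tendsto_cinner[OF tendsto_const s(2), of "u - v"]] by simp
  then show ?thesis by (simp add: cinner_self)
qed

lemma F_op: "operator_on DP F1" "operator_on DP F2"
  using fund by (simp_all add: fundamental_operators_def)

lemma fund_eq: "A - adj B * P = D * f1 * D" "B - adj A * P = D * f2 * D"
proof -
  have a: "adjoint_on UNIV (bapp T) y = adj T *\<^sub>V y" for T :: "'h bop" and y
    by (simp add: adjoint_on_ext ext_UNIV_bapp)
  show "A - adj B * P = D * f1 * D" "B - adj A * P = D * f2 * D"
    using fund unfolding fundamental_operators_def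
    by (auto intro!: bop_eqI simp: a D(3) bapp_ext[OF F_op(1) D_in] bapp_ext[OF F_op(2) D_in])
qed

lemma commute: "A * B = B * A" "A * P = P * A" "B * P = P * B"
  using contraction_commute[OF contr] by auto

text \<open>The difference \<open>W\<close> of the two sides takes values in \<open>DP\<close> and
  satisfies \<open>D W = 0\<close> by the fundamental equations; \<open>D\<close> is injective on
  \<open>DP\<close>. The relation is what commutation of the model operators with \<open>v3\<close>
  requires.\<close>

lemma D_intertwine_aux:
  assumes fe: "A' - adj B' * P = D * f * D" "B' - adj A' * P = D * g * D" and c: "A' * P = P * A'"
    and f: "\<And>x. f *\<^sub>V x \<in> DP" "\<And>x. adj g *\<^sub>V x \<in> DP"
  shows "D * A' = f * D + adj g * D * P"
proof -
  define W where "W = D * A' - (f * D + adj g * D * P)"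
  have "D * W = (D * D) * A' - (D * f * D) - (D * adj g * D) * P"
    by (simp add: W_def algebra_simps)
  also have "D * adj g * D = adj B' - adj P * A'"
    using arg_cong[OF fe(2), of adj] by (simp add: D_adj mult.assoc)
  also have "D * D * A' - D * f * D - (adj B' - adj P * A') * P = adj P * (A' * P - P * A')"
    unfolding fe(1)[symmetric] D(2) by (simp add: algebra_simps)
  finally have DW: "D * W = 0" using c by simp
  have "W *\<^sub>V x = 0" for x
  proof (rule DP_eqI)
    have "W *\<^sub>V x = D *\<^sub>V A' *\<^sub>V x - (f *\<^sub>V D *\<^sub>V x + adj g *\<^sub>V D *\<^sub>V P *\<^sub>V x)" by (simp add: W_def)
    also have "\<dots> \<in> DP" by (intro closed_csubspaceD(2,6)[OF DP] D_in f)
    finally show "W *\<^sub>V x \<in> DP" .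
    show "0 \<in> DP" by (rule closed_csubspaceD(1)[OF DP])
    show "cinner (W *\<^sub>V x) (D *\<^sub>V g) = cinner 0 (D *\<^sub>V g)" for g
      using cinner_adj[of D "W *\<^sub>V x" g] arg_cong[OF DW, of "\<lambda>a. a *\<^sub>V x"] by (simp add: D_adj)
  qed
  then have "W = 0" by (intro bop_eqI) simp
  then show ?thesis by (simp add: W_def)
qed

lemma D_intertwine: "D * A = f1 * D + adj f2 * D * P" "D * B = f2 * D + adj f1 * D * P"
  by (rule D_intertwine_aux[OF fund_eq commute(2)] D_intertwine_aux[OF fund_eq(2,1) commute(3)];
      simp add: ext_in F_op adj_ext_in)+

text \<open>Replacing \<open>h0\<close> by \<open>D h0\<close> separates the two ingredients of the
  model: \<open>v3\<close> prepends \<open>P h0\<close> to \<open>cD x\<close>, and the tail of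
  \<open>v T f g x\<close> is a two-term Toeplitz operator applied to \<open>cD x\<close>.\<close>

definition cD :: "'h ell2 \<Rightarrow> 'h ell2" where
  "cD x = ell2_cons (D *\<^sub>V ell2_nth x 0) (ell2_tl x)"

definition v :: "'h bop \<Rightarrow> 'h bop \<Rightarrow> 'h bop \<Rightarrow> 'h ell2 \<Rightarrow> 'h ell2" where
  "v T f g x = ell2_cons (T *\<^sub>V ell2_nth x 0) (ell2_map (adj g) (cD x) + ell2_map f (ell2_tl x))"

definition v3 :: "'h ell2 \<Rightarrow> 'h ell2" where
  "v3 x = ell2_cons (P *\<^sub>V ell2_nth x 0) (cD x)"

abbreviation "Kd \<equiv> dilation_space (bapp P)"

lemma Kd: "closed_csubspace Kd"
proof -
  have "Kd = {x. \<forall>n. ell2_nth x n \<in> (case n of 0 \<Rightarrow> UNIV | Suc _ \<Rightarrow> DP)}"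
    unfolding dilation_space_def by (auto split: nat.split)
  then show ?thesis
    using closed_csubspace_ell2[of "\<lambda>n. case n of 0 \<Rightarrow> UNIV | Suc _ \<Rightarrow> DP"] DP
    by (simp split: nat.split)
qed

lemma dilation_op_eq:
  assumes F: "operator_on DP F" and G: "operator_on DP G" and x: "x \<in> Kd"
  shows "dilation_op (bapp P) (bapp T) F G x = v T (ext DP F) (ext DP G) x"
proof -
  have xn: "ell2_nth x (Suc n) \<in> DP" for n using x by (simp add: dilation_space_def)
  have "dilation_op (bapp P) (bapp T) F G x = Abs_ell2 (ell2_nth (v T (ext DP F) (ext DP G) x))"
    unfolding dilation_op_def
    by (rule arg_cong[of _ _ Abs_ell2], rule ext)
      (simp add: v_def cD_def D(3) ell2_nth_add ell2_nth_cons adjoint_on_ext[OF G] D_in xn bapp_ext[OF F]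
        split: nat.split)
  then show ?thesis by (simp add: ell2_nth_inverse)
qed

lemma V_eq:
  assumes "x \<in> Kd"
  shows "V1 (bapp A) (bapp P) F1 F2 x = v A f1 f2 x" "V2 (bapp B) (bapp P) F1 F2 x = v B f2 f1 x"
  using assms by (simp_all add: V1_def V2_def dilation_op_eq F_op)

lemma V3_eq: "V3 (bapp P) = v3"
proof (rule HOL.ext)
  fix x
  have "V3 (bapp P) x = Abs_ell2 (ell2_nth (v3 x))"
    unfolding V3_def
    by (rule arg_cong[of _ _ Abs_ell2], rule HOL.ext)
      (simp add: v3_def cD_def D(3) ell2_nth_cons split: nat.split)
  then show "V3 (bapp P) x = v3 x" by (simp add: ell2_nth_inverse)
qed

lemma cD_linear: "cD (x + y) = cD x + cD y" "cD (c *\<^sub>C x) = c *\<^sub>C cD x"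
  by (simp_all add: cD_def ell2_cons_linear ell2_tl_linear ell2_nth_simps bapp_add bapp_scaleC)

lemma norm_cD: "(norm (cD x))\<^sup>2 = (norm (D *\<^sub>V ell2_nth x 0))\<^sup>2 + (norm (ell2_tl x))\<^sup>2"
  by (simp add: cD_def norm_cons)

lemma cD_nth: "x \<in> Kd \<Longrightarrow> ell2_nth (cD x) n \<in> DP"
  by (cases n) (simp_all add: cD_def D_in dilation_space_def)

lemma v3_norm: "norm (v3 x) = norm x"
proof -
  have "(norm (v3 x))\<^sup>2 = (norm x)\<^sup>2"
    by (simp add: v3_def norm_cons norm_cD norm_D norm_ell2_split[of x])
  then show ?thesis by simp
qed

lemma norm_ell2_cons_le: "norm (ell2_cons h x) \<le> norm h + norm x" for h :: 'h
proof (rule power2_le_imp_le)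
  show "(norm (ell2_cons h x))\<^sup>2 \<le> (norm h + norm x)\<^sup>2"
    by (simp add: norm_cons power2_sum)
qed simp

lemma v_op:
  assumes f: "\<And>x. f *\<^sub>V x \<in> DP" "\<And>x. adj g *\<^sub>V x \<in> DP"
  shows "operator_on Kd (v T f g)"
proof -
  have "clinear_on Kd (v T f g)"
    by (simp add: clinear_on_def v_def cD_linear ell2_map_linear ell2_tl_linear ell2_nth_simps
        ell2_cons_linear bapp_add bapp_scaleC scaleC_add_right)
  moreover have "v T f g ` Kd \<subseteq> Kd"
    by (auto simp: dilation_space_def v_def ell2_nth_simps intro!: closed_csubspaceD(2)[OF DP] f)
  moreover have "norm (v T f g x) \<le> (norm T + norm g * (norm D + 1) + norm f) * norm x" for x
  proof -
    have n0: "norm (ell2_nth x 0) \<le> norm x" by (rule norm_ell2_nth_le)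
    have c: "norm (cD x) \<le> (norm D + 1) * norm x"
    proof -
      have "norm (cD x) \<le> norm (D *\<^sub>V ell2_nth x 0) + norm (ell2_tl x)"
        unfolding cD_def by (rule norm_ell2_cons_le)
      also have "\<dots> \<le> norm D * norm x + norm x"
        by (intro add_mono order_trans[OF norm_bapp] mult_left_mono n0 norm_tl_le) simp
      finally show ?thesis by (simp add: distrib_right)
    qed
    have "norm (v T f g x) \<le> norm (T *\<^sub>V ell2_nth x 0) + norm (ell2_map (adj g) (cD x) + ell2_map f (ell2_tl x))"
      unfolding v_def by (rule norm_ell2_cons_le)
    also have "\<dots> \<le> norm T * norm x + (norm g * ((norm D + 1) * norm x) + norm f * norm x)"
    proof (intro add_mono order_trans[OF norm_triangle_ineq] add_mono)
      show "norm (T *\<^sub>V ell2_nth x 0) \<le> norm T * norm x"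
        by (intro order_trans[OF norm_bapp] mult_left_mono n0) simp
      show "norm (ell2_map (adj g) (cD x)) \<le> norm g * ((norm D + 1) * norm x)"
        using norm_ell2_map_le[of "adj g" "cD x"] mult_left_mono[OF c norm_ge_zero[of g]] by simp
      show "norm (ell2_map f (ell2_tl x)) \<le> norm f * norm x"
        by (intro order_trans[OF norm_ell2_map_le] mult_left_mono norm_tl_le) simp
    qed
    finally show ?thesis by (simp add: algebra_simps)
  qed
  ultimately show ?thesis using Kd unfolding operator_on_def by blast
qed

lemma f_in: "f1 *\<^sub>V x \<in> DP" "f2 *\<^sub>V x \<in> DP" "adj f1 *\<^sub>V x \<in> DP" "adj f2 *\<^sub>V x \<in> DP"
  by (simp_all add: ext_in adj_ext_in F_op)

lemma v1_op: "operator_on Kd (v A f1 f2)" and v2_op: "operator_on Kd (v B f2 f1)"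
  by (simp_all add: v_op f_in)

lemma v3_in: "x \<in> Kd \<Longrightarrow> v3 x \<in> Kd"
  by (simp add: dilation_space_def v3_def) (use cD_nth in \<open>simp add: dilation_space_def\<close>)

lemma v3_op: "operator_on S v3" if "closed_csubspace S" "\<And>x. x \<in> S \<Longrightarrow> v3 x \<in> S"
proof -
  have "clinear_on S v3"
    by (simp add: clinear_on_def v3_def cD_linear ell2_nth_simps ell2_cons_linear bapp_add bapp_scaleC)
  then show ?thesis
    using that v3_norm unfolding operator_on_def by (auto intro!: exI[of _ 1])
qed

lemma v3_op_Kd: "operator_on Kd v3"
  by (rule v3_op[OF Kd v3_in])

lemma v_v3_commute_aux:
  assumes "D * T = f * D + adj g * D * P" "T * P = P * T"
  shows "v T f g (v3 x) = v3 (v T f g x)"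
proof -
  have DT: "D *\<^sub>V T *\<^sub>V y = f *\<^sub>V D *\<^sub>V y + adj g *\<^sub>V D *\<^sub>V P *\<^sub>V y" for y
    using arg_cong[OF assms(1), of "\<lambda>a. a *\<^sub>V y"] by simp
  have TP: "T *\<^sub>V P *\<^sub>V y = P *\<^sub>V T *\<^sub>V y" for y
    using arg_cong[OF assms(2), of "\<lambda>a. a *\<^sub>V y"] by simp
  show ?thesis
    by (simp add: v_def v3_def cD_def ell2_map_linear ell2_cons_linear DT TP add.commute)
qed

lemma v_v3_commute: "v A f1 f2 (v3 x) = v3 (v A f1 f2 x)" "v B f2 f1 (v3 x) = v3 (v B f2 f1 x)"
  by (rule v_v3_commute_aux[OF D_intertwine(1) commute(2)] v_v3_commute_aux[OF D_intertwine(2) commute(3)])+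

text \<open>Displayed entry by entry because the same expansion serves both directions: to verify
  commutation of the model operators and to read the commutator relations off from it.\<close>

lemma v_v:
  fixes x :: "'h ell2"
  defines "t \<equiv> ell2_tl x" and "x0 \<equiv> ell2_nth x 0"
  shows "v T f g (v T' f' g' x) = ell2_cons (T *\<^sub>V T' *\<^sub>V x0)
    (ell2_cons (adj g *\<^sub>V D *\<^sub>V T' *\<^sub>V x0 + f *\<^sub>V adj g' *\<^sub>V D *\<^sub>V x0)
      (ell2_cons (adj g *\<^sub>V adj g' *\<^sub>V D *\<^sub>V x0) (ell2_map (adj g * adj g') t)
        + ell2_map (adj g * f' + f * adj g') t)
      + ell2_map (f * f') t)"
  by (simp add: v_def cD_def t_def x0_def ell2_map_linear ell2_cons_linear add.assoc[symmetric])

text \<open>Only the entry fed by \<open>x0\<close> through \<open>D T'\<close> is not immediate: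
  \<open>D_intertwine\<close> moves \<open>D\<close> past \<open>B\<close> and \<open>A\<close>,
  after which the commutator relations apply.\<close>

lemma v1_v2_commute:
  assumes c: "f1 * f2 = f2 * f1" and n: "adj f2 * f2 + f1 * adj f1 = adj f1 * f1 + f2 * adj f2"
  shows "v A f1 f2 (v B f2 f1 x) = v B f2 f1 (v A f1 f2 x)"
proof -
  have c': "adj f2 * adj f1 = adj f1 * adj f2" using arg_cong[OF c, of adj] by simp
  have AB: "A *\<^sub>V B *\<^sub>V y = B *\<^sub>V A *\<^sub>V y" for y
    using arg_cong[OF commute(1), of "\<lambda>a. a *\<^sub>V y"] by simp
  have c'y: "adj f2 *\<^sub>V adj f1 *\<^sub>V y = adj f1 *\<^sub>V adj f2 *\<^sub>V y" for y
    using arg_cong[OF c', of "\<lambda>a. a *\<^sub>V y"] by simp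
  have "adj f2 * D * B + f1 * adj f1 * D = adj f2 * (D * B) + f1 * adj f1 * D" by (simp add: mult.assoc)
  also have "\<dots> = (adj f2 * f2 + f1 * adj f1) * D + adj f2 * adj f1 * D * P"
    unfolding D_intertwine(2) by (simp add: algebra_simps)
  also have "\<dots> = (adj f1 * f1 + f2 * adj f2) * D + adj f1 * adj f2 * D * P" by (simp only: n c')
  also have "\<dots> = adj f1 * (D * A) + f2 * adj f2 * D"
    unfolding D_intertwine(1) by (simp add: algebra_simps)
  finally have eq: "adj f2 * D * B + f1 * adj f1 * D = adj f1 * D * A + f2 * adj f2 * D"
    by (simp add: mult.assoc)
  have e: "adj f2 *\<^sub>V D *\<^sub>V B *\<^sub>V y + f1 *\<^sub>V adj f1 *\<^sub>V D *\<^sub>V y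
      = adj f1 *\<^sub>V D *\<^sub>V A *\<^sub>V y + f2 *\<^sub>V adj f2 *\<^sub>V D *\<^sub>V y" for y
    using arg_cong[OF eq, of "\<lambda>a. a *\<^sub>V y"] by simp
  show ?thesis unfolding v_v by (simp only: AB c'y c c' e n)
qed

text \<open>All entries agree by construction except the one from the original space to itself, and
  that one is the fundamental equation.\<close>

lemma v_cinner_aux:
  assumes "T - adj T' * P = D * f * D"
  shows "cinner (v T f g x) y = cinner (v3 x) (v T' g f y)"
proof -
  have T: "T = adj T' * P + D * f * D" using assms by (simp add: algebra_simps)
  let ?t = "ell2_tl x" and ?s = "ell2_tl y"
  have "cinner (v3 x) (v T' g f y) = cinner (P *\<^sub>V ell2_nth x 0) (T' *\<^sub>V ell2_nth y 0)
      + cinner (ell2_map f (cD x)) (cD y) + cinner (ell2_map (adj g) (cD x)) ?s"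
    by (simp add: v3_def v_def cinner_add_right cinner_ell2_map)
  also have "cinner (ell2_map f (cD x)) (cD y)
      = cinner (f *\<^sub>V D *\<^sub>V ell2_nth x 0) (D *\<^sub>V ell2_nth y 0) + cinner (ell2_map f ?t) ?s"
    by (simp add: cD_def ell2_map_linear)
  also have "cinner (P *\<^sub>V ell2_nth x 0) (T' *\<^sub>V ell2_nth y 0)
      + (cinner (f *\<^sub>V D *\<^sub>V ell2_nth x 0) (D *\<^sub>V ell2_nth y 0) + cinner (ell2_map f ?t) ?s)
      + cinner (ell2_map (adj g) (cD x)) ?s
      = cinner (T *\<^sub>V ell2_nth x 0) (ell2_nth y 0) + cinner (ell2_map (adj g) (cD x) + ell2_map f ?t) ?s"
    using cinner_adj'[of T' "P *\<^sub>V ell2_nth x 0" "ell2_nth y 0"]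
      cinner_adj[of D "f *\<^sub>V D *\<^sub>V ell2_nth x 0" "ell2_nth y 0"]
    by (simp add: T cinner_add_left D_adj)
  also have "\<dots> = cinner (v T f g x) y"
    by (subst cinner_ell2_split[of "v T f g x" y]) (simp add: v_def)
  finally show ?thesis by simp
qed

lemma v1_cinner: "cinner (v A f1 f2 x) y = cinner (v3 x) (v B f2 f1 y)"
  by (rule v_cinner_aux[OF fund_eq(1)])

text \<open>At a vector \<open>D x\<close> the forms of \<open>f1\<close> and \<open>f2\<close> are
  the two sides of \<open>contraction_form_gap\<close>; density of the range of \<open>D\<close>
  gives the rest of \<open>DP\<close>.\<close>

lemma fundamental_form_bound: "cmod (cinner (f1 *\<^sub>V d) d) + cmod (cinner (f2 *\<^sub>V d) d) \<le> (norm d)\<^sup>2"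
proof -
  have range: "cmod (cinner (f1 *\<^sub>V D *\<^sub>V x) (D *\<^sub>V x)) + cmod (cinner (f2 *\<^sub>V D *\<^sub>V x) (D *\<^sub>V x)) \<le> (norm (D *\<^sub>V x))\<^sup>2" for x
  proof -
    have "cinner (f *\<^sub>V D *\<^sub>V x) (D *\<^sub>V x) = cinner (T *\<^sub>V x) x - cinner (P *\<^sub>V x) (T' *\<^sub>V x)"
      if "T - adj T' * P = D * f * D" for T T' f
    proof -
      have "cinner (f *\<^sub>V D *\<^sub>V x) (D *\<^sub>V x) = cinner ((T - adj T' * P) *\<^sub>V x) x"
        unfolding that using cinner_adj[of D "f *\<^sub>V D *\<^sub>V x" x] by (simp add: D_adj)
      then show ?thesis by (simp add: cinner_diff_left cinner_adj')
    qed
    from this[OF fund_eq(1)] this[OF fund_eq(2)] show ?thesis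
      using contraction_form_gap[OF contr, of x] by (simp add: norm_D)
  qed
  have DPb: "cmod (cinner (f1 *\<^sub>V d) d) + cmod (cinner (f2 *\<^sub>V d) d) \<le> (norm d)\<^sup>2" if "d \<in> DP" for d
  proof -
    obtain s where s: "\<And>n. s n \<in> range (bapp D)" "s \<longlonglongrightarrow> d"
      using \<open>d \<in> DP\<close> unfolding DP_eq closure_sequential by blast
    have "(\<lambda>n. cmod (cinner (f1 *\<^sub>V s n) (s n)) + cmod (cinner (f2 *\<^sub>V s n) (s n)))
        \<longlonglongrightarrow> cmod (cinner (f1 *\<^sub>V d) d) + cmod (cinner (f2 *\<^sub>V d) d)"
      by (intro tendsto_add tendsto_norm tendsto_cinner tendsto_bapp s)
    moreover have "(\<lambda>n. (norm (s n))\<^sup>2) \<longlonglongrightarrow> (norm d)\<^sup>2" by (intro tendsto_power tendsto_norm s)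
    moreover have "cmod (cinner (f1 *\<^sub>V s n) (s n)) + cmod (cinner (f2 *\<^sub>V s n) (s n)) \<le> (norm (s n))\<^sup>2" for n
      using s(1)[of n] range by auto
    ultimately show ?thesis by (intro LIMSEQ_le) auto
  qed
  \<comment> \<open>Off \<open>DP\<close> the extended operators see only the projection of
    \<open>d\<close>.\<close>
  let ?e = "orth_proj DP d"
  have e: "?e \<in> DP" by (rule orth_proj_in[OF DP])
  have "cinner (ext DP F *\<^sub>V d) d = cinner (ext DP F *\<^sub>V ?e) ?e" if "operator_on DP F" for F
    using cinner_orth_proj_right[OF DP ext_in[OF that], of d d]
    by (simp add: bapp_ext_proj[OF that] orth_proj_id[OF DP e])
  from this[OF F_op(1)] this[OF F_op(2)]
  have "cmod (cinner (f1 *\<^sub>V d) d) + cmod (cinner (f2 *\<^sub>V d) d) \<le> (norm ?e)\<^sup>2"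
    using DPb[OF e] by simp
  also have "\<dots> \<le> (norm d)\<^sup>2" by (intro power_mono norm_orth_proj_le[OF DP]) simp
  finally show ?thesis .
qed

lemma v3_pow_nth: "ell2_nth ((v3 ^^ n) x) 0 = (P ^ n) *\<^sub>V ell2_nth x 0"
  by (induction n) (simp_all add: v3_def)

lemma v3_pow_norm: "norm ((v3 ^^ n) x) = norm x"
  by (induction n) (simp_all add: v3_norm)

text \<open>The terms are the successive differences of the decreasing sequence
  \<open>norm (P ^ n x) ^ 2\<close>.\<close>

lemma D_P_pow_tendsto: "(\<lambda>n. (norm (D *\<^sub>V (P ^ n) *\<^sub>V x))\<^sup>2) \<longlonglongrightarrow> 0"
proof -
  let ?p = "\<lambda>n. (norm ((P ^ n) *\<^sub>V x))\<^sup>2"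
  have "?p (Suc n) \<le> ?p n" for n
    by (intro power_mono) (simp_all add: P_norm)
  then obtain l where l: "?p \<longlonglongrightarrow> l"
    by (rule decseq_convergent[of ?p 0, OF decseq_SucI]) auto
  have "(\<lambda>n. ?p n - ?p (Suc n)) \<longlonglongrightarrow> l - l" by (intro tendsto_diff l LIMSEQ_Suc)
  then show ?thesis by (simp add: norm_D)
qed

text \<open>Only \<open>\<parallel>V\<^sub>2 x\<parallel>\<^sup>2 \<le> \<parallel>x\<parallel>\<^sup>2 + \<parallel>D x\<^sub>0\<parallel>\<^sup>2\<close> is immediate; replacing \<open>x\<close> by \<open>V\<^sub>3\<^sup>n x\<close> removes the last
  term.\<close>

lemma v2_norm_le:
  assumes c: "f1 * f2 = f2 * f1" and n: "adj f2 * f2 + f1 * adj f1 = adj f1 * f1 + f2 * adj f2"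
  shows "norm (v B f2 f1 x) \<le> norm x"
proof -
  \<comment> \<open>\<open>f2 + z adj f1\<close> is the symbol of the Toeplitz part of
    \<open>V2\<close>.\<close>
  have N: "norm (f2 *\<^sub>V d + z *\<^sub>C (adj f1 *\<^sub>V d)) \<le> norm d" if z: "cmod z = 1" for z d
  proof -
    define M where "M = f2 + bscal z * adj f1"
    have zz: "z * cnj z = 1" using z by (simp add: complex_norm_square[symmetric])
    have zz': "cnj z * z = 1" using zz by (simp add: mult.commute)
    have c': "adj f2 * adj f1 = adj f1 * adj f2" using arg_cong[OF c, of adj] by simp
    have aM: "adj M *\<^sub>V y = adj f2 *\<^sub>V y + cnj z *\<^sub>C (f1 *\<^sub>V y)" for y
      by (simp add: M_def bapp_scaleC)
    have Mv: "M *\<^sub>V y = f2 *\<^sub>V y + z *\<^sub>C (adj f1 *\<^sub>V y)" for y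
      by (simp add: M_def)
    have "nrm M"
      unfolding nrm_def
    proof (rule bop_eqI)
      fix y
      have cy: "f1 *\<^sub>V f2 *\<^sub>V y = f2 *\<^sub>V f1 *\<^sub>V y"
        "adj f2 *\<^sub>V adj f1 *\<^sub>V y = adj f1 *\<^sub>V adj f2 *\<^sub>V y"
        "adj f2 *\<^sub>V f2 *\<^sub>V y + f1 *\<^sub>V adj f1 *\<^sub>V y = adj f1 *\<^sub>V f1 *\<^sub>V y + f2 *\<^sub>V adj f2 *\<^sub>V y"
        using arg_cong[OF c, of "\<lambda>a. a *\<^sub>V y"] arg_cong[OF c', of "\<lambda>a. a *\<^sub>V y"] arg_cong[OF n, of "\<lambda>a. a *\<^sub>V y"] by simp_all
      have 1: "M *\<^sub>V adj M *\<^sub>V y = (adj f1 *\<^sub>V f1 *\<^sub>V y + f2 *\<^sub>V adj f2 *\<^sub>V y)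
          + (cnj z *\<^sub>C (f2 *\<^sub>V f1 *\<^sub>V y) + z *\<^sub>C (adj f1 *\<^sub>V adj f2 *\<^sub>V y))"
        by (simp only: aM Mv bapp_add bapp_scaleC scaleC_add_right scaleC_scaleC zz zz' scaleC_one add_ac)
      have 2: "adj M *\<^sub>V M *\<^sub>V y = (adj f2 *\<^sub>V f2 *\<^sub>V y + f1 *\<^sub>V adj f1 *\<^sub>V y)
          + (cnj z *\<^sub>C (f1 *\<^sub>V f2 *\<^sub>V y) + z *\<^sub>C (adj f2 *\<^sub>V adj f1 *\<^sub>V y))"
        by (simp only: aM Mv bapp_add bapp_scaleC scaleC_add_right scaleC_scaleC zz zz' scaleC_one add_ac)
      show "(M * adj M) *\<^sub>V y = (adj M * M) *\<^sub>V y"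
        by (simp only: bop_simps(6) 1 2 cy)
    qed
    moreover have "cmod (cinner (M *\<^sub>V x) x) \<le> (norm x)\<^sup>2" for x
    proof -
      have "cinner (M *\<^sub>V x) x = cinner (f2 *\<^sub>V x) x + z * cinner x (f1 *\<^sub>V x)"
        by (simp add: M_def cinner_add_left cinner_scaleC_left cinner_adj')
      then have "cmod (cinner (M *\<^sub>V x) x) \<le> cmod (cinner (f2 *\<^sub>V x) x) + cmod (z * cinner x (f1 *\<^sub>V x))"
        by (simp only: norm_triangle_ineq)
      also have "cmod (z * cinner x (f1 *\<^sub>V x)) = cmod (cinner (f1 *\<^sub>V x) x)"
        using z cinner_commute[of x "f1 *\<^sub>V x"] by (simp add: norm_mult)
      finally show ?thesis using fundamental_form_bound[of x] by linarith
    qed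
    ultimately have "norm M \<le> 1" by (rule norm_le_of_numerical_radius)
    then have "norm (M *\<^sub>V d) \<le> 1 * norm d"
      by (intro order_trans[OF norm_bapp] mult_right_mono) auto
    then show ?thesis by (simp add: M_def)
  qed
  \<comment> \<open>The surplus arises because the norm of \<open>cD y\<close> counts
    \<open>D y0\<close> besides the tail, while the zeroth entry contributes
    \<open>B y0\<close>.\<close>
  have weak: "(norm (v B f2 f1 y))\<^sup>2 \<le> (norm y)\<^sup>2 + (norm (D *\<^sub>V ell2_nth y 0))\<^sup>2" for y
  proof -
    have "norm (ell2_map (adj f1) (cD y) + ell2_map f2 (ell2_tl y)) \<le> norm (cD y)"
      using two_term_toeplitz_contraction[of f2 "adj f1" "cD y"] N by (simp add: cD_def)
    then have "(norm (ell2_map (adj f1) (cD y) + ell2_map f2 (ell2_tl y)))\<^sup>2 \<le> (norm (cD y))\<^sup>2"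
      by (intro power_mono) auto
    moreover have "(norm (B *\<^sub>V ell2_nth y 0))\<^sup>2 \<le> (norm (ell2_nth y 0))\<^sup>2"
      by (intro power_mono contraction_norm_le(2)[OF contr]) simp
    ultimately show ?thesis
      unfolding v_def norm_cons norm_cD norm_ell2_split[of y] ell2_nth_cons by linarith
  qed
  have pow: "v B f2 f1 ((v3 ^^ k) x) = (v3 ^^ k) (v B f2 f1 x)" for k
    by (induction k) (simp_all add: v_v3_commute)
  have "(norm (v B f2 f1 x))\<^sup>2 \<le> (norm x)\<^sup>2 + (norm (D *\<^sub>V (P ^ k) *\<^sub>V ell2_nth x 0))\<^sup>2" for k
    using weak[of "(v3 ^^ k) x"] by (simp add: pow v3_pow_norm v3_pow_nth)
  then have "(norm (v B f2 f1 x))\<^sup>2 \<le> (norm x)\<^sup>2 + 0"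
    by (intro LIMSEQ_le_const[OF tendsto_add[OF tendsto_const D_P_pow_tendsto]]) auto
  then have "(norm (v B f2 f1 x))\<^sup>2 \<le> (norm x)\<^sup>2" by simp
  then show ?thesis by (rule power2_le_imp_le) simp
qed

lemma embed_eq: "ell2_embed h = ell2_cons h 0"
proof -
  have "ell2_embed h = Abs_ell2 (ell2_nth (ell2_cons h 0))"
    unfolding ell2_embed_def
    by (rule arg_cong[of _ _ Abs_ell2], rule HOL.ext) (simp add: ell2_nth_cons ell2_nth_simps split: nat.split)
  then show ?thesis by (simp add: ell2_nth_inverse)
qed

lemma embed_in: "ell2_embed h \<in> Kd"
  by (simp add: embed_eq dilation_space_def ell2_nth_simps closed_csubspaceD(1)[OF DP])

lemma embed_isometric: "isometric_embedding UNIV Kd ell2_embed"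
  unfolding isometric_embedding_def clinear_on_def using embed_in
  by (auto simp: embed_eq ell2_cons_linear)

lemma orth_proj_embed: "orth_proj (range ell2_embed) x = ell2_embed (ell2_nth x 0)" for x :: "'h ell2"
proof (rule orth_proj_unique)
  show "closed_csubspace (range (ell2_embed :: 'h \<Rightarrow> 'h ell2))"
    by (rule isometric_embedding_range[OF embed_isometric])
  show "cinner (x - ell2_embed (ell2_nth x 0)) m = 0" if "m \<in> range ell2_embed" for m
    using that by (auto simp: cinner_ell2_split[of "x - _"] embed_eq ell2_nth_simps ell2_tl_linear)
qed simp

lemma funpow_nth:
  assumes "\<And>x. x \<in> Kd \<Longrightarrow> W x \<in> Kd \<and> ell2_nth (W x) 0 = T (ell2_nth x 0)" "x \<in> Kd"
  shows "(W ^^ k) x \<in> Kd \<and> ell2_nth ((W ^^ k) x) 0 = (T ^^ k) (ell2_nth x 0)"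
  by (induction k) (use assms in auto)

section \<open>Minimality of the model dilation\<close>

definition pos :: "nat \<Rightarrow> 'h \<Rightarrow> 'h ell2" where
  "pos k h = (ell2_cons 0 ^^ k) (ell2_cons h 0)"

lemma nth_funpow_cons: "ell2_nth ((ell2_cons 0 ^^ k) x) m = (if m < k then 0 else ell2_nth x (m - k))"
proof (induction k arbitrary: m)
  case (Suc k)
  then show ?case by (cases m) simp_all
qed simp

lemma norm_funpow_cons: "norm ((ell2_cons 0 ^^ k) x) = norm x" for x :: "'h ell2"
proof (induction k)
  case (Suc k)
  have "(norm (ell2_cons 0 ((ell2_cons 0 ^^ k) x)))\<^sup>2 = (norm x)\<^sup>2"
    by (simp add: norm_cons Suc)
  then show ?case by simp
qed simp

lemma nth_pos: "ell2_nth (pos k h) m = (if m = k then h else 0)"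
  by (cases "m - k") (auto simp: pos_def nth_funpow_cons ell2_nth_cons ell2_nth_simps split: nat.split)

lemma v3_pow_cons: "(v3 ^^ k) (ell2_cons 0 y) = (ell2_cons 0 ^^ k) (ell2_cons 0 y)"
proof (induction k)
  case (Suc k)
  have "v3 ((ell2_cons 0 ^^ k) (ell2_cons 0 y)) = ell2_cons 0 ((ell2_cons 0 ^^ k) (ell2_cons 0 y))"
    by (cases k) (simp_all add: v3_def cD_def)
  then show ?case by (simp add: Suc)
qed simp

text \<open>\<open>V3 - P\<close> applied to an embedded vector leaves \<open>D h\<close> in
  position 1, and powers of \<open>v3\<close> move it on. These vectors prove minimality and later
  serve as test vectors.\<close>

lemma pos_D: "pos (Suc k) (D *\<^sub>V h) = (v3 ^^ k) (v3 (ell2_embed h) - ell2_embed (P *\<^sub>V h))"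
proof -
  have "v3 (ell2_embed h) - ell2_embed (P *\<^sub>V h) = ell2_cons 0 (ell2_cons (D *\<^sub>V h) 0)"
    by (simp add: v3_def cD_def embed_eq ell2_cons_linear)
  then show ?thesis by (simp add: v3_pow_cons pos_def funpow_swap1)
qed

text \<open>The span reaches \<open>D h\<close> in every positive position, by closure every element
  of \<open>DP\<close> there, and finite sums of such vectors approximate any member of the
  space.\<close>

lemma Kd_span: "Kd = closed_cspan {(v3 ^^ k) (ell2_embed h) | k h. True}" (is "_ = closed_cspan ?X")
proof
  have "(v3 ^^ k) (ell2_embed h) \<in> Kd" for k h by (induction k) (simp_all add: embed_in v3_in)
  then show "closed_cspan ?X \<subseteq> Kd" by (intro closed_cspan_minimal[OF Kd]) auto
  note M = closed_csubspaceD[OF closed_cspan_closed_csubspace[of ?X]]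
  have gen: "(v3 ^^ k) (ell2_embed h) \<in> closed_cspan ?X" for k h
    using closed_cspan_superset[of ?X] by blast
  have lin3: "(v3 ^^ k) (x - y) = (v3 ^^ k) x - (v3 ^^ k) y" for k x y
    by (rule operator_on_diff[OF funpow_operator_on[OF v3_op[OF closed_csubspace_UNIV UNIV_I]] UNIV_I UNIV_I])
  have posD: "pos (Suc k) (D *\<^sub>V h) \<in> closed_cspan ?X" for k h
    unfolding pos_D lin3
    using M(6)[OF gen[of "Suc k" h] gen[of k "P *\<^sub>V h"]] by (simp add: funpow_swap1)
  have pos_lim: "(\<lambda>n. pos k (s n)) \<longlonglongrightarrow> pos k l" if "s \<longlonglongrightarrow> l" for k s l
  proof -
    have "pos k a - pos k b = pos k (a - b)" for a b
      by (rule ell2_eqI) (simp add: nth_pos ell2_nth_simps)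
    then have "norm (pos k a - pos k b) = norm (a - b)" for a b
      using norm_cons[of "a - b" 0] by (simp add: pos_def norm_funpow_cons)
    then show ?thesis using that by (simp add: LIMSEQ_iff)
  qed
  have posDP: "pos (Suc k) d \<in> closed_cspan ?X" if "d \<in> DP" for k d
  proof -
    have "\<exists>s. (\<forall>n. s n \<in> range (bapp D)) \<and> s \<longlonglongrightarrow> d"
      using that unfolding DP_eq closure_sequential .
    then obtain s where s: "\<forall>n. s n \<in> range (bapp D)" "s \<longlonglongrightarrow> d" by (elim exE conjE)
    have "pos (Suc k) (s n) \<in> closed_cspan ?X" for n
    proof -
      obtain h where "s n = D *\<^sub>V h" using spec[OF s(1), of n] by (rule rangeE)
      then show ?thesis using posD[of k h] by (simp only:)
    qed
    then show ?thesis by (rule closed_sequentially[OF M(4) _ pos_lim[OF s(2)]])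
  qed
  show "Kd \<subseteq> closed_cspan ?X"
  proof
    fix x assume x: "x \<in> Kd"
    have pk: "pos k (ell2_nth x k) \<in> closed_cspan ?X" for k
    proof (cases k)
      case 0
      then show ?thesis using gen[of 0 "ell2_nth x 0"] by (simp add: pos_def embed_eq)
    next
      case (Suc j)
      then show ?thesis using posDP x by (simp add: dilation_space_def)
    qed
    define S where "S n = (\<Sum>k<n. pos k (ell2_nth x k))" for n
    have "S n \<in> closed_cspan ?X" for n
    proof (induction n)
      case 0
      then show ?case using M(1) by (simp only: S_def lessThan_0 sum.empty)
    next
      case (Suc n)
      then show ?case using M(2)[OF Suc pk] by (simp only: S_def sum.lessThan_Suc)
    qed
    moreover have "S \<longlonglongrightarrow> x"
    proof -
      have "x - S n = (ell2_cons 0 ^^ n) ((ell2_tl ^^ n) x)" for n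
      proof (rule ell2_eqI)
        fix m
        have "ell2_nth (S n) m = (\<Sum>k<n. if m = k then ell2_nth x k else 0)"
          unfolding S_def linear_sum[OF bounded_linear.linear[OF bounded_linear_ell2_nth]]
          by (simp only: nth_pos)
        then show "ell2_nth (x - S n) m = ell2_nth ((ell2_cons 0 ^^ n) ((ell2_tl ^^ n) x)) m"
          by (simp add: ell2_nth_simps nth_funpow_cons ell2_nth_funpow_tl)
      qed
      then have "norm (S n - x) = norm ((ell2_tl ^^ n) x)" for n
        by (simp add: norm_minus_commute[of "S n"] norm_funpow_cons)
      then have "(\<lambda>n. norm (S n - x)) \<longlonglongrightarrow> 0" using norm_funpow_tl_tendsto[of x] by simp
      then show ?thesis by (simp add: LIM_zero_iff tendsto_norm_zero_iff)
    qed
    ultimately show "x \<in> closed_cspan ?X" by (rule closed_sequentially[OF M(4)])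
  qed
qed

text \<open>The second relation is rearranged into sums, the shape in which it occurs as an entry of
  the product of the model operators.\<close>

lemma commutators_bop:
  assumes "\<forall>x\<in>DP. commutator F1 F2 x = 0"
    and "\<forall>x\<in>DP. commutator F1 (adjoint_on DP F1) x = commutator F2 (adjoint_on DP F2) x"
  shows "f1 * f2 = f2 * f1" "adj f2 * f2 + f1 * adj f1 = adj f1 * f1 + f2 * adj f2"
proof -
  show "f1 * f2 = f2 * f1" using assms(1) by (intro ext_commute F_op) (simp add: commutator_def)
  show "adj f2 * f2 + f1 * adj f1 = adj f1 * f1 + f2 * adj f2"
  proof (rule bop_eqI)
    fix x
    let ?y = "orth_proj DP x"
    have y: "?y \<in> DP" by (rule orth_proj_in[OF DP])
    have p: "f1 *\<^sub>V x = f1 *\<^sub>V ?y" "f2 *\<^sub>V x = f2 *\<^sub>V ?y" "adj f1 *\<^sub>V x = adj f1 *\<^sub>V ?y" "adj f2 *\<^sub>V x = adj f2 *\<^sub>V ?y"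
      by (simp_all add: adj_ext F_op bapp_ext_proj adjoint_on_operator orth_proj_id[OF DP y])
    have "commutator F1 (adjoint_on DP F1) ?y = commutator F2 (adjoint_on DP F2) ?y" using assms(2) y by blast
    then have "f1 *\<^sub>V adj f1 *\<^sub>V ?y - adj f1 *\<^sub>V f1 *\<^sub>V ?y = f2 *\<^sub>V adj f2 *\<^sub>V ?y - adj f2 *\<^sub>V f2 *\<^sub>V ?y"
      using y by (simp add: commutator_def adjoint_on_ext F_op bapp_ext f_in operator_onD(2)[OF F_op(1)]
          operator_onD(2)[OF F_op(2)] adj_ext_in)
    then show "(adj f2 * f2 + f1 * adj f1) *\<^sub>V x = (adj f1 * f1 + f2 * adj f2) *\<^sub>V x"
      by (simp add: p algebra_simps)
  qed
qed

lemma bop_commutators: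
  assumes "\<And>d. d \<in> DP \<Longrightarrow> f1 *\<^sub>V f2 *\<^sub>V d = f2 *\<^sub>V f1 *\<^sub>V d"
    and "\<And>d. d \<in> DP \<Longrightarrow> adj f2 *\<^sub>V f2 *\<^sub>V d + f1 *\<^sub>V adj f1 *\<^sub>V d = adj f1 *\<^sub>V f1 *\<^sub>V d + f2 *\<^sub>V adj f2 *\<^sub>V d"
  shows "\<forall>x\<in>DP. commutator F1 F2 x = 0"
    "\<forall>x\<in>DP. commutator F1 (adjoint_on DP F1) x = commutator F2 (adjoint_on DP F2) x"
proof -
  note s = commutator_def adjoint_on_ext F_op bapp_ext f_in operator_onD(2)[OF F_op(1)]
          operator_onD(2)[OF F_op(2)] adj_ext_in
  show "\<forall>x\<in>DP. commutator F1 F2 x = 0"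
    using assms(1) by (simp add: s)
  show "\<forall>x\<in>DP. commutator F1 (adjoint_on DP F1) x = commutator F2 (adjoint_on DP F2) x"
    using assms(2) by (simp add: s algebra_simps)
qed

lemma model_minimal_isometric_dilation:
  assumes "\<forall>x\<in>DP. commutator F1 F2 x = 0"
    and "\<forall>x\<in>DP. commutator F1 (adjoint_on DP F1) x = commutator F2 (adjoint_on DP F2) x"
  shows "minimal_dilation Kd ell2_embed (V1 (bapp A) (bapp P) F1 F2) (V2 (bapp B) (bapp P) F1 F2) (V3 (bapp P))
      (bapp A) (bapp B) (bapp P)"
    "tetrablock_isometry TYPE('h ell2 ell2) Kd (V1 (bapp A) (bapp P) F1 F2) (V2 (bapp B) (bapp P) F1 F2) (V3 (bapp P))"
proof -
  let ?V1 = "V1 (bapp A) (bapp P) F1 F2" and ?V2 = "V2 (bapp B) (bapp P) F1 F2"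
  note fc = commutators_bop[OF assms]
  have o: "operator_on Kd ?V1" "operator_on Kd ?V2" "operator_on Kd (V3 (bapp P))"
    using operator_on_cong[OF v1_op V_eq(1)] operator_on_cong[OF v2_op V_eq(2)] v3_op_Kd by (simp_all add: V3_eq)
  have i: "v A f1 f2 x \<in> Kd" "v B f2 f1 x \<in> Kd" "v3 x \<in> Kd" if "x \<in> Kd" for x
    using operator_onD(2)[OF v1_op that] operator_onD(2)[OF v2_op that] v3_in[OF that] .
  have ct: "commuting_triple_on Kd ?V1 ?V2 (V3 (bapp P))"
    unfolding commuting_triple_on_def using o
    by (simp add: commutator_def V_eq i V3_eq v1_v2_commute[OF fc] v_v3_commute)
  show "tetrablock_isometry TYPE('h ell2 ell2) Kd ?V1 ?V2 (V3 (bapp P))"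
    by (rule tetrablock_isometryI[OF ct]) (simp_all add: V3_eq v3_norm V_eq v2_norm_le[OF fc] v1_cinner)
  \<comment> \<open>The zeroth coordinate evolves by itself under the three operators, and
    projecting onto the embedded space reads off exactly this coordinate.\<close>
  have gen: "(?V1 ^^ k1) ((?V2 ^^ k2) ((V3 (bapp P) ^^ k3) (ell2_embed h))) \<in> Kd \<and>
      ell2_nth ((?V1 ^^ k1) ((?V2 ^^ k2) ((V3 (bapp P) ^^ k3) (ell2_embed h)))) 0
      = (bapp A ^^ k1) ((bapp B ^^ k2) ((bapp P ^^ k3) h))" for k1 k2 k3 h
  proof -
    have a: "(V3 (bapp P) ^^ k3) (ell2_embed h) \<in> Kd \<and> ell2_nth ((V3 (bapp P) ^^ k3) (ell2_embed h)) 0 = (bapp P ^^ k3) (ell2_nth (ell2_embed h) 0)"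
      by (rule funpow_nth[OF _ embed_in]) (simp add: V3_eq i, simp add: v3_def)
    have b: "(?V2 ^^ k2) x \<in> Kd \<and> ell2_nth ((?V2 ^^ k2) x) 0 = (bapp B ^^ k2) (ell2_nth x 0)" if "x \<in> Kd" for x
      by (rule funpow_nth[OF _ that]) (simp add: V_eq i, simp add: v_def)
    have c: "(?V1 ^^ k1) x \<in> Kd \<and> ell2_nth ((?V1 ^^ k1) x) 0 = (bapp A ^^ k1) (ell2_nth x 0)" if "x \<in> Kd" for x
      by (rule funpow_nth[OF _ that]) (simp add: V_eq i, simp add: v_def)
    show ?thesis using a b c by (simp add: embed_eq)
  qed
  have "dilation Kd ell2_embed ?V1 ?V2 (V3 (bapp P)) (bapp A) (bapp B) (bapp P)"
    unfolding dilation_def using ct embed_isometric gen by (simp add: orth_proj_embed)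
  moreover have "Kd = closed_cspan {(?V1 ^^ k1) ((?V2 ^^ k2) ((V3 (bapp P) ^^ k3) (ell2_embed h))) | k1 k2 k3 h. True}"
    (is "_ = closed_cspan ?Y")
  proof
    show "closed_cspan ?Y \<subseteq> Kd" using gen by (intro closed_cspan_minimal[OF Kd]) blast
    \<comment> \<open>The orbits under \<open>V3\<close> alone already span the space.\<close>
    have "{(v3 ^^ k) (ell2_embed h) | k h. True} \<subseteq> ?Y"
    proof
      fix y assume "y \<in> {(v3 ^^ k) (ell2_embed h) | k h. True}"
      then obtain k h where y: "y = (v3 ^^ k) (ell2_embed h)" by blast
      have "y = (?V1 ^^ 0) ((?V2 ^^ 0) ((V3 (bapp P) ^^ k) (ell2_embed h)))" by (simp add: y V3_eq)
      then show "y \<in> ?Y" by blast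
    qed
    then have "{(v3 ^^ k) (ell2_embed h) | k h. True} \<subseteq> closed_cspan ?Y"
      using closed_cspan_superset[of ?Y] by (rule order_trans)
    then show "Kd \<subseteq> closed_cspan ?Y"
      by (subst Kd_span) (rule closed_cspan_minimal[OF closed_cspan_closed_csubspace])
  qed
  ultimately show "minimal_dilation Kd ell2_embed ?V1 ?V2 (V3 (bapp P)) (bapp A) (bapp B) (bapp P)"
    unfolding minimal_dilation_def by blast
qed

text \<open>The coordinates of \<open>W\<^sub>1 h\<close> along the model are found by testing against
  \<open>W\<^sub>3\<^sup>n (W\<^sub>3 - P) g\<close> and moving \<open>W\<^sub>1\<close> across with \<open>W\<^sub>1 = W\<^sub>2\<^sup>* W\<^sub>3\<close>.\<close>

lemma transported_operator:
  fixes W W' W3 :: "'k::chilbert_space \<Rightarrow> 'k"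
  assumes U: "isometric_embedding S Kd U" "\<And>x. x \<in> S \<Longrightarrow> U (W3 x) = v3 (U x)" "\<And>h. U (J h) = ell2_embed h"
    and J: "\<And>h. J h \<in> S"
    and ops: "operator_on S W" "operator_on S W'" "operator_on S W3"
    and c: "\<And>x. x \<in> S \<Longrightarrow> W' (W3 x) = W3 (W' x)"
    and W3: "\<And>x y. x \<in> S \<Longrightarrow> y \<in> S \<Longrightarrow> cinner (W3 x) (W3 y) = cinner x y"
    and WW': "\<And>x y. x \<in> S \<Longrightarrow> y \<in> S \<Longrightarrow> cinner (W x) y = cinner (W3 x) (W' y)"
    and dil: "\<And>h g. cinner (W (J h)) (J g) = cinner (T *\<^sub>V h) g"
      "\<And>m h g. cinner (W' ((W3 ^^ m) (J h))) (J g) = cinner (T' *\<^sub>V (P ^ m) *\<^sub>V h) g"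
    and fe: "T' - adj T * P = D * f' * D" and f': "\<And>x. adj f' *\<^sub>V x \<in> DP"
  shows "U (W (J h)) = v T f f' (ell2_embed h)"
proof -
  note S = closed_csubspaceD[OF operator_onD(1)[OF ops(1)]]
  have Uc: "cinner (U x) (U y) = cinner x y" if "x \<in> S" "y \<in> S" for x y
    using U(1) that by (simp add: isometric_embedding_def)
  have UK: "U x \<in> Kd" if "x \<in> S" for x using U(1) that by (auto simp: isometric_embedding_def)
  have Ulin: "U (x - y) = U x - U y" if "x \<in> S" "y \<in> S" for x y
  proof -
    have "U (x + (- 1) *\<^sub>C y) = U x + (- 1) *\<^sub>C U y"
      using U(1) that S(3)[OF that(2), of "- 1"] by (simp only: isometric_embedding_def clinear_on_def)
    then show ?thesis by (simp add: scaleC_minus_left)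
  qed
  let ?t = "U (W (J h))"
  have WS: "W (J h) \<in> S" by (rule operator_onD(2)[OF ops(1) J])
  have W3S: "W3 x \<in> S" "W' x \<in> S" if "x \<in> S" for x
    using operator_onD(2)[OF ops(3) that] operator_onD(2)[OF ops(2) that] .
  have powS: "(W3 ^^ m) x \<in> S" if "x \<in> S" for m x by (induction m) (simp_all add: that W3S)
  have Upow: "U ((W3 ^^ m) x) = (v3 ^^ m) (U x)" if "x \<in> S" for m x
    by (induction m) (simp_all add: that U(2) powS)
  \<comment> \<open>\<open>U\<close> carries \<open>z g\<close> to \<open>D g\<close> in position 1,
    so the vectors \<open>W3 ^ n (z g)\<close> probe each later coordinate against a dense subset of
    \<open>DP\<close>.\<close>
  define z where "z g = W3 (J g) - J (P *\<^sub>V g)" for g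
  have zS: "z g \<in> S" for g unfolding z_def by (intro S(6) W3S J)
  have Uz: "U ((W3 ^^ n) (z g)) = pos (Suc n) (D *\<^sub>V g)" for n g
    unfolding Upow[OF zS] by (simp add: z_def Ulin W3S J U(2,3) pos_D)
  have cpos: "cinner x (pos k d) = cinner (ell2_nth x k) d" for x k d
  proof (induction k arbitrary: x)
    case 0
    then show ?case by (subst cinner_ell2_split) (simp add: pos_def)
  next
    case (Suc k)
    have "pos (Suc k) d = ell2_cons 0 (pos k d)" by (simp add: pos_def)
    then show ?case by (subst cinner_ell2_split) (simp add: Suc)
  qed
  have W3p: "W' ((W3 ^^ m) x) = (W3 ^^ m) (W' x)" if "x \<in> S" for m x
    by (induction m) (simp_all add: that c powS)
  have test: "cinner (ell2_nth ?t (Suc n)) (D *\<^sub>V g) = cinner (W3 (J h)) (W' ((W3 ^^ n) (z g)))" for n g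
    unfolding cpos[symmetric] Uz[symmetric] Uc[OF WS powS[OF zS]] by (rule WW'[OF J powS[OF zS]])
  have "ell2_nth ?t 0 = T *\<^sub>V h"
  proof (rule cinner_left_eqI)
    fix g
    have "cinner (ell2_nth ?t 0) g = cinner ?t (ell2_embed g)"
      by (subst cinner_ell2_split) (simp add: embed_eq)
    also have "\<dots> = cinner (T *\<^sub>V h) g" unfolding U(3)[symmetric] Uc[OF WS J] by (rule dil(1))
    finally show "cinner (ell2_nth ?t 0) g = cinner (T *\<^sub>V h) g" .
  qed
  moreover have tDP: "ell2_nth ?t (Suc n) \<in> DP" for n
    using UK[OF WS] by (simp add: dilation_space_def)
  \<comment> \<open>The two parts of \<open>z g\<close> contribute \<open><h, T' g>\<close> and
    \<open><h, adj T P g>\<close>, so their difference is evaluated by \<open>fe\<close>.\<close>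
  moreover have "ell2_nth ?t (Suc 0) = adj f' *\<^sub>V D *\<^sub>V h"
  proof (rule DP_eqI[OF tDP f'])
    fix g
    have "cinner (ell2_nth ?t (Suc 0)) (D *\<^sub>V g) = cinner (W3 (J h)) (W' (W3 (J g))) - cinner (W3 (J h)) (W' (J (P *\<^sub>V g)))"
      unfolding test by (simp add: z_def operator_on_diff[OF ops(2)] W3S J cinner_diff_right)
    also have "cinner (W3 (J h)) (W' (W3 (J g))) = cinner h (T' *\<^sub>V g)"
      using dil(2)[of 0 g h] cinner_commute[of "J h" "W' (J g)"] cinner_commute[of h "T' *\<^sub>V g"]
      by (simp add: c J W3 W3S)
    also have "cinner (W3 (J h)) (W' (J (P *\<^sub>V g))) = cinner h (adj T *\<^sub>V P *\<^sub>V g)"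
      using WW'[OF J J, of h "P *\<^sub>V g"] dil(1) by (simp add: cinner_adj)
    also have "cinner h (T' *\<^sub>V g) - cinner h (adj T *\<^sub>V P *\<^sub>V g) = cinner h ((T' - adj T * P) *\<^sub>V g)"
      by (simp add: cinner_diff_right)
    also have "\<dots> = cinner (adj f' *\<^sub>V D *\<^sub>V h) (D *\<^sub>V g)"
      unfolding fe using cinner_adj[of D h "f' *\<^sub>V D *\<^sub>V g"] by (simp add: D_adj cinner_adj')
    finally show "cinner (ell2_nth ?t (Suc 0)) (D *\<^sub>V g) = cinner (adj f' *\<^sub>V D *\<^sub>V h) (D *\<^sub>V g)" .
  qed
  \<comment> \<open>One factor \<open>W3\<close> cancels isometrically. The two parts of
    \<open>z g\<close> then compress to the same vector \<open>T' P^(m+1) g\<close>, and their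
    difference is 0.\<close>
  moreover have "ell2_nth ?t (Suc (Suc m)) = 0" for m
  proof (rule DP_eqI[OF tDP closed_csubspaceD(1)[OF DP]])
    fix g
    have "W' ((W3 ^^ Suc m) (z g)) = W3 ((W3 ^^ m) (W' (z g)))"
      using W3p[OF zS, of "Suc m" g] by simp
    then have "cinner (ell2_nth ?t (Suc (Suc m))) (D *\<^sub>V g) = cinner (J h) ((W3 ^^ m) (W' (z g)))"
      unfolding test by (simp only: W3[OF J powS[OF W3S(2)[OF zS]]])
    also have "\<dots> = cnj (cinner (W' ((W3 ^^ m) (z g))) (J h))"
      unfolding W3p[OF zS, symmetric] by (rule cinner_commute)
    also have "W' ((W3 ^^ m) (z g)) = W' ((W3 ^^ Suc m) (J g)) - W' ((W3 ^^ m) (J (P *\<^sub>V g)))"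
    proof -
      have "(W3 ^^ m) (z g) = (W3 ^^ m) (W3 (J g)) - (W3 ^^ m) (J (P *\<^sub>V g))"
        unfolding z_def by (rule operator_on_diff[OF funpow_operator_on[OF ops(3)] W3S(1)[OF J] J])
      then show ?thesis
        using operator_on_diff[OF ops(2) powS[OF J, of "Suc m" g] powS[OF J, of m "P *\<^sub>V g"]]
        by (simp add: funpow_swap1)
    qed
    also have "cinner \<dots> (J h) = 0"
      unfolding cinner_diff_left dil(2) by (simp add: power_commutes[symmetric] bapp_power funpow_swap1)
    finally show "cinner (ell2_nth ?t (Suc (Suc m))) (D *\<^sub>V g) = cinner 0 (D *\<^sub>V g)" by simp
  qed
  ultimately show ?thesis
  proof (intro ell2_eqI)
    fix n
    assume t: "ell2_nth ?t 0 = T *\<^sub>V h" "ell2_nth ?t (Suc 0) = adj f' *\<^sub>V D *\<^sub>V h"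
      "\<And>m. ell2_nth ?t (Suc (Suc m)) = 0"
    consider "n = 0" | "n = Suc 0" | m where "n = Suc (Suc m)" by (metis not0_implies_Suc)
    then show "ell2_nth ?t n = ell2_nth (v T f f' (ell2_embed h)) n"
      by cases (simp_all add: t v_def cD_def embed_eq ell2_map_linear ell2_nth_simps)
  qed
qed

lemma isometric_dilation_equivalent_to_model:
  fixes S :: "'k::chilbert_space set" and t :: "'u::chilbert_space itself"
  assumes dil: "dilation S J W1 W2 W3 (bapp A) (bapp B) (bapp P)"
    and iso: "tetrablock_isometry t S W1 W2 W3"
    and min: "minimal_isometric_dilation S J W3 (bapp P)"
  shows "unitarily_equivalent S W1 W2 W3 Kd (V1 (bapp A) (bapp P) F1 F2) (V2 (bapp B) (bapp P) F1 F2) (V3 (bapp P))"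
    "\<forall>x\<in>DP. commutator F1 F2 x = 0"
    "\<forall>x\<in>DP. commutator F1 (adjoint_on DP F1) x = commutator F2 (adjoint_on DP F2) x"
proof -
  have ct: "commuting_triple_on S W1 W2 W3" and Jiso: "isometric_embedding UNIV S J"
    and dilf: "\<And>k1 k2 k3 h. orth_proj (range J) ((W1 ^^ k1) ((W2 ^^ k2) ((W3 ^^ k3) (J h))))
          = J ((bapp A ^^ k1) ((bapp B ^^ k2) ((bapp P ^^ k3) h)))"
    using dil by (auto simp: dilation_def)
  have W3n: "\<And>x. x \<in> S \<Longrightarrow> norm (W3 x) = norm x"
    and Sspan: "S = closed_cspan {(W3 ^^ k) (J h) | k h. True}"
    using min by (auto simp: minimal_isometric_dilation_def)
  have o: "operator_on S W1" "operator_on S W2" "operator_on S W3"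
    and c: "\<And>x. x \<in> S \<Longrightarrow> W1 (W2 x) = W2 (W1 x)" "\<And>x. x \<in> S \<Longrightarrow> W1 (W3 x) = W3 (W1 x)"
      "\<And>x. x \<in> S \<Longrightarrow> W2 (W3 x) = W3 (W2 x)"
    using ct by (auto simp: commuting_triple_on_def commutator_def)
  note S = operator_onD(1)[OF o(1)]
  have J: "J h \<in> S" for h using Jiso by (auto simp: isometric_embedding_def)
  have Jc: "cinner (J h) (J g) = cinner h g" for h g using Jiso by (simp add: isometric_embedding_def)
  have W3c: "cinner (W3 x) (W3 y) = cinner x y" if "x \<in> S" "y \<in> S" for x y
    by (rule isometric_cinner[OF operator_onD(5)[OF o(3)] S W3n that])
  have rel: "cinner (W2 x) y = cinner (W3 x) (W1 y)" "cinner (W1 x) y = cinner (W3 x) (W2 y)" if "x \<in> S" "y \<in> S" for x y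
    using tetrablock_isometry_adjoint_relations[OF iso W3n that] by auto
  have dilc: "cinner ((W1 ^^ k1) ((W2 ^^ k2) ((W3 ^^ k3) (J h)))) (J g)
      = cinner ((bapp A ^^ k1) ((bapp B ^^ k2) ((bapp P ^^ k3) h))) g" for k1 k2 k3 h g
    using cinner_orth_proj_left[OF isometric_embedding_range[OF Jiso] rangeI, of "(W1 ^^ k1) ((W2 ^^ k2) ((W3 ^^ k3) (J h)))" g]
    by (simp add: dilf Jc)
  \<comment> \<open>Two families indexed by \<open>(k, h)\<close> whose closed spans are
    \<open>S\<close> and \<open>Kd\<close>; their Gram matrices agree because both depend on
    \<open>P\<close> alone.\<close>
  define xW where "xW = (\<lambda>(k, h). (W3 ^^ k) (J h))"
  define xV where "xV = (\<lambda>(k, h). (v3 ^^ k) (ell2_embed h :: 'h ell2))"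
  have rW: "range xW = {(W3 ^^ k) (J h) | k h. True}" and rV: "range xV = {(v3 ^^ k) (ell2_embed h) | k h. True}"
    by (auto simp: xW_def xV_def image_def)
  have v3c: "cinner (v3 x) (v3 y) = cinner x y" if "x \<in> Kd" "y \<in> Kd" for x y
    by (rule isometric_cinner[OF operator_onD(5)[OF v3_op_Kd] Kd v3_norm that])
  have "cinner (xW i) (xW j) = cinner (xV i) (xV j)" for i j
  proof (cases i; cases j)
    fix k h l g assume i: "i = (k, h)" "j = (l, g)"
    have 1: "cinner ((W3 ^^ m) (J h)) (J g) = cinner ((bapp P ^^ m) h) g" for m h g
      using dilc[of 0 0 m h g] by simp
    have 2: "cinner ((v3 ^^ m) (ell2_embed h)) (ell2_embed g) = cinner ((bapp P ^^ m) h) g" for m h g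
      by (subst cinner_ell2_split) (simp add: v3_pow_nth embed_eq ell2_tl_linear bapp_power)
    show ?thesis
      unfolding i xW_def xV_def case_prod_conv
      using isometric_pow_gram[of S W3 J "bapp P", OF W3c operator_onD(2)[OF o(3)] J 1]
        isometric_pow_gram[of Kd v3 ell2_embed "bapp P", OF v3c v3_in embed_in 2]
      by simp
  qed
  then obtain U where U: "isometric_embedding S Kd U" "U ` S = Kd" "\<And>i. U (xW i) = xV i"
    using gram_unitary[of xW xV] unfolding rW rV Sspan[symmetric] Kd_span[symmetric] by blast
  have UJ: "U (J h) = ell2_embed h" for h using U(3)[of "(0, h)"] by (simp add: xW_def xV_def)
  have UK: "U x \<in> Kd" if "x \<in> S" for x using U(1) that by (auto simp: isometric_embedding_def)
  have Un: "norm (U x) = norm x" if "x \<in> S" for x by (rule isometric_embedding_norm[OF U(1) that])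
  have Ulin: "clinear_on S U" using U(1) by (simp add: isometric_embedding_def)
  \<comment> \<open>Boundedness and linearity reduce an intertwining relation to the orbit of the
    embedded space under \<open>W3\<close>.\<close>
  have intertwine: "U (W x) = R (U x)"
    if W: "operator_on S W" and R: "operator_on Kd R" and g: "\<And>k h. U (W ((W3 ^^ k) (J h))) = R ((v3 ^^ k) (ell2_embed h))"
      and x: "x \<in> S" for W R x
  proof -
    obtain C where C: "\<And>x. x \<in> S \<Longrightarrow> norm (W x) \<le> C * norm x" using W by (auto simp: operator_on_def)
    obtain C' where C': "\<And>x. x \<in> Kd \<Longrightarrow> norm (R x) \<le> C' * norm x" using R by (auto simp: operator_on_def)
    have 1: "clinear_on S (\<lambda>x. U (W x))"
      using Ulin by (simp add: clinear_on_def operator_onD(2,3,4)[OF W])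
    have 2: "clinear_on S (\<lambda>x. R (U x))"
      using Ulin by (simp add: clinear_on_def operator_onD(2,3,4)[OF R] UK)
    show ?thesis
    proof (rule eq_on_closed_cspan[of "{(W3 ^^ k) (J h) | k h. True}" "\<lambda>x. U (W x)" C "\<lambda>x. R (U x)" C' x,
          folded Sspan, OF 1 _ 2 _ _ x])
      show "norm (U (W y)) \<le> C * norm y" if "y \<in> S" for y
        using C[OF that] by (simp add: Un operator_onD(2)[OF W] that)
      show "norm (R (U y)) \<le> C' * norm y" if "y \<in> S" for y
        using C'[OF UK[OF that]] by (simp add: Un that)
      show "U (W y) = R (U y)" if "y \<in> {(W3 ^^ k) (J h) | k h. True}" for y
      proof -
        obtain k h where y: "y = (W3 ^^ k) (J h)" using \<open>y \<in> _\<close> by blast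
        show ?thesis using g[of k h] U(3)[of "(k, h)"] by (simp add: y xW_def xV_def)
      qed
    qed
  qed
  have Ux: "U ((W3 ^^ k) (J h)) = (v3 ^^ k) (ell2_embed h)" for k h
    using U(3)[of "(k, h)"] by (simp add: xW_def xV_def)
  have U3: "U (W3 x) = v3 (U x)" if "x \<in> S" for x
    by (rule intertwine[OF o(3) v3_op_Kd _ that]) (use Ux[of "Suc _"] in simp)
  have powS: "(W3 ^^ m) (J h) \<in> S" for m h by (induction m) (simp_all add: J operator_onD(2)[OF o(3)])
  have Upow: "U ((W3 ^^ k) x) = (v3 ^^ k) (U x)" if "x \<in> S" for k x
  proof (induction k)
    case (Suc k)
    have "(W3 ^^ k) x \<in> S" by (induction k) (simp_all add: that operator_onD(2)[OF o(3)])
    then show ?case by (simp add: U3 Suc)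
  qed simp
  have embed1: "U (W1 (J h)) = v A f1 f2 (ell2_embed h)" for h
  proof (rule transported_operator[OF U(1) U3 UJ J o(1,2,3) c(3) W3c rel(2) _ _ fund_eq(2) f_in(4)])
    show "cinner (W1 (J h)) (J g) = cinner (A *\<^sub>V h) g" for h g using dilc[of 1 0 0 h g] by simp
    show "cinner (W2 ((W3 ^^ m) (J h))) (J g) = cinner (B *\<^sub>V (P ^ m) *\<^sub>V h) g" for m h g
      using dilc[of 0 1 m h g] by (simp add: bapp_power)
  qed
  have embed2: "U (W2 (J h)) = v B f2 f1 (ell2_embed h)" for h
  proof (rule transported_operator[OF U(1) U3 UJ J o(2,1,3) c(2) W3c rel(1) _ _ fund_eq(1) f_in(3)])
    show "cinner (W2 (J h)) (J g) = cinner (B *\<^sub>V h) g" for h g using dilc[of 0 1 0 h g] by simp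
    show "cinner (W1 ((W3 ^^ m) (J h))) (J g) = cinner (A *\<^sub>V (P ^ m) *\<^sub>V h) g" for m h g
      using dilc[of 1 0 m h g] by (simp add: bapp_power)
  qed
  have gens: "U (W ((W3 ^^ k) (J h))) = R ((v3 ^^ k) (ell2_embed h))"
    if "operator_on S W" "\<And>x. x \<in> S \<Longrightarrow> W (W3 x) = W3 (W x)" "\<And>x. R (v3 x) = v3 (R x)"
      "\<And>h. U (W (J h)) = R (ell2_embed h)" for W R k h
  proof -
    have "W ((W3 ^^ k) (J h)) = (W3 ^^ k) (W (J h))" by (induction k) (simp_all add: that(2) powS)
    moreover have "R ((v3 ^^ k) y) = (v3 ^^ k) (R y)" for y by (induction k) (simp_all add: that(3))
    ultimately show ?thesis by (simp add: Upow operator_onD(2)[OF that(1) J] that(4))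
  qed
  have U1: "U (W1 x) = v A f1 f2 (U x)" if "x \<in> S" for x
    by (rule intertwine[OF o(1) v1_op gens[OF o(1) c(2) v_v3_commute(1) embed1] that])
  have U2: "U (W2 x) = v B f2 f1 (U x)" if "x \<in> S" for x
    by (rule intertwine[OF o(2) v2_op gens[OF o(2) c(3) v_v3_commute(2) embed2] that])
  show "unitarily_equivalent S W1 W2 W3 Kd (V1 (bapp A) (bapp P) F1 F2) (V2 (bapp B) (bapp P) F1 F2) (V3 (bapp P))"
    unfolding unitarily_equivalent_def
    by (rule exI[of _ U]) (simp add: U(1,2) V_eq UK V3_eq U1 U2 U3)
  \<comment> \<open>Commutation of \<open>W1\<close> and \<open>W2\<close> is carried over by
    \<open>U\<close>, which maps onto \<open>Kd\<close>.\<close>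
  have com: "v A f1 f2 (v B f2 f1 y) = v B f2 f1 (v A f1 f2 y)" if "y \<in> Kd" for y
  proof -
    have "y \<in> U ` S" using that by (simp only: U(2))
    then obtain x where x: "y = U x" "x \<in> S" by (rule imageE)
    show ?thesis
      using arg_cong[OF c(1)[OF x(2)], of U]
      by (simp add: x U1 U2 operator_onD(2)[OF o(1)] operator_onD(2)[OF o(2)])
  qed
  have rels: "f1 *\<^sub>V f2 *\<^sub>V d = f2 *\<^sub>V f1 *\<^sub>V d \<and>
      adj f2 *\<^sub>V f2 *\<^sub>V d + f1 *\<^sub>V adj f1 *\<^sub>V d = adj f1 *\<^sub>V f1 *\<^sub>V d + f2 *\<^sub>V adj f2 *\<^sub>V d" if d: "d \<in> DP" for d
  proof -
    \<comment> \<open>With zeroth entry 0 and \<open>d\<close> in position 1, entries 1 and 2 of the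
      two products are precisely the two sides of the wanted relations.\<close>
    let ?y = "ell2_cons 0 (ell2_cons d 0)"
    have y: "?y \<in> Kd"
      using d by (simp add: dilation_space_def ell2_nth_cons ell2_nth_simps closed_csubspaceD(1)[OF DP] split: nat.split)
    have e: "ell2_nth (v A f1 f2 (v B f2 f1 ?y)) n = ell2_nth (v B f2 f1 (v A f1 f2 ?y)) n" for n
      using com[OF y] by simp
    show ?thesis
      using e[of "Suc 0"] e[of "Suc (Suc 0)"] unfolding v_v
      by (simp add: ell2_nth_simps)
  qed
  show "\<forall>x\<in>DP. commutator F1 F2 x = 0"
    "\<forall>x\<in>DP. commutator F1 (adjoint_on DP F1) x = commutator F2 (adjoint_on DP F2) x"
    by (rule bop_commutators; use rels in blast)+
qed

end

theorem theorem6p1: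
  fixes A B P F1 F2 :: "'h::chilbert_space \<Rightarrow> 'h"
  assumes "tetrablock_contraction UNIV A B P"
    and "fundamental_operators A B P F1 F2"
  shows
    "((\<forall>x\<in>defect_space P. commutator F1 F2 x = 0) \<and>
      (\<forall>x\<in>defect_space P. commutator F1 (adjoint_on (defect_space P) F1) x
                          = commutator F2 (adjoint_on (defect_space P) F2) x) \<longrightarrow>
      minimal_dilation (dilation_space P) ell2_embed (V1 A P F1 F2) (V2 B P F1 F2) (V3 P) A B P \<and>
      tetrablock_isometry TYPE('h ell2 ell2) (dilation_space P) (V1 A P F1 F2) (V2 B P F1 F2) (V3 P))
     \<and>
     (\<forall>(S :: 'k::chilbert_space set) J W1 W2 W3.
        dilation S J W1 W2 W3 A B P \<and>
        tetrablock_isometry TYPE('u::chilbert_space) S W1 W2 W3 \<and>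
        minimal_isometric_dilation S J W3 P \<longrightarrow>
        unitarily_equivalent S W1 W2 W3 (dilation_space P) (V1 A P F1 F2) (V2 B P F1 F2) (V3 P) \<and>
        (\<forall>x\<in>defect_space P. commutator F1 F2 x = 0) \<and>
        (\<forall>x\<in>defect_space P. commutator F1 (adjoint_on (defect_space P) F1) x
                            = commutator F2 (adjoint_on (defect_space P) F2) x))"
proof -
  define a where "a = ext UNIV A"
  define b where "b = ext UNIV B"
  define p where "p = ext UNIV P"
  have "operator_on UNIV A" "operator_on UNIV B" "operator_on UNIV P"
    using assms(1) by (auto simp: tetrablock_contraction_def commuting_triple_on_def)
  then have e: "A = bapp a" "B = bapp b" "P = bapp p"
    by (simp_all add: a_def b_def p_def bapp_ext_UNIV)
  interpret tetrablock_model a b p F1 F2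
    by unfold_locales (use assms in \<open>simp_all add: e\<close>)
  show ?thesis
    unfolding e using model_minimal_isometric_dilation isometric_dilation_equivalent_to_model[where ?'k = 'k and t = "TYPE('u)"] by blast
qed

end
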